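(* Let $(X_{1i},X_{2i})^\tau$, $i=1,\dots,n$, be i.i.d. bivariate normal with means $\mu_1,\mu_2$, standard deviations $\sigma_1,\sigma_2>0$ and correlation $\rho=0$. Suppose only the unordered pairs $Y_{1i}=\min\{X_{1i},X_{2i}\}$, $Y_{2i}=\max\{X_{1i},X_{2i}\}$ are observed, and let $$\ell_n(\boldsymbol\theta)=\sum_{i=1}^n\log\{\phi(Y_{1i},Y_{2i};\boldsymbol\theta)+\phi(Y_{2i},Y_{1i};\boldsymbol\theta)\},$$ where $\boldsymbol\theta=(\mu_1,\mu_2,\sigma_1,\sigma_2,\rho)^\tau$ and $\phi(x_1,x_2;\boldsymbol\theta)$ is the bivariate normal density with these parameters. Define the maximum likelihood estimators $\hat{\boldsymbol\theta}=\arg\sup\{\ell_n(\boldsymbol\theta):\rho=0\}$, $\tilde{\boldsymbol\theta}=\arg\sup\{\ell_n(\boldsymbol\theta):\sigma_1=\sigma_2=\sigma,\rho=0\}$ (with common standard deviation estimate $\tilde\sigma$), and $\check{\boldsymbol\theta}=\arg\sup\{\ell_n(\boldsymbol\theta):(\mu_1,\sigma_1)=(\mu_2,\sigma_2),\rho=0\}$, with entries denoted $\hat\mu_1,\hat\mu_2,\hat\sigma_1,\hat\sigma_2$, $\tilde\mu_1,\tilde\mu_2,\tilde\sigma$, etc. Let $R_{n,1}=2\{\ell_n(\tilde{\boldsymbol\theta})-\ell_n(\check{\boldsymbol\theta})\}$ and $R_{n,2}=2\{\ell_n(\hat{\boldsymbol\theta})-\ell_n(\check{\boldsymbol\theta})\}$.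 Suppose the null hypothesis $H_0:\mu_1=\mu_2=\mu_0,\ \sigma_1=\sigma_2=\sigma_0$ holds. Then, as $n\to\infty$: (a) $(\tilde\mu_1-\mu_0)^2$, $(\tilde\mu_2-\mu_0)^2$ and $\tilde\sigma-\sigma_0$ are all $O_p(n^{-1/2})$, and $R_{n,1}$ converges in distribution to $0.5\chi^2_0+0.5\chi^2_1$; (b) $(\hat\mu_j-\mu_0)^2$ and $(\hat\sigma_j-\sigma_0)^2$ for $j=1,2$ are all $O_p(n^{-1/2})$, and $R_{n,2}$ converges in distribution to $$R\equiv\sup_{x_1,x_2\in\mathbb R}\{2\mathbf x^\tau\mathbf w-\mathbf x^\tau\mathbf x\},$$ where $\mathbf x^\tau=(x_1^2,x_2^2,2x_1x_2)$ and $\mathbf w^\tau=(w_1,w_2,w_3)$ with $w_1,w_2,w_3$ i.i.d. $N(0,1)$.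
   Context: $0.5\chi^2_0+0.5\chi^2_1$ denotes the equal mixture of a point mass at zero and the chi-square distribution with one degree of freedom. $\mu_0,\sigma_0$ denote the true common mean and standard deviation under the null hypothesis. *)

theory Defs
  imports "HOL-Probability.Probability"
begin

type_synonym param = "real \<times> real \<times> real \<times> real \<times> real"
  (* theta = (mu1, mu2, sigma1, sigma2, rho) *)

definition bvn_density :: "param \<Rightarrow> real \<times> real \<Rightarrow> real" where
  "bvn_density \<theta> x = (case \<theta> of (m1, m2, s1, s2, r) \<Rightarrow> (case x of (x1, x2) \<Rightarrow>
     1 / (2 * pi * s1 * s2 * sqrt (1 - r\<^sup>2)) *
     exp (- 1 / (2 * (1 - r\<^sup>2)) *
          (((x1 - m1) / s1)\<^sup>2 - 2 * r * ((x1 - m1) / s1) * ((x2 - m2) / s2) + ((x2 - m2) / s2)\<^sup>2))))"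

definition loglik :: "nat \<Rightarrow> (nat \<Rightarrow> real \<times> real) \<Rightarrow> param \<Rightarrow> real" where
  "loglik n ys \<theta> = (\<Sum>i<n. ln (bvn_density \<theta> (fst (ys i), snd (ys i)) + bvn_density \<theta> (snd (ys i), fst (ys i))))"

definition unorder :: "real \<times> real \<Rightarrow> real \<times> real" where
  "unorder x = (min (fst x) (snd x), max (fst x) (snd x))"

definition Theta_hat :: "param set" where
  "Theta_hat = {(m1, m2, s1, s2, r). s1 > 0 \<and> s2 > 0 \<and> r = 0}"
definition Theta_tilde :: "param set" where
  "Theta_tilde = {(m1, m2, s1, s2, r). s1 > 0 \<and> s1 = s2 \<and> r = 0}"
definition Theta_check :: "param set" where
  "Theta_check = {(m1, m2, s1, s2, r). s1 > 0 \<and> m1 = m2 \<and> s1 = s2 \<and> r = 0}"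

definition is_maximizer :: "(param \<Rightarrow> real) \<Rightarrow> param set \<Rightarrow> param \<Rightarrow> bool" where
  "is_maximizer f S t \<longleftrightarrow> t \<in> S \<and> (\<forall>s\<in>S. f s \<le> f t)"

definition bounded_in_prob :: "'a measure \<Rightarrow> (nat \<Rightarrow> 'a \<Rightarrow> real) \<Rightarrow> (nat \<Rightarrow> real) \<Rightarrow> bool" where
  "bounded_in_prob M Z a \<longleftrightarrow>
     (\<forall>\<epsilon>>0. \<exists>C. \<exists>N. \<forall>n\<ge>N. measure M {\<omega> \<in> space M. \<bar>Z n \<omega>\<bar> > C * a n} < \<epsilon>)"

definition std_normal :: "real measure" where
  "std_normal = density lborel (\<lambda>x. ennreal (std_normal_density x))"

definition chi2_1 :: "real measure" where
  "chi2_1 = distr std_normal borel (\<lambda>z. z\<^sup>2)"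

definition half_chibar :: "real measure" where
  "half_chibar = measure_pmf (bernoulli_pmf (1/2)) \<bind> (\<lambda>b. if b then return borel 0 else chi2_1)"

definition R_stat :: "real \<times> real \<times> real \<Rightarrow> real" where
  "R_stat w = (case w of (w1, w2, w3) \<Rightarrow>
     (SUP x \<in> (UNIV :: (real \<times> real) set). case x of (x1, x2) \<Rightarrow>
        2 * (x1\<^sup>2 * w1 + x2\<^sup>2 * w2 + 2 * x1 * x2 * w3) - ((x1\<^sup>2)\<^sup>2 + (x2\<^sup>2)\<^sup>2 + (2 * x1 * x2)\<^sup>2)))"

definition R_law :: "real measure" where
  "R_law = distr (std_normal \<Otimes>\<^sub>M (std_normal \<Otimes>\<^sub>M std_normal)) borel R_stat"

end

theory Submission
  imports Defs
begin

text \<open>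
  Let \<open>c, w\<close> be the maximum likelihood estimates of the common mean and standard deviation, and let
  \<open>P, S\<close> be the difference and the sum of the two observations, rotated and standardised by
  \<open>c, w\<close>. The log-likelihood ratio against the null fit is \<open>n\<close> times
  \<open>avg (ln cosh (P (\<surd>2 \<beta> + \<alpha> S))) - g\<close>, where \<open>\<alpha>\<close> and \<open>\<beta>\<close> vanish under the null hypothesis, the average
  is over the sample, and \<open>g\<close> is an explicit log-partition function of \<open>\<alpha>, \<beta>\<close> and two further parameters,
  which can be profiled out. Expanding \<open>ln cosh z = z\<^sup>2/2 - z\<^sup>4/12 + O(z\<^sup>6)\<close>, the terms quadratic in
  \<open>(\<alpha>, \<beta>)\<close> are random of order \<open>1/\<surd>n\<close>, and the terms of degree four are deterministic up to smaller order.
  With \<open>x = n\<^sup>1\<^sup>/\<^sup>4 (\<beta>, \<alpha>)\<close>, twice the log-likelihood ratio becomes \<open>2 y \<bullet> V - y \<bullet> y + o(1)\<close> for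
  \<open>y = (x\<^sub>1\<^sup>2, x\<^sub>2\<^sup>2, 2 x\<^sub>1 x\<^sub>2)\<close> and a normalised sum \<open>V\<close> that converges to a standard Gaussian vector.

  The maximiser is localised in two steps. For large \<open>\<bar>\<alpha>\<bar> + \<bar>\<beta>\<bar>\<close> the growth of \<open>g\<close> beats
  \<open>ln cosh z \<le> \<bar>z\<bar>\<close>. In between, positivity of the Kullback-Leibler divergence, compactness, and the
  Lipschitz continuity of \<open>ln cosh\<close> give a uniform gap. With equal standard deviations \<open>\<alpha> = 0\<close>,
  and the supremum of the limiting form over \<open>x\<^sub>1\<close> is \<open>max(V\<^sub>1, 0)\<^sup>2\<close>.

  All estimates are deterministic consequences of finitely many sample averages being within
  \<open>K/\<surd>n\<close> of their expectations, which holds with probability close to one by Chebyshev's inequality.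
  The multivariate central limit theorem is obtained from convergence of characteristic functions
  by smoothing test functions with a Gaussian kernel.
\<close>

subsection \<open>Bounds for log cosh and for the log-partition function\<close>

text \<open>Relabelling the two observations sends \<open>(\<alpha>, \<beta>)\<close> to its
  negative and leaves the likelihood unchanged. Hence the score vanishes in these directions, the
  Fisher information is singular there, and the usual quadratic expansion has to be replaced by one
  of degree four with a sextic remainder. Degree four collects two contributions: the quartic term
  of \<open>lncosh\<close>, and a gain of half of
  \<open>(\<alpha>\<^sup>2 + \<beta>\<^sup>2)\<^sup>2\<close> from reoptimising the mean precision
  \<open>a\<close>. Only their sum is the square norm of \<open>y\<close>. Centring at the null fit
  makes the mean of \<open>S\<close> exactly 0 and that of \<open>P\<^sup>2 + S\<^sup>2\<close>
  exactly 2, so the terms linear in these two statistics leave the log-likelihood ratio without any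
  remainder. The parameter space is not compact, since \<open>a\<close> may approach
  \<open>\<bar>\<alpha>\<bar>\<close> or infinity, and maximisers are assumed rather than
  constructed. Upper bounds are therefore proved for all parameters at a fixed good sample, and
  lower bounds at one explicit trial point; no supremum of the likelihood over parameters has to be
  measurable.\<close>

lemma le_from_deriv_le:
  fixes f g :: "real \<Rightarrow> real"
  assumes f: "\<And>x. 0 \<le> x \<Longrightarrow> x \<le> z \<Longrightarrow> (f has_real_derivative f' x) (at x)"
    and g: "\<And>x. 0 \<le> x \<Longrightarrow> x \<le> z \<Longrightarrow> (g has_real_derivative g' x) (at x)"
    and le: "\<And>x. 0 \<le> x \<Longrightarrow> x \<le> z \<Longrightarrow> f' x \<le> g' x"
    and "f 0 \<le> g 0" "0 \<le> z"
  shows "f z \<le> g z"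
proof -
  have "g 0 - f 0 \<le> g z - f z"
  proof (rule DERIV_nonneg_imp_nondecreasing[OF \<open>0 \<le> z\<close>])
    fix x assume "0 \<le> x" "x \<le> z"
    then show "\<exists>y. ((\<lambda>x. g x - f x) has_real_derivative y) (at x) \<and> 0 \<le> y"
      using DERIV_diff[OF g f] le by fastforce
  qed
  with \<open>f 0 \<le> g 0\<close> show ?thesis by linarith
qed

lemma tanh_deriv: "(tanh has_real_derivative 1 - (tanh x)\<^sup>2) (at x)" for x :: real
  by (rule DERIV_subset[OF has_field_derivative_tanh[where g="\<lambda>x. x" and Db=1, simplified]]) auto

lemma tanh_le_self: "0 \<le> z \<Longrightarrow> tanh z \<le> (z::real)"
  by (rule le_from_deriv_le[where f'="\<lambda>x. 1 - (tanh x)\<^sup>2" and g'="\<lambda>_. 1"])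
     (auto intro!: tanh_deriv derivative_eq_intros)

text \<open>Bootstrapping on the differential equation of \<open>tanh\<close>, whose derivative is
  \<open>1 - (tanh x)\<^sup>2\<close>: an upper bound on \<open>tanh\<close> gives a lower one, and
  that gives a sharper upper one. Integrating once more yields the bounds on
  \<open>lncosh\<close>.\<close>

lemma tanh_ge_cubic: "0 \<le> z \<Longrightarrow> z - z^3/3 \<le> tanh (z::real)"
proof (rule le_from_deriv_le[where g'="\<lambda>x. 1 - (tanh x)\<^sup>2" and f'="\<lambda>x. 1 - x\<^sup>2" and f="\<lambda>z. z - z^3/3"])
  fix x :: real assume "0 \<le> x"
  then show "1 - x\<^sup>2 \<le> 1 - (tanh x)\<^sup>2"
    using tanh_le_self[of x] by (simp add: power_mono)
qed (auto intro!: tanh_deriv derivative_eq_intros)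

lemma tanh_le_quintic: "0 \<le> z \<Longrightarrow> tanh (z::real) \<le> z - z^3/3 + 2*z^5/15"
proof (rule le_from_deriv_le[where f'="\<lambda>x. 1 - (tanh x)\<^sup>2" and g'="\<lambda>x. 1 - x\<^sup>2 + 2*x^4/3"
      and g="\<lambda>z. z - z^3/3 + 2*z^5/15"])
  fix x :: real assume x: "0 \<le> x"
  show "1 - (tanh x)\<^sup>2 \<le> 1 - x\<^sup>2 + 2*x^4/3"
  \<comment> \<open>The cubic lower bound may be squared only while it is nonnegative, that is for
    \<open>x\<^sup>2 \<le> 3\<close>. Beyond that, \<open>2*x^4/3\<close> alone exceeds
    \<open>x\<^sup>2\<close>.\<close>
  proof (cases "x\<^sup>2 \<le> 3")
    case True
    have eq: "x - x^3/3 = x * (1 - x\<^sup>2/3)" by (simp add: power2_eq_square power3_eq_cube algebra_simps)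
    have "0 \<le> x - x^3/3" unfolding eq using x True by (intro mult_nonneg_nonneg) auto
    then have "(x - x^3/3)\<^sup>2 \<le> (tanh x)\<^sup>2" using tanh_ge_cubic[OF x] by (intro power_mono)
    moreover have "(x - x^3/3)\<^sup>2 = x\<^sup>2 - 2*x^4/3 + (x^3)\<^sup>2/9"
      by (simp add: power2_eq_square power3_eq_cube power4_eq_xxxx algebra_simps)
    moreover have "0 \<le> (x^3)\<^sup>2/9" by simp
    ultimately show ?thesis by linarith
  next
    case False
    have "x\<^sup>2 * 1 \<le> x\<^sup>2 * (2*x\<^sup>2/3)" using False by (intro mult_left_mono) auto
    moreover have "x\<^sup>2 * (2*x\<^sup>2/3) = 2*x^4/3"
      by (simp add: power2_eq_square power4_eq_xxxx algebra_simps)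
    ultimately show ?thesis using zero_le_power2[of "tanh x"] by linarith
  qed
qed (auto intro!: tanh_deriv derivative_eq_intros)

definition lncosh :: "real \<Rightarrow> real" where "lncosh z = ln (cosh z)"

lemma lncosh_deriv: "(lncosh has_real_derivative tanh x) (at x)"
proof -
  have "((\<lambda>z::real. ln (cosh z)) has_real_derivative (1 / cosh x * (sinh x * 1))) (at x)"
    by (rule derivative_intros | simp add: cosh_real_pos)+
  then show ?thesis by (simp add: lncosh_def[abs_def] tanh_def)
qed

lemma lncosh_0 [simp]: "lncosh 0 = 0" by (simp add: lncosh_def)
lemma lncosh_minus [simp]: "lncosh (- z) = lncosh z" by (simp add: lncosh_def)
lemma lncosh_abs: "lncosh \<bar>z\<bar> = lncosh z" by (simp add: lncosh_def)
lemma lncosh_nonneg: "0 \<le> lncosh z" by (simp add: lncosh_def cosh_real_ge_1)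

lemma lncosh_ge_quartic: "z\<^sup>2/2 - z^4/12 \<le> lncosh z"
proof -
  have "\<bar>z\<bar>\<^sup>2/2 - \<bar>z\<bar>^4/12 \<le> lncosh \<bar>z\<bar>"
    by (rule le_from_deriv_le[where f="\<lambda>z. z\<^sup>2/2 - z^4/12" and f'="\<lambda>z. z - z^3/3" and g'=tanh])
       (auto intro!: lncosh_deriv derivative_eq_intros tanh_ge_cubic)
  then show ?thesis by (simp add: lncosh_abs power_even_abs)
qed

lemma lncosh_le_sextic: "lncosh z \<le> z\<^sup>2/2 - z^4/12 + z^6/45"
proof -
  have "lncosh \<bar>z\<bar> \<le> \<bar>z\<bar>\<^sup>2/2 - \<bar>z\<bar>^4/12 + \<bar>z\<bar>^6/45"
    by (rule le_from_deriv_le[where g="\<lambda>z. z\<^sup>2/2 - z^4/12 + z^6/45"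
          and g'="\<lambda>z. z - z^3/3 + 2*z^5/15" and f'=tanh])
       (auto intro!: lncosh_deriv derivative_eq_intros tanh_le_quintic)
  then show ?thesis by (simp add: lncosh_abs power_even_abs)
qed

lemma lncosh_le_square: "lncosh z \<le> z\<^sup>2/2"
proof -
  have "lncosh \<bar>z\<bar> \<le> \<bar>z\<bar>\<^sup>2/2"
    by (rule le_from_deriv_le[where g="\<lambda>z. z\<^sup>2/2" and g'="\<lambda>z. z" and f'=tanh])
       (auto intro!: lncosh_deriv derivative_eq_intros tanh_le_self)
  then show ?thesis by (simp add: lncosh_abs)
qed

lemma lncosh_lipschitz: "\<bar>lncosh x - lncosh y\<bar> \<le> \<bar>x - y\<bar>"
proof -
  have "norm (lncosh x - lncosh y) \<le> 1 * norm (x - y)"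
    by (rule field_differentiable_bound[where S=UNIV and f'=tanh])
       (use tanh_real_bounds in \<open>auto intro!: lncosh_deriv simp: abs_le_iff less_imp_le minus_le_iff\<close>)
  then show ?thesis by simp
qed

lemma lncosh_le_abs: "lncosh z \<le> \<bar>z\<bar>"
  using lncosh_lipschitz[of z 0] lncosh_nonneg[of z] by simp

lemma continuous_lncosh [continuous_intros]:
  "continuous_on S f \<Longrightarrow> continuous_on S (\<lambda>x. lncosh (f x))"
  unfolding lncosh_def by (intro continuous_intros) (auto simp: cosh_real_pos less_imp_neq)

lemma lncosh_measurable [measurable]: "lncosh \<in> borel_measurable borel"
  by (intro borel_measurable_continuous_onI continuous_intros)

lemma lncosh_eq_0_iff: "lncosh z = 0 \<longleftrightarrow> z = 0"
proof
  assume "lncosh z = 0"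
  then have "cosh z = 1" unfolding lncosh_def using cosh_real_pos[of z] ln_eq_zero_iff by blast
  then show "z = 0" by simp
qed simp

text \<open>The profiled log-partition function: for given \<open>\<alpha>, \<beta>\<close> the remaining location
  parameter has been eliminated.\<close>

definition g_prof :: "real \<Rightarrow> real \<Rightarrow> real \<Rightarrow> real" where
  "g_prof a \<alpha> \<beta> = a - 1 - ln (a\<^sup>2 - \<alpha>\<^sup>2) / 2 + \<beta>\<^sup>2 / a"

text \<open>The version before profiling: \<open>a1, a2\<close> stand for the precisions and
  \<open>u1, u2\<close> for the means, in the units of the null fit, as in
  \<open>par_of\<close>.\<close>

definition g_full :: "real \<Rightarrow> real \<Rightarrow> real \<Rightarrow> real \<Rightarrow> real" where
  "g_full a1 a2 u1 u2 = (a1 + a2) / 2 - 1 - ln (a1 * a2) / 2 + (a1 * u1\<^sup>2 + a2 * u2\<^sup>2) / 2"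

text \<open>Completing the square in \<open>u1 + u2\<close>. The data term of the likelihood depends
  on \<open>\<alpha>\<close> and \<open>\<beta>\<close> only, so this square is a pure penalty and
  must vanish at a maximiser, which forces \<open>u2 = - u1\<close>.\<close>

lemma g_full_eq:
  assumes "a1 > 0" "a2 > 0"
  shows "g_full a1 a2 u1 u2 = g_prof ((a1 + a2)/2) ((a2 - a1)/2) ((a1*u1 - a2*u2)/2)
           + a1 * a2 * (u1 + u2)\<^sup>2 / (2 * (a1 + a2))"
proof -
  have 1: "((a1 + a2)/2)\<^sup>2 - ((a2 - a1)/2)\<^sup>2 = a1 * a2"
    by (simp add: power2_eq_square field_simps)
  have "a1 + a2 \<noteq> 0" using assms by simp
  then have 2: "(a1 * u1\<^sup>2 + a2 * u2\<^sup>2) / 2 =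
      ((a1*u1 - a2*u2)/2)\<^sup>2 / ((a1 + a2)/2) + a1 * a2 * (u1 + u2)\<^sup>2 / (2 * (a1 + a2))"
    by (simp add: divide_simps) algebra
  show ?thesis unfolding g_full_def g_prof_def 1 2 by simp
qed

section \<open>Fourth-order bounds for the profiled log-partition function\<close>

lemma ln_one_minus_le: "0 \<le> u \<Longrightarrow> u < 1 \<Longrightarrow> u/2 + u\<^sup>2/4 \<le> - ln (1 - u) / (2::real)"
proof (rule le_from_deriv_le[where f="\<lambda>u. u/2 + u\<^sup>2/4" and g="\<lambda>u. - ln (1 - u)/2"
      and f'="\<lambda>u. 1/2 + u/2" and g'="\<lambda>u. 1/(2*(1-u))"])
  fix x assume "0 \<le> x" "x \<le> u" "u < 1"
  then show "1/2 + x/2 \<le> 1/(2*(1-x))"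
    by (auto simp: field_simps power2_eq_square)
  show "((\<lambda>u. - ln (1 - u)/2) has_real_derivative 1/(2*(1-x))) (at x)"
    using \<open>x \<le> u\<close> \<open>u < 1\<close> by (auto intro!: derivative_eq_intros simp: field_simps)
qed (auto intro!: derivative_eq_intros)

lemma ln_one_minus_ge: "0 \<le> u \<Longrightarrow> u \<le> 1/2 \<Longrightarrow> - ln (1 - u) / (2::real) \<le> u/2 + u\<^sup>2/4 + u^3"
proof (rule le_from_deriv_le[where g="\<lambda>u. u/2 + u\<^sup>2/4 + u^3" and f="\<lambda>u. - ln (1 - u)/2"
      and g'="\<lambda>u. 1/2 + u/2 + 3*u\<^sup>2" and f'="\<lambda>u. 1/(2*(1-u))"])
  fix x :: real assume x: "0 \<le> x" "x \<le> u" "u \<le> 1/2"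
  have "1 \<le> 1 + x\<^sup>2 * (5 - 6*x)" using x by simp
  also have "\<dots> = (1/2 + x/2 + 3*x\<^sup>2) * (2*(1-x))" by algebra
  finally show "1/(2*(1-x)) \<le> 1/2 + x/2 + 3*x\<^sup>2" using x by (simp add: pos_divide_le_eq)
  show "((\<lambda>u. - ln (1 - u)/2) has_real_derivative 1/(2*(1-x))) (at x)"
    using x by (auto intro!: derivative_eq_intros simp: field_simps)
qed (auto intro!: derivative_eq_intros)

lemma ln_one_plus_ge: "0 \<le> u \<Longrightarrow> u - u\<^sup>2/2 \<le> ln (1 + u)" for u :: real
proof (rule le_from_deriv_le[where f="\<lambda>u. u - u\<^sup>2/2" and g="\<lambda>u. ln (1 + u)"
      and f'="\<lambda>u. 1 - u" and g'="\<lambda>u. 1/(1+u)"])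
  fix x :: real assume "0 \<le> x"
  then show "1 - x \<le> 1/(1+x)" by (simp add: field_simps)
  show "((\<lambda>u. ln (1 + u)) has_real_derivative 1/(1+x)) (at x)"
    using \<open>0 \<le> x\<close> by (auto intro!: derivative_eq_intros)
qed (auto intro!: derivative_eq_intros)

lemma g_prof_split:
  assumes "\<bar>\<alpha>\<bar> < a"
  shows "g_prof a \<alpha> \<beta> = (a - 1 - ln a) - ln (1 - \<alpha>\<^sup>2/a\<^sup>2) / 2 + \<beta>\<^sup>2/a" "0 \<le> \<alpha>\<^sup>2/a\<^sup>2" "\<alpha>\<^sup>2/a\<^sup>2 < 1"
proof -
  have a: "a > 0" using assms by linarith
  have "\<bar>\<alpha>\<bar>\<^sup>2 < a\<^sup>2" using assms by (intro power_strict_mono) auto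
  then have lt: "\<alpha>\<^sup>2 < a\<^sup>2" by simp
  then show u: "\<alpha>\<^sup>2/a\<^sup>2 < 1" using a by simp
  show "0 \<le> \<alpha>\<^sup>2/a\<^sup>2" by simp
  have "a\<^sup>2 - \<alpha>\<^sup>2 = a\<^sup>2 * (1 - \<alpha>\<^sup>2/a\<^sup>2)" using a by (simp add: field_simps)
  then have "ln (a\<^sup>2 - \<alpha>\<^sup>2) = 2 * ln a + ln (1 - \<alpha>\<^sup>2/a\<^sup>2)"
    using a u by (simp add: ln_mult ln_realpow)
  then show "g_prof a \<alpha> \<beta> = (a - 1 - ln a) - ln (1 - \<alpha>\<^sup>2/a\<^sup>2) / 2 + \<beta>\<^sup>2/a"
    by (simp add: g_prof_def diff_divide_distrib add_divide_distrib)
qed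

text \<open>\<open>ln t \<le> t - 1\<close> at \<open>t = 1/a^k\<close>. Bounds linear in
  \<open>ln a\<close> turn the minimisation over \<open>a\<close> in \<open>g_prof_lower\<close>
  into that of a quadratic polynomial.\<close>

lemma inverse_power_ge_ln:
  assumes "a > (0::real)"
  shows "1/a \<ge> 1 - ln a" "1/a\<^sup>2 \<ge> 1 - 2*ln a" "1/a^4 \<ge> 1 - 4*ln a"
proof -
  have *: "1/a^k \<ge> 1 - k * ln a" for k :: nat
    using ln_le_minus_one[of "1/a^k"] assms by (simp add: ln_div ln_realpow)
  show "1/a \<ge> 1 - ln a" "1/a\<^sup>2 \<ge> 1 - 2*ln a" "1/a^4 \<ge> 1 - 4*ln a"
    using *[of 1] *[of 2] *[of 4] by simp_all
qed

text \<open>The bound is free of \<open>a\<close>. For \<open>a \<ge> 1\<close> and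
  \<open>y = ln a\<close>, the function dominates a constant plus \<open>y\<^sup>2/2 - y *
  (\<alpha>\<^sup>2 + \<beta>\<^sup>2 + \<alpha>^4)\<close>, whose minimum is the subtracted half
  square. For \<open>a < 1\<close> all inverse powers of \<open>a\<close> exceed 1 and nothing need
  be subtracted.\<close>

lemma g_prof_lower:
  assumes "\<bar>\<alpha>\<bar> < a"
  shows "\<beta>\<^sup>2 + \<alpha>\<^sup>2/2 + \<alpha>^4/4 - (\<alpha>\<^sup>2 + \<beta>\<^sup>2 + \<alpha>^4)\<^sup>2/2 \<le> g_prof a \<alpha> \<beta>"
proof -
  have a: "a > 0" using assms by linarith
  define y where "y = ln a"
  have s: "g_prof a \<alpha> \<beta> \<ge> (a - 1 - y) + (\<alpha>\<^sup>2/a\<^sup>2/2 + (\<alpha>\<^sup>2/a\<^sup>2)\<^sup>2/4) + \<beta>\<^sup>2/a"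
    using g_prof_split(1)[OF assms, of \<beta>] ln_one_minus_le[OF g_prof_split(2,3)[OF assms]] unfolding y_def by argo
  have e1: "\<beta>\<^sup>2/a = \<beta>\<^sup>2 * (1/a)" "\<alpha>\<^sup>2/a\<^sup>2/2 = \<alpha>\<^sup>2/2 * (1/a\<^sup>2)" "(\<alpha>\<^sup>2/a\<^sup>2)\<^sup>2/4 = \<alpha>^4/4 * (1/a^4)"
    by (simp_all add: power_divide)
  show ?thesis
  proof (cases "y \<ge> 0")
    case True
    have "\<beta>\<^sup>2/a \<ge> \<beta>\<^sup>2 * (1 - y)"
      unfolding e1 y_def by (intro mult_left_mono inverse_power_ge_ln[OF a]) simp
    moreover have "\<alpha>\<^sup>2/a\<^sup>2/2 \<ge> \<alpha>\<^sup>2/2 * (1 - 2*y)"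
      unfolding e1 y_def by (intro mult_left_mono inverse_power_ge_ln[OF a]) simp
    moreover have "(\<alpha>\<^sup>2/a\<^sup>2)\<^sup>2/4 \<ge> \<alpha>^4/4 * (1 - 4*y)"
      unfolding e1 y_def by (intro mult_left_mono inverse_power_ge_ln[OF a]) simp
    moreover have "a - 1 - y \<ge> y\<^sup>2/2"
    proof -
      have "exp y \<ge> 1 + y + y\<^sup>2/2" using exp_lower_Taylor_quadratic[OF True] .
      then show ?thesis using a by (simp add: y_def)
    qed
    moreover have "y\<^sup>2/2 - y * (\<alpha>\<^sup>2 + \<beta>\<^sup>2 + \<alpha>^4) \<ge> - (\<alpha>\<^sup>2 + \<beta>\<^sup>2 + \<alpha>^4)\<^sup>2/2"
      using zero_le_power2[of "y - (\<alpha>\<^sup>2 + \<beta>\<^sup>2 + \<alpha>^4)"] unfolding power2_diff by argo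
    moreover have "\<beta>\<^sup>2 * (1 - y) + \<alpha>\<^sup>2/2 * (1 - 2*y) + \<alpha>^4/4 * (1 - 4*y)
        = \<beta>\<^sup>2 + \<alpha>\<^sup>2/2 + \<alpha>^4/4 - y * (\<alpha>\<^sup>2 + \<beta>\<^sup>2 + \<alpha>^4)"
      by (simp add: field_simps)
    ultimately show ?thesis using s by linarith
  next
    case False
    then have "a < 1" using a by (simp add: y_def)
    then have "1/a \<ge> 1" "1/a\<^sup>2 \<ge> 1" "1/a^4 \<ge> 1" using a by (simp_all add: power_le_one)
    then have "\<beta>\<^sup>2/a \<ge> \<beta>\<^sup>2 * 1" "\<alpha>\<^sup>2/a\<^sup>2/2 \<ge> \<alpha>\<^sup>2/2 * 1" "(\<alpha>\<^sup>2/a\<^sup>2)\<^sup>2/4 \<ge> \<alpha>^4/4 * 1"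
      unfolding e1 using mult_left_mono[of 1 "1/a" "\<beta>\<^sup>2"] mult_left_mono[of 1 "1/a\<^sup>2" "\<alpha>\<^sup>2/2"]
        mult_left_mono[of 1 "1/a^4" "\<alpha>^4/4"] by simp_all
    moreover have "a - 1 - y \<ge> 0" using ln_le_minus_one[OF a] by (simp add: y_def)
    moreover have "(\<alpha>\<^sup>2 + \<beta>\<^sup>2 + \<alpha>^4)\<^sup>2/2 \<ge> 0" by simp
    ultimately show ?thesis using s by linarith
  qed
qed

text \<open>Converts a bound on the value into one on \<open>a\<close>: if \<open>g_prof\<close> is
  within \<open>D\<close> of its quadratic part, then \<open>a - 1\<close> is of order
  \<open>\<alpha>\<^sup>2 + \<beta>\<^sup>2\<close> plus the root of \<open>D\<close>. This is the
  source of the rate for the mean precision.\<close>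

lemma g_prof_curvature:
  assumes "\<bar>\<alpha>\<bar> < a" "g_prof a \<alpha> \<beta> \<le> \<beta>\<^sup>2 + \<alpha>\<^sup>2/2 + D" "\<alpha>\<^sup>2 + \<beta>\<^sup>2 \<le> 1/8" "D < 1/8" "D \<ge> 0"
  shows "(a - 1)\<^sup>2 \<le> 16 * (\<alpha>\<^sup>2 + \<beta>\<^sup>2)\<^sup>2 + 8 * D"
proof -
  have a: "a > 0" using assms by linarith
  have s: "g_prof a \<alpha> \<beta> \<ge> (a - 1 - ln a) + \<alpha>\<^sup>2/a\<^sup>2/2 + \<beta>\<^sup>2/a"
    using g_prof_split(1)[OF assms(1), of \<beta>] ln_one_minus_le[OF g_prof_split(2,3)[OF assms(1)]] zero_le_power2[of "\<alpha>\<^sup>2/a\<^sup>2"] by argo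
  have e1: "\<beta>\<^sup>2/a = \<beta>\<^sup>2 * (1/a)" "\<alpha>\<^sup>2/a\<^sup>2/2 = \<alpha>\<^sup>2/2 * (1/a\<^sup>2)"
    by simp_all
  define k where "k = \<alpha>\<^sup>2 + \<beta>\<^sup>2"
  have k: "0 \<le> k" "k \<le> 1/8" using assms by (auto simp: k_def)
  show ?thesis
  proof (cases "a \<ge> 1")
    case True
    define t where "t = a - 1"
    have t: "t \<ge> 0" using True by (simp add: t_def)
    have "\<beta>\<^sup>2/a \<ge> \<beta>\<^sup>2 * (1 - ln a)"
      unfolding e1 by (intro mult_left_mono inverse_power_ge_ln[OF a]) simp
    moreover have "\<alpha>\<^sup>2/a\<^sup>2/2 \<ge> \<alpha>\<^sup>2/2 * (1 - 2*ln a)"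
      unfolding e1 by (intro mult_left_mono inverse_power_ge_ln[OF a]) simp
    moreover have "\<beta>\<^sup>2 * (1 - ln a) + \<alpha>\<^sup>2/2 * (1 - 2*ln a) = \<beta>\<^sup>2 + \<alpha>\<^sup>2/2 - k * ln a"
      by (simp add: k_def field_simps)
    moreover have "k * ln a \<le> k * t" using ln_le_minus_one[OF a] k by (auto simp: t_def intro!: mult_left_mono)
    ultimately have 1: "a - 1 - ln a \<le> k * t + D" using s assms(2) by linarith
    have 2: "t\<^sup>2/(2*(1+t)) \<le> a - 1 - ln a"
      unfolding t_def using True
      proof -
        have "t\<^sup>2/(2*(1+t)) \<le> t - ln (1 + t)"
          by (rule le_from_deriv_le[where f="\<lambda>t. t\<^sup>2/(2*(1+t))" and g="\<lambda>t. t - ln (1 + t)"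
                and f'="\<lambda>t. t*(2+t)/(2*(1+t)\<^sup>2)" and g'="\<lambda>t. 1 - 1/(1+t)"])
             (use t in \<open>auto intro!: derivative_eq_intros simp: divide_simps power2_eq_square, auto simp: algebra_simps\<close>)
        then show "(a - 1)\<^sup>2/(2*(1+(a-1))) \<le> a - 1 - ln a" by (simp add: t_def)
      qed
    \<comment> \<open>For \<open>t > 1\<close> the convex lower bound is at least
      \<open>t/4\<close>, while the allowance \<open>k * t + D\<close> is at most
      \<open>t/8 + D\<close> with \<open>D < 1/8\<close>.\<close>
    have "t \<le> 1"
    proof (rule ccontr)
      assume "\<not> t \<le> 1"
      then have "t/4 \<le> t\<^sup>2/(2*(1+t))" by (simp add: field_simps power2_eq_square)
      moreover have "k * t \<le> 1/8 * t" using k t by (intro mult_right_mono) auto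
      ultimately have "t/8 \<le> D" using 1 2 by linarith
      then show False using \<open>\<not> t \<le> 1\<close> assms(4) by linarith
    qed
    then have "t\<^sup>2/4 \<le> t\<^sup>2/(2*(1+t))" using t by (intro divide_left_mono) auto
    then have "t\<^sup>2 \<le> 4*(k * t) + 4*D" using 1 2 by linarith
    \<comment> \<open>Weighted arithmetic-geometric mean, with weights chosen so that one of the two
      copies of \<open>t\<^sup>2\<close> absorbs the mixed term.\<close>
    moreover have "8*(k*t) \<le> t\<^sup>2 + 16*k\<^sup>2" using zero_le_power2[of "t - 4*k"]
      by (simp add: power2_diff power_mult_distrib mult.commute)
    ultimately have "t\<^sup>2 \<le> 16*k\<^sup>2 + 8 * D" by linarith
    then show ?thesis by (simp add: t_def k_def)
  next
    case False
    then have "1/a \<ge> 1" "1/a\<^sup>2 \<ge> 1" using a by (simp_all add: power_le_one)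
    then have "\<beta>\<^sup>2/a \<ge> \<beta>\<^sup>2 * 1" "\<alpha>\<^sup>2/a\<^sup>2/2 \<ge> \<alpha>\<^sup>2/2 * 1"
      unfolding e1 using mult_left_mono[of 1 "1/a" "\<beta>\<^sup>2"] mult_left_mono[of 1 "1/a\<^sup>2" "\<alpha>\<^sup>2/2"] by simp_all
    then have 1: "a - 1 - ln a \<le> D" using s assms(2) by linarith
    define u where "u = 1 - a"
    have 2: "1 - u = a" by (simp add: u_def)
    have "u/2 + u\<^sup>2/4 \<le> - ln a/2"
      using ln_one_minus_le[of u] False a unfolding 2 by (auto simp: u_def)
    then have "u\<^sup>2 \<le> 2 * D" using 1 2 by linarith
    moreover have "(a-1)\<^sup>2 = u\<^sup>2" by (simp add: u_def power2_commute)
    moreover have "0 \<le> 16 * (\<alpha>\<^sup>2 + \<beta>\<^sup>2)\<^sup>2" by simp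
    ultimately show ?thesis using assms(5) by linarith
  qed
qed

text \<open>The trial point \<open>a = 1 + \<alpha>\<^sup>2 + \<beta>\<^sup>2\<close> solves the
  stationarity condition in \<open>a\<close> to leading order. Hence the value agrees with
  \<open>g_prof_lower\<close> through degree four.\<close>

lemma g_prof_upper:
  assumes "\<alpha>\<^sup>2 + \<beta>\<^sup>2 \<le> 1/2"
  shows "g_prof (1 + \<alpha>\<^sup>2 + \<beta>\<^sup>2) \<alpha> \<beta>
    \<le> \<beta>\<^sup>2 + \<alpha>\<^sup>2/2 + \<alpha>^4/4 - (\<alpha>\<^sup>2 + \<beta>\<^sup>2)\<^sup>2/2 + 3 * (\<alpha>\<^sup>2 + \<beta>\<^sup>2)^3"
    and "\<bar>\<alpha>\<bar> < 1 + \<alpha>\<^sup>2 + \<beta>\<^sup>2"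
proof -
  define x b c where "x = \<alpha>\<^sup>2" and "b = \<beta>\<^sup>2" and "c = x + b"
  have nn: "0 \<le> x" "0 \<le> b" "0 \<le> c" "c \<le> 1/2" "x \<le> c" using assms by (auto simp: x_def b_def c_def)
  have ec: "c = \<alpha>\<^sup>2 + \<beta>\<^sup>2" by (simp add: x_def b_def c_def)
  have x4: "x\<^sup>2 = \<alpha>^4" by (simp add: x_def)
  have c1: "1 + \<alpha>\<^sup>2 + \<beta>\<^sup>2 = 1 + c" by (simp add: x_def b_def c_def)
  have "2 * \<bar>\<alpha>\<bar> \<le> 1 + \<bar>\<alpha>\<bar>\<^sup>2" using zero_le_power2[of "1 - \<bar>\<alpha>\<bar>"] by (simp add: power2_diff)
  then have "2 * \<bar>\<alpha>\<bar> \<le> 1 + \<alpha>\<^sup>2" by simp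
  moreover have "0 \<le> \<alpha>\<^sup>2" "0 \<le> \<beta>\<^sup>2" by auto
  ultimately show lt: "\<bar>\<alpha>\<bar> < 1 + \<alpha>\<^sup>2 + \<beta>\<^sup>2" by linarith
  define u where "u = x/(1+c)\<^sup>2"
  have u: "g_prof (1+c) \<alpha> \<beta> = (c - ln (1+c)) - ln (1 - u)/2 + b/(1+c)"
    using g_prof_split(1)[OF lt, of \<beta>] unfolding c1 by (simp add: u_def x_def b_def)
  have "1 \<le> (1+c)\<^sup>2" using nn by simp
  then have ux: "0 \<le> u" "u \<le> x" using nn by (auto simp: u_def divide_le_eq mult_le_cancel_left1)
  have "- ln (1 - u)/2 \<le> u/2 + u\<^sup>2/4 + u^3" using ux nn by (intro ln_one_minus_ge) auto
  moreover have "u\<^sup>2 \<le> x\<^sup>2" "u^3 \<le> x^3" using ux by (auto intro!: power_mono)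
  moreover have "u \<le> x * (1 - 2*c + 3*c\<^sup>2)"
  proof -
    have "1 \<le> 1 + c\<^sup>2 * (4*c + 3*c\<^sup>2)" using nn by simp
    also have "\<dots> = (1 - 2*c + 3*c\<^sup>2) * (1+c)\<^sup>2" by algebra
    finally have "x * 1 \<le> x * ((1 - 2*c + 3*c\<^sup>2) * (1+c)\<^sup>2)" using nn by (intro mult_left_mono) auto
    then show ?thesis using nn unfolding u_def by (simp add: pos_divide_le_eq mult.assoc)
  qed
  moreover have "b/(1+c) \<le> b * (1 - c + c\<^sup>2)"
  proof -
    have "1 \<le> 1 + c^3" using nn by simp
    also have "\<dots> = (1 - c + c\<^sup>2) * (1+c)" by algebra
    finally have "b * 1 \<le> b * ((1 - c + c\<^sup>2) * (1+c))" using nn by (intro mult_left_mono) auto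
    then show ?thesis using nn by (simp add: pos_divide_le_eq mult.assoc)
  qed
  moreover have "c - ln (1+c) \<le> c\<^sup>2/2"
    using ln_one_plus_ge[OF nn(3)] by argo
  ultimately have "g_prof (1+c) \<alpha> \<beta> \<le> c\<^sup>2/2 + x * (1 - 2*c + 3*c\<^sup>2)/2 + x\<^sup>2/4 + x^3 + b * (1 - c + c\<^sup>2)"
    unfolding u by linarith
  also have "\<dots> = b + x/2 + x\<^sup>2/4 - c\<^sup>2/2 + (3/2 * x * c\<^sup>2 + x^3 + b*c\<^sup>2)"
    by (simp add: c_def) algebra
  finally have "g_prof (1+c) \<alpha> \<beta> \<le> b + x/2 + x\<^sup>2/4 - c\<^sup>2/2 + (3/2 * x * c\<^sup>2 + x^3 + b*c\<^sup>2)" .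
  moreover have "3/2 * x * c\<^sup>2 + x^3 + b*c\<^sup>2 \<le> 3 * c^3"
  proof -
    have "x^3 \<le> c^3" using nn by (intro power_mono)
    moreover have "3/2 * x * c\<^sup>2 + b*c\<^sup>2 \<le> 3/2 * c^3"
    proof -
      have "3/2 * x * c\<^sup>2 + b*c\<^sup>2 = (3/2*x + b) * c\<^sup>2" by algebra
      also have "\<dots> \<le> (3/2 * c) * c\<^sup>2" using nn by (intro mult_right_mono) (auto simp: c_def)
      finally show ?thesis by (simp add: power2_eq_square power3_eq_cube mult.assoc)
    qed
    moreover have "0 \<le> c^3" using nn by simp
    ultimately show ?thesis by linarith
  qed
  ultimately have 7: "g_prof (1+c) \<alpha> \<beta> \<le> b + x/2 + x\<^sup>2/4 - c\<^sup>2/2 + 3 * c^3" by linarith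
  show "g_prof (1 + \<alpha>\<^sup>2 + \<beta>\<^sup>2) \<alpha> \<beta>
    \<le> \<beta>\<^sup>2 + \<alpha>\<^sup>2/2 + \<alpha>^4/4 - (\<alpha>\<^sup>2 + \<beta>\<^sup>2)\<^sup>2/2 + 3 * (\<alpha>\<^sup>2 + \<beta>\<^sup>2)^3"
    using 7[unfolded x4] unfolding c1 unfolding ec b_def x_def by assumption
qed

text \<open>The slope 9/10 has to beat the slope 84/100 that \<open>J_far\<close> finds for the
  averaged \<open>lncosh\<close>. The second bound combines the first with
  \<open>\<beta>\<^sup>2/a\<close>, because the square of \<open>a + \<beta>\<^sup>2/a\<close> is at
  least \<open>\<alpha>\<^sup>2 + 2*\<beta>\<^sup>2\<close>.\<close>

lemma g_prof_ge_linear: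
  assumes "\<bar>\<alpha>\<bar> < a"
  shows "g_prof a \<alpha> \<beta> \<ge> 9/10 * a - 5" "g_prof a \<alpha> \<beta> \<ge> 9/10 * sqrt (\<alpha>\<^sup>2 + 2*\<beta>\<^sup>2) - 5"
proof -
  have a: "a > 0" using assms by linarith
  \<comment> \<open>The tangent of \<open>ln\<close> at 10 costs only a tenth of the linear term
    \<open>a\<close>.\<close>
  have "ln (a/10) \<le> a/10 - 1" using a by (intro ln_le_minus_one) auto
  then have 1: "ln a \<le> a/10 - 1 + ln 10" using a by (simp add: ln_div)
  have "ln (10::real) \<le> 5"
  proof -
    have "sqrt 10 \<le> 7/2" by (rule real_le_lsqrt) (auto simp: power2_eq_square)
    then have "ln (sqrt 10) \<le> 7/2 - 1" using ln_le_minus_one[of "sqrt 10"] by simp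
    then show ?thesis by (simp add: ln_sqrt)
  qed
  moreover have "- ln (1 - \<alpha>\<^sup>2/a\<^sup>2)/2 \<ge> 0"
    using ln_one_minus_le[OF g_prof_split(2,3)[OF assms]] g_prof_split(2)[OF assms] zero_le_power2[of "\<alpha>\<^sup>2/a\<^sup>2"] by argo
  ultimately have 2: "g_prof a \<alpha> \<beta> \<ge> 9/10 * a - 5 + \<beta>\<^sup>2/a"
    using g_prof_split(1)[OF assms, of \<beta>] 1 by argo
  moreover have nn: "\<beta>\<^sup>2/a \<ge> 0" using a by simp
  ultimately show "g_prof a \<alpha> \<beta> \<ge> 9/10 * a - 5" by linarith
  have "sqrt (\<alpha>\<^sup>2 + 2*\<beta>\<^sup>2) \<le> a + \<beta>\<^sup>2/a"
  proof (rule real_le_lsqrt)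
    have "\<bar>\<alpha>\<bar>\<^sup>2 \<le> a\<^sup>2" using assms by (intro power_mono) auto
    moreover have "(a + \<beta>\<^sup>2/a)\<^sup>2 = a\<^sup>2 + 2*\<beta>\<^sup>2 + (\<beta>\<^sup>2/a)\<^sup>2"
      using a by (simp add: power2_sum)
    moreover have "0 \<le> (\<beta>\<^sup>2/a)\<^sup>2" by simp
    ultimately show "\<alpha>\<^sup>2 + 2*\<beta>\<^sup>2 \<le> (a + \<beta>\<^sup>2/a)\<^sup>2" unfolding power2_abs by linarith
  qed (use a in auto)
  with 2 nn show "g_prof a \<alpha> \<beta> \<ge> 9/10 * sqrt (\<alpha>\<^sup>2 + 2*\<beta>\<^sup>2) - 5" by linarith
qed

subsection \<open>Convergence to a Gaussian law by smoothing\<close>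

lemma cis_measurable [measurable]: "cis \<in> borel_measurable borel"
  by (intro borel_measurable_continuous_onI continuous_intros)

text \<open>The facts that make smoothing work: the density is a Gaussian kernel, and the
  characteristic function is the same kernel again. The constant \<open>c\<close> stays a parameter,
  so that product laws fall under the locale with the product of the constants.\<close>

locale gaussian_like = prob_space N
  for N :: "'a::euclidean_space measure" and c :: real +
  assumes N_eq: "N = density lborel (\<lambda>z. ennreal (c * exp (- (norm z)\<^sup>2 / 2)))"
    and c_pos: "c > 0"
    and char_N: "\<And>u. (CLINT x|N. cis (u \<bullet> x)) = of_real (exp (- (norm u)\<^sup>2 / 2))"
    and int_norm: "integrable N norm"
begin

lemma sets_N [measurable_cong, simp]: "sets N = sets borel"
  by (subst N_eq) simp

lemma space_N [simp]: "space N = UNIV"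
  by (subst N_eq) simp

text \<open>By self-duality the kernel is an average of characters over \<open>N\<close>. Fubini
  turns its integral against \<open>\<mu> n\<close> into an average of the characteristic function
  of \<open>\<mu> n\<close>, which converges pointwise and is bounded by 1.\<close>

lemma gaussian_kernel_conv:
  assumes \<mu>: "\<And>n. prob_space (\<mu> n)" "\<And>n. sets (\<mu> n) = sets borel"
    and conv: "\<And>u. (\<lambda>n. CLINT x|\<mu> n. cis (u \<bullet> x)) \<longlonglongrightarrow> (CLINT x|N. cis (u \<bullet> x))"
    and "\<epsilon> > 0"
  shows "(\<lambda>n. \<integral>x. exp (- (norm ((y - x) /\<^sub>R \<epsilon>))\<^sup>2 / 2) \<partial>\<mu> n) \<longlonglongrightarrow>
    (\<integral>x. exp (- (norm ((y - x) /\<^sub>R \<epsilon>))\<^sup>2 / 2) \<partial>N)"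
proof -
  have rep: "complex_of_real (\<integral>x. exp (- (norm ((y - x) /\<^sub>R \<epsilon>))\<^sup>2 / 2) \<partial>\<nu>) =
      (CLINT t|N. cis ((y /\<^sub>R \<epsilon>) \<bullet> t) * (CLINT x|\<nu>. cis ((- t /\<^sub>R \<epsilon>) \<bullet> x)))"
    if "prob_space \<nu>" and s[measurable_cong]: "sets \<nu> = sets borel" for \<nu> :: "'a measure"
  proof -
    interpret nu: prob_space \<nu> by fact
    interpret pair_prob_space \<nu> N ..
    have int: "integrable (\<nu> \<Otimes>\<^sub>M N) (\<lambda>(x,t). cis (((y - x) /\<^sub>R \<epsilon>) \<bullet> t))"
      by (rule P.integrable_const_bound[where B=1]) auto
    have "complex_of_real (\<integral>x. exp (- (norm ((y - x) /\<^sub>R \<epsilon>))\<^sup>2 / 2) \<partial>\<nu>)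
        = (CLINT x|\<nu>. (CLINT t|N. cis (((y - x) /\<^sub>R \<epsilon>) \<bullet> t)))"
      unfolding char_N by simp
    also have "\<dots> = (CLINT t|N. (CLINT x|\<nu>. cis (((y - x) /\<^sub>R \<epsilon>) \<bullet> t)))"
      by (rule Fubini_integral[OF int, symmetric])
    also have "\<dots> = (CLINT t|N. cis ((y /\<^sub>R \<epsilon>) \<bullet> t) * (CLINT x|\<nu>. cis ((- t /\<^sub>R \<epsilon>) \<bullet> x)))"
    proof (rule Bochner_Integration.integral_cong[OF refl])
      fix t
      have "cis (((y - x) /\<^sub>R \<epsilon>) \<bullet> t) = cis ((y /\<^sub>R \<epsilon>) \<bullet> t) * cis ((- t /\<^sub>R \<epsilon>) \<bullet> x)" for x
        by (simp add: cis_mult inner_commute[of t] algebra_simps)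
      then show "(CLINT x|\<nu>. cis (((y - x) /\<^sub>R \<epsilon>) \<bullet> t)) = cis ((y /\<^sub>R \<epsilon>) \<bullet> t) * (CLINT x|\<nu>. cis ((- t /\<^sub>R \<epsilon>) \<bullet> x))"
        by simp
    qed
    finally show ?thesis .
  qed
  have bnd: "norm (CLINT x|\<nu>. cis (u \<bullet> x)) \<le> 1" if "prob_space \<nu>" and s[measurable_cong]: "sets \<nu> = sets borel" for \<nu> :: "'a measure" and u
  proof -
    interpret nu: prob_space \<nu> by fact
    have "norm (CLINT x|\<nu>. cis (u \<bullet> x)) \<le> (\<integral>x. norm (cis (u \<bullet> x)) \<partial>\<nu>)"
      by (rule integral_norm_bound)
    then show ?thesis by (simp add: nu.prob_space)
  qed
  have meas: "(\<lambda>t. CLINT x|\<nu>. cis ((- t /\<^sub>R \<epsilon>) \<bullet> x)) \<in> borel_measurable N"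
    if "prob_space \<nu>" and s[measurable_cong]: "sets \<nu> = sets borel" for \<nu> :: "'a measure"
  proof -
    interpret nu: prob_space \<nu> by fact
    show ?thesis by measurable
  qed
  have "(\<lambda>n. CLINT t|N. cis ((y /\<^sub>R \<epsilon>) \<bullet> t) * (CLINT x|\<mu> n. cis ((- t /\<^sub>R \<epsilon>) \<bullet> x)))
     \<longlonglongrightarrow> (CLINT t|N. cis ((y /\<^sub>R \<epsilon>) \<bullet> t) * (CLINT x|N. cis ((- t /\<^sub>R \<epsilon>) \<bullet> x)))"
  proof (rule integral_dominated_convergence[where w="\<lambda>_. 1"])
    show "AE t in N. (\<lambda>n. cis ((y /\<^sub>R \<epsilon>) \<bullet> t) * (CLINT x|\<mu> n. cis ((- t /\<^sub>R \<epsilon>) \<bullet> x)))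
      \<longlonglongrightarrow> cis ((y /\<^sub>R \<epsilon>) \<bullet> t) * (CLINT x|N. cis ((- t /\<^sub>R \<epsilon>) \<bullet> x))"
      by (intro AE_I2 tendsto_mult tendsto_const conv)
    show "AE t in N. norm (cis ((y /\<^sub>R \<epsilon>) \<bullet> t) * (CLINT x|\<mu> n. cis ((- t /\<^sub>R \<epsilon>) \<bullet> x))) \<le> 1" for n
    proof (intro AE_I2)
      fix t show "norm (cis ((y /\<^sub>R \<epsilon>) \<bullet> t) * (CLINT x|\<mu> n. cis ((- t /\<^sub>R \<epsilon>) \<bullet> x))) \<le> 1"
        using bnd[OF \<mu>, of n "- t /\<^sub>R \<epsilon>"] by (simp only: norm_mult norm_cis mult_1_left)
    qed
  qed (use meas[OF \<mu>] meas[OF prob_space_axioms sets_N] in \<open>auto intro!: borel_measurable_times\<close>)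
  then have "(\<lambda>n. complex_of_real (\<integral>x. exp (- (norm ((y - x) /\<^sub>R \<epsilon>))\<^sup>2 / 2) \<partial>\<mu> n)) \<longlonglongrightarrow>
    complex_of_real (\<integral>x. exp (- (norm ((y - x) /\<^sub>R \<epsilon>))\<^sup>2 / 2) \<partial>N)"
    unfolding rep[OF \<mu>] rep[OF prob_space_axioms sets_N] .
  then show ?thesis by (simp add: tendsto_of_real_iff)
qed

text \<open>The substitution \<open>y = x + \<epsilon> *\<^sub>R z\<close> moves \<open>x\<close>
  out of \<open>f\<close> and into the kernel, where \<open>gaussian_kernel_conv\<close> can reach
  it.\<close>

lemma smoothing_eq:
  fixes f :: "'a \<Rightarrow> real"
  assumes f[measurable]: "f \<in> borel_measurable borel" and "\<epsilon> > 0"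
  shows "(\<integral>z. f (x + \<epsilon> *\<^sub>R z) \<partial>N) = c / \<epsilon>^DIM('a) * (\<integral>y. f y * exp (- (norm ((y - x) /\<^sub>R \<epsilon>))\<^sup>2 / 2) \<partial>lborel)"
proof -
  let ?g = "\<lambda>y. f y * exp (- (norm ((y - x) /\<^sub>R \<epsilon>))\<^sup>2 / 2)"
  have "(x + \<epsilon> *\<^sub>R z - x) /\<^sub>R \<epsilon> = z" for z
    using \<open>\<epsilon> > 0\<close> by simp
  then have k: "?g (x + \<epsilon> *\<^sub>R z) = f (x + \<epsilon> *\<^sub>R z) * exp (- (norm z)\<^sup>2 / 2)" for z
    by metis
  have "(\<integral>y. ?g y \<partial>lborel) = (\<integral>y. ?g y \<partial>density (distr lborel borel (\<lambda>z. x + \<epsilon> *\<^sub>R z)) (\<lambda>_. ennreal (\<bar>\<epsilon>\<bar>^DIM('a))))"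
    using lborel_affine[of \<epsilon> x] \<open>\<epsilon> > 0\<close> by (simp add: ennreal_power)
  also have "\<dots> = (\<integral>y. \<bar>\<epsilon>\<bar>^DIM('a) *\<^sub>R ?g y \<partial>distr lborel borel (\<lambda>z. x + \<epsilon> *\<^sub>R z))"
    by (rule integral_density) auto
  also have "\<dots> = (\<integral>z. \<bar>\<epsilon>\<bar>^DIM('a) *\<^sub>R ?g (x + \<epsilon> *\<^sub>R z) \<partial>lborel)"
    by (rule integral_distr) auto
  also have "\<dots> = \<epsilon>^DIM('a) * (\<integral>z. f (x + \<epsilon> *\<^sub>R z) * exp (- (norm z)\<^sup>2 / 2) \<partial>lborel)"
    unfolding k using \<open>\<epsilon> > 0\<close> by simp
  finally have 1: "(\<integral>y. ?g y \<partial>lborel) = \<epsilon>^DIM('a) * (\<integral>z. f (x + \<epsilon> *\<^sub>R z) * exp (- (norm z)\<^sup>2 / 2) \<partial>lborel)" .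
  have "(\<integral>z. f (x + \<epsilon> *\<^sub>R z) \<partial>N) = (\<integral>z. c * (f (x + \<epsilon> *\<^sub>R z) * exp (- (norm z)\<^sup>2 / 2)) \<partial>lborel)"
    using c_pos by (subst N_eq, subst integral_density) (auto simp: mult_ac)
  also have "\<dots> = c * (\<integral>z. f (x + \<epsilon> *\<^sub>R z) * exp (- (norm z)\<^sup>2 / 2) \<partial>lborel)"
    by simp
  finally show ?thesis using 1 \<open>\<epsilon> > 0\<close> by simp
qed

text \<open>Fubini leaves an integral of \<open>f\<close> times a kernel average bounded by 1.
  Lebesgue integrability of \<open>f\<close> then provides the dominating function.\<close>

lemma smoothed_conv:
  fixes f :: "'a \<Rightarrow> real"
  assumes \<mu>: "\<And>n. prob_space (\<mu> n)" "\<And>n. sets (\<mu> n) = sets borel"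
    and conv: "\<And>u. (\<lambda>n. CLINT x|\<mu> n. cis (u \<bullet> x)) \<longlonglongrightarrow> (CLINT x|N. cis (u \<bullet> x))"
    and "\<epsilon> > 0" and f[measurable]: "f \<in> borel_measurable borel" and int_f: "integrable lborel f"
  shows "(\<lambda>n. \<integral>x. (\<integral>z. f (x + \<epsilon> *\<^sub>R z) \<partial>N) \<partial>\<mu> n) \<longlonglongrightarrow> (\<integral>x. (\<integral>z. f (x + \<epsilon> *\<^sub>R z) \<partial>N) \<partial>N)"
proof -
  let ?k = "\<lambda>y x. exp (- (norm ((y - x) /\<^sub>R \<epsilon>))\<^sup>2 / 2)"
  have sw: "(\<integral>x. (\<integral>z. f (x + \<epsilon> *\<^sub>R z) \<partial>N) \<partial>\<nu>) = c / \<epsilon>^DIM('a) * (\<integral>y. f y * (\<integral>x. ?k y x \<partial>\<nu>) \<partial>lborel)"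
    if "prob_space \<nu>" and s[measurable_cong]: "sets \<nu> = sets borel" for \<nu> :: "'a measure"
  proof -
    interpret nu: prob_space \<nu> by fact
    interpret pair_sigma_finite lborel \<nu> ..
    have int1: "integrable (lborel \<Otimes>\<^sub>M \<nu>) (\<lambda>(y,x). f y)"
    proof (rule Fubini_integrable)
      show "integrable lborel (\<lambda>x. LINT y|\<nu>. norm (case (x, y) of (y, x) \<Rightarrow> f y))"
        using int_f by (simp add: nu.prob_space)
    qed auto
    have int: "integrable (lborel \<Otimes>\<^sub>M \<nu>) (\<lambda>(y,x). f y * ?k y x)"
      by (rule Bochner_Integration.integrable_bound[OF int1])
         (auto simp: abs_mult split_beta intro!: AE_I2 mult_left_le)
    have "(\<integral>x. (\<integral>z. f (x + \<epsilon> *\<^sub>R z) \<partial>N) \<partial>\<nu>) = (\<integral>x. c / \<epsilon>^DIM('a) * (\<integral>y. f y * ?k y x \<partial>lborel) \<partial>\<nu>)"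
      using smoothing_eq[OF f \<open>\<epsilon> > 0\<close>] by simp
    also have "\<dots> = c / \<epsilon>^DIM('a) * (\<integral>x. (\<integral>y. f y * ?k y x \<partial>lborel) \<partial>\<nu>)" by simp
    also have "(\<integral>x. (\<integral>y. f y * ?k y x \<partial>lborel) \<partial>\<nu>) = (\<integral>y. (\<integral>x. f y * ?k y x \<partial>\<nu>) \<partial>lborel)"
      by (rule Fubini_integral[OF int])
    finally show ?thesis by simp
  qed
  have meas: "(\<lambda>y. f y * (\<integral>x. ?k y x \<partial>\<nu>)) \<in> borel_measurable lborel"
    if "prob_space \<nu>" and s[measurable_cong]: "sets \<nu> = sets borel" for \<nu> :: "'a measure"
  proof -
    interpret nu: prob_space \<nu> by fact
    show ?thesis by measurable
  qed
  have k1: "\<bar>\<integral>x. ?k y x \<partial>\<nu>\<bar> \<le> 1" if "prob_space \<nu>" and s[measurable_cong]: "sets \<nu> = sets borel" for \<nu> :: "'a measure" and y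
  proof -
    interpret nu: prob_space \<nu> by fact
    have "(\<integral>x. ?k y x \<partial>\<nu>) \<le> (\<integral>x. 1 \<partial>\<nu>)"
      by (intro integral_mono nu.integrable_const_bound[where B=1]) auto
    moreover have "0 \<le> (\<integral>x. ?k y x \<partial>\<nu>)" by (intro integral_nonneg_AE) auto
    ultimately show ?thesis by (simp add: nu.prob_space)
  qed
  have "(\<lambda>n. \<integral>y. f y * (\<integral>x. ?k y x \<partial>\<mu> n) \<partial>lborel) \<longlonglongrightarrow> (\<integral>y. f y * (\<integral>x. ?k y x \<partial>N) \<partial>lborel)"
  proof (rule integral_dominated_convergence[where w="\<lambda>y. \<bar>f y\<bar>"])
    show "AE y in lborel. (\<lambda>n. f y * (\<integral>x. ?k y x \<partial>\<mu> n)) \<longlonglongrightarrow> f y * (\<integral>x. ?k y x \<partial>N)"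
      by (intro AE_I2 tendsto_mult tendsto_const gaussian_kernel_conv \<mu> conv \<open>\<epsilon> > 0\<close>)
    show "AE y in lborel. norm (f y * (\<integral>x. ?k y x \<partial>\<mu> n)) \<le> \<bar>f y\<bar>" for n
      using k1[OF \<mu>] by (auto simp: abs_mult intro!: mult_left_le)
  qed (use meas[OF \<mu>] meas[OF prob_space_axioms sets_N] int_f in auto)
  then show ?thesis unfolding sw[OF \<mu>] sw[OF prob_space_axioms sets_N] by (intro tendsto_intros)
qed

text \<open>Small displacements are handled by uniform continuity, large ones by Markov's inequality
  with the first moment of \<open>N\<close>.\<close>

lemma smoothing_uniform:
  fixes f :: "'a \<Rightarrow> real"
  assumes cont: "continuous_on UNIV f" and supp: "\<And>x. norm x > L \<Longrightarrow> f x = 0"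
    and B: "\<And>x. \<bar>f x\<bar> \<le> B" and "\<eta> > 0"
  shows "\<exists>\<epsilon>>0. \<forall>x. \<bar>(\<integral>z. f (x + \<epsilon> *\<^sub>R z) \<partial>N) - f x\<bar> \<le> \<eta>"
proof -
  have fm[measurable]: "f \<in> borel_measurable borel"
    using cont by (rule borel_measurable_continuous_onI)
  have "B \<ge> 0" using B[of 0] by linarith
  have "uniformly_continuous_on (cball 0 (L+1)) f"
    by (rule compact_uniformly_continuous) (auto intro: continuous_on_subset[OF cont])
  then obtain d where d: "d > 0" "\<And>x y. norm x \<le> L+1 \<Longrightarrow> norm y \<le> L+1 \<Longrightarrow> norm (y - x) < d \<Longrightarrow> \<bar>f y - f x\<bar> < \<eta>/2"
    unfolding uniformly_continuous_on_def using \<open>\<eta> > 0\<close>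
    by (auto simp: dist_norm dest!: spec[of _ "\<eta>/2"])
  define \<delta> where "\<delta> = min d 1"
  have \<delta>: "\<delta> > 0" using d by (simp add: \<delta>_def)
  have near: "\<bar>f (x + h) - f x\<bar> \<le> \<eta>/2" if "norm h < \<delta>" for x h
  proof (cases "norm x \<le> L \<or> norm (x + h) \<le> L")
    case True
    have "norm h < 1" "norm h < d" using that by (auto simp: \<delta>_def)
    moreover have "norm (x + h) \<le> norm x + norm h" by (rule norm_triangle_ineq)
    moreover have "norm x \<le> norm (x + h) + norm h" using norm_triangle_ineq4[of "x + h" h] by simp
    ultimately have "norm x \<le> L + 1" "norm (x + h) \<le> L + 1" using True by linarith+
    from d(2)[OF this] show ?thesis using \<open>norm h < d\<close> by simp
  next
    case False then show ?thesis using supp[of x] supp[of "x+h"] \<open>\<eta> > 0\<close> by auto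
  qed
  define m where "m = (\<integral>z. norm z \<partial>N)"
  have m: "m \<ge> 0" by (simp add: m_def)
  \<comment> \<open>Chosen so that the Markov term \<open>2 * B * \<epsilon> / \<delta> * m\<close>
    is at most \<open>\<eta>/2\<close>; the added ones guard against \<open>B = 0\<close> and
    \<open>m = 0\<close>.\<close>
  define \<epsilon> where "\<epsilon> = \<eta> * \<delta> / (4 * (B + 1) * (m + 1))"
  have \<epsilon>: "\<epsilon> > 0" using \<open>\<eta> > 0\<close> \<delta> \<open>B \<ge> 0\<close> m by (simp add: \<epsilon>_def)
  have "\<bar>(\<integral>z. f (x + \<epsilon> *\<^sub>R z) \<partial>N) - f x\<bar> \<le> \<eta>" for x
  proof -
    have i1: "integrable N (\<lambda>z. f (x + \<epsilon> *\<^sub>R z))"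
      by (rule integrable_const_bound[where B=B]) (use B in auto)
    have i2: "integrable N (\<lambda>z. \<eta>/2 + 2 * B * \<epsilon> / \<delta> * norm z)"
      by (intro Bochner_Integration.integrable_add integrable_mult_right int_norm) auto
    have "(\<integral>z. f (x + \<epsilon> *\<^sub>R z) \<partial>N) - f x = (\<integral>z. f (x + \<epsilon> *\<^sub>R z) - f x \<partial>N)"
      using i1 prob_space by simp
    also have "\<bar>\<dots>\<bar> \<le> (\<integral>z. \<bar>f (x + \<epsilon> *\<^sub>R z) - f x\<bar> \<partial>N)"
      using integral_norm_bound[of N "\<lambda>z. f (x + \<epsilon> *\<^sub>R z) - f x"] by simp
    also have "\<dots> \<le> (\<integral>z. \<eta>/2 + 2 * B * \<epsilon> / \<delta> * norm z \<partial>N)"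
    proof (rule integral_mono[OF _ i2])
      show "integrable N (\<lambda>z. \<bar>f (x + \<epsilon> *\<^sub>R z) - f x\<bar>)"
        using i1 by (intro integrable_abs Bochner_Integration.integrable_diff) auto
      fix z
      show "\<bar>f (x + \<epsilon> *\<^sub>R z) - f x\<bar> \<le> \<eta>/2 + 2 * B * \<epsilon> / \<delta> * norm z"
      proof (cases "norm (\<epsilon> *\<^sub>R z) < \<delta>")
        case True
        have "0 \<le> 2 * B * \<epsilon> / \<delta> * norm z" using \<open>B \<ge> 0\<close> \<epsilon> \<delta> by simp
        with near[OF True, of x] show ?thesis by linarith
      next
        case False
        then have "1 \<le> \<epsilon> * norm z / \<delta>" using \<delta> \<epsilon> by simp
        then have "2 * B * 1 \<le> 2 * B * (\<epsilon> * norm z / \<delta>)" using \<open>B \<ge> 0\<close> by (intro mult_left_mono) auto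
        moreover have "\<bar>f (x + \<epsilon> *\<^sub>R z) - f x\<bar> \<le> 2 * B" using B[of x] B[of "x + \<epsilon> *\<^sub>R z"] by linarith
        moreover have "2 * B * (\<epsilon> * norm z / \<delta>) = 2 * B * \<epsilon> / \<delta> * norm z" by simp
        ultimately show ?thesis using \<open>\<eta> > 0\<close> by linarith
      qed
    qed
    also have "\<dots> = \<eta>/2 + 2 * B * \<epsilon> / \<delta> * m"
      using int_norm prob_space by (simp add: m_def)
    also have "2 * B * \<epsilon> / \<delta> * m = \<eta>/2 * (B/(B+1) * (m/(m+1)))"
      using \<delta> \<open>B \<ge> 0\<close> m by (simp add: \<epsilon>_def divide_simps)
    also have "\<dots> \<le> \<eta>/2 * (1 * 1)"
      using \<open>\<eta> > 0\<close> \<open>B \<ge> 0\<close> m by (intro mult_left_mono mult_mono) auto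
    finally show ?thesis by simp
  qed
  with \<epsilon> show ?thesis by blast
qed

lemma compact_support_conv:
  fixes f :: "'a \<Rightarrow> real"
  assumes \<mu>: "\<And>n. prob_space (\<mu> n)" "\<And>n. sets (\<mu> n) = sets borel"
    and conv: "\<And>u. (\<lambda>n. CLINT x|\<mu> n. cis (u \<bullet> x)) \<longlonglongrightarrow> (CLINT x|N. cis (u \<bullet> x))"
    and cont: "continuous_on UNIV f" and supp: "\<And>x. norm x > L \<Longrightarrow> f x = 0"
    and B: "\<And>x. \<bar>f x\<bar> \<le> B"
  shows "(\<lambda>n. \<integral>x. f x \<partial>\<mu> n) \<longlonglongrightarrow> (\<integral>x. f x \<partial>N)"
proof (rule LIMSEQ_I)
  fix r :: real assume "r > 0"
  have fm[measurable]: "f \<in> borel_measurable borel"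
    using cont by (rule borel_measurable_continuous_onI)
  obtain \<epsilon> where \<epsilon>: "\<epsilon> > 0" "\<And>x. \<bar>(\<integral>z. f (x + \<epsilon> *\<^sub>R z) \<partial>N) - f x\<bar> \<le> r/4"
    using smoothing_uniform[OF cont supp B, of L "r/4"] \<open>r > 0\<close> by auto
  let ?F = "\<lambda>x. \<integral>z. f (x + \<epsilon> *\<^sub>R z) \<partial>N"
  have "integrable lborel (\<lambda>x. indicator (cball 0 L) x *\<^sub>R f x)"
    by (rule borel_integrable_compact) (auto intro: continuous_on_subset[OF cont])
  then have "integrable lborel f"
    by (rule Bochner_Integration.integrable_cong[THEN iffD1, rotated -1])
       (use supp in \<open>auto simp: indicator_def not_le\<close>)
  from smoothed_conv[OF \<mu> conv \<open>\<epsilon> > 0\<close> fm this]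
  have "(\<lambda>n. \<integral>x. ?F x \<partial>\<mu> n) \<longlonglongrightarrow> (\<integral>x. ?F x \<partial>N)" .
  from LIMSEQ_D[OF this, of "r/4"] obtain k where
    k: "\<And>n. n \<ge> k \<Longrightarrow> \<bar>(\<integral>x. ?F x \<partial>\<mu> n) - (\<integral>x. ?F x \<partial>N)\<bar> < r/4"
    using \<open>r > 0\<close> by (auto)
  have app: "\<bar>(\<integral>x. ?F x \<partial>\<nu>) - (\<integral>x. f x \<partial>\<nu>)\<bar> \<le> r/4"
    if "prob_space \<nu>" and s[measurable_cong]: "sets \<nu> = sets borel" for \<nu> :: "'a measure"
  proof -
    interpret nu: prob_space \<nu> by fact
    have i1: "integrable \<nu> f"
      by (rule nu.integrable_const_bound[where B=B]) (use B in auto)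
    have i2: "integrable \<nu> ?F"
    proof (rule nu.integrable_const_bound[where B="B + r/4"])
      show "AE x in \<nu>. norm (?F x) \<le> B + r/4"
      proof (intro AE_I2)
        fix x show "norm (?F x) \<le> B + r/4" using \<epsilon>(2)[of x] B[of x] unfolding real_norm_def by linarith
      qed
    qed measurable
    have "(\<integral>x. ?F x \<partial>\<nu>) - (\<integral>x. f x \<partial>\<nu>) = (\<integral>x. ?F x - f x \<partial>\<nu>)"
      using i1 i2 by simp
    also have "\<bar>\<dots>\<bar> \<le> (\<integral>x. \<bar>?F x - f x\<bar> \<partial>\<nu>)"
      using integral_norm_bound[of \<nu> "\<lambda>x. ?F x - f x"] by simp
    also have "\<dots> \<le> (\<integral>x. r/4 \<partial>\<nu>)"
      using i1 i2 \<epsilon>(2) by (intro integral_mono integrable_abs Bochner_Integration.integrable_diff) auto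
    finally show ?thesis by (simp add: nu.prob_space)
  qed
  show "\<exists>no. \<forall>n\<ge>no. norm ((\<integral>x. f x \<partial>\<mu> n) - (\<integral>x. f x \<partial>N)) < r"
  proof (intro exI allI impI)
    fix n assume "n \<ge> k"
    show "norm ((\<integral>x. f x \<partial>\<mu> n) - (\<integral>x. f x \<partial>N)) < r"
      using k[OF \<open>n \<ge> k\<close>] app[OF \<mu>, of n] app[OF prob_space_axioms sets_N] \<open>r > 0\<close>
      unfolding real_norm_def by linarith
  qed
qed

text \<open>Tightness is obtained along the way: the truncation error under \<open>\<mu> n\<close>
  is at most \<open>B * (1 - (\<integral>x. ct x \<partial>\<mu> n))\<close>, and the cutoff
  \<open>ct\<close> has compact support, so its integrals already converge to a value close to
  1.\<close>

theorem char_conv_imp_bdd_continuous_conv: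
  fixes f :: "'a \<Rightarrow> real"
  assumes \<mu>: "\<And>n. prob_space (\<mu> n)" "\<And>n. sets (\<mu> n) = sets borel"
    and conv: "\<And>u. (\<lambda>n. CLINT x|\<mu> n. cis (u \<bullet> x)) \<longlonglongrightarrow> (CLINT x|N. cis (u \<bullet> x))"
    and cont: "continuous_on UNIV f"
    and B: "\<And>x. \<bar>f x\<bar> \<le> B"
  shows "(\<lambda>n. \<integral>x. f x \<partial>\<mu> n) \<longlonglongrightarrow> (\<integral>x. f x \<partial>N)"
proof (rule LIMSEQ_I)
  fix r :: real assume "r > 0"
  have fm[measurable]: "f \<in> borel_measurable borel"
    using cont by (rule borel_measurable_continuous_onI)
  have "B \<ge> 0" using B[of 0] by linarith
  define m where "m = (\<integral>z. norm z \<partial>N)"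
  have m: "m \<ge> 0" by (simp add: m_def)
  \<comment> \<open>By Markov's inequality the cutoff misses mass at most \<open>m / L\<close> under
    \<open>N\<close>; this choice makes \<open>B\<close> times that mass at most
    \<open>r/8\<close>.\<close>
  define L where "L = 8 * (B + 1) * (m + 1) / r"
  have L: "L > 0" using \<open>r > 0\<close> m \<open>B \<ge> 0\<close> by (simp add: L_def)
  define ct where "ct x = max 0 (min 1 (L + 1 - norm x))" for x :: 'a
  have ct: "0 \<le> ct x" "ct x \<le> 1" "norm x > L + 1 \<Longrightarrow> ct x = 0" "1 - ct x \<le> norm x / L" for x
  proof -
    show "0 \<le> ct x" "ct x \<le> 1" "norm x > L + 1 \<Longrightarrow> ct x = 0" by (auto simp: ct_def)
    show "1 - ct x \<le> norm x / L"
    proof (cases "norm x \<le> L")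
      case True then have "ct x = 1" by (simp add: ct_def)
      then show ?thesis using L by simp
    next
      case False then have "1 \<le> norm x / L" using L by simp
      then show ?thesis using \<open>0 \<le> ct x\<close> by linarith
    qed
  qed
  have ct_cont: "continuous_on UNIV ct" unfolding ct_def by (intro continuous_intros)
  then have ctm[measurable]: "ct \<in> borel_measurable borel" by (rule borel_measurable_continuous_onI)
  have c1: "(\<lambda>n. \<integral>x. ct x \<partial>\<mu> n) \<longlonglongrightarrow> (\<integral>x. ct x \<partial>N)"
    by (rule compact_support_conv[OF \<mu> conv ct_cont, of "L + 1" 1]) (use ct in auto)
  have c2: "(\<lambda>n. \<integral>x. f x * ct x \<partial>\<mu> n) \<longlonglongrightarrow> (\<integral>x. f x * ct x \<partial>N)"
  proof (rule compact_support_conv[OF \<mu> conv, of _ "L + 1" B])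
    show "\<bar>f x * ct x\<bar> \<le> B" for x
      using mult_mono[OF B[of x], of "\<bar>ct x\<bar>" 1] ct[of x] \<open>B \<ge> 0\<close> by (simp add: abs_mult)
  qed (use ct cont ct_cont in \<open>auto intro!: continuous_intros\<close>)
  have intct: "integrable \<nu> ct" if "prob_space \<nu>" and s[measurable_cong]: "sets \<nu> = sets borel" for \<nu> :: "'a measure"
  proof -
    interpret nu: prob_space \<nu> by fact
    show ?thesis by (rule nu.integrable_const_bound[where B=1]) (use ct in auto)
  qed
  have tail: "\<bar>(\<integral>x. f x \<partial>\<nu>) - (\<integral>x. f x * ct x \<partial>\<nu>)\<bar> \<le> B * (1 - (\<integral>x. ct x \<partial>\<nu>))"
    if "prob_space \<nu>" and s[measurable_cong]: "sets \<nu> = sets borel" for \<nu> :: "'a measure"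
  proof -
    interpret nu: prob_space \<nu> by fact
    have i1: "integrable \<nu> f"
      by (rule nu.integrable_const_bound[where B=B]) (use B in auto)
    have i2: "integrable \<nu> (\<lambda>x. f x * ct x)"
      by (rule Bochner_Integration.integrable_bound[OF i1]) (use ct in \<open>auto simp: abs_mult intro!: mult_left_le\<close>)
    have "(\<integral>x. f x \<partial>\<nu>) - (\<integral>x. f x * ct x \<partial>\<nu>) = (\<integral>x. f x - f x * ct x \<partial>\<nu>)"
      using i1 i2 by simp
    also have "\<bar>\<dots>\<bar> \<le> (\<integral>x. \<bar>f x - f x * ct x\<bar> \<partial>\<nu>)"
      using integral_norm_bound[of \<nu> "\<lambda>x. f x - f x * ct x"] by simp
    also have "\<dots> \<le> (\<integral>x. B * (1 - ct x) \<partial>\<nu>)"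
    proof (intro integral_mono integrable_abs Bochner_Integration.integrable_diff i1 i2)
      show "integrable \<nu> (\<lambda>x. B * (1 - ct x))" using intct[OF that] by auto
      fix x
      have "f x - f x * ct x = f x * (1 - ct x)" by (simp add: algebra_simps)
      then have "\<bar>f x - f x * ct x\<bar> = \<bar>f x\<bar> * (1 - ct x)" using ct[of x] by (simp add: abs_mult)
      then show "\<bar>f x - f x * ct x\<bar> \<le> B * (1 - ct x)" using B[of x] ct[of x] by (simp add: mult_right_mono)
    qed
    also have "\<dots> = B * (1 - (\<integral>x. ct x \<partial>\<nu>))" using intct[OF that] by (simp add: nu.prob_space)
    finally show ?thesis .
  qed
  have "1 - (\<integral>x. ct x \<partial>N) = (\<integral>x. 1 - ct x \<partial>N)"
    using intct[OF prob_space_axioms sets_N] prob_space by simp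
  also have "\<dots> \<le> (\<integral>x. norm x / L \<partial>N)"
    using intct[OF prob_space_axioms sets_N] int_norm ct by (intro integral_mono) auto
  also have "\<dots> = m / L" using int_norm by (simp add: m_def)
  finally have t1: "1 - (\<integral>x. ct x \<partial>N) \<le> m / L" .
  have "B * (m / L) = r/8 * (B/(B+1) * (m/(m+1)))"
    using \<open>r > 0\<close> \<open>B \<ge> 0\<close> m by (simp add: L_def divide_simps)
  also have "\<dots> \<le> r/8 * (1 * 1)"
    using \<open>r > 0\<close> \<open>B \<ge> 0\<close> m by (intro mult_left_mono mult_mono) auto
  finally have t2: "B * (1 - (\<integral>x. ct x \<partial>N)) \<le> r/8"
    using mult_left_mono[OF t1 \<open>B \<ge> 0\<close>] by linarith
  have "(\<lambda>n. B * (1 - (\<integral>x. ct x \<partial>\<mu> n))) \<longlonglongrightarrow> B * (1 - (\<integral>x. ct x \<partial>N))"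
    by (intro tendsto_intros c1)
  from LIMSEQ_D[OF this, of "r/8"] obtain k where
    k: "\<And>n. n \<ge> k \<Longrightarrow> \<bar>B * (1 - (\<integral>x. ct x \<partial>\<mu> n)) - B * (1 - (\<integral>x. ct x \<partial>N))\<bar> < r/8"
    using \<open>r > 0\<close> by auto
  from LIMSEQ_D[OF c2, of "r/8"] obtain l where
    l: "\<And>n. n \<ge> l \<Longrightarrow> \<bar>(\<integral>x. f x * ct x \<partial>\<mu> n) - (\<integral>x. f x * ct x \<partial>N)\<bar> < r/8"
    using \<open>r > 0\<close> by auto
  show "\<exists>no. \<forall>n\<ge>no. norm ((\<integral>x. f x \<partial>\<mu> n) - (\<integral>x. f x \<partial>N)) < r"
  proof (intro exI allI impI)
    fix n assume "n \<ge> max k l"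
    then have "n \<ge> k" "n \<ge> l" by auto
    show "norm ((\<integral>x. f x \<partial>\<mu> n) - (\<integral>x. f x \<partial>N)) < r"
      using k[OF \<open>n \<ge> k\<close>] l[OF \<open>n \<ge> l\<close>] tail[OF \<mu>, of n] tail[OF prob_space_axioms sets_N] t2 \<open>r > 0\<close>
      unfolding real_norm_def by linarith
  qed
qed

end

section \<open>The standard normal law and its products as instances of the smoothing locale\<close>

lemma std_normal_eq: "std_normal = std_normal_distribution"
  by (simp add: std_normal_def)

interpretation std_normal: prob_space std_normal
  unfolding std_normal_eq by (rule prob_space_normal_density) simp

lemma sets_std_normal [measurable_cong, simp]: "sets std_normal = sets borel"
  and space_std_normal [simp]: "space std_normal = UNIV"
  by (simp_all add: std_normal_def)

lemma gaussian_like_std_normal: "gaussian_like std_normal (1 / sqrt (2 * pi))"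
proof (unfold_locales)
  show "std_normal = density lborel (\<lambda>z. ennreal (1 / sqrt (2 * pi) * exp (- (norm z)\<^sup>2 / 2)))"
    by (simp add: std_normal_def std_normal_density_def)
  show "(CLINT x|std_normal. cis (u \<bullet> x)) = complex_of_real (exp (- (norm u)\<^sup>2 / 2))" for u
    using fun_cong[OF char_std_normal_distribution, of u]
    by (simp add: char_def std_normal_eq cis_conv_exp mult.commute)
  have "integrable lborel (\<lambda>x. std_normal_density x * \<bar>x\<bar>^1)" by (rule integrable_std_normal_moment_abs)
  then show "integrable std_normal norm"
    unfolding std_normal_def by (subst integrable_density) auto
qed simp

lemma gaussian_like_pair:
  fixes N1 :: "'a::euclidean_space measure" and N2 :: "'b::euclidean_space measure"
  assumes "gaussian_like N1 c1" "gaussian_like N2 c2"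
  shows "gaussian_like (N1 \<Otimes>\<^sub>M N2) (c1 * c2)"
proof -
  interpret A: gaussian_like N1 c1 by fact
  interpret B: gaussian_like N2 c2 by fact
  interpret pair_prob_space N1 N2 ..
  show ?thesis
  proof (unfold_locales)
    have "N1 \<Otimes>\<^sub>M N2 = density lborel (\<lambda>z. ennreal (c1 * exp (- (norm z)\<^sup>2 / 2))) \<Otimes>\<^sub>M density lborel (\<lambda>z. ennreal (c2 * exp (- (norm z)\<^sup>2 / 2)))"
      using A.N_eq B.N_eq by simp
    also have "\<dots> = density (lborel \<Otimes>\<^sub>M lborel) (\<lambda>(x,y). ennreal (c1 * exp (- (norm x)\<^sup>2 / 2)) * ennreal (c2 * exp (- (norm y)\<^sup>2 / 2)))"
    proof (rule pair_measure_density)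
      show "sigma_finite_measure (density lborel (\<lambda>z::'b. ennreal (c2 * exp (- (norm z)\<^sup>2 / 2))))"
        using B.sigma_finite_measure_axioms unfolding B.N_eq[symmetric] .
    qed (auto intro: sigma_finite_lborel)
    also have "(\<lambda>(x::'a,y::'b). ennreal (c1 * exp (- (norm x)\<^sup>2 / 2)) * ennreal (c2 * exp (- (norm y)\<^sup>2 / 2)))
       = (\<lambda>z. ennreal (c1 * c2 * exp (- (norm z)\<^sup>2 / 2)))"
    proof (clarsimp simp: fun_eq_iff)
      fix x :: 'a and y :: 'b
      have "exp (- ((norm (x, y))\<^sup>2 / 2)) = exp (- ((norm x)\<^sup>2 / 2)) * exp (- ((norm y)\<^sup>2 / 2))"
        unfolding exp_add[symmetric] by (simp add: norm_Pair field_simps)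
      then show "ennreal (c1 * exp (- ((norm x)\<^sup>2 / 2))) * ennreal (c2 * exp (- ((norm y)\<^sup>2 / 2))) =
          ennreal (c1 * c2 * exp (- ((norm (x, y))\<^sup>2 / 2)))"
        using A.c_pos B.c_pos by (simp add: ennreal_mult[symmetric] mult_ac)
    qed
    finally show "N1 \<Otimes>\<^sub>M N2 = density lborel (\<lambda>z. ennreal (c1 * c2 * exp (- (norm z)\<^sup>2 / 2)))"
      by (simp add: lborel_prod)
    show "c1 * c2 > 0" using A.c_pos B.c_pos by simp
    show "(CLINT x|N1 \<Otimes>\<^sub>M N2. cis (u \<bullet> x)) = complex_of_real (exp (- (norm u)\<^sup>2 / 2))" for u
    proof -
      obtain a b where u: "u = (a, b)" by (cases u)
      have int: "integrable (N1 \<Otimes>\<^sub>M N2) (\<lambda>(x,y). cis (a \<bullet> x) * cis (b \<bullet> y))"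
        by (rule P.integrable_const_bound[where B=1]) (auto simp: norm_mult)
      have "(CLINT x|N1 \<Otimes>\<^sub>M N2. cis (u \<bullet> x)) = (CLINT z|N1 \<Otimes>\<^sub>M N2. (\<lambda>(x,y). cis (a \<bullet> x) * cis (b \<bullet> y)) z)"
        by (intro Bochner_Integration.integral_cong) (auto simp: u inner_Pair cis_mult)
      also have "\<dots> = (CLINT x|N1. CLINT y|N2. cis (a \<bullet> x) * cis (b \<bullet> y))"
        using integral_fst[OF int] by simp
      also have "\<dots> = of_real (exp (- (norm a)\<^sup>2 / 2)) * of_real (exp (- (norm b)\<^sup>2 / 2))"
        by (simp add: A.char_N B.char_N)
      also have "\<dots> = complex_of_real (exp (- (norm u)\<^sup>2 / 2))"
        unfolding of_real_mult[symmetric] exp_add[symmetric] by (simp add: u norm_Pair field_simps)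
      finally show ?thesis .
    qed
    have "integrable (distr (N1 \<Otimes>\<^sub>M N2) N1 fst) norm"
      using A.int_norm by (simp add: B.distr_pair_fst)
    then have f: "integrable (N1 \<Otimes>\<^sub>M N2) (\<lambda>z. norm (fst z))"
      by (subst (asm) integrable_distr_eq) auto
    have s: "integrable (N1 \<Otimes>\<^sub>M N2) (\<lambda>z. norm (snd z))"
    proof (rule Fubini_integrable)
      have "(\<lambda>z::'b. norm z) \<in> borel_measurable N2" by measurable
      then show "(\<lambda>z. norm (snd z)) \<in> borel_measurable (N1 \<Otimes>\<^sub>M N2)" by measurable
    qed (use B.int_norm in auto)
    have "sets (N1 \<Otimes>\<^sub>M N2) = sets (borel :: ('a \<times> 'b) measure)"
      using sets_pair_measure_cong[OF A.sets_N B.sets_N] unfolding borel_prod .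
    then have [measurable]: "norm \<in> borel_measurable (N1 \<Otimes>\<^sub>M N2)"
      by (subst measurable_cong_sets[OF _ refl]) auto
    show "integrable (N1 \<Otimes>\<^sub>M N2) norm"
      by (rule Bochner_Integration.integrable_bound[OF Bochner_Integration.integrable_add[OF f s]])
         (auto simp: norm_Pair sqrt_sum_squares_le_sum)
  qed
qed

subsection \<open>The rotated standardised pair\<close>

definition std_normal2 :: "(real \<times> real) measure" where
  "std_normal2 = std_normal \<Otimes>\<^sub>M std_normal"

interpretation std_normal2: pair_prob_space std_normal std_normal ..

interpretation N2: gaussian_like std_normal2 "1 / sqrt (2 * pi) * (1 / sqrt (2 * pi))"
  unfolding std_normal2_def by (intro gaussian_like_pair gaussian_like_std_normal)

text \<open>Swapping the two observations is the reflection of the first coordinate.\<close>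

definition rot :: "real \<Rightarrow> real \<Rightarrow> real \<times> real \<Rightarrow> real \<times> real" where
  "rot c w x = ((fst x - snd x) / (sqrt 2 * w), (fst x + snd x - 2 * c) / (sqrt 2 * w))"

lemma rot_measurable [measurable]: "rot c w \<in> borel \<rightarrow>\<^sub>M borel"
  unfolding rot_def by (simp only: borel_prod[symmetric]) measurable

lemma bvn_measurable [measurable]: "bvn_density \<theta> \<in> borel_measurable borel"
  unfolding bvn_density_def[abs_def] by (cases \<theta>) (simp add: split_beta borel_prod[symmetric])

text \<open>Tonelli and two substitutions in one variable each: \<open>x1\<close> at fixed
  \<open>x2\<close>, then \<open>x2\<close> at fixed \<open>p\<close>. Their Jacobians
  \<open>sqrt 2 * \<sigma>\<close> and \<open>\<sigma> / sqrt 2\<close> multiply to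
  \<open>\<sigma>\<^sup>2\<close>, which cancels the normalisation of the density.\<close>

lemma distr_rot:
  assumes "\<sigma> > 0"
  shows "distr (density lborel (\<lambda>x. ennreal (bvn_density (\<mu>, \<mu>, \<sigma>, \<sigma>, 0) x))) borel (rot \<mu> \<sigma>) = std_normal2"
proof (rule measure_eqI)
  let ?D = "density lborel (\<lambda>x. ennreal (bvn_density (\<mu>, \<mu>, \<sigma>, \<sigma>, 0) x))"
  fix A :: "(real \<times> real) set" assume "A \<in> sets (distr ?D borel (rot \<mu> \<sigma>))"
  then have A[measurable]: "A \<in> sets borel" by simp
  define F where "F x = ennreal (bvn_density (\<mu>, \<mu>, \<sigma>, \<sigma>, 0) x) * indicator A (rot \<mu> \<sigma> x)" for x :: "real \<times> real"
  have F[measurable]: "F \<in> borel_measurable (borel \<Otimes>\<^sub>M borel)"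
    unfolding F_def borel_prod by measurable
  have F': "F \<in> borel_measurable (lborel \<Otimes>\<^sub>M lborel)" by measurable
  have c: "sqrt 2 * \<sigma> \<noteq> 0" "\<sigma> / sqrt 2 \<noteq> 0" using assms by auto
  have val: "ennreal (sqrt 2 * \<sigma>) * (ennreal (\<sigma> / sqrt 2) * F (\<mu> - \<sigma> / sqrt 2 * p + \<sigma> / sqrt 2 * s + sqrt 2 * \<sigma> * p, \<mu> - \<sigma> / sqrt 2 * p + \<sigma> / sqrt 2 * s))
      = ennreal (1 / sqrt (2 * pi) * (1 / sqrt (2 * pi)) * exp (- (norm (p, s))\<^sup>2 / 2)) * indicator A (p, s)" for p s
  proof -
    define x1 x2 where "x1 = \<mu> - \<sigma> / sqrt 2 * p + \<sigma> / sqrt 2 * s + sqrt 2 * \<sigma> * p"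
      and "x2 = \<mu> - \<sigma> / sqrt 2 * p + \<sigma> / sqrt 2 * s"
    have h: "\<sigma> / sqrt 2 * t = sqrt 2 * \<sigma> * t / 2" for t by (simp add: field_simps)
    have x1: "x1 = \<mu> + sqrt 2 * \<sigma> * ((s + p) / 2)" and x2: "x2 = \<mu> + sqrt 2 * \<sigma> * ((s - p) / 2)"
      unfolding x1_def x2_def h by (simp_all add: field_simps)
    have rot: "rot \<mu> \<sigma> (x1, x2) = (p, s)"
      unfolding rot_def x1 x2 using assms by (simp add: field_simps)
    have d1: "(x1 - \<mu>) / \<sigma> = sqrt 2 * ((s + p) / 2)" "(x2 - \<mu>) / \<sigma> = sqrt 2 * ((s - p) / 2)"
      unfolding x1 x2 using assms by simp_all
    have "bvn_density (\<mu>, \<mu>, \<sigma>, \<sigma>, 0) (x1, x2) = 1 / (2 * pi * \<sigma> * \<sigma>) * exp (- (norm (p, s))\<^sup>2 / 2)"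
      unfolding bvn_density_def by (simp add: d1 norm_Pair power_mult_distrib) (simp add: power2_eq_square field_simps)
    moreover have "sqrt 2 * \<sigma> * (\<sigma> / sqrt 2) * (1 / (2 * pi * \<sigma> * \<sigma>)) = 1 / sqrt (2 * pi) * (1 / sqrt (2 * pi))"
      using assms by (simp add: field_simps)
    ultimately have "sqrt 2 * \<sigma> * (\<sigma> / sqrt 2) * bvn_density (\<mu>, \<mu>, \<sigma>, \<sigma>, 0) (x1, x2)
       = 1 / sqrt (2 * pi) * (1 / sqrt (2 * pi)) * exp (- (norm (p, s))\<^sup>2 / 2)"
      by (metis mult.assoc)
    moreover have "0 \<le> bvn_density (\<mu>, \<mu>, \<sigma>, \<sigma>, 0) (x1, x2)"
      unfolding bvn_density_def using assms by simp
    ultimately have "ennreal (sqrt 2 * \<sigma>) * (ennreal (\<sigma> / sqrt 2) * F (x1, x2)) =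
        ennreal (1 / sqrt (2 * pi) * (1 / sqrt (2 * pi)) * exp (- (norm (p, s))\<^sup>2 / 2)) * indicator A (p, s)"
      using assms unfolding F_def rot
      by (simp add: mult.assoc[symmetric] ennreal_mult[symmetric])
    then show ?thesis unfolding x1_def x2_def .
  qed
  have "emeasure (distr ?D borel (rot \<mu> \<sigma>)) A = (\<integral>\<^sup>+x. indicator A (rot \<mu> \<sigma> x) \<partial>?D)"
    by (simp add: nn_integral_distr flip: nn_integral_indicator)
  also have "\<dots> = (\<integral>\<^sup>+x. F x \<partial>lborel)"
    unfolding F_def by (rule nn_integral_density) measurable
  also have "\<dots> = (\<integral>\<^sup>+x2. \<integral>\<^sup>+x1. F (x1, x2) \<partial>lborel \<partial>lborel)"
    unfolding lborel_prod[symmetric] by (rule lborel_pair.nn_integral_snd[symmetric]) measurable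
  also have "\<dots> = (\<integral>\<^sup>+x2. \<integral>\<^sup>+p. ennreal (sqrt 2 * \<sigma>) * F (x2 + sqrt 2 * \<sigma> * p, x2) \<partial>lborel \<partial>lborel)"
  proof (rule nn_integral_cong)
    fix x2
    show "(\<integral>\<^sup>+x1. F (x1, x2) \<partial>lborel) = (\<integral>\<^sup>+p. ennreal (sqrt 2 * \<sigma>) * F (x2 + sqrt 2 * \<sigma> * p, x2) \<partial>lborel)"
      using assms by (subst nn_integral_real_affine[OF _ c(1), where t=x2]) (auto simp: nn_integral_cmult)
  qed
  also have "\<dots> = (\<integral>\<^sup>+p. \<integral>\<^sup>+x2. ennreal (sqrt 2 * \<sigma>) * F (x2 + sqrt 2 * \<sigma> * p, x2) \<partial>lborel \<partial>lborel)"
    by (rule lborel_pair.Fubini'[symmetric]) measurable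
  also have "\<dots> = (\<integral>\<^sup>+p. \<integral>\<^sup>+s. ennreal (sqrt 2 * \<sigma>) * (ennreal (\<sigma> / sqrt 2) * F (\<mu> - \<sigma> / sqrt 2 * p + \<sigma> / sqrt 2 * s + sqrt 2 * \<sigma> * p, \<mu> - \<sigma> / sqrt 2 * p + \<sigma> / sqrt 2 * s)) \<partial>lborel \<partial>lborel)"
  proof (rule nn_integral_cong)
    fix p
    show "(\<integral>\<^sup>+x2. ennreal (sqrt 2 * \<sigma>) * F (x2 + sqrt 2 * \<sigma> * p, x2) \<partial>lborel) =
      (\<integral>\<^sup>+s. ennreal (sqrt 2 * \<sigma>) * (ennreal (\<sigma> / sqrt 2) * F (\<mu> - \<sigma> / sqrt 2 * p + \<sigma> / sqrt 2 * s + sqrt 2 * \<sigma> * p, \<mu> - \<sigma> / sqrt 2 * p + \<sigma> / sqrt 2 * s)) \<partial>lborel)"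
      using assms by (subst nn_integral_real_affine[OF _ c(2), where t="\<mu> - \<sigma> / sqrt 2 * p"])
        (auto simp: nn_integral_cmult mult.left_commute)
  qed
  also have "\<dots> = (\<integral>\<^sup>+p. \<integral>\<^sup>+s. ennreal (1 / sqrt (2 * pi) * (1 / sqrt (2 * pi)) * exp (- (norm (p, s))\<^sup>2 / 2)) * indicator A (p, s) \<partial>lborel \<partial>lborel)"
    unfolding val ..
  also have "\<dots> = (\<integral>\<^sup>+z. ennreal (1 / sqrt (2 * pi) * (1 / sqrt (2 * pi)) * exp (- (norm z)\<^sup>2 / 2)) * indicator A z \<partial>lborel)"
    unfolding lborel_prod[symmetric]
    by (rule lborel.nn_integral_fst) (unfold lborel_prod, measurable)
  also have "\<dots> = emeasure std_normal2 A"
    by (subst N2.N_eq) (simp add: emeasure_density)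
  finally show "emeasure (distr ?D borel (rot \<mu> \<sigma>)) A = emeasure std_normal2 A" .
qed simp

lemma integral_std_normal2_product:
  assumes "integrable std_normal f" "integrable std_normal g"
  shows "has_bochner_integral std_normal2 (\<lambda>z. f (fst z) * g (snd z)) ((\<integral>x. f x \<partial>std_normal) * (\<integral>x. g x \<partial>std_normal) :: real)"
proof -
  have m[measurable]: "f \<in> borel_measurable std_normal" "g \<in> borel_measurable std_normal" using assms by auto
  have int: "integrable (std_normal \<Otimes>\<^sub>M std_normal) (\<lambda>(x,y). f x * g y)"
    by (rule std_normal2.Fubini_integrable) (use assms in \<open>auto simp: abs_mult\<close>)
  have "(\<integral>z. (\<lambda>(x,y). f x * g y) z \<partial>(std_normal \<Otimes>\<^sub>M std_normal)) = (\<integral>x. (\<integral>y. f x * g y \<partial>std_normal) \<partial>std_normal)"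
    using std_normal2.integral_fst[OF int] by simp
  also have "\<dots> = (\<integral>x. f x \<partial>std_normal) * (\<integral>x. g x \<partial>std_normal)" by simp
  finally show ?thesis
    using int unfolding std_normal2_def has_bochner_integral_iff by (simp add: case_prod_beta')
qed

section \<open>Gaussian moments and functions of polynomial growth\<close>

definition std_mom :: "nat \<Rightarrow> real" where "std_mom k = (\<integral>x. x^k \<partial>std_normal)"

lemma integrable_std_pow: "integrable std_normal (\<lambda>x. x^k)"
  using integrable_std_normal_moment[of k] unfolding std_normal_def by (subst integrable_density) auto

lemma std_mom_eq: "std_mom k = (\<integral>x. std_normal_density x * x^k \<partial>lborel)"
  unfolding std_mom_def std_normal_def by (subst integral_density) auto

lemma std_mom_even: "std_mom (2*k) = fact (2 * k) / (2^k * fact k)"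
  unfolding std_mom_eq by (rule integral_std_normal_moment_even)

lemma std_mom_odd: "std_mom (2*k+1) = 0"
  unfolding std_mom_eq by (rule integral_std_normal_moment_odd)

lemma std_mom_values [simp]:
  "std_mom 0 = 1" "std_mom (Suc 0) = 0" "std_mom 2 = 1" "std_mom 3 = 0" "std_mom 4 = 3"
  using std_mom_even[of 0] std_mom_even[of 1] std_mom_even[of 2] std_mom_odd[of 0] std_mom_odd[of 1]
  by (simp_all add: fact_numeral eval_nat_numeral)

lemma moment2: "has_bochner_integral std_normal2 (\<lambda>z. fst z ^ i * snd z ^ j) (std_mom i * std_mom j)"
  unfolding std_mom_def by (rule integral_std_normal2_product) (rule integrable_std_pow)+

lemma integrable_std_poly: "integrable std_normal (\<lambda>x. x^(2*j) * (1 + x\<^sup>2)^k)"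
proof (induction k arbitrary: j)
  case 0 then show ?case using integrable_std_pow[of "2*j"] by simp
next
  case (Suc k)
  have "integrable std_normal (\<lambda>x. x^(2*j) * (1 + x\<^sup>2)^k + x^(2*Suc j) * (1 + x\<^sup>2)^k)"
    by (intro Bochner_Integration.integrable_add Suc)
  then show ?case by (simp add: algebra_simps power2_eq_square)
qed

text \<open>Degree eight in each coordinate accommodates \<open>f_six\<close> and all monomials in
  use. The square is still Gaussian integrable, which is what Chebyshev's inequality asks
  for.\<close>

definition poly_bdd :: "(real \<times> real \<Rightarrow> real) \<Rightarrow> bool" where
  "poly_bdd f \<longleftrightarrow> f \<in> borel_measurable borel \<and>
     (\<exists>C. \<forall>z. \<bar>f z\<bar> \<le> C * ((1 + (fst z)\<^sup>2)^4 * (1 + (snd z)\<^sup>2)^4))"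

lemma poly_bdd_integrable:
  assumes "poly_bdd f"
  shows "integrable std_normal2 f" "integrable std_normal2 (\<lambda>z. (f z)\<^sup>2)"
proof -
  obtain C where m[measurable]: "f \<in> borel_measurable borel" and C: "\<And>z. \<bar>f z\<bar> \<le> C * ((1 + (fst z)\<^sup>2)^4 * (1 + (snd z)\<^sup>2)^4)"
    using assms unfolding poly_bdd_def by blast
  have "integrable std_normal2 (\<lambda>z. C\<^sup>2 * ((1 + (fst z)\<^sup>2)^8 * (1 + (snd z)\<^sup>2)^8))"
    using integral_std_normal2_product[OF integrable_std_poly[of 0 8] integrable_std_poly[of 0 8]]
    by (intro integrable_mult_right) (auto simp: has_bochner_integral_iff)
  then show sq: "integrable std_normal2 (\<lambda>z. (f z)\<^sup>2)"
  proof (rule Bochner_Integration.integrable_bound)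
    show "AE z in std_normal2. norm ((f z)\<^sup>2) \<le> norm (C\<^sup>2 * ((1 + (fst z)\<^sup>2)^8 * (1 + (snd z)\<^sup>2)^8))"
    proof (intro AE_I2)
      fix z :: "real \<times> real"
      have "\<bar>f z\<bar>\<^sup>2 \<le> (C * ((1 + (fst z)\<^sup>2)^4 * (1 + (snd z)\<^sup>2)^4))\<^sup>2"
        using C by (intro power_mono) auto
      also have "\<dots> = C\<^sup>2 * ((1 + (fst z)\<^sup>2)^8 * (1 + (snd z)\<^sup>2)^8)"
        by (simp add: power_mult_distrib flip: power_mult)
      finally show "norm ((f z)\<^sup>2) \<le> norm (C\<^sup>2 * ((1 + (fst z)\<^sup>2)^8 * (1 + (snd z)\<^sup>2)^8))" by simp
    qed
  qed measurable
  show "integrable std_normal2 f"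
    by (rule N2.square_integrable_imp_integrable[OF _ sq]) measurable
qed

lemma poly_bddI:
  assumes "f \<in> borel_measurable borel" "\<And>p s. \<bar>f (p, s)\<bar> \<le> C * ((1 + p\<^sup>2)^4 * (1 + s\<^sup>2)^4)"
  shows "poly_bdd f"
  unfolding poly_bdd_def using assms by (intro conjI exI[of _ C]) auto

section \<open>Positivity of the Kullback-Leibler divergence\<close>

lemma cosh_measurable [measurable]: "(cosh :: real \<Rightarrow> real) \<in> borel_measurable borel"
  by (intro borel_measurable_continuous_onI continuous_intros)

text \<open>Completing the square in both exponentials of \<open>cosh\<close> leaves two normal
  densities with means \<open>c/a\<close> and \<open>-c/a\<close> and variance
  \<open>1/a\<close>.\<close>

lemma nn_integral_gaussian_cosh:
  assumes "a > (0::real)"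
  shows "(\<integral>\<^sup>+p. ennreal (exp (- (a - 1) * p\<^sup>2 / 2) * cosh (p * c)) \<partial>std_normal) = ennreal (exp (c\<^sup>2 / (2 * a)) / sqrt a)"
proof -
  define \<sigma> where "\<sigma> = 1 / sqrt a"
  have \<sigma>: "\<sigma> > 0" "\<sigma>\<^sup>2 = 1 / a" using assms by (simp_all add: \<sigma>_def power_divide)
  have nd: "std_normal_density p * (exp (- (a - 1) * p\<^sup>2 / 2) * exp (p * b)) = exp (b\<^sup>2 / (2 * a)) / sqrt a * normal_density (b / a) \<sigma> p" for p b
  proof -
    have "exp (- p\<^sup>2 / 2) * (exp (- (a - 1) * p\<^sup>2 / 2) * exp (p * b)) = exp (b\<^sup>2 / (2 * a)) * exp (- (p - b / a)\<^sup>2 / (2 * \<sigma>\<^sup>2))"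
      unfolding exp_add[symmetric] \<sigma> using assms by (simp add: power2_eq_square field_simps)
    moreover have "1 / sqrt (2 * pi) = 1 / sqrt a * (1 / sqrt (2 * pi * \<sigma>\<^sup>2))"
      unfolding \<sigma> using assms by (simp add: real_sqrt_divide)
    ultimately show ?thesis unfolding normal_density_def std_normal_density_def by simp
  qed
  have m: "std_normal_density p * (exp (- (a - 1) * p\<^sup>2 / 2) * cosh (p * c)) =
     exp (c\<^sup>2 / (2 * a)) / sqrt a / 2 * (normal_density (c / a) \<sigma> p + normal_density (- c / a) \<sigma> p)" for p
  proof -
    have "std_normal_density p * (exp (- (a - 1) * p\<^sup>2 / 2) * cosh (p * c)) =
      (std_normal_density p * (exp (- (a - 1) * p\<^sup>2 / 2) * exp (p * c)) +
       std_normal_density p * (exp (- (a - 1) * p\<^sup>2 / 2) * exp (p * (- c)))) / 2"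
      by (simp add: cosh_field_def algebra_simps)
    moreover have "(A * x + A * y) / 2 = A / 2 * (x + y)" for A x y :: real by (simp add: field_simps)
    ultimately show ?thesis unfolding nd by (simp only: power2_minus)
  qed
  have one: "(\<integral>\<^sup>+p. ennreal (normal_density \<mu> \<sigma> p) \<partial>lborel) = 1" for \<mu>
  proof -
    interpret prob_space "density lborel (normal_density \<mu> \<sigma>)" using \<sigma>(1) by (rule prob_space_normal_density)
    show ?thesis using emeasure_space_1 by (simp add: emeasure_density)
  qed
  have "(\<integral>\<^sup>+p. ennreal (exp (- (a - 1) * p\<^sup>2 / 2) * cosh (p * c)) \<partial>std_normal) =
    (\<integral>\<^sup>+p. ennreal (std_normal_density p * (exp (- (a - 1) * p\<^sup>2 / 2) * cosh (p * c))) \<partial>lborel)"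
    unfolding std_normal_def by (subst nn_integral_density) (auto simp: ennreal_mult'[symmetric])
  also have "\<dots> = (\<integral>\<^sup>+p. ennreal (exp (c\<^sup>2 / (2 * a)) / sqrt a / 2) * (ennreal (normal_density (c / a) \<sigma> p) + ennreal (normal_density (- c / a) \<sigma> p)) \<partial>lborel)"
    unfolding m using assms by (intro nn_integral_cong) (simp add: ennreal_mult'[symmetric] flip: ennreal_plus)
  also have "\<dots> = ennreal (exp (c\<^sup>2 / (2 * a)) / sqrt a / 2) * (1 + 1)"
    by (subst nn_integral_cmult, measurable, subst nn_integral_add) (auto simp: one simp del: minus_divide_left[symmetric])
  also have "\<dots> = ennreal (exp (c\<^sup>2 / (2 * a)) / sqrt a)"
    using assms by (simp add: ennreal_mult'[symmetric] flip: ennreal_numeral)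
  finally show ?thesis .
qed

text \<open>The log density ratio against the null law, in rotated coordinates and symmetrised over
  the two orders, for precisions \<open>a - \<alpha>\<close>, \<open>a + \<alpha>\<close> and means
  \<open>\<beta>/a\<close>, \<open>-\<beta>/a\<close>; these means are the profiled choice from
  \<open>g_full_eq\<close>.\<close>

definition log_ratio :: "real \<Rightarrow> real \<Rightarrow> real \<Rightarrow> real \<times> real \<Rightarrow> real" where
  "log_ratio a \<alpha> \<beta> z = - g_prof a \<alpha> \<beta> + (a - 1) * (1 - ((fst z)\<^sup>2 + (snd z)\<^sup>2) / 2)
     + sqrt 2 * (- \<alpha> * \<beta> / a) * snd z + lncosh (fst z * (sqrt 2 * \<beta> + \<alpha> * snd z))"

text \<open>A density ratio integrates to 1. The first coordinate is integrated at fixed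
  \<open>s\<close>; what remains is a centred Gaussian weight in \<open>s\<close> with precision
  \<open>k\<close>, and \<open>a * k\<close> is the determinant
  \<open>a\<^sup>2 - \<alpha>\<^sup>2\<close> inside \<open>g_prof\<close>.\<close>

lemma nn_integral_exp_log_ratio:
  assumes "\<bar>\<alpha>\<bar> < a"
  shows "(\<integral>\<^sup>+z. ennreal (exp (log_ratio a \<alpha> \<beta> z)) \<partial>std_normal2) = 1"
proof -
  have a: "a > 0" using assms by linarith
  define k where "k = (a\<^sup>2 - \<alpha>\<^sup>2) / a"
  have "\<bar>\<alpha>\<bar>\<^sup>2 < a\<^sup>2" using assms by (intro power_strict_mono) auto
  then have d: "a\<^sup>2 - \<alpha>\<^sup>2 > 0" by simp
  then have k: "k > 0" using a by (simp add: k_def)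
  define G where "G = exp (- g_prof a \<alpha> \<beta> + a - 1)"
  define c where "c s = sqrt 2 * \<beta> + \<alpha> * s" for s
  define q where "q s = exp (- (a - 1) * s\<^sup>2 / 2 + sqrt 2 * (- \<alpha> * \<beta> / a) * s)" for s
  have e: "exp (log_ratio a \<alpha> \<beta> (p, s)) = G * q s * (exp (- (a - 1) * p\<^sup>2 / 2) * cosh (p * c s))" for p s
    unfolding log_ratio_def G_def q_def c_def lncosh_def
    by (simp add: exp_add cosh_real_pos) (simp add: exp_add[symmetric] field_simps)
  have qc: "q s * (exp ((c s)\<^sup>2 / (2 * a)) / sqrt a) = exp (\<beta>\<^sup>2 / a) / sqrt a * (exp (- (k - 1) * s\<^sup>2 / 2) * cosh (s * 0))" for s
  proof -
    have "- (a - 1) * s\<^sup>2 / 2 + sqrt 2 * (- \<alpha> * \<beta> / a) * s + (c s)\<^sup>2 / (2 * a) = \<beta>\<^sup>2 / a + - (k - 1) * s\<^sup>2 / 2"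
      unfolding c_def k_def using a by (simp add: power2_sum power_mult_distrib) (simp add: power2_eq_square field_simps)
    then have "q s * exp ((c s)\<^sup>2 / (2 * a)) = exp (\<beta>\<^sup>2 / a) * exp (- (k - 1) * s\<^sup>2 / 2)"
      unfolding q_def exp_add[symmetric] by simp
    then show ?thesis by simp
  qed
  have m: "(\<lambda>z. ennreal (exp (log_ratio a \<alpha> \<beta> z))) \<in> borel_measurable (std_normal \<Otimes>\<^sub>M std_normal)"
    unfolding log_ratio_def by measurable
  have "(\<integral>\<^sup>+z. ennreal (exp (log_ratio a \<alpha> \<beta> z)) \<partial>std_normal2) =
     (\<integral>\<^sup>+s. \<integral>\<^sup>+p. ennreal (exp (log_ratio a \<alpha> \<beta> (p, s))) \<partial>std_normal \<partial>std_normal)"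
    unfolding std_normal2_def using std_normal2.nn_integral_snd[OF m] by simp
  also have "\<dots> = (\<integral>\<^sup>+s. ennreal (G * q s) * ennreal (exp ((c s)\<^sup>2 / (2 * a)) / sqrt a) \<partial>std_normal)"
    unfolding e using a by (subst nn_integral_gaussian_cosh[OF a, symmetric], subst nn_integral_cmult[symmetric])
      (auto simp: G_def q_def ennreal_mult'[symmetric])
  also have "\<dots> = (\<integral>\<^sup>+s. ennreal (G * exp (\<beta>\<^sup>2 / a) / sqrt a) * ennreal (exp (- (k - 1) * s\<^sup>2 / 2) * cosh (s * 0)) \<partial>std_normal)"
  proof (rule nn_integral_cong)
    fix s
    have "ennreal (G * q s) * ennreal (exp ((c s)\<^sup>2 / (2 * a)) / sqrt a) = ennreal (G * (q s * (exp ((c s)\<^sup>2 / (2 * a)) / sqrt a)))"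
      by (subst ennreal_mult'[symmetric]) (auto simp: G_def q_def mult_ac)
    also have "\<dots> = ennreal (G * exp (\<beta>\<^sup>2 / a) / sqrt a) * ennreal (exp (- (k - 1) * s\<^sup>2 / 2) * cosh (s * 0))"
      unfolding qc using a by (subst ennreal_mult'[symmetric]) (auto simp: G_def)
    finally show "ennreal (G * q s) * ennreal (exp ((c s)\<^sup>2 / (2 * a)) / sqrt a) =
       ennreal (G * exp (\<beta>\<^sup>2 / a) / sqrt a) * ennreal (exp (- (k - 1) * s\<^sup>2 / 2) * cosh (s * 0))" .
  qed
  also have "\<dots> = ennreal (G * exp (\<beta>\<^sup>2 / a) / sqrt a) * ennreal (1 / sqrt k)"
    by (subst nn_integral_cmult, measurable, subst nn_integral_gaussian_cosh[OF k]) simp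
  also have "\<dots> = ennreal (G * exp (\<beta>\<^sup>2 / a) / sqrt (a * k))"
    using k a by (subst ennreal_mult'[symmetric]) (auto simp: G_def real_sqrt_mult)
  also have "G * exp (\<beta>\<^sup>2 / a) / sqrt (a * k) = 1"
  proof -
    have "sqrt (a\<^sup>2 - \<alpha>\<^sup>2) = exp (ln (a\<^sup>2 - \<alpha>\<^sup>2) / 2)"
      using d by (simp flip: ln_sqrt)
    moreover have "a * k = a\<^sup>2 - \<alpha>\<^sup>2" using a by (simp add: k_def)
    moreover have "G * exp (\<beta>\<^sup>2 / a) = exp (ln (a\<^sup>2 - \<alpha>\<^sup>2) / 2)"
      unfolding G_def g_prof_def exp_add[symmetric] by simp
    ultimately show ?thesis by simp
  qed
  finally show ?thesis by simp
qed

definition L_pop :: "real \<Rightarrow> real \<Rightarrow> real" where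
  "L_pop \<alpha> \<beta> = (\<integral>z. lncosh (fst z * (sqrt 2 * \<beta> + \<alpha> * snd z)) \<partial>std_normal2)"

lemma abs_le_1_sq: "\<bar>x\<bar> \<le> 1 + (x::real)\<^sup>2"
proof -
  have "2 * \<bar>x\<bar> \<le> 1 + \<bar>x\<bar>\<^sup>2" using zero_le_power2[of "1 - \<bar>x\<bar>"] by (simp add: power2_diff)
  moreover have "0 \<le> x\<^sup>2" by simp
  ultimately show ?thesis unfolding power2_abs by linarith
qed

lemma pow4_ge: "1 + (x::real)\<^sup>2 \<le> (1 + x\<^sup>2)^4" "1 \<le> (1 + x\<^sup>2)^4"
  using power_increasing[of 1 4 "1 + x\<^sup>2"] by (simp_all add: one_le_power)

lemma poly_bdd_lncosh: "poly_bdd (\<lambda>z. lncosh (fst z * (sqrt 2 * \<beta> + \<alpha> * snd z)))"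
proof (rule poly_bddI[where C="sqrt 2 * \<bar>\<beta>\<bar> + \<bar>\<alpha>\<bar>"])
  show "(\<lambda>z. lncosh (fst z * (sqrt 2 * \<beta> + \<alpha> * snd z))) \<in> borel_measurable borel"
    unfolding borel_prod[symmetric] by measurable
  fix p s :: real
  have "\<bar>lncosh (p * (sqrt 2 * \<beta> + \<alpha> * s))\<bar> \<le> \<bar>p\<bar> * \<bar>sqrt 2 * \<beta> + \<alpha> * s\<bar>"
    using lncosh_le_abs[of "p * (sqrt 2 * \<beta> + \<alpha> * s)"] lncosh_nonneg by (simp add: abs_mult)
  also have "\<dots> \<le> (1 + p\<^sup>2)^4 * ((sqrt 2 * \<bar>\<beta>\<bar> + \<bar>\<alpha>\<bar>) * (1 + s\<^sup>2)^4)"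
  proof (rule mult_mono)
    show "\<bar>p\<bar> \<le> (1 + p\<^sup>2)^4" using abs_le_1_sq[of p] pow4_ge[of p] by linarith
    have s: "\<bar>s\<bar> \<le> (1 + s\<^sup>2)^4" "1 \<le> (1 + s\<^sup>2)^4" using abs_le_1_sq[of s] pow4_ge[of s] by linarith+
    have "\<bar>sqrt 2 * \<beta> + \<alpha> * s\<bar> \<le> sqrt 2 * \<bar>\<beta>\<bar> * 1 + \<bar>\<alpha>\<bar> * \<bar>s\<bar>"
      using abs_triangle_ineq[of "sqrt 2 * \<beta>" "\<alpha> * s"] by (simp add: abs_mult)
    also have "\<dots> \<le> sqrt 2 * \<bar>\<beta>\<bar> * (1 + s\<^sup>2)^4 + \<bar>\<alpha>\<bar> * (1 + s\<^sup>2)^4"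
      using s by (intro add_mono mult_left_mono) auto
    finally show "\<bar>sqrt 2 * \<beta> + \<alpha> * s\<bar> \<le> (sqrt 2 * \<bar>\<beta>\<bar> + \<bar>\<alpha>\<bar>) * (1 + s\<^sup>2)^4" by (simp add: algebra_simps)
  qed auto
  finally show "\<bar>lncosh (fst (p, s) * (sqrt 2 * \<beta> + \<alpha> * snd (p, s)))\<bar> \<le> (sqrt 2 * \<bar>\<beta>\<bar> + \<bar>\<alpha>\<bar>) * ((1 + p\<^sup>2)^4 * (1 + s\<^sup>2)^4)"
    by (simp add: mult_ac)
qed

text \<open>Gibbs' inequality: \<open>exp l - 1 - l\<close> is nonnegative for
  \<open>l = log_ratio a \<alpha> \<beta> z\<close> and integrates to
  \<open>g_prof a \<alpha> \<beta> - L_pop \<alpha> \<beta>\<close>. If that is not positive,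
  \<open>l\<close> vanishes almost everywhere, hence everywhere by continuity, and a few points
  identify the parameters.\<close>

lemma L_pop_less:
  assumes "\<bar>\<alpha>\<bar> < a" "(\<alpha>, \<beta>) \<noteq> (0, 0)"
  shows "L_pop \<alpha> \<beta> < g_prof a \<alpha> \<beta>"
proof (rule ccontr)
  assume neg: "\<not> L_pop \<alpha> \<beta> < g_prof a \<alpha> \<beta>"
  let ?l = "log_ratio a \<alpha> \<beta>"
  have lm[measurable]: "?l \<in> borel_measurable borel"
    unfolding log_ratio_def[abs_def] borel_prod[symmetric] by measurable
  have i1: "has_bochner_integral std_normal2 (\<lambda>z. (fst z)\<^sup>2 + (snd z)\<^sup>2) 2"
    using has_bochner_integral_add[OF moment2[of 2 0] moment2[of 0 2]] by simp
  have i2: "has_bochner_integral std_normal2 (\<lambda>z. snd z) 0"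
    using moment2[of 0 1] by simp
  note i3 = poly_bdd_integrable(1)[OF poly_bdd_lncosh, of \<beta> \<alpha>]
  have il: "integrable std_normal2 ?l"
    unfolding log_ratio_def[abs_def]
    using i1 i2 i3 by (intro Bochner_Integration.integrable_add integrable_mult_right Bochner_Integration.integrable_diff)
      (auto simp: has_bochner_integral_iff)
  have el: "(\<integral>z. ?l z \<partial>std_normal2) = - g_prof a \<alpha> \<beta> + L_pop \<alpha> \<beta>"
  proof -
    have "(\<integral>z. ?l z \<partial>std_normal2) = (\<integral>z. (- g_prof a \<alpha> \<beta> + (a - 1)) + (- (a - 1) / 2 * ((fst z)\<^sup>2 + (snd z)\<^sup>2)
         + sqrt 2 * (- \<alpha> * \<beta> / a) * snd z + lncosh (fst z * (sqrt 2 * \<beta> + \<alpha> * snd z))) \<partial>std_normal2)"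
      unfolding log_ratio_def by (intro Bochner_Integration.integral_cong) (auto simp: field_simps)
    also have "\<dots> = (- g_prof a \<alpha> \<beta> + (a - 1)) + (- (a - 1) / 2 * 2 + sqrt 2 * (- \<alpha> * \<beta> / a) * 0 + L_pop \<alpha> \<beta>)"
      using i1 i2 i3 N2.prob_space unfolding L_pop_def has_bochner_integral_iff
      by (subst Bochner_Integration.integral_add, force, force, subst Bochner_Integration.integral_add, force, force,
          subst Bochner_Integration.integral_add, force, force) simp
    finally show ?thesis by (simp add: field_simps)
  qed
  have ie: "has_bochner_integral std_normal2 (\<lambda>z. exp (?l z)) 1"
    by (rule has_bochner_integral_nn_integral) (use nn_integral_exp_log_ratio[OF assms(1)] in auto)
  have h: "has_bochner_integral std_normal2 (\<lambda>z. exp (?l z) - 1 - ?l z) (1 - 1 - (- g_prof a \<alpha> \<beta> + L_pop \<alpha> \<beta>))"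
    using ie il el N2.prob_space unfolding has_bochner_integral_iff by auto
  have nn: "0 \<le> exp (?l z) - 1 - ?l z" for z using exp_ge_add_one_self[of "?l z"] by linarith
  have "(\<integral>z. exp (?l z) - 1 - ?l z \<partial>std_normal2) = 0"
    using h neg Bochner_Integration.integral_nonneg[where M=std_normal2 and f="\<lambda>z. exp (?l z) - 1 - ?l z", OF nn]
    unfolding has_bochner_integral_iff by linarith
  then have "AE z in std_normal2. exp (?l z) - 1 - ?l z = 0"
    using h nn by (subst (asm) integral_nonneg_eq_0_iff_AE) (auto simp: has_bochner_integral_iff)
  then have "AE z in std_normal2. z \<in> {z. ?l z = 0}"
  proof eventually_elim
    case (elim z)
    have "exp (?l z) = 1" using elim ln_eq_minus_one[of "exp (?l z)"] by simp
    then show ?case by simp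
  qed
  then have "AE z in lborel. z \<in> {z. ?l z = 0}"
    by (subst (asm) N2.N_eq) (auto simp: AE_density)
  then have "AE z in lebesgue. z \<in> {z. ?l z = 0}" by (rule AE_completion)
  moreover have "a \<noteq> 0" using assms(1) by linarith
  then have "continuous_on UNIV ?l"
    unfolding log_ratio_def[abs_def] by (auto intro!: continuous_intros)
  then have "closed {z. ?l z = 0}" by (intro closed_Collect_eq continuous_on_const)
  ultimately have z: "?l z = 0" for z using mem_closed_if_AE_lebesgue[of "{z. ?l z = 0}" z] by blast
  \<comment> \<open>At the points \<open>(0, sqrt 2)\<close> and \<open>(0, - sqrt 2)\<close> used
    below, \<open>1 - (p\<^sup>2 + s\<^sup>2)/2\<close> vanishes, which isolates
    \<open>g_prof\<close> and the linear coefficient; with the origin this gives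
    \<open>a = 1\<close>.\<close>
  have e0: "- g_prof a \<alpha> \<beta> + (a - 1) = 0" using z[of "(0, 0)"] by (simp add: log_ratio_def)
  define t where "t = - \<alpha> * \<beta> / a"
  have s2: "sqrt 2 * t * sqrt 2 = 2 * t"
  proof -
    have "sqrt 2 * t * sqrt 2 = sqrt 2 * sqrt 2 * t" by (simp only: mult_ac)
    then show ?thesis by simp
  qed
  have "- g_prof a \<alpha> \<beta> + sqrt 2 * t * sqrt 2 = 0" "- g_prof a \<alpha> \<beta> - sqrt 2 * t * sqrt 2 = 0"
    using z[of "(0, sqrt 2)"] z[of "(0, - sqrt 2)"] unfolding log_ratio_def t_def[symmetric] by simp_all
  then have g0: "g_prof a \<alpha> \<beta> = 0" "- \<alpha> * \<beta> / a = 0" unfolding s2 t_def[symmetric] by linarith+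
  then have "a = 1" using e0 by simp
  then have l: "lncosh (fst z * (sqrt 2 * \<beta> + \<alpha> * snd z)) = 0" for z
    using z[of z] g0 by (simp add: log_ratio_def)
  from l[of "(1, 0)"] have "\<beta> = 0" by (simp add: lncosh_eq_0_iff)
  moreover from l[of "(1, 1)"] this have "\<alpha> = 0" by (simp add: lncosh_eq_0_iff)
  ultimately show False using assms(2) by simp
qed

subsection \<open>The population criterion\<close>

type_synonym sample = "nat \<times> (nat \<Rightarrow> real \<times> real)"

definition avg :: "sample \<Rightarrow> (real \<times> real \<Rightarrow> real) \<Rightarrow> real" where
  "avg x f = (\<Sum>i<fst x. f (snd x i)) / real (fst x)"

lemma avg_add: "avg x (\<lambda>z. f z + g z) = avg x f + avg x g"
  by (simp add: avg_def sum.distrib add_divide_distrib)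
lemma avg_diff: "avg x (\<lambda>z. f z - g z) = avg x f - avg x g"
  by (simp add: avg_def sum_subtractf diff_divide_distrib)
lemma avg_cmult: "avg x (\<lambda>z. c * f z) = c * avg x f"
  by (simp add: avg_def sum_distrib_left)
lemma avg_mono: "(\<And>z. f z \<le> g z) \<Longrightarrow> avg x f \<le> avg x g"
  unfolding avg_def by (intro divide_right_mono sum_mono) auto
lemma avg_const: "fst x > 0 \<Longrightarrow> avg x (\<lambda>_. c) = c"
  by (simp add: avg_def)

definition mon :: "nat \<Rightarrow> nat \<Rightarrow> real \<times> real \<Rightarrow> real" where
  "mon i j z = fst z ^ i * snd z ^ j"
definition amon :: "nat \<Rightarrow> real \<times> real \<Rightarrow> real" where
  "amon j z = \<bar>fst z\<bar> * snd z ^ j"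
definition f_six :: "real \<times> real \<Rightarrow> real" where
  "f_six z = fst z ^ 6 * (2 + (snd z)\<^sup>2) ^ 3"
definition f_lip :: "real \<times> real \<Rightarrow> real" where
  "f_lip z = \<bar>fst z\<bar> * (2 + \<bar>snd z\<bar>)"
definition f_lnc :: "real \<Rightarrow> real \<Rightarrow> real \<times> real \<Rightarrow> real" where
  "f_lnc \<alpha> \<beta> z = lncosh (fst z * (sqrt 2 * \<beta> + \<alpha> * snd z))"

text \<open>Monomials of degree at most 2 in the first coordinate enter the null fit and the
  quadratic form, those of degree 4 the quartic term. \<open>f_six\<close> controls the sextic
  remainder, the \<open>amon\<close> functions the far region, and \<open>f_lip\<close> the
  Lipschitz constant in between.\<close>

definition base_funs :: "(real \<times> real \<Rightarrow> real) set" where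
  "base_funs = {mon 0 1, mon 2 0, mon 0 2, mon 2 1, mon 2 2, mon 4 0, mon 4 1, mon 4 2, mon 4 3, mon 4 4,
     amon 0, amon 1, amon 2, f_six, f_lip}"

abbreviation EZ :: "(real \<times> real \<Rightarrow> real) \<Rightarrow> real" where "EZ f \<equiv> \<integral>z. f z \<partial>std_normal2"

lemma EZ_mon: "EZ (mon i j) = std_mom i * std_mom j"
  using moment2[of i j] unfolding mon_def[abs_def] has_bochner_integral_iff by simp

lemma pi_ge_3: "pi \<ge> 3"
proof -
  have "sin (pi / 6) \<le> pi / 6" by (rule sin_x_le_x) simp
  then show ?thesis by (simp add: sin_30)
qed

text \<open>The mean of the modulus of a standard normal variable is \<open>sqrt (2 / pi)\<close>,
  and \<open>pi \<ge> 3\<close> suffices for 0.82. It is the slope of the averaged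
  \<open>lncosh\<close> at infinity, to be compared with 9/10 in
  \<open>g_prof_ge_linear\<close>.\<close>

lemma EZ_amon: "EZ (amon 0) \<le> 82/100" "EZ (amon 1) = 0" "EZ (amon 2) = EZ (amon 0)"
proof -
  have i: "integrable std_normal (\<lambda>x. \<bar>x\<bar>)"
  proof -
    have n: "(norm :: real \<Rightarrow> real) = (\<lambda>x. \<bar>x\<bar>)" by (simp add: fun_eq_iff)
    show ?thesis using gaussian_like.int_norm[OF gaussian_like_std_normal] unfolding n .
  qed
  have a: "EZ (amon j) = (\<integral>x. \<bar>x\<bar> \<partial>std_normal) * std_mom j" for j
    using integral_std_normal2_product[OF i integrable_std_pow[of j]]
    unfolding amon_def[abs_def] std_mom_def has_bochner_integral_iff by simp
  have "(\<integral>x. \<bar>x\<bar> \<partial>std_normal) = (\<integral>x. std_normal_density x * \<bar>x\<bar> \<partial>lborel)"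
    unfolding std_normal_def by (subst integral_density) auto
  also have "\<dots> = sqrt (2 / pi)" using integral_std_normal_moment_abs_odd[of 0] by simp
  also have "\<dots> \<le> 82/100"
    by (rule real_le_lsqrt) (use pi_ge_3 in \<open>auto simp: power2_eq_square field_simps\<close>)
  finally show "EZ (amon 0) \<le> 82/100" using a[of 0] by simp
  show "EZ (amon 1) = 0" "EZ (amon 2) = EZ (amon 0)" using a[of 1] a[of 2] a[of 0] by simp_all
qed

lemma sqr_pow_le: "(x::real)\<^sup>2 \<le> 1 + x\<^sup>2" "1 \<le> 1 + x\<^sup>2" "\<bar>x\<bar> \<le> 1 + x\<^sup>2" "1 + x\<^sup>2 \<ge> 0"
  using abs_le_1_sq[of x] by auto

lemma abs_pow_le:
  assumes "k \<le> 8" shows "\<bar>x::real\<bar>^k \<le> (1 + x\<^sup>2)^4"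
proof (cases "\<bar>x\<bar> \<le> 1")
  case True
  then have "\<bar>x\<bar>^k \<le> 1" by (intro power_le_one) auto
  then show ?thesis using pow4_ge(2)[of x] by linarith
next
  case False
  then have "\<bar>x\<bar>^k \<le> \<bar>x\<bar>^8" using assms by (intro power_increasing) auto
  also have "\<dots> = (x\<^sup>2)^4" by (simp add: power_mult[symmetric] power_even_abs)
  also have "\<dots> \<le> (1 + x\<^sup>2)^4" by (intro power_mono) auto
  finally show ?thesis .
qed

lemma poly_bdd_mon:
  assumes "i \<le> 8" "j \<le> 8" shows "poly_bdd (mon i j)"
proof (rule poly_bddI[where C=1])
  show "mon i j \<in> borel_measurable borel" unfolding mon_def[abs_def] borel_prod[symmetric] by measurable
  show "\<bar>mon i j (p, s)\<bar> \<le> 1 * ((1 + p\<^sup>2)^4 * (1 + s\<^sup>2)^4)" for p s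
    unfolding mon_def using assms by (auto simp: abs_mult power_abs intro!: mult_mono abs_pow_le)
qed

lemma poly_bdd_amon:
  assumes "j \<le> 8" shows "poly_bdd (amon j)"
proof (rule poly_bddI[where C=1])
  show "amon j \<in> borel_measurable borel" unfolding amon_def[abs_def] borel_prod[symmetric] by measurable
  show "\<bar>amon j (p, s)\<bar> \<le> 1 * ((1 + p\<^sup>2)^4 * (1 + s\<^sup>2)^4)" for p s
    unfolding amon_def using assms abs_pow_le[of 1 p] by (auto simp: abs_mult power_abs intro!: mult_mono abs_pow_le)
qed

lemma poly_bdd_six: "poly_bdd f_six"
proof (rule poly_bddI[where C=8])
  show "f_six \<in> borel_measurable borel" unfolding f_six_def[abs_def] borel_prod[symmetric] by measurable
  fix p s :: real
  have "(2 + s\<^sup>2)^3 \<le> (2 * (1 + s\<^sup>2))^3" by (intro power_mono) auto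
  also have "\<dots> = 8 * (1 + s\<^sup>2)^3" by (simp only: power_mult_distrib) simp
  also have "\<dots> \<le> 8 * (1 + s\<^sup>2)^4" by (intro mult_left_mono power_increasing) auto
  finally have 1: "(2 + s\<^sup>2)^3 \<le> 8 * (1 + s\<^sup>2)^4" .
  have "p^6 * (2 + s\<^sup>2)^3 \<le> (1 + p\<^sup>2)^4 * (8 * (1 + s\<^sup>2)^4)"
    using abs_pow_le[of 6 p] 1 by (intro mult_mono) auto
  then show "\<bar>f_six (p, s)\<bar> \<le> 8 * ((1 + p\<^sup>2)^4 * (1 + s\<^sup>2)^4)"
    unfolding f_six_def by (simp add: abs_mult mult_ac)
qed

lemma poly_bdd_lip: "poly_bdd f_lip"
proof (rule poly_bddI[where C=3])
  show "f_lip \<in> borel_measurable borel" unfolding f_lip_def[abs_def] borel_prod[symmetric] by measurable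
  fix p s :: real
  have "2 + \<bar>s\<bar> \<le> 3 * (1 + s\<^sup>2)^4"
  proof -
    have "\<bar>s\<bar> \<le> (1 + s\<^sup>2)^4" using abs_pow_le[of 1 s] by simp
    then show ?thesis using pow4_ge(2)[of s] by linarith
  qed
  then have "\<bar>p\<bar> * (2 + \<bar>s\<bar>) \<le> (1 + p\<^sup>2)^4 * (3 * (1 + s\<^sup>2)^4)"
    using abs_pow_le[of 1 p] by (intro mult_mono) auto
  then show "\<bar>f_lip (p, s)\<bar> \<le> 3 * ((1 + p\<^sup>2)^4 * (1 + s\<^sup>2)^4)"
    unfolding f_lip_def by (simp add: abs_mult mult_ac)
qed

lemma poly_bdd_lnc: "poly_bdd (f_lnc \<alpha> \<beta>)"
  unfolding f_lnc_def[abs_def] by (rule poly_bdd_lncosh)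

lemma poly_bdd_base: "f \<in> base_funs \<Longrightarrow> poly_bdd f"
  unfolding base_funs_def
  by (auto intro!: poly_bdd_mon poly_bdd_amon poly_bdd_six poly_bdd_lip)

section \<open>Lipschitz continuity and the uniform population gap\<close>

lemma lnc_lipschitz:
  "\<bar>f_lnc \<alpha> \<beta> z - f_lnc \<alpha>' \<beta>' z\<bar> \<le> (\<bar>\<alpha> - \<alpha>'\<bar> + \<bar>\<beta> - \<beta>'\<bar>) * f_lip z"
proof -
  have "\<bar>f_lnc \<alpha> \<beta> z - f_lnc \<alpha>' \<beta>' z\<bar> \<le> \<bar>fst z * (sqrt 2 * \<beta> + \<alpha> * snd z) - fst z * (sqrt 2 * \<beta>' + \<alpha>' * snd z)\<bar>"
    unfolding f_lnc_def by (rule lncosh_lipschitz)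
  also have "\<dots> = \<bar>fst z * (sqrt 2 * (\<beta> - \<beta>') + (\<alpha> - \<alpha>') * snd z)\<bar>"
    by (simp add: algebra_simps)
  also have "\<dots> = \<bar>fst z\<bar> * \<bar>sqrt 2 * (\<beta> - \<beta>') + (\<alpha> - \<alpha>') * snd z\<bar>" by (rule abs_mult)
  also have "\<dots> \<le> \<bar>fst z\<bar> * ((\<bar>\<alpha> - \<alpha>'\<bar> + \<bar>\<beta> - \<beta>'\<bar>) * (2 + \<bar>snd z\<bar>))"
  proof (rule mult_left_mono)
    have "sqrt 2 \<le> 2" by (rule real_le_lsqrt) auto
    then have "sqrt 2 * \<bar>\<beta> - \<beta>'\<bar> \<le> 2 * \<bar>\<beta> - \<beta>'\<bar>" by (rule mult_right_mono) simp
    moreover have "\<bar>sqrt 2 * (\<beta> - \<beta>') + (\<alpha> - \<alpha>') * snd z\<bar> \<le> sqrt 2 * \<bar>\<beta> - \<beta>'\<bar> + \<bar>\<alpha> - \<alpha>'\<bar> * \<bar>snd z\<bar>"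
      using abs_triangle_ineq[of "sqrt 2 * (\<beta> - \<beta>')" "(\<alpha> - \<alpha>') * snd z"] by (simp add: abs_mult)
    moreover have "0 \<le> \<bar>\<beta> - \<beta>'\<bar> * \<bar>snd z\<bar>" "0 \<le> 2 * \<bar>\<alpha> - \<alpha>'\<bar>" by auto
    ultimately show "\<bar>sqrt 2 * (\<beta> - \<beta>') + (\<alpha> - \<alpha>') * snd z\<bar> \<le> (\<bar>\<alpha> - \<alpha>'\<bar> + \<bar>\<beta> - \<beta>'\<bar>) * (2 + \<bar>snd z\<bar>)"
      by (simp only: distrib_left distrib_right)
  qed simp
  finally show ?thesis unfolding f_lip_def by (simp add: mult_ac)
qed

lemma L_pop_lipschitz: "\<bar>L_pop \<alpha> \<beta> - L_pop \<alpha>' \<beta>'\<bar> \<le> (\<bar>\<alpha> - \<alpha>'\<bar> + \<bar>\<beta> - \<beta>'\<bar>) * EZ f_lip"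
proof -
  note i = poly_bdd_integrable(1)[OF poly_bdd_lnc] and il = poly_bdd_integrable(1)[OF poly_bdd_lip]
  have L: "L_pop a b = EZ (f_lnc a b)" for a b by (simp add: L_pop_def f_lnc_def)
  have "L_pop \<alpha> \<beta> - L_pop \<alpha>' \<beta>' = EZ (\<lambda>z. f_lnc \<alpha> \<beta> z - f_lnc \<alpha>' \<beta>' z)"
    unfolding L using i by simp
  also have "\<bar>\<dots>\<bar> \<le> EZ (\<lambda>z. \<bar>f_lnc \<alpha> \<beta> z - f_lnc \<alpha>' \<beta>' z\<bar>)"
    using integral_norm_bound[of std_normal2 "\<lambda>z. f_lnc \<alpha> \<beta> z - f_lnc \<alpha>' \<beta>' z"] by simp
  also have "\<dots> \<le> EZ (\<lambda>z. (\<bar>\<alpha> - \<alpha>'\<bar> + \<bar>\<beta> - \<beta>'\<bar>) * f_lip z)"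
    using i il lnc_lipschitz by (intro integral_mono integrable_abs Bochner_Integration.integrable_diff) auto
  finally show ?thesis by simp
qed

lemma EZ_lip_nonneg: "EZ f_lip \<ge> 0"
  by (rule Bochner_Integration.integral_nonneg) (simp add: f_lip_def)

lemma L_pop_continuous: "continuous_on UNIV (\<lambda>p. L_pop (fst p) (snd p))"
proof (rule continuous_onI)
  fix p :: "real \<times> real" and e :: real assume "e > 0"
  define d where "d = e / (2 * (EZ f_lip + 1))"
  have d: "d > 0" using \<open>e > 0\<close> EZ_lip_nonneg by (simp add: d_def)
  show "\<exists>d>0. \<forall>x'\<in>UNIV. dist x' p < d \<longrightarrow> dist (L_pop (fst x') (snd x')) (L_pop (fst p) (snd p)) \<le> e"
  proof (intro exI conjI ballI impI, rule d)
    fix x' assume "dist x' p < d"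
    then have "\<bar>fst x' - fst p\<bar> + \<bar>snd x' - snd p\<bar> \<le> 2 * d"
      using dist_fst_le[of x' p] dist_snd_le[of x' p] by (simp add: dist_real_def)
    then have "(\<bar>fst x' - fst p\<bar> + \<bar>snd x' - snd p\<bar>) * EZ f_lip \<le> 2 * d * (EZ f_lip + 1)"
      using EZ_lip_nonneg d by (intro mult_mono) auto
    also have "\<dots> = e" using EZ_lip_nonneg by (simp add: d_def field_simps)
    finally show "dist (L_pop (fst x') (snd x')) (L_pop (fst p) (snd p)) \<le> e"
      using L_pop_lipschitz[of "fst x'" "snd x'" "fst p" "snd p"] by (simp add: dist_real_def)
  qed
qed

text \<open>By compactness, since \<open>g_prof\<close> blows up
  both as \<open>a \<rightarrow> \<infinity>\<close> and as \<open>a \<rightarrow> \<bar>\<alpha>\<bar>\<close>.\<close>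

lemma L_pop_gap:
  assumes "\<delta> > 0"
  shows "\<exists>\<eta>>0. \<forall>\<alpha> \<beta> a. \<delta> \<le> \<alpha>\<^sup>2 + \<beta>\<^sup>2 \<longrightarrow> \<alpha>\<^sup>2 + \<beta>\<^sup>2 \<le> R \<longrightarrow> \<bar>\<alpha>\<bar> < a \<longrightarrow> L_pop \<alpha> \<beta> + \<eta> \<le> g_prof a \<alpha> \<beta>"
proof -
  define B where "B = 2 * (1 + R) * EZ f_lip"
  have B: "L_pop \<alpha> \<beta> \<le> B" if "\<alpha>\<^sup>2 + \<beta>\<^sup>2 \<le> R" for \<alpha> \<beta>
  proof -
    have "\<bar>\<alpha>\<bar> + \<bar>\<beta>\<bar> \<le> 2 + (\<alpha>\<^sup>2 + \<beta>\<^sup>2)"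
      using sqr_pow_le(3)[of \<alpha>] sqr_pow_le(3)[of \<beta>] by linarith
    moreover have "0 \<le> \<alpha>\<^sup>2 + \<beta>\<^sup>2" by simp
    ultimately have "\<bar>\<alpha>\<bar> + \<bar>\<beta>\<bar> \<le> 2 * (1 + R)" using that by argo
    then have "(\<bar>\<alpha>\<bar> + \<bar>\<beta>\<bar>) * EZ f_lip \<le> B" unfolding B_def by (rule mult_right_mono) (rule EZ_lip_nonneg)
    then show ?thesis using L_pop_lipschitz[of \<alpha> \<beta> 0 0] by (simp add: L_pop_def)
  qed
  \<comment> \<open>Beyond \<open>\<Lambda>\<close> the linear growth of \<open>g_prof\<close> alone
    exceeds \<open>B + 1\<close>, hence \<open>L_pop\<close> by at least 1.\<close>
  define \<Lambda> where "\<Lambda> = max 1 ((B + 6) * 10 / 9)"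
  have \<Lambda>: "\<Lambda> \<ge> 1" "9/10 * \<Lambda> - 5 \<ge> B + 1" by (auto simp: \<Lambda>_def max_def)
  \<comment> \<open>If \<open>a < \<bar>\<alpha>\<bar> + \<kappa>\<close> and
    \<open>a \<le> \<Lambda>\<close>, then \<open>a\<^sup>2 - \<alpha>\<^sup>2 \<le> \<kappa> * (2 *
    \<Lambda>)\<close>, so the logarithmic term contributes at least \<open>B + 2\<close>. What
    remains of the domain is compact.\<close>
  define \<kappa> where "\<kappa> = exp (- 2 * (B + 2)) / (2 * \<Lambda>)"
  have \<kappa>: "\<kappa> > 0" using \<Lambda> by (simp add: \<kappa>_def)
  define C where "C = {q :: real \<times> real \<times> real. \<delta> \<le> (fst (snd q))\<^sup>2 + (snd (snd q))\<^sup>2 \<and> (fst (snd q))\<^sup>2 + (snd (snd q))\<^sup>2 \<le> R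
      \<and> \<bar>fst (snd q)\<bar> + \<kappa> \<le> fst q \<and> fst q \<le> \<Lambda>}"
  define h where "h q = L_pop (fst (snd q)) (snd (snd q)) - g_prof (fst q) (fst (snd q)) (snd (snd q))" for q :: "real \<times> real \<times> real"
  have closed: "closed C"
    unfolding C_def by (intro closed_Collect_conj closed_Collect_le continuous_intros)
  have bdd: "bounded C"
  proof (rule bounded_subset)
    show "bounded (cbox (0, - (1+R), - (1+R)) (\<Lambda>, 1+R, 1+R))" by (rule bounded_cbox)
    show "C \<subseteq> cbox (0, - (1+R), - (1+R)) (\<Lambda>, 1+R, 1+R)"
    proof
      fix q assume "q \<in> C"
      then obtain a \<alpha> \<beta> where q: "q = (a, \<alpha>, \<beta>)" and c: "\<alpha>\<^sup>2 + \<beta>\<^sup>2 \<le> R" "\<bar>\<alpha>\<bar> + \<kappa> \<le> a" "a \<le> \<Lambda>"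
        by (cases q) (auto simp: C_def)
      have "\<bar>\<alpha>\<bar> \<le> 1 + R" "\<bar>\<beta>\<bar> \<le> 1 + R"
        using sqr_pow_le(3)[of \<alpha>] sqr_pow_le(3)[of \<beta>] c zero_le_power2[of \<alpha>] zero_le_power2[of \<beta>] by linarith+
      then show "q \<in> cbox (0, - (1+R), - (1+R)) (\<Lambda>, 1+R, 1+R)"
        using c \<kappa> by (auto simp: q cbox_Pair_eq)
    qed
  qed
  have pos: "fst q > 0 \<and> (fst q)\<^sup>2 - (fst (snd q))\<^sup>2 > 0" if "q \<in> C" for q
  proof -
    have "\<bar>fst (snd q)\<bar> < fst q" using that \<kappa> by (auto simp: C_def)
    then have "\<bar>fst (snd q)\<bar>\<^sup>2 < (fst q)\<^sup>2" by (intro power_strict_mono) auto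
    with \<open>\<bar>fst (snd q)\<bar> < fst q\<close> show ?thesis by auto
  qed
  have cont: "continuous_on C h"
    unfolding h_def g_prof_def
    by (intro continuous_intros continuous_on_compose2[OF L_pop_continuous, of _ snd, simplified]) (use pos in fastforce)+
  obtain \<eta>1 where \<eta>1: "\<eta>1 > 0" "\<And>q. q \<in> C \<Longrightarrow> h q \<le> - \<eta>1"
  proof (cases "C = {}")
    case True then show ?thesis using that[of 1] by auto
  next
    case False
    obtain q0 where q0: "q0 \<in> C" "\<And>q. q \<in> C \<Longrightarrow> h q \<le> h q0"
      using continuous_attains_sup[OF compact_eq_bounded_closed[THEN iffD2] False cont] closed bdd by auto
    have "h q0 < 0"
    proof -
      have "\<bar>fst (snd q0)\<bar> < fst q0" "(fst (snd q0), snd (snd q0)) \<noteq> (0, 0)"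
        using q0(1) \<kappa> assms by (auto simp: C_def)
      from L_pop_less[OF this] show ?thesis by (simp add: h_def)
    qed
    then show ?thesis using that[of "- h q0"] q0 by auto
  qed
  show ?thesis
  proof (intro exI[of _ "min 1 \<eta>1"] conjI allI impI)
    fix \<alpha> \<beta> a assume A: "\<delta> \<le> \<alpha>\<^sup>2 + \<beta>\<^sup>2" "\<alpha>\<^sup>2 + \<beta>\<^sup>2 \<le> R" "\<bar>\<alpha>\<bar> < a"
    consider "a > \<Lambda>" | "a \<le> \<Lambda>" "a < \<bar>\<alpha>\<bar> + \<kappa>" | "(a, \<alpha>, \<beta>) \<in> C"
      using A by (fastforce simp: C_def)
    then show "L_pop \<alpha> \<beta> + min 1 \<eta>1 \<le> g_prof a \<alpha> \<beta>"
    proof cases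
      case 1
      then show ?thesis using g_prof_ge_linear(1)[OF A(3), of \<beta>] B[OF A(2)] \<Lambda> by linarith
    next
      case 2
      have a: "a > 0" using A by linarith
      have "a\<^sup>2 - \<alpha>\<^sup>2 = (a - \<bar>\<alpha>\<bar>) * (a + \<bar>\<alpha>\<bar>)" by (simp add: algebra_simps power2_eq_square abs_mult_self_eq)
      also have "\<dots> \<le> \<kappa> * (2 * \<Lambda>)" using A 2 \<kappa> by (intro mult_mono) auto
      also have "\<dots> = exp (- 2 * (B + 2))" using \<Lambda> by (simp add: \<kappa>_def)
      finally have le: "a\<^sup>2 - \<alpha>\<^sup>2 \<le> exp (- 2 * (B + 2))" .
      have "\<bar>\<alpha>\<bar>\<^sup>2 < a\<^sup>2" using A by (intro power_strict_mono) auto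
      then have "ln (a\<^sup>2 - \<alpha>\<^sup>2) \<le> - 2 * (B + 2)" using le by (metis diff_gt_0_iff_gt exp_gt_zero ln_exp ln_le_cancel_iff power2_abs)
      moreover have "\<beta>\<^sup>2 / a \<ge> 0" using a by simp
      ultimately have "g_prof a \<alpha> \<beta> \<ge> B + 1" unfolding g_prof_def using a by argo
      then show ?thesis using B[OF A(2)] by linarith
    next
      case 3
      from \<eta>1(2)[OF 3] show ?thesis by (simp add: h_def)
    qed
  qed (use \<eta>1 in auto)
qed

subsection \<open>Asymptotics over well-behaved samples\<close>

definition good :: "(real \<times> real \<Rightarrow> real) set \<Rightarrow> real \<Rightarrow> sample \<Rightarrow> bool" where
  "good Fs K x \<longleftrightarrow> (\<forall>f\<in>Fs. sqrt (real (fst x)) * \<bar>avg x f - EZ f\<bar> \<le> K)"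

text \<open>Asymptotic statements that hold uniformly over all samples whose relevant averages are
  within \<open>K / sqrt n\<close> of their expectations are expressed through this filter, so that the
  usual limit calculus applies to functions of the sample.\<close>

definition dfilter :: "(real \<times> real \<Rightarrow> real) set \<Rightarrow> real \<Rightarrow> sample filter" where
  "dfilter Fs K = inf (filtercomap fst sequentially) (principal {x. good Fs K x})"

lemma eventually_dfilter:
  "eventually P (dfilter Fs K) \<longleftrightarrow> (\<exists>N. \<forall>n\<ge>N. \<forall>d. good Fs K (n, d) \<longrightarrow> P (n, d))"
  unfolding dfilter_def eventually_inf_principal eventually_filtercomap eventually_sequentially
proof safe
  fix Q N assume "\<forall>n\<ge>N. Q n" "\<forall>x. Q (fst x) \<longrightarrow> x \<in> {x. good Fs K x} \<longrightarrow> P x"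
  then show "\<exists>N. \<forall>n\<ge>N. \<forall>d. good Fs K (n, d) \<longrightarrow> P (n, d)" by (intro exI[of _ N]) auto
next
  fix N assume *: "\<forall>n\<ge>N. \<forall>d. good Fs K (n, d) \<longrightarrow> P (n, d)"
  show "\<exists>Q. (\<exists>N. \<forall>n\<ge>N. Q n) \<and> (\<forall>x. Q (fst x) \<longrightarrow> x \<in> {x. good Fs K x} \<longrightarrow> P x)"
    by (intro exI[of _ "\<lambda>n. n \<ge> N"]) (use * in auto)
qed

abbreviation rn :: "sample \<Rightarrow> real" where "rn x \<equiv> sqrt (real (fst x))"

section \<open>Null fit and normalised statistics of a sample\<close>

definition smean :: "sample \<Rightarrow> real" where "smean x = avg x (mon 0 1)"
text \<open>The pooled variance under the null model, halved because each observation supplies two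
  coordinates. Only the sum coordinate is centred: equal means make the difference coordinate mean
  zero by hypothesis.\<close>

definition svar :: "sample \<Rightarrow> real" where
  "svar x = (avg x (mon 2 0) + avg x (mon 0 2) - (smean x)\<^sup>2) / 2"
definition ssd :: "sample \<Rightarrow> real" where "ssd x = sqrt (svar x)"

text \<open>Samples are rotated with the true parameters; this restandardises them with the
  empirical null fit, which in those units is \<open>smean\<close> and \<open>ssd\<close>. The
  result is the argument of \<open>lncosh\<close> in the likelihood ratio.\<close>

definition zed :: "sample \<Rightarrow> real \<Rightarrow> real \<Rightarrow> real \<times> real \<Rightarrow> real" where
  "zed x \<alpha> \<beta> z = fst z / ssd x * (sqrt 2 * \<beta> + \<alpha> * ((snd z - smean x) / ssd x))"

definition J :: "sample \<Rightarrow> real \<Rightarrow> real \<Rightarrow> real" where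
  "J x \<alpha> \<beta> = avg x (\<lambda>z. lncosh (zed x \<alpha> \<beta> z))"

text \<open>\<open>W1\<close>, \<open>W2\<close>, \<open>W3\<close> are the exact fluctuations of
  the three coefficients in the empirical second moment of \<open>zed\<close>; see
  \<open>avg_zed_2\<close>.\<close>

definition W1 :: "sample \<Rightarrow> real" where "W1 x = rn x * (avg x (mon 2 0) / (ssd x)^2 - 1)"
definition W2 :: "sample \<Rightarrow> real" where
  "W2 x = rn x / 2 * ((avg x (mon 2 2) - 2 * smean x * avg x (mon 2 1) + (smean x)\<^sup>2 * avg x (mon 2 0)) / (ssd x)^4 - 1)"
definition W3 :: "sample \<Rightarrow> real" where
  "W3 x = rn x * (avg x (mon 2 1) - smean x * avg x (mon 2 0)) / (sqrt 2 * (ssd x)^3)"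

text \<open>Linearisations of the \<open>W\<close> statistics. For \<open>z = (p, s)\<close> they
  are normalised sums of \<open>(p\<^sup>2 - s\<^sup>2)/2\<close>,
  \<open>(p\<^sup>2 - 1) * (s\<^sup>2 - 1)/2\<close> and
  \<open>(p\<^sup>2 - 1) * s / sqrt 2\<close>. These are orthonormal Hermite combinations,
  orthogonal to \<open>s\<close> and \<open>p\<^sup>2 + s\<^sup>2 - 2\<close>, the directions
  consumed by fitting the common mean and variance.\<close>

definition V1 :: "sample \<Rightarrow> real" where "V1 x = rn x * (avg x (mon 2 0) - avg x (mon 0 2)) / 2"
definition V2 :: "sample \<Rightarrow> real" where
  "V2 x = rn x * (avg x (mon 2 2) - avg x (mon 2 0) - avg x (mon 0 2) + 1) / 2"
definition V3 :: "sample \<Rightarrow> real" where "V3 x = rn x * (avg x (mon 2 1) - smean x) / sqrt 2"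

lemma tendsto_0_mult_bounded:
  fixes X Y :: "'a \<Rightarrow> real"
  assumes "(X \<longlongrightarrow> 0) F" "eventually (\<lambda>x. \<bar>Y x\<bar> \<le> B) F"
  shows "((\<lambda>x. Y x * X x) \<longlongrightarrow> 0) F"
proof (rule Lim_null_comparison)
  show "eventually (\<lambda>x. norm (Y x * X x) \<le> B * \<bar>X x\<bar>) F"
    using assms(2) by eventually_elim (simp add: abs_mult mult_right_mono)
  show "((\<lambda>x. B * \<bar>X x\<bar>) \<longlongrightarrow> 0) F"
    using tendsto_mult[OF tendsto_const tendsto_rabs[OF assms(1)], of B] by simp
qed

lemma eventually_small:
  fixes X :: "'a \<Rightarrow> real"
  assumes "(X \<longlongrightarrow> l) F" "e > 0"
  shows "eventually (\<lambda>x. \<bar>X x - l\<bar> < e) F"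
  using tendstoD[OF assms] by (simp add: dist_real_def)

lemma abs_comb_le:
  fixes a b c K :: real
  assumes "\<bar>a\<bar> \<le> K" "\<bar>b\<bar> \<le> K" "\<bar>c\<bar> \<le> K"
  shows "\<bar>(a + b - c) / 2\<bar> \<le> 2 * K" "\<bar>(a - b - c) / 2\<bar> \<le> 2 * K" "\<bar>(a - b) / 2\<bar> \<le> 2 * K" "\<bar>a - b\<bar> \<le> 2 * K"
  using assms by (auto simp: abs_le_iff)

lemma abs_sum5_le:
  fixes a b c d e :: real
  assumes "\<bar>a\<bar> \<le> A" "\<bar>b\<bar> \<le> B" "\<bar>c\<bar> \<le> C" "\<bar>d\<bar> \<le> D" "\<bar>e\<bar> \<le> E"
  shows "\<bar>a + b + c + d + e\<bar> \<le> A + B + C + D + E"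
  using assms by linarith

text \<open>512 is the cube of 8 in the pointwise bound of the squared \<open>zed\<close> by
  \<open>8 * p\<^sup>2 * (2 + s\<^sup>2) * q2 \<alpha> \<beta>\<close>; the added 1 is room for
  replacing the expectation of \<open>f_six\<close> by its average.\<close>

definition C_six :: real where "C_six = 512 * (EZ f_six + 1)"
text \<open>Below this radius the sextic remainder \<open>(C_six + 2) * q^3\<close> in
  \<open>H_upper\<close> is at most \<open>q\<^sup>2/8\<close>.\<close>

definition \<delta>_loc :: real where "\<delta>_loc = 1 / (8 * (C_six + 2))"

lemma C_six_nonneg: "C_six \<ge> 512"
proof -
  have "EZ f_six \<ge> 0" by (rule Bochner_Integration.integral_nonneg) (simp add: f_six_def)
  then show ?thesis by (simp add: C_six_def)
qed

lemma \<delta>_loc: "\<delta>_loc > 0" "\<delta>_loc \<le> 1/8" "\<delta>_loc * (C_six + 2) = 1/8"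
  using C_six_nonneg by (simp_all add: \<delta>_loc_def field_simps)

definition q2 :: "real \<Rightarrow> real \<Rightarrow> real" where "q2 \<alpha> \<beta> = \<alpha>\<^sup>2 + \<beta>\<^sup>2"

lemma zed_eq:
  assumes "ssd x > 0"
  shows "zed x \<alpha> \<beta> z = fst z * (sqrt 2 * (\<beta> / ssd x - \<alpha> * smean x / (sqrt 2 * (ssd x)\<^sup>2)) + \<alpha> / (ssd x)\<^sup>2 * snd z)"
  unfolding zed_def using assms by (simp add: field_simps power2_eq_square)

lemma J_eq:
  assumes "ssd x > 0"
  shows "J x \<alpha> \<beta> = avg x (f_lnc (\<alpha> / (ssd x)\<^sup>2) (\<beta> / ssd x - \<alpha> * smean x / (sqrt 2 * (ssd x)\<^sup>2)))"
  unfolding J_def f_lnc_def[abs_def] zed_eq[OF assms] ..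

text \<open>An exact identity. Half of the deterministic part
  \<open>2 * \<beta>\<^sup>2 + \<alpha>\<^sup>2\<close> cancels against the quadratic part of
  \<open>g_prof\<close>, so only noise is left at degree two.\<close>

lemma avg_zed_2:
  assumes "ssd x > 0" "fst x > 0"
  shows "avg x (\<lambda>z. (zed x \<alpha> \<beta> z)\<^sup>2) = 2 * \<beta>\<^sup>2 + \<alpha>\<^sup>2 + 2 / rn x * (\<beta>\<^sup>2 * W1 x + \<alpha>\<^sup>2 * W2 x + 2 * \<alpha> * \<beta> * W3 x)"
proof -
  define v m where "v = ssd x" and "m = smean x"
  define b a where "b = sqrt 2 * \<beta> / v" and "a = \<alpha> / v\<^sup>2"
  have v: "v > 0" using assms by (simp add: v_def)
  have z: "zed x \<alpha> \<beta> z = fst z * (b - a * m + a * snd z)" for z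
    unfolding zed_def v_def[symmetric] m_def[symmetric] a_def b_def using v by (simp add: field_simps power2_eq_square)
  have "(zed x \<alpha> \<beta> z)\<^sup>2 = (b - a * m)\<^sup>2 * mon 2 0 z + 2 * (b - a*m) * a * mon 2 1 z + a\<^sup>2 * mon 2 2 z" for z
    unfolding z mon_def by (simp add: power_mult_distrib) algebra
  then have 1: "avg x (\<lambda>z. (zed x \<alpha> \<beta> z)\<^sup>2) = (b - a * m)\<^sup>2 * avg x (mon 2 0) + 2 * (b - a*m) * a * avg x (mon 2 1) + a\<^sup>2 * avg x (mon 2 2)"
    by (simp add: avg_add avg_cmult)
  have r: "rn x > 0" using assms by simp
  have b2: "b\<^sup>2 = 2 * \<beta>\<^sup>2 / v\<^sup>2" by (simp add: b_def power_divide power_mult_distrib)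
  have a2: "a\<^sup>2 = \<alpha>\<^sup>2 / v^4" by (simp add: a_def power_divide)
  have ab: "2 * a * b = 4 * \<alpha> * \<beta> / (sqrt 2 * v^3)" unfolding a_def b_def using v
    by (simp add: field_simps power2_eq_square power3_eq_cube)
  have w1: "2 / rn x * (\<beta>\<^sup>2 * W1 x) = b\<^sup>2 * avg x (mon 2 0) - 2 * \<beta>\<^sup>2"
    unfolding W1_def b2 v_def[symmetric] using r by (simp add: field_simps)
  have w2: "2 / rn x * (\<alpha>\<^sup>2 * W2 x) = a\<^sup>2 * (avg x (mon 2 2) - 2 * m * avg x (mon 2 1) + m\<^sup>2 * avg x (mon 2 0)) - \<alpha>\<^sup>2"
  proof -
    have "2 / rn x * (\<alpha>\<^sup>2 * (rn x / 2 * (T / v^4 - 1))) = \<alpha>\<^sup>2 / v^4 * T - \<alpha>\<^sup>2" for T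
    proof -
      have "2 / rn x * (\<alpha>\<^sup>2 * (rn x / 2 * (T / v^4 - 1))) = \<alpha>\<^sup>2 * (T / v^4 - 1)" using r by simp
      then show ?thesis by (simp add: algebra_simps)
    qed
    then show ?thesis unfolding W2_def a2 v_def[symmetric] m_def[symmetric] .
  qed
  have w3: "2 / rn x * (2 * \<alpha> * \<beta> * W3 x) = 2 * a * b * (avg x (mon 2 1) - m * avg x (mon 2 0))"
  proof -
    have "2 / rn x * (2 * \<alpha> * \<beta> * (rn x * T / (sqrt 2 * v^3))) = 4 * \<alpha> * \<beta> / (sqrt 2 * v^3) * T" for T
      using r by simp
    then show ?thesis unfolding W3_def ab v_def[symmetric] m_def[symmetric] .
  qed
  show ?thesis unfolding 1 distrib_left w1 w2 w3 by algebra
qed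

lemma avg_zed_4:
  shows "avg x (\<lambda>z. (fst z * (B + a * snd z)) ^ 4) = B^4 * avg x (mon 4 0) + 4*B^3*a * avg x (mon 4 1)
     + 6 * B\<^sup>2 * a\<^sup>2 * avg x (mon 4 2) + 4 * B * a^3 * avg x (mon 4 3) + a^4 * avg x (mon 4 4)"
proof -
  have "(fst z * (B + a * snd z)) ^ 4 = B^4 * mon 4 0 z + 4*B^3*a * mon 4 1 z
     + 6 * B\<^sup>2 * a\<^sup>2 * mon 4 2 z + 4 * B * a^3 * mon 4 3 z + a^4 * mon 4 4 z" for z
    unfolding mon_def by (simp add: power_mult_distrib) algebra
  then show ?thesis by (simp add: avg_add avg_cmult)
qed

lemma abs_le_sqrt_q2: "\<bar>\<alpha>\<bar> \<le> sqrt (q2 \<alpha> \<beta>)" "\<bar>\<beta>\<bar> \<le> sqrt (q2 \<alpha> \<beta>)"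
  unfolding q2_def by (auto intro!: real_le_rsqrt)

lemma q2_nonneg [simp]: "q2 \<alpha> \<beta> \<ge> 0" by (simp add: q2_def)

lemma quartic_form_bound:
  "\<bar>c0 * \<beta>^4 + c1 * (\<beta>^3 * \<alpha>) + c2 * (\<beta>\<^sup>2 * \<alpha>\<^sup>2) + c3 * (\<beta> * \<alpha>^3) + c4 * \<alpha>^4\<bar>
     \<le> (\<bar>c0\<bar> + \<bar>c1\<bar> + \<bar>c2\<bar> + \<bar>c3\<bar> + \<bar>c4\<bar>) * (q2 \<alpha> \<beta>)\<^sup>2"
proof -
  define r where "r = sqrt (q2 \<alpha> \<beta>)"
  have r: "\<bar>\<alpha>\<bar> \<le> r" "\<bar>\<beta>\<bar> \<le> r" using abs_le_sqrt_q2 by (auto simp: r_def)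
  have r4: "r^4 = (q2 \<alpha> \<beta>)\<^sup>2" unfolding r_def
    by (metis q2_nonneg numeral_Bit0_eq_double power_mult real_sqrt_pow2)
  have m: "\<bar>c * (\<beta>^i * \<alpha>^j)\<bar> \<le> \<bar>c\<bar> * r^4" if "i + j = 4" for c i j
  proof -
    have "\<bar>\<beta>\<bar>^i * \<bar>\<alpha>\<bar>^j \<le> r^i * r^j" using r by (intro mult_mono power_mono) auto
    then show ?thesis using that by (simp add: abs_mult power_abs power_add[symmetric] mult_left_mono)
  qed
  show ?thesis
    using abs_sum5_le[OF m[of 4 0 c0] m[of 3 1 c1] m[of 2 2 c2] m[of 1 3 c3] m[of 0 4 c4]]
    unfolding r4[symmetric] by (simp add: distrib_right)
qed

section \<open>Limits of sample statistics along good samples\<close>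

locale data_filter =
  fixes Fs :: "(real \<times> real \<Rightarrow> real) set" and K :: real
  assumes base: "base_funs \<subseteq> Fs" and K: "K \<ge> 0"
begin

abbreviation F :: "sample filter" where "F \<equiv> dfilter Fs K"

lemma ev_good: "eventually (good Fs K) F"
  unfolding eventually_dfilter by auto

lemma fst_at_top: "filterlim fst sequentially F"
  unfolding dfilter_def
  by (rule filterlim_mono[OF filterlim_filtercomap order_refl inf_le1])

lemma rn_at_top: "filterlim rn at_top F"
  using filterlim_compose[OF filterlim_compose[OF sqrt_at_top filterlim_real_sequentially] fst_at_top] by simp

lemma inv_rn: "((\<lambda>x. 1 / rn x) \<longlongrightarrow> 0) F"
  by (rule real_tendsto_divide_at_top[OF tendsto_const rn_at_top])

lemma ev_n: "eventually (\<lambda>x. fst x \<ge> N) F"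
  using fst_at_top eventually_ge_at_top[of N] by (rule eventually_compose_filterlim[rotated])

lemma ev_bound: "f \<in> Fs \<Longrightarrow> eventually (\<lambda>x. \<bar>rn x * (avg x f - EZ f)\<bar> \<le> K) F"
  using ev_good by eventually_elim (auto simp: good_def abs_mult)

lemma ev_close:
  assumes "e > 0"
  shows "eventually (\<lambda>x. \<forall>f\<in>Fs. \<bar>avg x f - EZ f\<bar> \<le> e) F"
proof -
  have "eventually (\<lambda>x. rn x \<ge> K / e + 1) F"
    using rn_at_top unfolding filterlim_at_top by auto
  with ev_good show ?thesis
  proof eventually_elim
    case (elim x)
    show ?case
    proof
      fix f assume "f \<in> Fs"
      then have "rn x * \<bar>avg x f - EZ f\<bar> \<le> K" using elim(1) by (simp add: good_def)
      moreover have "K / e < rn x" using elim(2) by linarith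
      moreover from this have "(K / e) * \<bar>avg x f - EZ f\<bar> \<le> rn x * \<bar>avg x f - EZ f\<bar>"
        by (intro mult_right_mono) auto
      ultimately show "\<bar>avg x f - EZ f\<bar> \<le> e"
      proof (cases "K = 0")
        case True
        then have "rn x > 0" using \<open>K / e < rn x\<close> by simp
        then have "\<bar>avg x f - EZ f\<bar> \<le> 0" using \<open>rn x * \<bar>avg x f - EZ f\<bar> \<le> K\<close> True
          by (simp add: mult_le_0_iff)
        then show ?thesis using assms by linarith
      next
        case False
        then have "K > 0" using K by simp
        have "(K / e) * \<bar>avg x f - EZ f\<bar> \<le> K" using \<open>rn x * \<bar>avg x f - EZ f\<bar> \<le> K\<close> \<open>(K / e) * \<bar>avg x f - EZ f\<bar> \<le> rn x * \<bar>avg x f - EZ f\<bar>\<close> by linarith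
        then show ?thesis using \<open>K > 0\<close> assms by (simp add: field_simps)
      qed
    qed
  qed
qed

lemma tendsto_avg: "f \<in> Fs \<Longrightarrow> ((\<lambda>x. avg x f) \<longlongrightarrow> EZ f) F"
proof (rule tendstoI)
  fix e :: real assume "f \<in> Fs" "e > 0"
  then show "eventually (\<lambda>x. dist (avg x f) (EZ f) < e) F"
    using ev_close[of "e/2"] by (auto elim!: eventually_mono simp: dist_real_def)
qed

lemma in_Fs: "mon 0 1 \<in> Fs" "mon 2 0 \<in> Fs" "mon 0 2 \<in> Fs" "mon 2 1 \<in> Fs" "mon 2 2 \<in> Fs"
  "mon 4 0 \<in> Fs" "mon 4 1 \<in> Fs" "mon 4 2 \<in> Fs" "mon 4 3 \<in> Fs" "mon 4 4 \<in> Fs"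
  "amon 0 \<in> Fs" "amon 1 \<in> Fs" "amon 2 \<in> Fs" "f_six \<in> Fs" "f_lip \<in> Fs"
  using base by (auto simp: base_funs_def)

lemma lims: "((\<lambda>x. avg x (mon 2 0)) \<longlongrightarrow> 1) F" "((\<lambda>x. avg x (mon 0 2)) \<longlongrightarrow> 1) F"
  "((\<lambda>x. avg x (mon 2 1)) \<longlongrightarrow> 0) F" "((\<lambda>x. avg x (mon 2 2)) \<longlongrightarrow> 1) F" "(smean \<longlongrightarrow> 0) F"
  "((\<lambda>x. avg x (mon 4 0)) \<longlongrightarrow> 3) F" "((\<lambda>x. avg x (mon 4 1)) \<longlongrightarrow> 0) F" "((\<lambda>x. avg x (mon 4 2)) \<longlongrightarrow> 3) F"
  "((\<lambda>x. avg x (mon 4 3)) \<longlongrightarrow> 0) F" "((\<lambda>x. avg x (mon 4 4)) \<longlongrightarrow> 9) F"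
  "((\<lambda>x. avg x (amon 0)) \<longlongrightarrow> EZ (amon 0)) F" "((\<lambda>x. avg x (amon 1)) \<longlongrightarrow> 0) F"
  "((\<lambda>x. avg x (amon 2)) \<longlongrightarrow> EZ (amon 0)) F"
  using in_Fs[THEN tendsto_avg] unfolding EZ_mon EZ_amon(2,3) smean_def[abs_def] by simp_all

lemma svar_lim: "(svar \<longlongrightarrow> 1) F"
proof -
  have "((\<lambda>x. (avg x (mon 2 0) + avg x (mon 0 2) - (smean x)\<^sup>2) / 2) \<longlongrightarrow> (1 + 1 - 0\<^sup>2) / 2) F"
    by (intro tendsto_intros lims) auto
  then show ?thesis by (simp add: svar_def[abs_def])
qed

lemma ssd_lim: "(ssd \<longlongrightarrow> 1) F"
  using tendsto_real_sqrt[OF svar_lim] by (simp add: ssd_def[abs_def])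

lemma ev_ssd: "eventually (\<lambda>x. ssd x > 1/2) F"
  by (rule order_tendstoD(1)[OF ssd_lim]) simp

lemma ssd_sq: "ssd x > 0 \<Longrightarrow> (ssd x)\<^sup>2 = svar x"
  unfolding ssd_def by simp

lemma ev_mean_bound: "eventually (\<lambda>x. \<bar>rn x * smean x\<bar> \<le> K) F"
  using ev_bound[OF in_Fs(1)] by (simp add: smean_def EZ_mon)

lemma ev_mon_bound: "eventually (\<lambda>x. \<bar>rn x * (avg x (mon 2 0) - 1)\<bar> \<le> K) F"
  "eventually (\<lambda>x. \<bar>rn x * (avg x (mon 0 2) - 1)\<bar> \<le> K) F"
  "eventually (\<lambda>x. \<bar>rn x * (avg x (mon 2 2) - 1)\<bar> \<le> K) F"
  "eventually (\<lambda>x. \<bar>rn x * avg x (mon 2 1)\<bar> \<le> K) F"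
  using in_Fs(2-5)[THEN ev_bound] unfolding EZ_mon by simp_all

lemma ev_svar_bound: "eventually (\<lambda>x. \<bar>rn x * (svar x - 1)\<bar> \<le> 2 * K) F"
proof -
  have "eventually (\<lambda>x. \<bar>smean x - 0\<bar> < 1) F" by (rule eventually_small[OF lims(5)]) simp
  with ev_mean_bound ev_mon_bound(1,2) show ?thesis
  proof eventually_elim
    case (elim x)
    have "rn x * (svar x - 1) = (rn x * (avg x (mon 2 0) - 1) + rn x * (avg x (mon 0 2) - 1) - (rn x * smean x) * smean x) / 2"
      unfolding svar_def by (simp add: field_simps power2_eq_square)
    moreover have "\<bar>(rn x * smean x) * smean x\<bar> \<le> K * 1"
      unfolding abs_mult[of "rn x * smean x"] using elim K by (intro mult_mono) auto
    ultimately show ?case using elim abs_comb_le(1) by (metis mult_1_right)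
  qed
qed

lemma V_bound: "eventually (\<lambda>x. \<bar>V1 x\<bar> \<le> 2 * K \<and> \<bar>V2 x\<bar> \<le> 2 * K \<and> \<bar>V3 x\<bar> \<le> 2 * K) F"
  using ev_mean_bound ev_mon_bound
proof eventually_elim
  case (elim x)
  have 1: "V1 x = (rn x * (avg x (mon 2 0) - 1) - rn x * (avg x (mon 0 2) - 1)) / 2"
    by (simp add: V1_def field_simps)
  have 2: "V2 x = (rn x * (avg x (mon 2 2) - 1) - rn x * (avg x (mon 2 0) - 1) - rn x * (avg x (mon 0 2) - 1)) / 2"
    by (simp add: V2_def field_simps)
  have 3: "V3 x = (rn x * avg x (mon 2 1) - rn x * smean x) / sqrt 2"
    by (simp add: V3_def field_simps)
  have "\<bar>V3 x\<bar> \<le> \<bar>rn x * avg x (mon 2 1) - rn x * smean x\<bar> / 1"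
    unfolding 3 abs_divide by (intro divide_left_mono) auto
  then have "\<bar>V3 x\<bar> \<le> \<bar>rn x * avg x (mon 2 1) - rn x * smean x\<bar>" unfolding div_by_1 .
  moreover have "\<bar>rn x * avg x (mon 2 1) - rn x * smean x\<bar> \<le> 2 * K" by (rule abs_comb_le(4)[OF elim(5,1,1)])
  ultimately have "\<bar>V3 x\<bar> \<le> 2 * K" by linarith
  moreover have "\<bar>V1 x\<bar> \<le> 2 * K" unfolding 1 by (rule abs_comb_le(3)[OF elim(2,3,3)])
  moreover have "\<bar>V2 x\<bar> \<le> 2 * K" unfolding 2 by (rule abs_comb_le(2)[OF elim(4,2,3)])
  ultimately show ?case by blast
qed

text \<open>Since \<open>svar\<close> averages both coordinates,
  \<open>avg x (mon 2 0) - svar x\<close> is half the difference of the two second moments plus half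
  of the squared mean. This is how fitting the variance turns \<open>W1\<close> into
  \<open>V1\<close>; every correction is a bounded factor times a vanishing one.\<close>

lemma W_V1: "((\<lambda>x. W1 x - V1 x) \<longlongrightarrow> 0) F"
proof -
  have l: "((\<lambda>x. 1 / (ssd x)\<^sup>2 - 1) \<longlongrightarrow> 1 / 1\<^sup>2 - 1) F" by (intro tendsto_intros ssd_lim) auto
  have l2: "((\<lambda>x. smean x / (ssd x)\<^sup>2 / 2) \<longlongrightarrow> 0 / 1\<^sup>2 / 2) F" by (intro tendsto_intros ssd_lim lims) auto
  have "((\<lambda>x. V1 x * (1 / (ssd x)\<^sup>2 - 1) + rn x * smean x * (smean x / (ssd x)\<^sup>2 / 2)) \<longlongrightarrow> 0 + 0) F"
    using l l2 V_bound ev_mean_bound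
    by (intro tendsto_add tendsto_0_mult_bounded[where B="2*K"] tendsto_0_mult_bounded[where B=K]) (auto elim: eventually_mono)
  then have "((\<lambda>x. V1 x * (1 / (ssd x)\<^sup>2 - 1) + rn x * smean x * (smean x / (ssd x)\<^sup>2 / 2)) \<longlongrightarrow> 0) F" by simp
  moreover have "eventually (\<lambda>x. V1 x * (1 / (ssd x)\<^sup>2 - 1) + rn x * smean x * (smean x / (ssd x)\<^sup>2 / 2) = W1 x - V1 x) F"
    using ev_ssd
  proof eventually_elim
    case (elim x)
    have s: "svar x \<noteq> 0" "(ssd x)\<^sup>2 = svar x" using elim ssd_sq[of x] by auto
    have "svar x * W1 x = rn x * (avg x (mon 2 0) - svar x)" unfolding W1_def s using s by (simp add: field_simps)
    also have "\<dots> = V1 x + rn x * smean x * smean x / 2"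
      unfolding svar_def V1_def by (simp add: field_simps power2_eq_square)
    finally have w: "W1 x = (V1 x + rn x * smean x * smean x / 2) / svar x" using s by (simp add: field_simps)
    show ?case unfolding s(2) w using s(1) by (simp add: field_simps)
  qed
  ultimately show ?thesis by (rule Lim_transform_eventually)
qed

lemma W_V2: "((\<lambda>x. W2 x - V2 x) \<longlongrightarrow> 0) F"
proof -
  define Z1 where "Z1 x = (smean x - 2 * avg x (mon 2 1) + smean x * avg x (mon 2 0)) / (ssd x)^4 / 2" for x
  define Z2 where "Z2 x = - (svar x - 1) / (ssd x)^4 / 2" for x
  have l: "((\<lambda>x. 1 / (ssd x)^4 - 1) \<longlongrightarrow> 1 / 1^4 - 1) F" by (intro tendsto_intros ssd_lim) auto
  have l1: "(Z1 \<longlongrightarrow> (0 - 2 * 0 + 0 * 1) / 1^4 / 2) F" unfolding Z1_def[abs_def] by (intro tendsto_intros ssd_lim lims) auto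
  have l2: "(Z2 \<longlongrightarrow> - (1 - 1) / 1^4 / 2) F" unfolding Z2_def[abs_def] by (intro tendsto_intros ssd_lim svar_lim) auto
  have "((\<lambda>x. V2 x * (1 / (ssd x)^4 - 1) + rn x * smean x * Z1 x + rn x * (svar x - 1) * Z2 x) \<longlongrightarrow> 0 + 0 + 0) F"
    using l l1 l2 V_bound ev_mean_bound ev_svar_bound
    by (intro tendsto_add tendsto_0_mult_bounded[where B="2*K"] tendsto_0_mult_bounded[where B=K]) (auto elim: eventually_mono)
  then have "((\<lambda>x. V2 x * (1 / (ssd x)^4 - 1) + rn x * smean x * Z1 x + rn x * (svar x - 1) * Z2 x) \<longlongrightarrow> 0) F" by simp
  moreover have "eventually (\<lambda>x. V2 x * (1 / (ssd x)^4 - 1) + rn x * smean x * Z1 x + rn x * (svar x - 1) * Z2 x = W2 x - V2 x) F"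
    using ev_ssd
  proof eventually_elim
    case (elim x)
    have s4: "(ssd x)^4 = ((ssd x)\<^sup>2)\<^sup>2" by simp
    have s: "svar x \<noteq> 0" "(ssd x)^4 = (svar x)\<^sup>2" unfolding s4 using elim ssd_sq[of x] by auto
    define T where "T = avg x (mon 2 2) - 2 * smean x * avg x (mon 2 1) + (smean x)\<^sup>2 * avg x (mon 2 0)"
    have sv: "2 * svar x = avg x (mon 2 0) + avg x (mon 0 2) - (smean x)\<^sup>2" by (simp add: svar_def)
    \<comment> \<open>The first bracket is the numerator of \<open>V2\<close>; each other term is a
      product of two factors of order \<open>1/sqrt n\<close>, hence negligible after
      scaling.\<close>
    have "T - (svar x)\<^sup>2 = (avg x (mon 2 2) - avg x (mon 2 0) - avg x (mon 0 2) + 1)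
       + smean x * (smean x - 2 * avg x (mon 2 1) + smean x * avg x (mon 2 0)) - (svar x - 1) * (svar x - 1)"
      unfolding T_def using sv by algebra
    note num = this
    have "W2 x = rn x / 2 * ((T - (svar x)\<^sup>2) / (svar x)\<^sup>2)"
      unfolding W2_def s T_def[symmetric] using s(1) by (simp add: diff_divide_distrib)
    note w = this[unfolded num]
    show ?case unfolding s w V2_def Z1_def Z2_def
      by (simp add: algebra_simps add_divide_distrib diff_divide_distrib)
  qed
  ultimately show ?thesis by (rule Lim_transform_eventually)
qed

lemma W_V3: "((\<lambda>x. W3 x - V3 x) \<longlongrightarrow> 0) F"
proof -
  have l: "((\<lambda>x. 1 / (ssd x)^3 - 1) \<longlongrightarrow> 1 / 1^3 - 1) F" by (intro tendsto_intros ssd_lim) auto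
  have l2: "((\<lambda>x. (1 - avg x (mon 2 0)) / sqrt 2 / (ssd x)^3) \<longlongrightarrow> (1 - 1) / sqrt 2 / 1^3) F" by (intro tendsto_intros ssd_lim lims) auto
  have "((\<lambda>x. V3 x * (1 / (ssd x)^3 - 1) + rn x * smean x * ((1 - avg x (mon 2 0)) / sqrt 2 / (ssd x)^3)) \<longlongrightarrow> 0 + 0) F"
    using l l2 V_bound ev_mean_bound
    by (intro tendsto_add tendsto_0_mult_bounded[where B="2*K"] tendsto_0_mult_bounded[where B=K]) (auto elim: eventually_mono)
  then have "((\<lambda>x. V3 x * (1 / (ssd x)^3 - 1) + rn x * smean x * ((1 - avg x (mon 2 0)) / sqrt 2 / (ssd x)^3)) \<longlongrightarrow> 0) F" by simp
  moreover have "eventually (\<lambda>x. V3 x * (1 / (ssd x)^3 - 1) + rn x * smean x * ((1 - avg x (mon 2 0)) / sqrt 2 / (ssd x)^3) = W3 x - V3 x) F"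
    using ev_ssd
  proof eventually_elim
    case (elim x)
    then have "ssd x > 0" by linarith
    then show ?case unfolding W3_def V3_def by (simp add: field_simps)
  qed
  ultimately show ?thesis by (rule Lim_transform_eventually)
qed

lemma W_close:
  assumes "e > 0"
  shows "eventually (\<lambda>x. \<bar>W1 x - V1 x\<bar> \<le> e \<and> \<bar>W2 x - V2 x\<bar> \<le> e \<and> \<bar>W3 x - V3 x\<bar> \<le> e) F"
  using eventually_small[OF W_V1 assms] eventually_small[OF W_V2 assms] eventually_small[OF W_V3 assms]
  by eventually_elim auto

lemma W_bound: "eventually (\<lambda>x. \<bar>W1 x\<bar> \<le> 2 * K + 1 \<and> \<bar>W2 x\<bar> \<le> 2 * K + 1 \<and> \<bar>W3 x\<bar> \<le> 2 * K + 1) F"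
  using W_close[OF zero_less_one] V_bound by eventually_elim linarith

end

section \<open>Expansion of the averaged log cosh near the null, and its growth far away\<close>

context data_filter
begin

text \<open>The target is the Gaussian fourth moment: 3 times that of
  \<open>sqrt 2 * \<beta> + \<alpha> * s\<close>, which is \<open>4 * \<beta>^4 + 12 *
  \<alpha>\<^sup>2 * \<beta>\<^sup>2 + 3 * \<alpha>^4\<close>. The deviation is a form of degree
  four whose five coefficients tend to 0, hence the uniformity in \<open>\<alpha>\<close> and
  \<open>\<beta>\<close>.\<close>

lemma J_upper_near:
  assumes "e > 0"
  shows "eventually (\<lambda>x. \<forall>\<alpha> \<beta>. \<bar>avg x (\<lambda>z. (zed x \<alpha> \<beta> z) ^ 4) - (12 * \<beta>^4 + 36 * (\<beta>\<^sup>2 * \<alpha>\<^sup>2) + 9 * \<alpha>^4)\<bar> \<le> e * (q2 \<alpha> \<beta>)\<^sup>2) F"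
proof -
  define x1 x2 x3 where "x1 x = sqrt 2 / ssd x" and "x2 x = - smean x / (ssd x)\<^sup>2" and "x3 x = 1 / (ssd x)\<^sup>2" for x
  have l: "(x1 \<longlongrightarrow> sqrt 2 / 1) F" "(x2 \<longlongrightarrow> - 0 / 1\<^sup>2) F" "(x3 \<longlongrightarrow> 1 / 1\<^sup>2) F"
    unfolding x1_def[abs_def] x2_def[abs_def] x3_def[abs_def] by (intro tendsto_intros ssd_lim lims; simp)+
  have l1: "(x1 \<longlongrightarrow> sqrt 2) F" "(x2 \<longlongrightarrow> 0) F" "(x3 \<longlongrightarrow> 1) F" using l by simp_all
  define A where "A k x = avg x (mon 4 k)" for k x
  have lA: "(A 0 \<longlongrightarrow> 3) F" "(A 1 \<longlongrightarrow> 0) F" "(A 2 \<longlongrightarrow> 3) F" "(A 3 \<longlongrightarrow> 0) F" "(A 4 \<longlongrightarrow> 9) F"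
    unfolding A_def[abs_def] using lims(6-10) by simp_all
  define c0 c1 c2 c3 c4 where
    "c0 x = x1 x ^ 4 * A 0 x - 12" and
    "c1 x = 4 * x1 x ^ 3 * x2 x * A 0 x + 4 * x1 x ^ 3 * x3 x * A 1 x" and
    "c2 x = 6 * (x1 x)\<^sup>2 * (x2 x)\<^sup>2 * A 0 x + 12 * (x1 x)\<^sup>2 * x2 x * x3 x * A 1 x + 6 * (x1 x)\<^sup>2 * (x3 x)\<^sup>2 * A 2 x - 36" and
    "c3 x = 4 * x1 x * x2 x ^ 3 * A 0 x + 12 * x1 x * (x2 x)\<^sup>2 * x3 x * A 1 x + 12 * x1 x * x2 x * (x3 x)\<^sup>2 * A 2 x + 4 * x1 x * x3 x ^ 3 * A 3 x" and
    "c4 x = x2 x ^ 4 * A 0 x + 4 * x2 x ^ 3 * x3 x * A 1 x + 6 * (x2 x)\<^sup>2 * (x3 x)\<^sup>2 * A 2 x + 4 * x2 x * x3 x ^ 3 * A 3 x + x3 x ^ 4 * A 4 x - 9" for x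
  have s4: "sqrt 2 ^ 4 = (4::real)"
  proof -
    have "sqrt 2 ^ (2 * 2) = (((sqrt 2)\<^sup>2)\<^sup>2 :: real)" by (rule power_mult)
    then show ?thesis by simp
  qed
  have "(c0 \<longlongrightarrow> sqrt 2 ^ 4 * 3 - 12) F" unfolding c0_def[abs_def] by (intro tendsto_intros l1 lA)
  then have t0: "(c0 \<longlongrightarrow> 0) F" by (simp add: s4)
  have "(c1 \<longlongrightarrow> 4 * sqrt 2 ^ 3 * 0 * 3 + 4 * sqrt 2 ^ 3 * 1 * 0) F" unfolding c1_def[abs_def] by (intro tendsto_intros l1 lA)
  then have t1: "(c1 \<longlongrightarrow> 0) F" by simp
  have "(c2 \<longlongrightarrow> 6 * (sqrt 2)\<^sup>2 * 0\<^sup>2 * 3 + 12 * (sqrt 2)\<^sup>2 * 0 * 1 * 0 + 6 * (sqrt 2)\<^sup>2 * 1\<^sup>2 * 3 - 36) F"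
    unfolding c2_def[abs_def] by (intro tendsto_intros l1 lA)
  then have t2: "(c2 \<longlongrightarrow> 0) F" by simp
  have "(c3 \<longlongrightarrow> 4 * sqrt 2 * 0 ^ 3 * 3 + 12 * sqrt 2 * 0\<^sup>2 * 1 * 0 + 12 * sqrt 2 * 0 * 1\<^sup>2 * 3 + 4 * sqrt 2 * 1 ^ 3 * 0) F"
    unfolding c3_def[abs_def] by (intro tendsto_intros l1 lA)
  then have t3: "(c3 \<longlongrightarrow> 0) F" by simp
  have "(c4 \<longlongrightarrow> 0 ^ 4 * 3 + 4 * 0 ^ 3 * 1 * 0 + 6 * 0\<^sup>2 * 1\<^sup>2 * 3 + 4 * 0 * 1 ^ 3 * 0 + 1 ^ 4 * 9 - 9) F"
    unfolding c4_def[abs_def] by (intro tendsto_intros l1 lA)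
  then have t4: "(c4 \<longlongrightarrow> 0) F" by simp
  have "((\<lambda>x. \<bar>c0 x\<bar> + \<bar>c1 x\<bar> + \<bar>c2 x\<bar> + \<bar>c3 x\<bar> + \<bar>c4 x\<bar>) \<longlongrightarrow> \<bar>0\<bar> + \<bar>0\<bar> + \<bar>0\<bar> + \<bar>0\<bar> + \<bar>0\<bar>) F"
    by (intro tendsto_intros t0 t1 t2 t3 t4)
  from eventually_small[OF this \<open>e > 0\<close>] ev_ssd show ?thesis
  proof eventually_elim
    case (elim x)
    have v: "ssd x > 0" using elim by linarith
    show ?case
    proof (intro allI)
      fix \<alpha> \<beta>
      have z: "zed x \<alpha> \<beta> z = fst z * ((\<beta> * x1 x + \<alpha> * x2 x) + (\<alpha> * x3 x) * snd z)" for z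
        unfolding zed_def x1_def x2_def x3_def using v by (simp add: field_simps power2_eq_square)
      have "avg x (\<lambda>z. (zed x \<alpha> \<beta> z) ^ 4) - (12 * \<beta>^4 + 36 * (\<beta>\<^sup>2 * \<alpha>\<^sup>2) + 9 * \<alpha>^4)
         = c0 x * \<beta>^4 + c1 x * (\<beta>^3 * \<alpha>) + c2 x * (\<beta>\<^sup>2 * \<alpha>\<^sup>2) + c3 x * (\<beta> * \<alpha>^3) + c4 x * \<alpha>^4"
        unfolding z avg_zed_4 A_def[symmetric] c0_def c1_def c2_def c3_def c4_def by algebra
      also have "\<bar>\<dots>\<bar> \<le> (\<bar>c0 x\<bar> + \<bar>c1 x\<bar> + \<bar>c2 x\<bar> + \<bar>c3 x\<bar> + \<bar>c4 x\<bar>) * (q2 \<alpha> \<beta>)\<^sup>2"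
        by (rule quartic_form_bound)
      also have "\<dots> \<le> e * (q2 \<alpha> \<beta>)\<^sup>2" using elim(1) by (intro mult_right_mono) auto
      finally show "\<bar>avg x (\<lambda>z. (zed x \<alpha> \<beta> z) ^ 4) - (12 * \<beta>^4 + 36 * (\<beta>\<^sup>2 * \<alpha>\<^sup>2) + 9 * \<alpha>^4)\<bar> \<le> e * (q2 \<alpha> \<beta>)\<^sup>2" .
    qed
  qed
qed

lemma avg_zed_6: "eventually (\<lambda>x. \<forall>\<alpha> \<beta>. avg x (\<lambda>z. (zed x \<alpha> \<beta> z) ^ 6) \<le> C_six * (q2 \<alpha> \<beta>)^3) F"
proof -
  have v: "eventually (\<lambda>x. \<bar>svar x - 1\<bar> < 1/2) F" by (rule eventually_small[OF svar_lim]) simp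
  have m: "eventually (\<lambda>x. \<bar>smean x - 0\<bar> < 1/2) F" by (rule eventually_small[OF lims(5)]) simp
  have s: "eventually (\<lambda>x. \<bar>avg x f_six - EZ f_six\<bar> < 1) F" by (rule eventually_small[OF tendsto_avg[OF in_Fs(14)]]) simp
  from v m s ev_ssd show ?thesis
  proof eventually_elim
    case (elim x)
    have sv: "(ssd x)\<^sup>2 = svar x" "svar x \<ge> 1/2" using elim(1,4) ssd_sq[of x] by linarith+
    show ?case
    proof (intro allI)
      fix \<alpha> \<beta>
      have pt: "(zed x \<alpha> \<beta> z) ^ 6 \<le> 512 * (q2 \<alpha> \<beta>)^3 * f_six z" for z
      proof -
        define t where "t = (snd z - smean x) / ssd x"
        have t: "t\<^sup>2 \<le> 4 * (snd z)\<^sup>2 + 1"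
        proof -
          have "(snd z - smean x)\<^sup>2 \<le> 2 * (snd z)\<^sup>2 + 2 * (smean x)\<^sup>2"
            using zero_le_power2[of "snd z + smean x"] by (simp add: power2_diff power2_sum)
          moreover have "(smean x)\<^sup>2 \<le> (1/2)\<^sup>2" using elim(2) by (intro abs_le_square_iff[THEN iffD1]) auto
          ultimately have "(snd z - smean x)\<^sup>2 \<le> (4 * (snd z)\<^sup>2 + 1) * (1/2)" by (simp add: power_divide)
          also have "\<dots> \<le> (4 * (snd z)\<^sup>2 + 1) * svar x" using sv by (intro mult_left_mono) auto
          finally show ?thesis unfolding t_def power_divide sv(1) using sv(2) by (simp add: pos_divide_le_eq)
        qed
        have p: "(fst z / ssd x)\<^sup>2 \<le> 2 * (fst z)\<^sup>2"
        proof -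
          have "(fst z)\<^sup>2 * (1/2) \<le> (fst z)\<^sup>2 * svar x" using sv by (intro mult_left_mono) auto
          then show ?thesis unfolding power_divide sv(1) using sv(2) by (simp add: pos_divide_le_eq)
        qed
        \<comment> \<open>Lagrange's identity, that is Cauchy-Schwarz for the vectors
          \<open>(sqrt 2, t)\<close> and \<open>(\<beta>, \<alpha>)\<close>.\<close>
        have "(sqrt 2 * \<beta> + \<alpha> * t)\<^sup>2 + (sqrt 2 * \<alpha> - \<beta> * t)\<^sup>2 = (2 + t\<^sup>2) * q2 \<alpha> \<beta>"
          unfolding q2_def by (simp add: power2_sum power2_diff power_mult_distrib algebra_simps)
        then have "(sqrt 2 * \<beta> + \<alpha> * t)\<^sup>2 \<le> (2 + t\<^sup>2) * q2 \<alpha> \<beta>"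
          using zero_le_power2[of "sqrt 2 * \<alpha> - \<beta> * t"] by linarith
        also have "\<dots> \<le> (4 * (2 + (snd z)\<^sup>2)) * q2 \<alpha> \<beta>" using t by (intro mult_right_mono) auto
        finally have b: "(sqrt 2 * \<beta> + \<alpha> * t)\<^sup>2 \<le> (4 * (2 + (snd z)\<^sup>2)) * q2 \<alpha> \<beta>" .
        have "(zed x \<alpha> \<beta> z)\<^sup>2 = (fst z / ssd x)\<^sup>2 * (sqrt 2 * \<beta> + \<alpha> * t)\<^sup>2"
          unfolding zed_def t_def[symmetric] by (rule power_mult_distrib)
        also have "\<dots> \<le> 2 * (fst z)\<^sup>2 * ((4 * (2 + (snd z)\<^sup>2)) * q2 \<alpha> \<beta>)"
          using p b by (intro mult_mono) auto
        finally have "((zed x \<alpha> \<beta> z)\<^sup>2)^3 \<le> (2 * (fst z)\<^sup>2 * ((4 * (2 + (snd z)\<^sup>2)) * q2 \<alpha> \<beta>))^3"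
          by (rule power_mono) simp
        moreover have "(2 * p * ((4 * y) * q))^3 = 512 * q^3 * (p^3 * y^3)" for p y q :: real by algebra
        moreover have "((zed x \<alpha> \<beta> z)\<^sup>2)^3 = (zed x \<alpha> \<beta> z)^6" "((fst z)\<^sup>2)^3 = fst z ^ 6" by simp_all
        ultimately show ?thesis unfolding f_six_def by metis
      qed
      have "avg x (\<lambda>z. (zed x \<alpha> \<beta> z) ^ 6) \<le> avg x (\<lambda>z. 512 * (q2 \<alpha> \<beta>)^3 * f_six z)" by (rule avg_mono[OF pt])
      also have "\<dots> = 512 * (q2 \<alpha> \<beta>)^3 * avg x f_six" by (rule avg_cmult)
      also have "\<dots> \<le> 512 * (q2 \<alpha> \<beta>)^3 * (EZ f_six + 1)" using elim(3) by (intro mult_left_mono) auto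
      finally show "avg x (\<lambda>z. (zed x \<alpha> \<beta> z) ^ 6) \<le> C_six * (q2 \<alpha> \<beta>)^3" unfolding C_six_def by (simp only: mult_ac)
    qed
  qed
qed

definition WW :: "sample \<Rightarrow> real \<Rightarrow> real \<Rightarrow> real" where
  "WW x \<alpha> \<beta> = \<beta>\<^sup>2 * W1 x + \<alpha>\<^sup>2 * W2 x + 2 * \<alpha> * \<beta> * W3 x"

text \<open>The quartic part of \<open>qform\<close> at \<open>x = (\<beta>, \<alpha>)\<close>,
  since the square of \<open>2 * \<alpha> * \<beta>\<close> contributes
  \<open>4 * \<alpha>\<^sup>2 * \<beta>\<^sup>2\<close>.\<close>

definition quart :: "real \<Rightarrow> real \<Rightarrow> real" where
  "quart \<alpha> \<beta> = \<beta>^4 + \<alpha>^4 + 4 * (\<alpha>\<^sup>2 * \<beta>\<^sup>2)"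

lemma quart_ge: "(q2 \<alpha> \<beta>)\<^sup>2 \<le> quart \<alpha> \<beta>"
proof -
  have "quart \<alpha> \<beta> = (q2 \<alpha> \<beta>)\<^sup>2 + 2 * (\<alpha>\<^sup>2 * \<beta>\<^sup>2)" unfolding quart_def q2_def by algebra
  then show ?thesis by simp
qed

text \<open>Cruder than the quartic bound, but without remainder. It supplies the hypothesis of
  \<open>g_prof_curvature\<close> when the mean precision of a maximiser is localised.\<close>

lemma J_le_square: "eventually (\<lambda>x. \<forall>\<alpha> \<beta>. J x \<alpha> \<beta> \<le> \<beta>\<^sup>2 + \<alpha>\<^sup>2/2 + WW x \<alpha> \<beta> / rn x) F"
  using ev_ssd ev_n[of 1]
proof eventually_elim
  case (elim x)
  have v: "ssd x > 0" "fst x > 0" using elim by auto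
  show ?case
  proof (intro allI)
    fix \<alpha> \<beta>
    have "J x \<alpha> \<beta> \<le> avg x (\<lambda>z. 1/2 * (zed x \<alpha> \<beta> z)\<^sup>2)"
      unfolding J_def by (rule avg_mono) (use lncosh_le_square in simp)
    also have "\<dots> = 1/2 * avg x (\<lambda>z. (zed x \<alpha> \<beta> z)\<^sup>2)" by (rule avg_cmult)
    finally show "J x \<alpha> \<beta> \<le> \<beta>\<^sup>2 + \<alpha>\<^sup>2/2 + WW x \<alpha> \<beta> / rn x" unfolding avg_zed_2[OF v] WW_def[symmetric] by simp
  qed
qed

lemma H_upper:
  assumes "e > 0"
  shows "eventually (\<lambda>x. \<forall>\<alpha> \<beta> a. \<bar>\<alpha>\<bar> < a \<longrightarrow> q2 \<alpha> \<beta> \<le> 1 \<longrightarrow>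
    J x \<alpha> \<beta> - g_prof a \<alpha> \<beta> \<le> WW x \<alpha> \<beta> / rn x - quart \<alpha> \<beta> / 2 + e * (q2 \<alpha> \<beta>)\<^sup>2 + (C_six + 2) * (q2 \<alpha> \<beta>)^3) F"
  using J_upper_near[OF assms] avg_zed_6 ev_ssd ev_n[of 1]
proof eventually_elim
  case (elim x)
  have v: "ssd x > 0" "fst x > 0" using elim by auto
  show ?case
  proof (intro allI impI)
    fix \<alpha> \<beta> a :: real assume a: "\<bar>\<alpha>\<bar> < a" and q1: "q2 \<alpha> \<beta> \<le> 1"
    define q where "q = q2 \<alpha> \<beta>"
    have q: "0 \<le> q" "q \<le> 1" using q1 by (auto simp: q_def)
    have "J x \<alpha> \<beta> \<le> avg x (\<lambda>z. 1/2 * (zed x \<alpha> \<beta> z)\<^sup>2 - 1/12 * (zed x \<alpha> \<beta> z)^4 + 1/45 * (zed x \<alpha> \<beta> z)^6)"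
      unfolding J_def by (rule avg_mono) (use lncosh_le_sextic in simp)
    also have "\<dots> = 1/2 * avg x (\<lambda>z. (zed x \<alpha> \<beta> z)\<^sup>2) - 1/12 * avg x (\<lambda>z. (zed x \<alpha> \<beta> z)^4) + 1/45 * avg x (\<lambda>z. (zed x \<alpha> \<beta> z)^6)"
      unfolding avg_add avg_diff avg_cmult ..
    finally have 1: "J x \<alpha> \<beta> \<le> 1/2 * avg x (\<lambda>z. (zed x \<alpha> \<beta> z)\<^sup>2) - 1/12 * avg x (\<lambda>z. (zed x \<alpha> \<beta> z)^4) + 1/45 * avg x (\<lambda>z. (zed x \<alpha> \<beta> z)^6)" .
    have 2: "1/2 * avg x (\<lambda>z. (zed x \<alpha> \<beta> z)\<^sup>2) = \<beta>\<^sup>2 + \<alpha>\<^sup>2/2 + WW x \<alpha> \<beta> / rn x"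
      unfolding avg_zed_2[OF v] WW_def[symmetric] by simp
    have 3: "avg x (\<lambda>z. (zed x \<alpha> \<beta> z)^4) \<ge> 12 * \<beta>^4 + 36 * (\<beta>\<^sup>2 * \<alpha>\<^sup>2) + 9 * \<alpha>^4 - e * q\<^sup>2"
      using abs_le_D2[OF elim(1)[rule_format, of \<alpha> \<beta>]] unfolding q_def by linarith
    have 4: "avg x (\<lambda>z. (zed x \<alpha> \<beta> z)^6) \<le> C_six * q^3" using elim(2) unfolding q_def by blast
    have 5: "g_prof a \<alpha> \<beta> \<ge> \<beta>\<^sup>2 + \<alpha>\<^sup>2/2 + \<alpha>^4/4 - (q + \<alpha>^4)\<^sup>2/2"
      using g_prof_lower[OF a, of \<beta>] unfolding q_def q2_def .
    have 6: "(q + \<alpha>^4)\<^sup>2/2 \<le> q\<^sup>2/2 + 2 * q^3"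
    proof -
      have "\<alpha>\<^sup>2 \<le> q" by (simp add: q_def q2_def)
      then have "(\<alpha>\<^sup>2)\<^sup>2 \<le> q\<^sup>2" by (intro power_mono) auto
      then have a4: "\<alpha>^4 \<le> q\<^sup>2" by simp
      have "(q + \<alpha>^4)\<^sup>2 \<le> (q + q\<^sup>2)\<^sup>2" using a4 q by (intro power_mono) auto
      also have "\<dots> = q\<^sup>2 + 2 * q^3 + q * q^3" by algebra
      also have "\<dots> \<le> q\<^sup>2 + 2 * q^3 + 1 * q^3" using q by (intro add_left_mono mult_right_mono) auto
      finally have "(q + \<alpha>^4)\<^sup>2 \<le> q\<^sup>2 + 3 * q^3" by simp
      moreover have "0 \<le> q^3" using q by simp
      ultimately show ?thesis by linarith
    qed
    \<comment> \<open>Balance at degree four: the gain from optimising \<open>a\<close>, minus a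
      twelfth of the Gaussian fourth moment, minus the quartic term of
      \<open>g_prof\<close>.\<close>
    have 7: "q\<^sup>2/2 - (\<beta>^4 + 3 * (\<beta>\<^sup>2 * \<alpha>\<^sup>2) + 3/4 * \<alpha>^4) - \<alpha>^4/4 = - quart \<alpha> \<beta> / 2"
      unfolding q_def q2_def quart_def by (simp add: power2_sum field_simps)
    have 8: "1/45 * (C_six * q^3) \<le> C_six * q^3"
      using C_six_nonneg q by simp
    have 9: "1/12 * (e * q\<^sup>2) \<le> e * q\<^sup>2" using assms by simp
    have "J x \<alpha> \<beta> - g_prof a \<alpha> \<beta> \<le> WW x \<alpha> \<beta> / rn x - quart \<alpha> \<beta> / 2 + e * q\<^sup>2 + (C_six * q^3 + 2 * q^3)"
      using 1 2 3 4 5 6 7 8 9 by linarith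
    then show "J x \<alpha> \<beta> - g_prof a \<alpha> \<beta> \<le> WW x \<alpha> \<beta> / rn x - quart \<alpha> \<beta> / 2 + e * (q2 \<alpha> \<beta>)\<^sup>2 + (C_six + 2) * (q2 \<alpha> \<beta>)^3"
      unfolding q_def by (simp add: distrib_right)
  qed
qed

text \<open>One value of \<open>a\<close> per \<open>(\<alpha>, \<beta>)\<close> is enough, because
  the bound is only used from below on a maximum. The near-optimal \<open>a\<close> makes it match
  \<open>H_upper\<close> at degree four.\<close>

lemma H_lower:
  assumes "e > 0"
  shows "eventually (\<lambda>x. \<forall>\<alpha> \<beta>. q2 \<alpha> \<beta> \<le> 1/2 \<longrightarrow>
    WW x \<alpha> \<beta> / rn x - quart \<alpha> \<beta> / 2 - e * (q2 \<alpha> \<beta>)\<^sup>2 - 3 * (q2 \<alpha> \<beta>)^3 \<le> J x \<alpha> \<beta> - g_prof (1 + \<alpha>\<^sup>2 + \<beta>\<^sup>2) \<alpha> \<beta>) F"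
  using J_upper_near[OF assms] ev_ssd ev_n[of 1]
proof eventually_elim
  case (elim x)
  have v: "ssd x > 0" "fst x > 0" using elim by auto
  show ?case
  proof (intro allI impI)
    fix \<alpha> \<beta> :: real assume q1: "q2 \<alpha> \<beta> \<le> 1/2"
    define q where "q = q2 \<alpha> \<beta>"
    have "avg x (\<lambda>z. 1/2 * (zed x \<alpha> \<beta> z)\<^sup>2 - 1/12 * (zed x \<alpha> \<beta> z)^4) \<le> J x \<alpha> \<beta>"
      unfolding J_def by (rule avg_mono) (use lncosh_ge_quartic in simp)
    then have 1: "J x \<alpha> \<beta> \<ge> 1/2 * avg x (\<lambda>z. (zed x \<alpha> \<beta> z)\<^sup>2) - 1/12 * avg x (\<lambda>z. (zed x \<alpha> \<beta> z)^4)"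
      unfolding avg_diff avg_cmult .
    have 2: "1/2 * avg x (\<lambda>z. (zed x \<alpha> \<beta> z)\<^sup>2) = \<beta>\<^sup>2 + \<alpha>\<^sup>2/2 + WW x \<alpha> \<beta> / rn x"
      unfolding avg_zed_2[OF v] WW_def[symmetric] by simp
    have 3: "avg x (\<lambda>z. (zed x \<alpha> \<beta> z)^4) \<le> 12 * \<beta>^4 + 36 * (\<beta>\<^sup>2 * \<alpha>\<^sup>2) + 9 * \<alpha>^4 + e * q\<^sup>2"
      using abs_le_D1[OF elim(1)[rule_format, of \<alpha> \<beta>]] unfolding q_def by linarith
    have 5: "g_prof (1 + \<alpha>\<^sup>2 + \<beta>\<^sup>2) \<alpha> \<beta> \<le> \<beta>\<^sup>2 + \<alpha>\<^sup>2/2 + \<alpha>^4/4 - q\<^sup>2/2 + 3 * q^3"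
      using g_prof_upper(1)[of \<alpha> \<beta>] q1 unfolding q_def q2_def by simp
    have 7: "q\<^sup>2/2 - (\<beta>^4 + 3 * (\<beta>\<^sup>2 * \<alpha>\<^sup>2) + 3/4 * \<alpha>^4) - \<alpha>^4/4 = - quart \<alpha> \<beta> / 2"
      unfolding q_def q2_def quart_def by (simp add: power2_sum field_simps)
    have 9: "1/12 * (e * q\<^sup>2) \<le> e * q\<^sup>2" using assms by simp
    show "WW x \<alpha> \<beta> / rn x - quart \<alpha> \<beta> / 2 - e * (q2 \<alpha> \<beta>)\<^sup>2 - 3 * (q2 \<alpha> \<beta>)^3 \<le> J x \<alpha> \<beta> - g_prof (1 + \<alpha>\<^sup>2 + \<beta>\<^sup>2) \<alpha> \<beta>"
      using 1 2 3 5 7 9 unfolding q_def[symmetric] by linarith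
  qed
qed

text \<open>With \<open>R\<^sup>2 = \<alpha>\<^sup>2 + 2 * \<beta>\<^sup>2\<close> the average is at
  most \<open>84/100 * R\<close>, whereas \<open>g_prof\<close> is at least
  \<open>9/10 * R - 5\<close>. For \<open>R > 100\<close> the difference in slopes outweighs 5, and
  \<open>q2 \<alpha> \<beta> \<ge> 10001\<close> ensures this strictly.\<close>

lemma J_far: "eventually (\<lambda>x. \<forall>\<alpha> \<beta> a. q2 \<alpha> \<beta> \<ge> 10001 \<longrightarrow> \<bar>\<alpha>\<bar> < a \<longrightarrow> J x \<alpha> \<beta> < g_prof a \<alpha> \<beta>) F"
proof -
  define B0 B1 B2 where "B0 x = avg x (amon 0) / ssd x" and
    "B1 x = (avg x (amon 1) - smean x * avg x (amon 0)) / (ssd x)\<^sup>2" and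
    "B2 x = (avg x (amon 2) - 2 * smean x * avg x (amon 1) + (smean x)\<^sup>2 * avg x (amon 0)) / (ssd x)^3" for x
  have small: "eventually (\<lambda>x. B x \<le> l + 1/100 \<and> - B x \<le> - l + 1/100) F" if "(B \<longlongrightarrow> l) F" for B and l :: real
  proof -
    have "eventually (\<lambda>x. \<bar>B x - l\<bar> < 1/100) F" by (rule eventually_small[OF that]) simp
    then show ?thesis by (rule eventually_mono) (unfold abs_less_iff, intro conjI; elim conjE; linarith)
  qed
  have "(B0 \<longlongrightarrow> EZ (amon 0) / 1) F" unfolding B0_def[abs_def] by (intro tendsto_intros lims ssd_lim) auto
  from small[OF this] have b0: "eventually (\<lambda>x. B0 x \<le> 83/100) F"
    by (rule eventually_mono) (use EZ_amon(1) in simp)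
  have "(B1 \<longlongrightarrow> (0 - 0 * EZ (amon 0)) / 1\<^sup>2) F" unfolding B1_def[abs_def] by (intro tendsto_intros lims ssd_lim) auto
  from small[OF this] have b1: "eventually (\<lambda>x. \<bar>B1 x\<bar> \<le> 1/100) F"
    by (rule eventually_mono) (auto simp: abs_le_iff)
  have "(B2 \<longlongrightarrow> (EZ (amon 0) - 2 * 0 * 0 + 0\<^sup>2 * EZ (amon 0)) / 1^3) F" unfolding B2_def[abs_def] by (intro tendsto_intros lims ssd_lim) auto
  from small[OF this] have b2: "eventually (\<lambda>x. B2 x \<le> 83/100) F"
    by (rule eventually_mono) (use EZ_amon(1) in simp)
  from b0 b1 b2 ev_ssd show ?thesis
  proof eventually_elim
    case (elim x)
    have v: "ssd x > 0" using elim by linarith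
    show ?case
    proof (intro allI impI)
      fix \<alpha> \<beta> a :: real assume q: "q2 \<alpha> \<beta> \<ge> 10001" and a: "\<bar>\<alpha>\<bar> < a"
      define R where "R = sqrt (\<alpha>\<^sup>2 + 2 * \<beta>\<^sup>2)"
      have R2: "R\<^sup>2 = \<alpha>\<^sup>2 + 2 * \<beta>\<^sup>2" unfolding R_def by simp
      have "10000 < \<alpha>\<^sup>2 + 2 * \<beta>\<^sup>2"
        using q zero_le_power2[of \<beta>] unfolding q2_def by linarith
      then have R: "R > 100" unfolding R_def by (intro real_less_rsqrt) simp
      define c where "c z = sqrt 2 * \<beta> + \<alpha> * ((snd z - smean x) / ssd x)" for z :: "real \<times> real"
      \<comment> \<open>The inequality \<open>\<bar>c\<bar> \<le> R/2 + c\<^sup>2/(2*R)\<close>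
        replaces a modulus depending on the parameters by a polynomial. Only three averages, uniform
        in the parameters, are then needed; \<open>R\<^sup>2\<close> is the Gaussian second moment
        of \<open>c\<close>, so the bound has the right order.\<close>
      have pt: "lncosh (zed x \<alpha> \<beta> z) \<le> R / 2 * (amon 0 z / ssd x) + 1 / (2 * R) * (amon 0 z / ssd x * (c z)\<^sup>2)" for z
      proof -
        have "lncosh (zed x \<alpha> \<beta> z) \<le> \<bar>fst z\<bar> / ssd x * \<bar>c z\<bar>"
          using lncosh_le_abs[of "zed x \<alpha> \<beta> z"] v unfolding zed_def c_def[symmetric] by (simp add: abs_mult)
        also have "\<bar>fst z\<bar> / ssd x * \<bar>c z\<bar> \<le> \<bar>fst z\<bar> / ssd x * (R / 2 + (c z)\<^sup>2 / (2 * R))"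
        proof (rule mult_left_mono)
          have "0 \<le> (R - \<bar>c z\<bar>)\<^sup>2" by simp
          then have "2 * (R * \<bar>c z\<bar>) \<le> R * R + (c z)\<^sup>2" unfolding power2_diff power2_abs by (simp add: power2_eq_square[of R] mult.assoc)
          then have "2 * \<bar>c z\<bar> \<le> (R * R + (c z)\<^sup>2) / R" using R by (simp add: pos_le_divide_eq mult_ac)
          then show "\<bar>c z\<bar> \<le> R / 2 + (c z)\<^sup>2 / (2 * R)" using R by (simp add: add_divide_distrib)
        qed (use v in simp)
        finally show ?thesis by (simp add: amon_def algebra_simps)
      qed
      have cz: "amon 0 z / ssd x * (c z)\<^sup>2 = (2 * \<beta>\<^sup>2 / ssd x - 2 * sqrt 2 * \<alpha> * \<beta> * smean x / (ssd x)\<^sup>2 + \<alpha>\<^sup>2 * (smean x)\<^sup>2 / (ssd x)^3) * amon 0 z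
          + (2 * sqrt 2 * \<alpha> * \<beta> / (ssd x)\<^sup>2 - 2 * \<alpha>\<^sup>2 * smean x / (ssd x)^3) * amon 1 z + \<alpha>\<^sup>2 / (ssd x)^3 * amon 2 z" for z
        unfolding c_def amon_def using v
        by (simp add: power2_sum power_mult_distrib power_divide power2_diff)
           (simp add: field_simps power2_eq_square power3_eq_cube)
      have av: "avg x (\<lambda>z. amon 0 z / ssd x * (c z)\<^sup>2) = 2 * \<beta>\<^sup>2 * B0 x + 2 * sqrt 2 * \<alpha> * \<beta> * B1 x + \<alpha>\<^sup>2 * B2 x"
        unfolding cz avg_add avg_cmult B0_def B1_def B2_def using v by (simp add: field_simps power2_eq_square power3_eq_cube)
      have av0: "avg x (\<lambda>z. amon 0 z / ssd x) = B0 x"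
        using avg_cmult[of x "1 / ssd x" "amon 0"] by (simp add: B0_def)
      have "J x \<alpha> \<beta> \<le> R / 2 * B0 x + 1 / (2 * R) * (2 * \<beta>\<^sup>2 * B0 x + 2 * sqrt 2 * \<alpha> * \<beta> * B1 x + \<alpha>\<^sup>2 * B2 x)"
        using avg_mono[of "\<lambda>z. lncosh (zed x \<alpha> \<beta> z)", OF pt, of x] unfolding avg_add avg_cmult av av0 J_def .
      also have "\<dots> \<le> R / 2 * (83/100) + 1 / (2 * R) * (84/100 * R\<^sup>2)"
      proof (intro add_mono mult_left_mono)
        have "2 * sqrt 2 * \<alpha> * \<beta> * B1 x \<le> \<bar>2 * sqrt 2 * \<alpha> * \<beta>\<bar> * (1/100)"
          using mult_left_mono[OF elim(2), of "\<bar>2 * sqrt 2 * \<alpha> * \<beta>\<bar>"] by (simp add: abs_mult[symmetric])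
        moreover have "\<bar>2 * sqrt 2 * \<alpha> * \<beta>\<bar> \<le> R\<^sup>2"
        proof -
          have "0 \<le> (\<bar>\<alpha>\<bar> - sqrt 2 * \<bar>\<beta>\<bar>)\<^sup>2" by simp
          then show ?thesis unfolding R2 by (simp add: power2_diff power_mult_distrib abs_mult algebra_simps)
        qed
        moreover have "2 * \<beta>\<^sup>2 * B0 x \<le> 2 * \<beta>\<^sup>2 * (83/100)" using elim(1) by (intro mult_left_mono) auto
        moreover have "\<alpha>\<^sup>2 * B2 x \<le> \<alpha>\<^sup>2 * (83/100)" using elim(3) by (intro mult_left_mono) auto
        ultimately show "2 * \<beta>\<^sup>2 * B0 x + 2 * sqrt 2 * \<alpha> * \<beta> * B1 x + \<alpha>\<^sup>2 * B2 x \<le> 84/100 * R\<^sup>2"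
          using R2 by linarith
      qed (use elim R in auto)
      also have "1 / (2 * R) * (84/100 * R\<^sup>2) = 42/100 * R" using R by (simp add: power2_eq_square)
      finally have "J x \<alpha> \<beta> \<le> 84/100 * R" using R by linarith
      moreover have "g_prof a \<alpha> \<beta> \<ge> 9/10 * R - 5" using g_prof_ge_linear(2)[OF a] unfolding R_def .
      ultimately show "J x \<alpha> \<beta> < g_prof a \<alpha> \<beta>" using R by linarith
    qed
  qed
qed

end

subsection \<open>Localisation and limit of the maximal likelihood ratio\<close>

definition qform :: "real \<times> real \<times> real \<Rightarrow> real \<times> real \<Rightarrow> real" where
  "qform w x = (case w of (w1, w2, w3) \<Rightarrow> case x of (x1, x2) \<Rightarrow>
     2 * (x1\<^sup>2 * w1 + x2\<^sup>2 * w2 + 2 * x1 * x2 * w3) - ((x1\<^sup>2)\<^sup>2 + (x2\<^sup>2)\<^sup>2 + (2 * x1 * x2)\<^sup>2))"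

text \<open>The flag \<open>eq\<close> selects the submodel with equal standard deviations, in which \<open>\<alpha> = 0\<close>.\<close>

definition cone :: "bool \<Rightarrow> (real \<times> real) set" where
  "cone eq = {x. eq \<longrightarrow> snd x = 0}"

definition Rlim :: "bool \<Rightarrow> real \<times> real \<times> real \<Rightarrow> real" where
  "Rlim eq w = (SUP x\<in>cone eq. qform w x)"

lemma R_stat_eq: "R_stat = Rlim False"
  by (auto simp: fun_eq_iff R_stat_def Rlim_def qform_def cone_def)

text \<open>The form is the squared norm of \<open>w\<close> minus the squared distance from
  \<open>w\<close> to \<open>(x1\<^sup>2, x2\<^sup>2, 2 * x1 * x2)\<close>.\<close>

lemma qform_le: "qform (w1, w2, w3) x \<le> w1\<^sup>2 + w2\<^sup>2 + w3\<^sup>2"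
proof -
  obtain x1 x2 where x: "x = (x1, x2)" by (cases x)
  have "w1\<^sup>2 + w2\<^sup>2 + w3\<^sup>2 - qform (w1, w2, w3) x = (w1 - x1\<^sup>2)\<^sup>2 + (w2 - x2\<^sup>2)\<^sup>2 + (w3 - 2 * x1 * x2)\<^sup>2"
    unfolding x qform_def prod.case by algebra
  moreover have "0 \<le> (w1 - x1\<^sup>2)\<^sup>2 + (w2 - x2\<^sup>2)\<^sup>2 + (w3 - 2 * x1 * x2)\<^sup>2" by simp
  ultimately show ?thesis by linarith
qed

lemma qform_bdd: "bdd_above (qform w ` S)"
  by (cases w) (auto intro!: bdd_aboveI2 qform_le)

lemma zero_in_cone: "(0, 0) \<in> cone eq" by (simp add: cone_def)

lemma qform_le_Rlim: "x \<in> cone eq \<Longrightarrow> qform w x \<le> Rlim eq w"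
  unfolding Rlim_def by (rule cSUP_upper[OF _ qform_bdd])

lemma Rlim_nonneg: "0 \<le> Rlim eq w"
  using qform_le_Rlim[OF zero_in_cone, of w eq] by (cases w) (simp add: qform_def)

lemma Rlim_leI: "(\<And>x. x \<in> cone eq \<Longrightarrow> qform w x \<le> B) \<Longrightarrow> Rlim eq w \<le> B"
  unfolding Rlim_def by (rule cSUP_least) (use zero_in_cone in auto)

lemma abs_two_mult_le: "\<bar>2 * x1 * x2\<bar> \<le> x1\<^sup>2 + (x2::real)\<^sup>2"
proof -
  have "0 \<le> (\<bar>x1\<bar> - \<bar>x2\<bar>)\<^sup>2" by simp
  then show ?thesis by (simp add: power2_diff abs_mult)
qed

lemma lin_form_bound:
  fixes w1 w2 w3 x1 x2 :: real
  assumes "\<bar>w1\<bar> \<le> K" "\<bar>w2\<bar> \<le> K" "\<bar>w3\<bar> \<le> K"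
  shows "\<bar>x1\<^sup>2 * w1 + x2\<^sup>2 * w2 + 2 * x1 * x2 * w3\<bar> \<le> 2 * K * (x1\<^sup>2 + x2\<^sup>2)"
proof -
  have "\<bar>x1\<^sup>2 * w1\<bar> \<le> x1\<^sup>2 * K" "\<bar>x2\<^sup>2 * w2\<bar> \<le> x2\<^sup>2 * K"
    using assms by (auto simp: abs_mult intro!: mult_left_mono)
  moreover have "\<bar>2 * x1 * x2 * w3\<bar> \<le> (x1\<^sup>2 + x2\<^sup>2) * K"
    unfolding abs_mult[of "2 * x1 * x2"] using assms abs_two_mult_le by (intro mult_mono) auto
  ultimately have "\<bar>x1\<^sup>2 * w1 + x2\<^sup>2 * w2 + 2 * x1 * x2 * w3\<bar> \<le> x1\<^sup>2 * K + x2\<^sup>2 * K + (x1\<^sup>2 + x2\<^sup>2) * K"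
    by linarith
  then show ?thesis by (simp add: algebra_simps)
qed

lemma quartic_sum_ge: "(x1\<^sup>2 + x2\<^sup>2)\<^sup>2 \<le> (x1\<^sup>2)\<^sup>2 + (x2\<^sup>2)\<^sup>2 + (2 * x1 * x2 :: real)\<^sup>2"
proof -
  have "(x1\<^sup>2)\<^sup>2 + (x2\<^sup>2)\<^sup>2 + (2 * x1 * x2)\<^sup>2 = (x1\<^sup>2 + x2\<^sup>2)\<^sup>2 + 2 * (x1 * x2)\<^sup>2" by algebra
  then show ?thesis by simp
qed

text \<open>The quartic part dominates the quadratic one, so points that can compete with the origin
  stay in a ball. This makes the supremum locally Lipschitz in \<open>w\<close> and gives compact
  control in \<open>lower_value\<close>.\<close>

lemma qform_nonneg_bound:
  assumes "\<bar>w1\<bar> \<le> K" "\<bar>w2\<bar> \<le> K" "\<bar>w3\<bar> \<le> K" "0 \<le> qform (w1, w2, w3) (x1, x2)"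
  shows "x1\<^sup>2 + x2\<^sup>2 \<le> 4 * K"
proof -
  define t where "t = x1\<^sup>2 + x2\<^sup>2"
  have t: "t \<ge> 0" by (simp add: t_def)
  have K: "K \<ge> 0" using assms(1) by linarith
  have "t\<^sup>2 \<le> 2 * (x1\<^sup>2 * w1 + x2\<^sup>2 * w2 + 2 * x1 * x2 * w3)"
    using assms(4) quartic_sum_ge[of x1 x2] unfolding qform_def t_def by simp
  also have "\<dots> \<le> 2 * (2 * K * t)"
    unfolding t_def by (rule mult_left_mono[OF abs_le_D1[OF lin_form_bound[OF assms(1-3), of x1 x2]]]) simp
  finally have "t * t \<le> (4 * K) * t" by (simp add: power2_eq_square)
  then show ?thesis
  proof (cases "t = 0")
    case False
    then show ?thesis using \<open>t * t \<le> (4 * K) * t\<close> t unfolding t_def[symmetric] by (simp add: mult_le_cancel_right)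
  qed (use K t_def in auto)
qed

lemma Rlim_close:
  assumes "\<bar>w1\<bar> \<le> K" "\<bar>w2\<bar> \<le> K" "\<bar>w3\<bar> \<le> K" "\<bar>w1 - v1\<bar> \<le> d" "\<bar>w2 - v2\<bar> \<le> d" "\<bar>w3 - v3\<bar> \<le> d"
  shows "Rlim eq (w1, w2, w3) \<le> Rlim eq (v1, v2, v3) + 16 * K * d"
proof (rule Rlim_leI)
  have K: "K \<ge> 0" and d: "d \<ge> 0" using assms(1,4) by linarith+
  fix x assume x: "x \<in> cone eq"
  obtain x1 x2 where x12: "x = (x1, x2)" by (cases x)
  show "qform (w1, w2, w3) x \<le> Rlim eq (v1, v2, v3) + 16 * K * d"
  proof (cases "qform (w1, w2, w3) x \<ge> 0")
    case False
    have "0 \<le> 16 * K * d" using K d by simp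
    then show ?thesis using False Rlim_nonneg[of eq "(v1, v2, v3)"] by linarith
  next
    case True
    then have t: "x1\<^sup>2 + x2\<^sup>2 \<le> 4 * K" using qform_nonneg_bound[OF assms(1-3)] unfolding x12 by blast
    have "qform (w1, w2, w3) x - qform (v1, v2, v3) x
        = 2 * (x1\<^sup>2 * (w1 - v1) + x2\<^sup>2 * (w2 - v2) + 2 * x1 * x2 * (w3 - v3))"
      unfolding x12 qform_def by (simp add: algebra_simps)
    also have "\<dots> \<le> 2 * (2 * d * (x1\<^sup>2 + x2\<^sup>2))"
      by (rule mult_left_mono[OF abs_le_D1[OF lin_form_bound[OF assms(4-6), of x1 x2]]]) simp
    also have "\<dots> \<le> 2 * (2 * d * (4 * K))" using t d by (intro mult_left_mono) auto
    also have "\<dots> = 16 * K * d" by simp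
    finally show ?thesis using qform_le_Rlim[OF x, of "(v1, v2, v3)"] by linarith
  qed
qed

section \<open>The likelihood ratio per observation in the new parameters\<close>

definition par_set :: "bool \<Rightarrow> (real \<times> real \<times> real \<times> real) set" where
  "par_set eq = {(a1, a2, u1, u2). 0 < a1 \<and> 0 < a2 \<and> (eq \<longrightarrow> a1 = a2)}"

definition Hs :: "sample \<Rightarrow> real \<times> real \<times> real \<times> real \<Rightarrow> real" where
  "Hs x p = (case p of (a1, a2, u1, u2) \<Rightarrow> J x ((a2 - a1) / 2) ((a1 * u1 - a2 * u2) / 2) - g_full a1 a2 u1 u2)"

lemma Hs_le_profile:
  fixes a1 a2 u1 u2 :: real
  assumes "0 < a1" "0 < a2"
  defines "a \<equiv> (a1 + a2) / 2" and "\<alpha> \<equiv> (a2 - a1) / 2" and "\<beta> \<equiv> (a1 * u1 - a2 * u2) / 2"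
  shows "Hs x (a1, a2, u1, u2) = J x \<alpha> \<beta> - g_prof a \<alpha> \<beta> - a1 * a2 * (u1 + u2)\<^sup>2 / (2 * (a1 + a2))" "\<bar>\<alpha>\<bar> < a"
  unfolding Hs_def using g_full_eq[OF assms(1,2), of u1 u2] assms(1,2) by (auto simp: a_def \<alpha>_def \<beta>_def)

text \<open>The means \<open>\<beta>/a\<close> and \<open>-\<beta>/a\<close> reproduce
  \<open>\<beta>\<close> and have sum zero, so the penalty of \<open>g_full_eq\<close> is
  absent.\<close>

lemma Hs_profile:
  assumes "\<bar>\<alpha>\<bar> < a"
  shows "Hs x (a - \<alpha>, a + \<alpha>, \<beta> / a, - \<beta> / a) = J x \<alpha> \<beta> - g_prof a \<alpha> \<beta>"
    "eq \<longrightarrow> \<alpha> = 0 \<Longrightarrow> (a - \<alpha>, a + \<alpha>, \<beta> / a, - \<beta> / a) \<in> par_set eq"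
proof -
  have p: "0 < a - \<alpha>" "0 < a + \<alpha>" "a \<noteq> 0" using assms by linarith+
  have e: "(a - \<alpha> + (a + \<alpha>)) / 2 = a" "(a + \<alpha> - (a - \<alpha>)) / 2 = \<alpha>"
    "((a - \<alpha>) * (\<beta> / a) - (a + \<alpha>) * (- \<beta> / a)) / 2 = \<beta>"
    using p by (simp_all add: field_simps)
  show "Hs x (a - \<alpha>, a + \<alpha>, \<beta> / a, - \<beta> / a) = J x \<alpha> \<beta> - g_prof a \<alpha> \<beta>"
    unfolding Hs_le_profile(1)[OF p(1,2)] e by simp
  show "eq \<longrightarrow> \<alpha> = 0 \<Longrightarrow> (a - \<alpha>, a + \<alpha>, \<beta> / a, - \<beta> / a) \<in> par_set eq"
    using p by (auto simp: par_set_def)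
qed

lemma Hs_null: "Hs x (1, 1, 0, 0) = 0" "(1, 1, 0, 0) \<in> par_set eq"
  by (simp_all add: Hs_def J_def zed_def g_full_def par_set_def avg_def)

lemma scaling_identities:
  fixes r :: real
  assumes "r > 0"
  shows "2 * r\<^sup>2 * (w / r - Q / 2 + e * q\<^sup>2 + c * q^3)
      = 2 * r * w - r\<^sup>2 * Q + 2 * e * (r * q)\<^sup>2 + 2 * c * (r * q)^3 * (1 / r)"
    "2 * r\<^sup>2 * (w / r - Q / 2 - e * q\<^sup>2 - c * q^3)
      = 2 * r * w - r\<^sup>2 * Q - 2 * e * (r * q)\<^sup>2 - 2 * c * (r * q)^3 * (1 / r)"
    "r\<^sup>2 * (16 * q\<^sup>2 + 8 * (2 * k * q / r)) = 16 * (r * q)\<^sup>2 + 16 * k * (r * q)"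
    "2 * k * q / r = 2 * k * (r * q) * (1 / r)\<^sup>2"
  using assms by (simp_all add: field_simps power2_eq_square power3_eq_cube)

text \<open>A finite net in the intermediate region keeps \<open>Fs\<close> finite, so that a union
  bound can control it. The radius 10001 is where \<open>J_far\<close> takes over, and
  \<open>\<epsilon>\<close> is tuned to the gap \<open>\<eta>\<close>.\<close>

locale net_filter = data_filter +
  fixes \<eta> \<epsilon> :: real
  assumes gap: "\<And>\<alpha> \<beta> a. \<delta>_loc \<le> q2 \<alpha> \<beta> \<Longrightarrow> q2 \<alpha> \<beta> \<le> 10001 \<Longrightarrow> \<bar>\<alpha>\<bar> < a \<Longrightarrow> L_pop \<alpha> \<beta> + \<eta> \<le> g_prof a \<alpha> \<beta>"
    and eps: "\<epsilon> > 0" "\<epsilon> * (4 * (EZ f_lip + 1)) \<le> \<eta>"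
    and net: "\<And>\<alpha> \<beta>. q2 \<alpha> \<beta> \<le> 10001 \<Longrightarrow> \<exists>\<alpha>0 \<beta>0. f_lnc \<alpha>0 \<beta>0 \<in> Fs \<and> \<bar>\<alpha> - \<alpha>0\<bar> + \<bar>\<beta> - \<beta>0\<bar> \<le> \<epsilon>"
begin

text \<open>Error budget: restandardising moves the parameters by at most \<open>\<epsilon>\<close>,
  the nearest net point is within another \<open>\<epsilon>\<close>, and its average is within
  \<open>\<epsilon>\<close> of the expectation. With the way back to
  \<open>L_pop \<alpha> \<beta>\<close> the total is
  \<open>3 * (\<epsilon> * (EZ f_lip + 1))\<close>, strictly below the gap. The factor 101 works
  because its square exceeds 10001.\<close>

lemma J_mid: "eventually (\<lambda>x. \<forall>\<alpha> \<beta> a. \<delta>_loc \<le> q2 \<alpha> \<beta> \<longrightarrow> q2 \<alpha> \<beta> \<le> 10001 \<longrightarrow> \<bar>\<alpha>\<bar> < a \<longrightarrow> J x \<alpha> \<beta> < g_prof a \<alpha> \<beta>) F"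
proof -
  define c where "c x = \<bar>1 / (ssd x)\<^sup>2 - 1\<bar> + (\<bar>1 / ssd x - 1\<bar> + \<bar>smean x / (sqrt 2 * (ssd x)\<^sup>2)\<bar>)" for x
  have "(c \<longlongrightarrow> \<bar>1 / 1\<^sup>2 - 1\<bar> + (\<bar>1 / 1 - 1\<bar> + \<bar>0 / (sqrt 2 * 1\<^sup>2)\<bar>)) F"
    unfolding c_def[abs_def] by (intro tendsto_intros ssd_lim lims) auto
  then have "(c \<longlongrightarrow> 0) F" by simp
  then have "eventually (\<lambda>x. \<bar>c x - 0\<bar> < \<epsilon> / 101) F" by (rule eventually_small) (use eps in simp)
  moreover have "eventually (\<lambda>x. \<bar>avg x f_lip - EZ f_lip\<bar> < 1) F"
    by (rule eventually_small[OF tendsto_avg[OF in_Fs(15)]]) simp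
  ultimately show ?thesis using ev_ssd ev_close[OF eps(1)]
  proof eventually_elim
    case (elim x)
    have v: "ssd x > 0" using elim by linarith
    show ?case
    proof (intro allI impI)
      fix \<alpha> \<beta> a :: real assume q: "\<delta>_loc \<le> q2 \<alpha> \<beta>" "q2 \<alpha> \<beta> \<le> 10001" and a: "\<bar>\<alpha>\<bar> < a"
      define \<alpha>' \<beta>' where "\<alpha>' = \<alpha> / (ssd x)\<^sup>2" and "\<beta>' = \<beta> / ssd x - \<alpha> * smean x / (sqrt 2 * (ssd x)\<^sup>2)"
      have "sqrt (q2 \<alpha> \<beta>) \<le> sqrt (101\<^sup>2)" using q by (subst real_sqrt_le_iff) simp
      then have ab: "\<bar>\<alpha>\<bar> \<le> 101" "\<bar>\<beta>\<bar> \<le> 101" using abs_le_sqrt_q2[where \<alpha>=\<alpha> and \<beta>=\<beta>] by auto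
      have d: "\<bar>\<alpha>' - \<alpha>\<bar> + \<bar>\<beta>' - \<beta>\<bar> \<le> \<epsilon>"
      proof -
        have "\<alpha>' - \<alpha> = \<alpha> * (1 / (ssd x)\<^sup>2 - 1)" "\<beta>' - \<beta> = \<beta> * (1 / ssd x - 1) - \<alpha> * (smean x / (sqrt 2 * (ssd x)\<^sup>2))"
          unfolding \<alpha>'_def \<beta>'_def by (simp_all add: algebra_simps)
        then have "\<bar>\<alpha>' - \<alpha>\<bar> + \<bar>\<beta>' - \<beta>\<bar> \<le> \<bar>\<alpha>\<bar> * \<bar>1 / (ssd x)\<^sup>2 - 1\<bar> + (\<bar>\<beta>\<bar> * \<bar>1 / ssd x - 1\<bar> + \<bar>\<alpha>\<bar> * \<bar>smean x / (sqrt 2 * (ssd x)\<^sup>2)\<bar>)"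
          using abs_triangle_ineq4[of "\<beta> * (1 / ssd x - 1)" "\<alpha> * (smean x / (sqrt 2 * (ssd x)\<^sup>2))"] by (simp only: abs_mult)
        also have "\<dots> \<le> 101 * \<bar>1 / (ssd x)\<^sup>2 - 1\<bar> + (101 * \<bar>1 / ssd x - 1\<bar> + 101 * \<bar>smean x / (sqrt 2 * (ssd x)\<^sup>2)\<bar>)"
          using ab by (intro add_mono mult_right_mono) auto
        also have "\<dots> = 101 * c x" by (simp add: c_def)
        also have "\<dots> \<le> \<epsilon>" using elim(1) by simp
        finally show ?thesis .
      qed
      obtain \<alpha>0 \<beta>0 where n: "f_lnc \<alpha>0 \<beta>0 \<in> Fs" "\<bar>\<alpha> - \<alpha>0\<bar> + \<bar>\<beta> - \<beta>0\<bar> \<le> \<epsilon>"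
        using net[OF q(2)] by blast
      have d0: "\<bar>\<alpha>' - \<alpha>0\<bar> + \<bar>\<beta>' - \<beta>0\<bar> \<le> 2 * \<epsilon>" using d n(2) by linarith
      have "J x \<alpha> \<beta> = avg x (f_lnc \<alpha>' \<beta>')" unfolding J_eq[OF v] \<alpha>'_def \<beta>'_def ..
      also have "\<dots> \<le> avg x (\<lambda>z. f_lnc \<alpha>0 \<beta>0 z + 2 * \<epsilon> * f_lip z)"
      proof (rule avg_mono)
        fix z
        have "(\<bar>\<alpha>' - \<alpha>0\<bar> + \<bar>\<beta>' - \<beta>0\<bar>) * f_lip z \<le> 2 * \<epsilon> * f_lip z"
          using d0 by (intro mult_right_mono) (auto simp: f_lip_def)
        then show "f_lnc \<alpha>' \<beta>' z \<le> f_lnc \<alpha>0 \<beta>0 z + 2 * \<epsilon> * f_lip z"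
          using abs_le_D1[OF lnc_lipschitz[of \<alpha>' \<beta>' z \<alpha>0 \<beta>0]] by linarith
      qed
      also have "\<dots> = avg x (f_lnc \<alpha>0 \<beta>0) + 2 * \<epsilon> * avg x f_lip" unfolding avg_add avg_cmult ..
      also have "\<dots> \<le> (EZ (f_lnc \<alpha>0 \<beta>0) + \<epsilon>) + 2 * \<epsilon> * (EZ f_lip + 1)"
        using elim(2,4) n(1) eps(1) by (intro add_mono mult_left_mono) (force simp: abs_le_iff)+
      also have "EZ (f_lnc \<alpha>0 \<beta>0) = L_pop \<alpha>0 \<beta>0" by (simp add: L_pop_def f_lnc_def)
      also have "L_pop \<alpha>0 \<beta>0 \<le> L_pop \<alpha> \<beta> + \<epsilon> * EZ f_lip"
      proof -
        have "(\<bar>\<alpha> - \<alpha>0\<bar> + \<bar>\<beta> - \<beta>0\<bar>) * EZ f_lip \<le> \<epsilon> * EZ f_lip"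
          using n(2) EZ_lip_nonneg by (intro mult_right_mono) auto
        then show ?thesis using abs_le_D2[OF L_pop_lipschitz[of \<alpha> \<beta> \<alpha>0 \<beta>0]] by linarith
      qed
      finally have "J x \<alpha> \<beta> \<le> L_pop \<alpha> \<beta> + 3 * (\<epsilon> * (EZ f_lip + 1))" by (simp add: algebra_simps)
      moreover have "0 < \<epsilon> * (EZ f_lip + 1)" using eps(1) EZ_lip_nonneg by (intro mult_pos_pos) auto
      moreover have "4 * (\<epsilon> * (EZ f_lip + 1)) \<le> \<eta>" using eps(2) by (simp only: mult.left_commute[of 4 \<epsilon>])
      ultimately show "J x \<alpha> \<beta> < g_prof a \<alpha> \<beta>" using gap[OF q a] by linarith
    qed
  qed
qed

abbreviation "Kw \<equiv> 2 * K + 1"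
abbreviation "Kr \<equiv> 8 * Kw"

text \<open>\<open>J_mid\<close> and \<open>J_far\<close> confine
  \<open>q = q2 \<alpha> \<beta>\<close> to \<open>\<delta>_loc\<close>. There the quartic loss
  \<open>q\<^sup>2/2\<close>, less \<open>q\<^sup>2/8\<close> for each of the two error terms,
  leaves \<open>q\<^sup>2/4 \<le> 2 * Kw * q / rn x\<close>, and dividing by \<open>q\<close> gives
  the constant \<open>Kr = 8 * Kw\<close>.\<close>

lemma localization:
  "eventually (\<lambda>x. \<forall>\<alpha> \<beta> a. \<bar>\<alpha>\<bar> < a \<longrightarrow> 0 \<le> J x \<alpha> \<beta> - g_prof a \<alpha> \<beta> \<longrightarrow>
     q2 \<alpha> \<beta> \<le> \<delta>_loc \<and> rn x * q2 \<alpha> \<beta> \<le> Kr) F"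
proof -
  have "eventually (\<lambda>x. \<forall>\<alpha> \<beta> a. \<bar>\<alpha>\<bar> < a \<longrightarrow> q2 \<alpha> \<beta> \<le> 1 \<longrightarrow>
    J x \<alpha> \<beta> - g_prof a \<alpha> \<beta> \<le> WW x \<alpha> \<beta> / rn x - quart \<alpha> \<beta> / 2 + 1/8 * (q2 \<alpha> \<beta>)\<^sup>2 + (C_six + 2) * (q2 \<alpha> \<beta>)^3) F"
    by (rule H_upper) simp
  then show ?thesis using J_mid J_far W_bound ev_n[of 1]
  proof eventually_elim
    case (elim x)
    have r: "rn x > 0" using elim(5) by simp
    show ?case
    proof (intro allI impI)
      fix \<alpha> \<beta> a :: real assume a: "\<bar>\<alpha>\<bar> < a" and H: "0 \<le> J x \<alpha> \<beta> - g_prof a \<alpha> \<beta>"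
      define q where "q = q2 \<alpha> \<beta>"
      have q0: "q \<ge> 0" by (simp add: q_def)
      have ql: "q \<le> \<delta>_loc"
      proof (rule ccontr)
        assume "\<not> q \<le> \<delta>_loc"
        then have "J x \<alpha> \<beta> < g_prof a \<alpha> \<beta>"
          using elim(2,3) a unfolding q_def by (cases "q2 \<alpha> \<beta> \<le> 10001") auto
        with H show False by linarith
      qed
      have "q \<le> 1" using ql \<delta>_loc(2) by linarith
      then have 1: "0 \<le> WW x \<alpha> \<beta> / rn x - quart \<alpha> \<beta> / 2 + 1/8 * q\<^sup>2 + (C_six + 2) * q^3"
        using elim(1) a H unfolding q_def by fastforce
      have 2: "(C_six + 2) * q^3 \<le> 1/8 * q\<^sup>2"
      proof -
        have "(C_six + 2) * q \<le> 1/8" using ql \<delta>_loc(3) C_six_nonneg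
          by (metis mult.commute mult_left_mono add_nonneg_nonneg order_trans zero_le_numeral)
        then have "((C_six + 2) * q) * q\<^sup>2 \<le> 1/8 * q\<^sup>2" by (intro mult_right_mono) auto
        then show ?thesis by (simp add: power2_eq_square power3_eq_cube mult.assoc)
      qed
      have 3: "q\<^sup>2 \<le> quart \<alpha> \<beta>" unfolding q_def by (rule quart_ge)
      have 4: "WW x \<alpha> \<beta> \<le> 2 * Kw * q"
        using abs_le_D1[OF lin_form_bound[of "W1 x" Kw "W2 x" "W3 x" \<beta> \<alpha>]] elim(4)
        unfolding WW_def q_def q2_def by (simp add: mult_ac add.commute)
      have "WW x \<alpha> \<beta> / rn x \<le> 2 * Kw * q / rn x" using 4 r by (intro divide_right_mono) auto
      then have "1/4 * q\<^sup>2 \<le> 2 * Kw * q / rn x" using 1 2 3 by linarith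
      then have "rn x * q * q \<le> Kr * q" using r by (simp add: field_simps power2_eq_square)
      then have "rn x * q \<le> Kr"
      proof (cases "q = 0")
        case False
        then show ?thesis using \<open>rn x * q * q \<le> Kr * q\<close> q0 by (simp add: mult_le_cancel_right)
      qed (use K in auto)
      with ql show "q2 \<alpha> \<beta> \<le> \<delta>_loc \<and> rn x * q2 \<alpha> \<beta> \<le> Kr" by (simp add: q_def)
    qed
  qed
qed

lemma qform_scaled:
  assumes "r > 0"
  shows "qform (w1, w2, w3) (sqrt r * \<beta>, sqrt r * \<alpha>) = 2 * r * (\<beta>\<^sup>2 * w1 + \<alpha>\<^sup>2 * w2 + 2 * \<alpha> * \<beta> * w3) - r\<^sup>2 * quart \<alpha> \<beta>"
proof -
  have s: "(sqrt r)\<^sup>2 = r" using assms by simp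
  have e: "2 * (sqrt r * \<beta>) * (sqrt r * \<alpha>) = 2 * r * \<alpha> * \<beta>"
    using s by (simp add: power2_eq_square mult_ac)
  show ?thesis unfolding qform_def quart_def prod.case e power_mult_distrib s by algebra
qed

lemma rn_sq: "real (fst x) = (rn x)\<^sup>2" by simp

lemma upper_value:
  assumes "e > 0"
  shows "eventually (\<lambda>x. \<forall>\<alpha> \<beta> a. \<bar>\<alpha>\<bar> < a \<longrightarrow> 0 \<le> J x \<alpha> \<beta> - g_prof a \<alpha> \<beta> \<longrightarrow> (eq \<longrightarrow> \<alpha> = 0) \<longrightarrow>
    2 * real (fst x) * (J x \<alpha> \<beta> - g_prof a \<alpha> \<beta>) \<le> Rlim eq (W1 x, W2 x, W3 x) + e) F"
proof -
  \<comment> \<open>On \<open>rn x * q \<le> Kr\<close> the quartic error then costs at most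
    \<open>e/2\<close>; the sextic error keeps a factor \<open>1 / rn x\<close> and fits into the
    other half.\<close>
  define e' where "e' = e / (4 * (Kr\<^sup>2 + 1))"
  have e': "e' > 0" "2 * e' * Kr\<^sup>2 \<le> e / 2"
  proof -
    have p: "0 < 4 * (Kr\<^sup>2 + 1)" by (simp add: add_nonneg_pos)
    show "e' > 0" unfolding e'_def using assms p by (rule divide_pos_pos)
    have "e = e' * (4 * (Kr\<^sup>2 + 1))"
      by (rule nonzero_divide_eq_eq[THEN iffD1, OF _ e'_def[symmetric]]) (use p in linarith)
    then show "2 * e' * Kr\<^sup>2 \<le> e / 2" using \<open>e' > 0\<close> by (simp add: algebra_simps)
  qed
  have "((\<lambda>x. 2 * (C_six + 2) * Kr^3 * (1 / rn x)) \<longlongrightarrow> 2 * (C_six + 2) * Kr^3 * 0) F"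
    by (intro tendsto_intros inv_rn)
  then have "eventually (\<lambda>x. 2 * (C_six + 2) * Kr^3 * (1 / rn x) < e / 2) F"
    using assms by (auto dest: order_tendstoD(2)[of _ _ _ "e/2"])
  then show ?thesis using H_upper[OF e'(1)] localization ev_n[of 1]
  proof eventually_elim
    case (elim x)
    have r: "rn x > 0" using elim(4) by simp
    show ?case
    proof (intro allI impI)
      fix \<alpha> \<beta> a :: real assume a: "\<bar>\<alpha>\<bar> < a" and H: "0 \<le> J x \<alpha> \<beta> - g_prof a \<alpha> \<beta>" and eq: "eq \<longrightarrow> \<alpha> = 0"
      define q where "q = q2 \<alpha> \<beta>"
      have q: "0 \<le> q" "q \<le> 1" "rn x * q \<le> Kr" using elim(3) a H \<delta>_loc(2) unfolding q_def by force+
      have "J x \<alpha> \<beta> - g_prof a \<alpha> \<beta> \<le> WW x \<alpha> \<beta> / rn x - quart \<alpha> \<beta> / 2 + e' * q\<^sup>2 + (C_six + 2) * q^3"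
        using elim(2) a q unfolding q_def by blast
      then have "2 * (rn x)\<^sup>2 * (J x \<alpha> \<beta> - g_prof a \<alpha> \<beta>) \<le> 2 * (rn x)\<^sup>2 * (WW x \<alpha> \<beta> / rn x - quart \<alpha> \<beta> / 2 + e' * q\<^sup>2 + (C_six + 2) * q^3)"
        by (rule mult_left_mono) simp
      also have "\<dots> = qform (W1 x, W2 x, W3 x) (sqrt (rn x) * \<beta>, sqrt (rn x) * \<alpha>) + 2 * e' * (rn x * q)\<^sup>2 + 2 * (C_six + 2) * (rn x * q)^3 * (1 / rn x)"
        unfolding qform_scaled[OF r] WW_def[symmetric] by (rule scaling_identities(1)[OF r])
      also have "\<dots> \<le> Rlim eq (W1 x, W2 x, W3 x) + e / 2 + e / 2"
      proof (intro add_mono)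
        show "qform (W1 x, W2 x, W3 x) (sqrt (rn x) * \<beta>, sqrt (rn x) * \<alpha>) \<le> Rlim eq (W1 x, W2 x, W3 x)"
          by (rule qform_le_Rlim) (use eq in \<open>auto simp: cone_def\<close>)
        have "(rn x * q)\<^sup>2 \<le> Kr\<^sup>2" using q r by (intro power_mono) auto
        then have "2 * e' * (rn x * q)\<^sup>2 \<le> 2 * e' * Kr\<^sup>2" using e' by (intro mult_left_mono) auto
        then show "2 * e' * (rn x * q)\<^sup>2 \<le> e / 2" using e'(2) by linarith
        have "(rn x * q)^3 \<le> Kr^3" using q r by (intro power_mono) auto
        then have "2 * (C_six + 2) * (rn x * q)^3 * (1 / rn x) \<le> 2 * (C_six + 2) * Kr^3 * (1 / rn x)"
          using r C_six_nonneg by (intro mult_right_mono mult_left_mono) auto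
        then show "2 * (C_six + 2) * (rn x * q)^3 * (1 / rn x) \<le> e / 2" using elim(1) by linarith
      qed
      finally show "2 * real (fst x) * (J x \<alpha> \<beta> - g_prof a \<alpha> \<beta>) \<le> Rlim eq (W1 x, W2 x, W3 x) + e"
        unfolding rn_sq[symmetric] by simp
    qed
  qed
qed

text \<open>Stated for an arbitrary nonnegative upper bound \<open>B\<close> of the likelihood
  ratio, so that no maximum is presupposed. Each competitor \<open>y\<close> of the limiting form is
  scaled back to a trial parameter.\<close>

lemma lower_value:
  assumes "e > 0"
  shows "eventually (\<lambda>x. \<forall>B. B \<ge> 0 \<longrightarrow> (\<forall>p\<in>par_set eq. 2 * real (fst x) * Hs x p \<le> B) \<longrightarrow>
    Rlim eq (W1 x, W2 x, W3 x) \<le> B + e) F"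
proof -
  define T where "T = 4 * Kw"
  have T: "T \<ge> 0" using K by (simp add: T_def)
  define e' where "e' = e / (4 * (T\<^sup>2 + 1))"
  have e': "e' > 0" "2 * e' * T\<^sup>2 \<le> e / 2"
  proof -
    have p: "0 < 4 * (T\<^sup>2 + 1)" by (simp add: add_nonneg_pos)
    show "e' > 0" unfolding e'_def using assms p by (rule divide_pos_pos)
    have "e = e' * (4 * (T\<^sup>2 + 1))"
      by (rule nonzero_divide_eq_eq[THEN iffD1, OF _ e'_def[symmetric]]) (use p in linarith)
    then show "2 * e' * T\<^sup>2 \<le> e / 2" using \<open>e' > 0\<close> by (simp add: algebra_simps)
  qed
  have "((\<lambda>x. 6 * T^3 * (1 / rn x)) \<longlongrightarrow> 6 * T^3 * 0) F" "((\<lambda>x. T * (1 / rn x)) \<longlongrightarrow> T * 0) F"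
    by (intro tendsto_intros inv_rn)+
  then have "eventually (\<lambda>x. 6 * T^3 * (1 / rn x) < e / 2) F" "eventually (\<lambda>x. T * (1 / rn x) < 1/2) F"
    using assms by (auto dest: order_tendstoD(2)[of _ _ _ "e/2"] order_tendstoD(2)[of _ _ _ "1/2"])
  then show ?thesis using H_lower[OF e'(1)] W_bound ev_n[of 1]
  proof eventually_elim
    case (elim x)
    have r: "rn x > 0" using elim(5) by simp
    show ?case
    proof (intro allI impI)
      fix B :: real assume B0: "B \<ge> 0" and B: "\<forall>p\<in>par_set eq. 2 * real (fst x) * Hs x p \<le> B"
      show "Rlim eq (W1 x, W2 x, W3 x) \<le> B + e"
      proof (rule Rlim_leI)
        fix y assume y: "y \<in> cone eq"
        obtain x1 x2 where y12: "y = (x1, x2)" by (cases y)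
        show "qform (W1 x, W2 x, W3 x) y \<le> B + e"
        proof (cases "qform (W1 x, W2 x, W3 x) y \<ge> 0")
          case False then show ?thesis using B0 assms by linarith
        next
          case True
          \<comment> \<open>Directions with negative form are trivial, so the remaining ones are
            bounded and their rescalings are small enough for \<open>H_lower\<close>.\<close>
          then have t: "x1\<^sup>2 + x2\<^sup>2 \<le> T" using qform_nonneg_bound[of "W1 x" Kw "W2 x" "W3 x" x1 x2] elim(4) unfolding y12 T_def by blast
          define \<beta> \<alpha> where "\<beta> = x1 / sqrt (rn x)" and "\<alpha> = x2 / sqrt (rn x)"
          have sr: "sqrt (rn x) > 0" using r by simp
          have x12: "x1 = sqrt (rn x) * \<beta>" "x2 = sqrt (rn x) * \<alpha>" using sr by (simp_all add: \<beta>_def \<alpha>_def)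
          have eq: "eq \<longrightarrow> \<alpha> = 0" using y by (auto simp: cone_def y12 \<alpha>_def)
          define q where "q = q2 \<alpha> \<beta>"
          have rq: "rn x * q = x1\<^sup>2 + x2\<^sup>2" unfolding q_def q2_def x12 power_mult_distrib using r by (simp add: algebra_simps)
          have q0: "q \<ge> 0" by (simp add: q_def)
          have "q \<le> 1/2"
          proof -
            have "q = (x1\<^sup>2 + x2\<^sup>2) * (1 / rn x)" using rq r by (simp add: field_simps)
            also have "\<dots> \<le> T * (1 / rn x)" using t r by (intro mult_right_mono) auto
            finally show ?thesis using elim(2) by linarith
          qed
          then have h: "WW x \<alpha> \<beta> / rn x - quart \<alpha> \<beta> / 2 - e' * q\<^sup>2 - 3 * q^3 \<le> J x \<alpha> \<beta> - g_prof (1 + \<alpha>\<^sup>2 + \<beta>\<^sup>2) \<alpha> \<beta>"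
            using elim(3) unfolding q_def by blast
          have lt: "\<bar>\<alpha>\<bar> < 1 + \<alpha>\<^sup>2 + \<beta>\<^sup>2" using \<open>q \<le> 1/2\<close> unfolding q_def q2_def by (rule g_prof_upper(2))
          have "qform (W1 x, W2 x, W3 x) y - 2 * e' * (rn x * q)\<^sup>2 - 6 * (rn x * q)^3 * (1 / rn x)
              = 2 * (rn x)\<^sup>2 * (WW x \<alpha> \<beta> / rn x - quart \<alpha> \<beta> / 2 - e' * q\<^sup>2 - 3 * q^3)"
            unfolding y12 x12 qform_scaled[OF r] WW_def[symmetric] scaling_identities(2)[OF r] by simp
          also have "\<dots> \<le> 2 * (rn x)\<^sup>2 * (J x \<alpha> \<beta> - g_prof (1 + \<alpha>\<^sup>2 + \<beta>\<^sup>2) \<alpha> \<beta>)"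
            using h by (rule mult_left_mono) simp
          also have "\<dots> \<le> B"
            using B Hs_profile(2)[OF lt eq] unfolding Hs_profile(1)[OF lt, symmetric] rn_sq[symmetric] by blast
          finally have 1: "qform (W1 x, W2 x, W3 x) y \<le> B + 2 * e' * (rn x * q)\<^sup>2 + 6 * (rn x * q)^3 * (1 / rn x)" by linarith
          have rqT: "0 \<le> rn x * q" "rn x * q \<le> T" using rq t q0 r by auto
          have "(rn x * q)\<^sup>2 \<le> T\<^sup>2" using rqT by (intro power_mono) auto
          then have "2 * e' * (rn x * q)\<^sup>2 \<le> 2 * e' * T\<^sup>2" using e' by (intro mult_left_mono) auto
          moreover have "(rn x * q)^3 \<le> T^3" using rqT by (intro power_mono) auto
          then have "6 * (rn x * q)^3 * (1 / rn x) \<le> 6 * T^3 * (1 / rn x)"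
            using r by (intro mult_right_mono mult_left_mono) auto
          ultimately show ?thesis using 1 e'(2) elim(1) by linarith
        qed
      qed
    qed
  qed
qed

text \<open>The rate constant \<open>C\<close> precedes the tolerance \<open>e\<close>: the rates
  hold with one constant while the value is approximated arbitrarily well. The statement covers
  every maximiser, whether or not it is unique.\<close>

lemma maximizer_asymptotics:
  "\<exists>C. \<forall>e>0. eventually (\<lambda>x. \<forall>a1 a2 u1 u2. (a1, a2, u1, u2) \<in> par_set eq \<longrightarrow>
     (\<forall>p\<in>par_set eq. Hs x p \<le> Hs x (a1, a2, u1, u2)) \<longrightarrow>
     \<bar>2 * real (fst x) * Hs x (a1, a2, u1, u2) - Rlim eq (V1 x, V2 x, V3 x)\<bar> \<le> e \<and>
     rn x * ((a2 - a1) / 2)\<^sup>2 \<le> C \<and> rn x * \<bar>(a1 + a2) / 2 - 1\<bar> \<le> C \<and> u2 = - u1 \<and> rn x * u1\<^sup>2 \<le> C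
     \<and> a1 \<ge> 1/4 \<and> a2 \<ge> 1/4) F"
proof -
  define C1 where "C1 = sqrt (16 * Kr\<^sup>2 + 16 * Kw * Kr)"
  define C where "C = max (2 * Kr) C1"
  have Kp: "Kw \<ge> 1" "Kr \<ge> 0" using K by auto
  show ?thesis
  proof (intro exI[of _ C] allI impI)
    fix e :: real assume e: "e > 0"
    define d where "d = e / (2 * (16 * Kw + 1))"
    have d: "d > 0" using e Kp by (simp add: d_def)
    have de: "16 * Kw * d \<le> e / 2"
    proof -
      have "e = d * (2 * (16 * Kw + 1))"
        by (rule nonzero_divide_eq_eq[THEN iffD1, OF _ d_def[symmetric]]) (use Kp in auto)
      then have "e = 2 * (16 * Kw * d) + 2 * d" by (simp add: algebra_simps)
      then show ?thesis using d by linarith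
    qed
    have "((\<lambda>x. C1 * (1 / rn x)) \<longlongrightarrow> C1 * 0) F" "((\<lambda>x. 2 * Kw * Kr * (1 / rn x)\<^sup>2) \<longlongrightarrow> 2 * Kw * Kr * 0\<^sup>2) F"
      by (intro tendsto_intros inv_rn)+
    then have "eventually (\<lambda>x. C1 * (1 / rn x) < 1/8) F" "eventually (\<lambda>x. 2 * Kw * Kr * (1 / rn x)\<^sup>2 < 1/8) F"
      by (auto dest: order_tendstoD(2)[of _ _ _ "1/8"])
    then show "eventually (\<lambda>x. \<forall>a1 a2 u1 u2. (a1, a2, u1, u2) \<in> par_set eq \<longrightarrow>
     (\<forall>p\<in>par_set eq. Hs x p \<le> Hs x (a1, a2, u1, u2)) \<longrightarrow>
     \<bar>2 * real (fst x) * Hs x (a1, a2, u1, u2) - Rlim eq (V1 x, V2 x, V3 x)\<bar> \<le> e \<and>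
     rn x * ((a2 - a1) / 2)\<^sup>2 \<le> C \<and> rn x * \<bar>(a1 + a2) / 2 - 1\<bar> \<le> C \<and> u2 = - u1 \<and> rn x * u1\<^sup>2 \<le> C
     \<and> a1 \<ge> 1/4 \<and> a2 \<ge> 1/4) F"
      using localization upper_value[OF half_gt_zero[OF e], of eq] lower_value[OF half_gt_zero[OF e], of eq]
        W_close[OF d] W_bound V_bound J_le_square ev_n[of 1]
    proof eventually_elim
      case (elim x)
      have r: "rn x > 0" using elim(10) by simp
      show ?case
      proof (intro allI impI)
        fix a1 a2 u1 u2 :: real
        assume par: "(a1, a2, u1, u2) \<in> par_set eq"
          and mx: "\<forall>p\<in>par_set eq. Hs x p \<le> Hs x (a1, a2, u1, u2)"
        define a \<alpha> \<beta> where "a = (a1 + a2) / 2" and "\<alpha> = (a2 - a1) / 2" and "\<beta> = (a1 * u1 - a2 * u2) / 2"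
        have pos: "0 < a1" "0 < a2" and eq: "eq \<longrightarrow> \<alpha> = 0" using par by (auto simp: par_set_def \<alpha>_def)
        note pr = Hs_le_profile(1)[OF pos, where x=x and ?u1.0=u1 and ?u2.0=u2, folded a_def \<alpha>_def \<beta>_def]
          Hs_le_profile(2)[OF pos, folded a_def \<alpha>_def]
        \<comment> \<open>Comparison with the profiled point of the same \<open>a\<close>,
          \<open>\<alpha>\<close>, \<open>\<beta>\<close>, which lies in the same submodel: the
          penalty in \<open>u1 + u2\<close> has to vanish.\<close>
        have "J x \<alpha> \<beta> - g_prof a \<alpha> \<beta> \<le> Hs x (a1, a2, u1, u2)"
          using mx Hs_profile(2)[OF pr(2) eq] unfolding Hs_profile(1)[OF pr(2), symmetric] by blast
        then have "a1 * a2 * (u1 + u2)\<^sup>2 / (2 * (a1 + a2)) \<le> 0" using pr(1) by linarith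
        moreover have "0 \<le> a1 * a2 * (u1 + u2)\<^sup>2 / (2 * (a1 + a2))" using pos by simp
        ultimately have z: "a1 * a2 * (u1 + u2)\<^sup>2 / (2 * (a1 + a2)) = 0" by linarith
        then have "u1 + u2 = 0" using pos by (simp add: divide_eq_0_iff)
        then have u: "u2 = - u1" by linarith
        have H: "Hs x (a1, a2, u1, u2) = J x \<alpha> \<beta> - g_prof a \<alpha> \<beta>" using pr(1) z by linarith
        have H0: "0 \<le> Hs x (a1, a2, u1, u2)"
          using mx[rule_format, OF Hs_null(2)] unfolding Hs_null(1) .
        have H0': "0 \<le> J x \<alpha> \<beta> - g_prof a \<alpha> \<beta>" using H0 unfolding H .
        define q where "q = q2 \<alpha> \<beta>"
        have q: "q \<le> \<delta>_loc" "rn x * q \<le> Kr" "0 \<le> q" using elim(3) pr(2) H0' unfolding q_def by auto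
        have q8: "q \<le> 1/8" using q(1) \<delta>_loc(2) by linarith
        have up: "2 * real (fst x) * Hs x (a1, a2, u1, u2) \<le> Rlim eq (W1 x, W2 x, W3 x) + e / 2"
          unfolding H using elim(4) pr(2) H0' eq by blast
        have lo: "Rlim eq (W1 x, W2 x, W3 x) \<le> 2 * real (fst x) * Hs x (a1, a2, u1, u2) + e / 2"
        proof (rule elim(5)[rule_format])
          show "0 \<le> 2 * real (fst x) * Hs x (a1, a2, u1, u2)" using H0 by simp
          fix p assume "p \<in> par_set eq"
          then show "2 * real (fst x) * Hs x p \<le> 2 * real (fst x) * Hs x (a1, a2, u1, u2)"
            using mx by (intro mult_left_mono) auto
        qed
        have WV: "Rlim eq (W1 x, W2 x, W3 x) \<le> Rlim eq (V1 x, V2 x, V3 x) + 16 * Kw * d"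
          using elim(6,7) by (intro Rlim_close) auto
        have VW: "Rlim eq (V1 x, V2 x, V3 x) \<le> Rlim eq (W1 x, W2 x, W3 x) + 16 * Kw * d"
          using elim(6,8) by (intro Rlim_close) (auto simp: abs_minus_commute)
        have c1: "\<bar>2 * real (fst x) * Hs x (a1, a2, u1, u2) - Rlim eq (V1 x, V2 x, V3 x)\<bar> \<le> e"
          unfolding abs_le_iff using up lo WV VW de by (intro conjI) linarith+
        have "rn x * \<alpha>\<^sup>2 \<le> rn x * q" using r by (intro mult_left_mono) (auto simp: q_def q2_def)
        then have c2: "rn x * \<alpha>\<^sup>2 \<le> C" using q(2) Kp unfolding C_def by linarith
        have rb: "rn x * \<beta>\<^sup>2 \<le> Kr"
        proof -
          have "rn x * \<beta>\<^sup>2 \<le> rn x * q" using r by (intro mult_left_mono) (auto simp: q_def q2_def)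
          then show ?thesis using q(2) by linarith
        qed
        define D where "D = 2 * Kw * q / rn x"
        have WWb: "WW x \<alpha> \<beta> / rn x \<le> D"
        proof -
          have "WW x \<alpha> \<beta> \<le> 2 * Kw * (\<beta>\<^sup>2 + \<alpha>\<^sup>2)"
            unfolding WW_def using abs_le_D1[OF lin_form_bound[of "W1 x" Kw "W2 x" "W3 x" \<beta> \<alpha>]] elim(7)
            by (simp only: mult.commute mult.left_commute mult.assoc)
          then have "WW x \<alpha> \<beta> \<le> 2 * Kw * q" unfolding q_def q2_def by (simp only: add.commute)
          then show ?thesis unfolding D_def using r by (intro divide_right_mono) auto
        qed
        have D0: "D \<ge> 0" unfolding D_def using Kp q r by simp
        have DK: "D = 2 * Kw * (rn x * q) * (1 / rn x)\<^sup>2"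
          unfolding D_def by (rule scaling_identities(4)[OF r])
        have "2 * Kw * (rn x * q) * (1 / rn x)\<^sup>2 \<le> 2 * Kw * Kr * (1 / rn x)\<^sup>2"
          using q Kp by (intro mult_right_mono mult_left_mono) auto
        then have D8: "D < 1/8" using elim(2) unfolding DK by linarith
        \<comment> \<open>A maximiser does at least as well as the null fit, so
          \<open>g_prof\<close> lies below \<open>J\<close>. The noise term \<open>D\<close> becomes
          the slack in \<open>g_prof_curvature\<close>.\<close>
        have "g_prof a \<alpha> \<beta> \<le> \<beta>\<^sup>2 + \<alpha>\<^sup>2/2 + D"
          using elim(9)[rule_format, of \<alpha> \<beta>] H0' WWb by linarith
        from g_prof_curvature[OF pr(2) this _ D8 D0] q8
        have cur: "(a - 1)\<^sup>2 \<le> 16 * q\<^sup>2 + 8 * D" unfolding q_def q2_def by simp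
        have "(rn x * \<bar>a - 1\<bar>)\<^sup>2 = (rn x)\<^sup>2 * (a - 1)\<^sup>2" by (simp only: power_mult_distrib power2_abs)
        also have "\<dots> \<le> (rn x)\<^sup>2 * (16 * q\<^sup>2 + 8 * D)" using cur by (intro mult_left_mono) auto
        also have "\<dots> = 16 * (rn x * q)\<^sup>2 + 16 * Kw * (rn x * q)"
          unfolding D_def by (rule scaling_identities(3)[OF r])
        also have "\<dots> \<le> 16 * Kr\<^sup>2 + 16 * Kw * Kr"
          using q r Kp by (intro add_mono mult_left_mono power_mono) auto
        finally have rc: "rn x * \<bar>a - 1\<bar> \<le> C1" unfolding C1_def by (rule real_le_rsqrt)
        then have c3: "rn x * \<bar>a - 1\<bar> \<le> C" unfolding C_def by linarith
        have a8: "\<bar>a - 1\<bar> \<le> 1/8"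
        proof -
          have "\<bar>a - 1\<bar> = rn x * \<bar>a - 1\<bar> * (1 / rn x)" using r by simp
          also have "\<dots> \<le> C1 * (1 / rn x)" using rc r by (intro mult_right_mono) auto
          finally show ?thesis using elim(1) by linarith
        qed
        have \<alpha>2: "\<bar>\<alpha>\<bar> \<le> 1/2"
        proof -
          have "\<alpha>\<^sup>2 \<le> q" by (simp add: q_def q2_def)
          then have "\<alpha>\<^sup>2 \<le> (1/2)\<^sup>2" using q8 by (simp add: power2_eq_square)
          then have "\<bar>\<alpha>\<bar> \<le> \<bar>1/2\<bar>" by (rule abs_le_square_iff[THEN iffD2])
          then show ?thesis by simp
        qed
        have a12: "a1 = a - \<alpha>" "a2 = a + \<alpha>" unfolding a_def \<alpha>_def by (simp_all add: field_simps)
        have \<beta>a: "\<beta> = a * u1" unfolding \<beta>_def a_def u by (simp add: field_simps)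
        have "a \<ge> 7/8" using a8 by linarith
        then have "(7/8)\<^sup>2 \<le> a\<^sup>2" by (intro power_mono) auto
        then have "1/2 * u1\<^sup>2 \<le> a\<^sup>2 * u1\<^sup>2" by (intro mult_right_mono) (auto simp: power2_eq_square)
        then have "u1\<^sup>2 \<le> 2 * \<beta>\<^sup>2" unfolding \<beta>a power_mult_distrib by linarith
        then have "rn x * u1\<^sup>2 \<le> rn x * (2 * \<beta>\<^sup>2)" using r by (intro mult_left_mono) auto
        then have "rn x * u1\<^sup>2 \<le> 2 * Kr" using rb by linarith
        then have c4: "rn x * u1\<^sup>2 \<le> C" unfolding C_def by linarith
        have c5: "a1 \<ge> 1/4" "a2 \<ge> 1/4" unfolding a12 using a8 \<alpha>2 by linarith+
        show "\<bar>2 * real (fst x) * Hs x (a1, a2, u1, u2) - Rlim eq (V1 x, V2 x, V3 x)\<bar> \<le> e \<and>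
           rn x * ((a2 - a1) / 2)\<^sup>2 \<le> C \<and> rn x * \<bar>(a1 + a2) / 2 - 1\<bar> \<le> C \<and> u2 = - u1 \<and> rn x * u1\<^sup>2 \<le> C
           \<and> a1 \<ge> 1/4 \<and> a2 \<ge> 1/4"
          using c1 c2 c3 c4 c5 u unfolding a_def \<alpha>_def by blast
      qed
    qed
  qed
qed

end

subsection \<open>The likelihood in the new parameters\<close>

lemma bvn_indep:
  assumes "0 < s1" "0 < s2"
  shows "bvn_density (m1, m2, s1, s2, 0) (x1, x2) =
    1 / (2 * pi * s1 * s2) * exp (- (((x1 - m1) / s1)\<^sup>2 + ((x2 - m2) / s2)\<^sup>2) / 2)"
  by (simp add: bvn_density_def add_divide_distrib)

text \<open>With \<open>E1, E2\<close> the two exponents, \<open>e^E1 + e^E2 = 2 e^((E1+E2)/2) cosh ((E1-E2)/2)\<close>.\<close>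

lemma log_mixture:
  fixes c w m1 m2 s1 s2 x1 x2 :: real
  assumes w: "0 < w" and s: "0 < s1" "0 < s2"
  defines "a1 \<equiv> w\<^sup>2 / s1\<^sup>2" and "a2 \<equiv> w\<^sup>2 / s2\<^sup>2" and "u1 \<equiv> (m1 - c) / w" and "u2 \<equiv> (m2 - c) / w"
    and "p \<equiv> (x1 - x2) / (sqrt 2 * w)" and "q \<equiv> (x1 + x2 - 2 * c) / (sqrt 2 * w)"
  shows "ln (bvn_density (m1, m2, s1, s2, 0) (x1, x2) + bvn_density (m1, m2, s1, s2, 0) (x2, x1)) =
    ln (bvn_density (c, c, w, w, 0) (x1, x2) + bvn_density (c, c, w, w, 0) (x2, x1)) +
    (- g_full a1 a2 u1 u2 + ((a1 + a2) / 2 - 1) * (1 - (p\<^sup>2 + q\<^sup>2) / 2) + sqrt 2 * ((a1 * u1 + a2 * u2) / 2) * q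
     + lncosh (p * (sqrt 2 * ((a1 * u1 - a2 * u2) / 2) + (a2 - a1) / 2 * q)))"
proof -
  define y1 y2 where "y1 = (x1 - c) / w" and "y2 = (x2 - c) / w"
  have a: "a1 > 0" "a2 > 0" using w s by (simp_all add: a1_def a2_def)
  have pq: "p = (y1 - y2) / sqrt 2" "q = (y1 + y2) / sqrt 2"
    unfolding p_def q_def y1_def y2_def using w by (simp_all add: field_simps)
  have e: "((z - m1) / s1)\<^sup>2 = a1 * ((z - c) / w - u1)\<^sup>2" "((z - m2) / s2)\<^sup>2 = a2 * ((z - c) / w - u2)\<^sup>2" for z
    unfolding a1_def a2_def u1_def u2_def using w s
    by (simp_all add: power_divide diff_divide_distrib[symmetric])
  define E1 E2 where "E1 = - (a1 * (y1 - u1)\<^sup>2 + a2 * (y2 - u2)\<^sup>2) / 2"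
    and "E2 = - (a1 * (y2 - u1)\<^sup>2 + a2 * (y1 - u2)\<^sup>2) / 2"
  have d: "bvn_density (m1, m2, s1, s2, 0) (x1, x2) = 1 / (2 * pi * s1 * s2) * exp E1"
    "bvn_density (m1, m2, s1, s2, 0) (x2, x1) = 1 / (2 * pi * s1 * s2) * exp E2"
    unfolding bvn_indep[OF s] e E1_def E2_def y1_def y2_def by simp_all
  have p2: "p\<^sup>2 = (y1 - y2)\<^sup>2 / 2" "q\<^sup>2 = (y1 + y2)\<^sup>2 / 2" unfolding pq by (simp_all add: power_divide)
  have d0: "bvn_density (c, c, w, w, 0) (x1, x2) = 1 / (2 * pi * w * w) * exp (- (p\<^sup>2 + q\<^sup>2) / 2)"
    "bvn_density (c, c, w, w, 0) (x2, x1) = 1 / (2 * pi * w * w) * exp (- (p\<^sup>2 + q\<^sup>2) / 2)"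
    unfolding bvn_indep[OF w w] p2 y1_def[symmetric] y2_def[symmetric]
    by (simp_all add: power2_sum power2_diff field_simps)
  have ch: "exp E1 + exp E2 = 2 * exp ((E1 + E2) / 2) * cosh ((E1 - E2) / 2)"
  proof -
    have "2 * exp ((E1 + E2) / 2) * cosh ((E1 - E2) / 2) = exp ((E1 + E2) / 2) * exp ((E1 - E2) / 2) + exp ((E1 + E2) / 2) * exp (- ((E1 - E2) / 2))"
      by (simp add: cosh_field_def algebra_simps)
    also have "\<dots> = exp E1 + exp E2" unfolding exp_add[symmetric] by (simp add: field_simps)
    finally show ?thesis by simp
  qed
  have l1: "ln (bvn_density (m1, m2, s1, s2, 0) (x1, x2) + bvn_density (m1, m2, s1, s2, 0) (x2, x1))
     = ln (1 / (pi * s1 * s2)) + (E1 + E2) / 2 + lncosh ((E1 - E2) / 2)"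
  proof -
    have "bvn_density (m1, m2, s1, s2, 0) (x1, x2) + bvn_density (m1, m2, s1, s2, 0) (x2, x1)
       = 1 / (pi * s1 * s2) * exp ((E1 + E2) / 2) * cosh ((E1 - E2) / 2)"
      unfolding d distrib_left[symmetric] ch by simp
    moreover have "ln (k * exp t * cosh y) = ln k + t + ln (cosh y)" if "k > 0" for k t y :: real
      using that by (simp add: ln_mult cosh_real_pos)
    moreover have "1 / (pi * s1 * s2) > 0" using s by simp
    ultimately show ?thesis unfolding lncosh_def by presburger
  qed
  have l0: "ln (bvn_density (c, c, w, w, 0) (x1, x2) + bvn_density (c, c, w, w, 0) (x2, x1))
     = ln (1 / (pi * w * w)) - (p\<^sup>2 + q\<^sup>2) / 2"
  proof -
    have "bvn_density (c, c, w, w, 0) (x1, x2) + bvn_density (c, c, w, w, 0) (x2, x1)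
       = 1 / (pi * w * w) * exp (- (p\<^sup>2 + q\<^sup>2) / 2)" unfolding d0 by simp
    moreover have "ln (k * exp (- t / 2)) = ln k - t / 2" if "k > 0" for k t :: real
      using that by (simp add: ln_mult)
    moreover have "1 / (pi * w * w) > 0" using w by simp
    ultimately show ?thesis by presburger
  qed
  have lc: "ln (1 / (pi * s1 * s2)) = ln (1 / (pi * w * w)) + ln (a1 * a2) / 2"
  proof -
    have "ln (1 / (pi * s1 * s2)) = - (ln pi + ln s1 + ln s2)" "ln (1 / (pi * w * w)) = - (ln pi + 2 * ln w)"
      "ln (a1 * a2) = 2 * (2 * ln w - ln s1 - ln s2)"
      unfolding a1_def a2_def using w s by (simp_all add: ln_mult ln_div ln_realpow)
    then show ?thesis by argo
  qed
  have pqy: "p * q = (y1\<^sup>2 - y2\<^sup>2) / 2" "p * sqrt 2 = y1 - y2" "sqrt 2 * q = y1 + y2"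
    unfolding pq by (simp add: power2_eq_square algebra_simps, simp_all)
  have "(E1 - E2) / 2 = (a1 * u1 - a2 * u2) / 2 * (y1 - y2) + (a2 - a1) / 2 * ((y1\<^sup>2 - y2\<^sup>2) / 2)"
    unfolding E1_def E2_def by (simp add: power2_diff field_simps)
  also have "\<dots> = p * (sqrt 2 * ((a1 * u1 - a2 * u2) / 2) + (a2 - a1) / 2 * q)"
    unfolding pqy[symmetric] by (simp add: algebra_simps)
  finally have m: "(E1 - E2) / 2 = p * (sqrt 2 * ((a1 * u1 - a2 * u2) / 2) + (a2 - a1) / 2 * q)" .
  have s: "(E1 + E2) / 2 = - (a1 + a2) / 2 * ((p\<^sup>2 + q\<^sup>2) / 2) + (a1 * u1 + a2 * u2) / 2 * (sqrt 2 * q) - (a1 * u1\<^sup>2 + a2 * u2\<^sup>2) / 2"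
    unfolding E1_def E2_def p2 pqy(3) by (simp add: power2_diff power2_sum field_simps)
  show ?thesis unfolding l1 l0 lc m[symmetric] s g_full_def by (simp add: field_simps)
qed

definition samp :: "real \<Rightarrow> real \<Rightarrow> nat \<Rightarrow> (nat \<Rightarrow> real \<times> real) \<Rightarrow> sample" where
  "samp \<mu> \<sigma> n xs = (n, \<lambda>i. rot \<mu> \<sigma> (xs i))"

definition par_of :: "real \<Rightarrow> real \<Rightarrow> param \<Rightarrow> real \<times> real \<times> real \<times> real" where
  "par_of c w \<theta> = (case \<theta> of (m1, m2, s1, s2, r) \<Rightarrow> (w\<^sup>2 / s1\<^sup>2, w\<^sup>2 / s2\<^sup>2, (m1 - c) / w, (m2 - c) / w))"

definition Theta_of :: "bool \<Rightarrow> param set" where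
  "Theta_of eq = (if eq then Theta_tilde else Theta_hat)"

lemma Theta_of_iff: "\<theta> \<in> Theta_of eq \<longleftrightarrow> (\<exists>m1 m2 s1 s2. \<theta> = (m1, m2, s1, s2, 0) \<and> 0 < s1 \<and> 0 < s2 \<and> (eq \<longrightarrow> s1 = s2))"
  by (cases \<theta>) (auto simp: Theta_of_def Theta_tilde_def Theta_hat_def)

lemma par_of_in:
  assumes "w > 0" "\<theta> \<in> Theta_of eq" shows "par_of c w \<theta> \<in> par_set eq"
  using assms by (auto simp: Theta_of_iff par_of_def par_set_def)

lemma par_of_surj:
  assumes "w > 0" "p \<in> par_set eq" shows "\<exists>\<theta>\<in>Theta_of eq. par_of c w \<theta> = p"
proof -
  obtain a1 a2 u1 u2 where p: "p = (a1, a2, u1, u2)" "0 < a1" "0 < a2" "eq \<longrightarrow> a1 = a2"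
    using assms(2) by (auto simp: par_set_def)
  let ?\<theta> = "(c + w * u1, c + w * u2, w / sqrt a1, w / sqrt a2, 0)"
  have "?\<theta> \<in> Theta_of eq" using p assms(1) by (auto simp: Theta_of_iff)
  moreover have "par_of c w ?\<theta> = p" using p assms(1) by (simp add: par_of_def power_divide)
  ultimately show ?thesis by blast
qed

lemma loglik_unorder:
  "loglik n (\<lambda>i. unorder (xs i)) \<theta> = (\<Sum>i<n. ln (bvn_density \<theta> (fst (xs i), snd (xs i)) + bvn_density \<theta> (snd (xs i), fst (xs i))))"
  unfolding loglik_def unorder_def
  by (intro sum.cong refl) (auto simp: min_def max_def add.commute)

lemma sum_eq_avg: "fst x > 0 \<Longrightarrow> (\<Sum>i<fst x. f (snd x i)) = real (fst x) * avg x f"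
  by (simp add: avg_def)

text \<open>\<open>c\<close> and \<open>w\<close> are the null fit in original units; the factor
  \<open>sqrt 2\<close> in \<open>c\<close> undoes the rotation of the mean. Matching first and
  second moments makes the averages of \<open>S\<close> and of
  \<open>1 - (P\<^sup>2 + S\<^sup>2)/2\<close> zero, so of \<open>log_mixture\<close> only
  \<open>g_full\<close> and the \<open>lncosh\<close> term survive.\<close>

lemma loglik_Hs:
  fixes \<mu> \<sigma> :: real and n :: nat and xs :: "nat \<Rightarrow> real \<times> real" and \<theta> :: param
  assumes "\<sigma> > 0" "n > 0" "\<theta> \<in> Theta_of False"
  defines "x \<equiv> samp \<mu> \<sigma> n xs"
  assumes v: "ssd x > 0"
  defines "c \<equiv> \<mu> + \<sigma> * smean x / sqrt 2" and "w \<equiv> \<sigma> * ssd x"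
  shows "loglik n (\<lambda>i. unorder (xs i)) \<theta> - loglik n (\<lambda>i. unorder (xs i)) (c, c, w, w, 0) = real n * Hs x (par_of c w \<theta>)"
proof -
  obtain m1 m2 s1 s2 where \<theta>: "\<theta> = (m1, m2, s1, s2, 0)" and s: "0 < s1" "0 < s2"
    using assms(3) by (auto simp: Theta_of_iff)
  have w: "w > 0" using assms(1) v by (simp add: w_def)
  define a1 a2 u1 u2 where "a1 = w\<^sup>2 / s1\<^sup>2" and "a2 = w\<^sup>2 / s2\<^sup>2" and "u1 = (m1 - c) / w" and "u2 = (m2 - c) / w"
  have fx: "fst x = n" "fst x > 0" using assms(2) by (simp_all add: x_def samp_def)
  have sx: "snd x i = rot \<mu> \<sigma> (xs i)" for i by (simp add: x_def samp_def)
  define P S where "P z = fst z / ssd x" and "S z = (snd z - smean x) / ssd x" for z :: "real \<times> real"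
  define T where "T z = - g_full a1 a2 u1 u2 + ((a1 + a2) / 2 - 1) * (1 - ((P z)\<^sup>2 + (S z)\<^sup>2) / 2) + sqrt 2 * ((a1 * u1 + a2 * u2) / 2) * S z
     + lncosh (zed x ((a2 - a1) / 2) ((a1 * u1 - a2 * u2) / 2) z)" for z
  have pt: "ln (bvn_density \<theta> (fst (xs i), snd (xs i)) + bvn_density \<theta> (snd (xs i), fst (xs i)))
     - ln (bvn_density (c, c, w, w, 0) (fst (xs i), snd (xs i)) + bvn_density (c, c, w, w, 0) (snd (xs i), fst (xs i))) = T (snd x i)" for i
  proof -
    have p: "(fst (xs i) - snd (xs i)) / (sqrt 2 * w) = P (snd x i)"
      unfolding sx rot_def P_def w_def using v assms(1) by (simp add: field_simps)
    have q: "(fst (xs i) + snd (xs i) - 2 * c) / (sqrt 2 * w) = S (snd x i)"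
    proof -
      have "2 * c = 2 * \<mu> + sqrt 2 * \<sigma> * smean x" unfolding c_def
        by (simp add: field_simps)
      then have "(fst (xs i) + snd (xs i) - 2 * c) / (sqrt 2 * w) = (fst (xs i) + snd (xs i) - 2 * \<mu> - sqrt 2 * \<sigma> * smean x) / (sqrt 2 * \<sigma> * ssd x)"
        unfolding w_def by (simp add: diff_diff_eq mult.assoc)
      also have "\<dots> = S (snd x i)" unfolding sx rot_def S_def using v assms(1) by (simp add: field_simps)
      finally show ?thesis .
    qed
    show ?thesis
      unfolding \<theta> log_mixture[OF w s, of m1 m2 "fst (xs i)" "snd (xs i)" c] p q T_def zed_def P_def[symmetric] S_def[symmetric]
        a1_def[symmetric] a2_def[symmetric] u1_def[symmetric] u2_def[symmetric] by simp
  qed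
  have "loglik n (\<lambda>i. unorder (xs i)) \<theta> - loglik n (\<lambda>i. unorder (xs i)) (c, c, w, w, 0) = (\<Sum>i<fst x. T (snd x i))"
    unfolding loglik_unorder sum_subtractf[symmetric] pt fx(1) ..
  also have "\<dots> = real n * avg x T" using sum_eq_avg[OF fx(2), of T] unfolding fx(1) .
  also have "avg x T = Hs x (par_of c w \<theta>)"
  proof -
    have aS: "avg x S = 0"
    proof -
      have S': "S z = 1 / ssd x * mon 0 1 z - smean x / ssd x" for z unfolding S_def mon_def by (simp add: diff_divide_distrib)
      have "avg x S = avg x (\<lambda>z. 1 / ssd x * mon 0 1 z - smean x / ssd x)" unfolding S'[abs_def] ..
      also have "\<dots> = 1 / ssd x * smean x - smean x / ssd x" unfolding avg_diff avg_cmult avg_const[OF fx(2)] smean_def ..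
      finally show ?thesis by simp
    qed
    have aPS: "avg x (\<lambda>z. (P z)\<^sup>2 + (S z)\<^sup>2) = 2"
    proof -
      have pt2: "(P z)\<^sup>2 + (S z)\<^sup>2 = 1 / (ssd x)\<^sup>2 * (mon 2 0 z + mon 0 2 z - 2 * smean x * mon 0 1 z + (smean x)\<^sup>2)" for z
        unfolding P_def S_def mon_def power_divide by (simp add: power2_diff add_divide_distrib diff_divide_distrib)
      have "avg x (\<lambda>z. (P z)\<^sup>2 + (S z)\<^sup>2) = 1 / (ssd x)\<^sup>2 * (avg x (mon 2 0) + avg x (mon 0 2) - 2 * smean x * smean x + (smean x)\<^sup>2)"
        unfolding pt2 avg_cmult avg_add avg_diff avg_const[OF fx(2)] smean_def ..
      also have "avg x (mon 2 0) + avg x (mon 0 2) - 2 * smean x * smean x + (smean x)\<^sup>2 = 2 * svar x"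
        unfolding svar_def by (simp add: power2_eq_square)
      also have "svar x = (ssd x)\<^sup>2" using v unfolding ssd_def by simp
      finally show ?thesis using v by simp
    qed
    have T': "T z = (- g_full a1 a2 u1 u2 + ((a1 + a2) / 2 - 1)) - ((a1 + a2) / 2 - 1) / 2 * ((P z)\<^sup>2 + (S z)\<^sup>2) + sqrt 2 * ((a1 * u1 + a2 * u2) / 2) * S z
     + lncosh (zed x ((a2 - a1) / 2) ((a1 * u1 - a2 * u2) / 2) z)" for z
      unfolding T_def by (simp add: field_simps)
    have "avg x T = (- g_full a1 a2 u1 u2 + ((a1 + a2) / 2 - 1)) - ((a1 + a2) / 2 - 1) / 2 * 2 + sqrt 2 * ((a1 * u1 + a2 * u2) / 2) * 0
        + J x ((a2 - a1) / 2) ((a1 * u1 - a2 * u2) / 2)"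
    proof -
      have "avg x T = avg x (\<lambda>z. (- g_full a1 a2 u1 u2 + ((a1 + a2) / 2 - 1)) - ((a1 + a2) / 2 - 1) / 2 * ((P z)\<^sup>2 + (S z)\<^sup>2) + sqrt 2 * ((a1 * u1 + a2 * u2) / 2) * S z
         + lncosh (zed x ((a2 - a1) / 2) ((a1 * u1 - a2 * u2) / 2) z))" unfolding T'[abs_def] ..
      also have "\<dots> = avg x (\<lambda>z. - g_full a1 a2 u1 u2 + ((a1 + a2) / 2 - 1)) - ((a1 + a2) / 2 - 1) / 2 * avg x (\<lambda>z. (P z)\<^sup>2 + (S z)\<^sup>2)
         + sqrt 2 * ((a1 * u1 + a2 * u2) / 2) * avg x S + J x ((a2 - a1) / 2) ((a1 * u1 - a2 * u2) / 2)"
        unfolding J_def avg_add[of x "\<lambda>z. _ z - _ z + _ z"] avg_add[of x "\<lambda>z. _ - _ z"] avg_diff[of x "\<lambda>_. _"] avg_cmult ..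
      finally show ?thesis unfolding aS aPS avg_const[OF fx(2)] .
    qed
    also have "\<dots> = Hs x (par_of c w \<theta>)"
      unfolding Hs_def par_of_def \<theta> prod.case a1_def[symmetric] a2_def[symmetric] u1_def[symmetric] u2_def[symmetric] by (simp add: field_simps)
    finally show ?thesis .
  qed
  finally show ?thesis .
qed

text \<open>Under the null model \<open>J\<close> is zero and \<open>g_full\<close> equals
  \<open>a - 1 - ln a + a * u\<^sup>2\<close>, which is nonnegative. So
  \<open>(c, c, w, w, 0)\<close> maximises the null likelihood, and every null maximiser has the
  same likelihood value.\<close>

lemma Hs_check_nonpos:
  assumes "\<theta> \<in> Theta_check" "w > 0" shows "Hs x (par_of c w \<theta>) \<le> 0"
proof -
  obtain m s where \<theta>: "\<theta> = (m, m, s, s, 0)" "0 < s" using assms(1) by (auto simp: Theta_check_def)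
  define a u where "a = w\<^sup>2 / s\<^sup>2" and "u = (m - c) / w"
  have a: "a > 0" using assms(2) \<theta> by (simp add: a_def)
  have p: "par_of c w \<theta> = (a, a, u, u)" by (simp add: \<theta> par_of_def a_def u_def)
  have "Hs x (a, a, u, u) = - g_full a a u u" by (simp add: Hs_def J_def zed_def avg_def)
  also have "g_full a a u u = a - 1 - ln a + a * u\<^sup>2" unfolding g_full_def using a by (simp add: ln_mult)
  also have "- \<dots> \<le> 0" using ln_le_minus_one[OF a] a zero_le_power2[of u] mult_nonneg_nonneg[of a "u\<^sup>2"] by linarith
  finally show ?thesis unfolding p .
qed

lemma Theta_check_subset: "Theta_check \<subseteq> Theta_of False"
  by (auto simp: Theta_check_def Theta_of_iff)

lemma Theta_of_subset: "Theta_of eq \<subseteq> Theta_of False"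
  by (auto simp: Theta_of_iff)

section \<open>From the new parameters back to means and standard deviations\<close>

lemma inv_sqrt_close: "a \<ge> 1/4 \<Longrightarrow> \<bar>1 / sqrt a - 1\<bar> \<le> 2 * \<bar>a - 1\<bar>" and inv_sqrt_le: "a \<ge> 1/4 \<Longrightarrow> 1 / sqrt a \<le> 2" for a :: real
proof -
  assume a: "a \<ge> 1/4"
  have s: "sqrt a \<ge> 1/2" by (rule real_le_rsqrt) (use a in \<open>simp add: power_divide\<close>)
  have "sqrt a > 0" using s by linarith
  then show "1 / sqrt a \<le> 2" using s by (simp add: pos_divide_le_eq)
  have sq: "sqrt a * sqrt a = a" using a by simp
  have eqT: "\<bar>1 / sqrt a - 1\<bar> * (sqrt a * (1 + sqrt a)) = \<bar>a - 1\<bar>"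
  proof -
    have "(1 / r - 1) * (r * (1 + r)) = (1 - r) * (1 + r)" if "r > 0" for r :: real
      using that by (simp add: field_simps)
    from this[OF \<open>sqrt a > 0\<close>]
    have "(1 / sqrt a - 1) * (sqrt a * (1 + sqrt a)) = (1 - sqrt a) * (1 + sqrt a)" .
    also have "\<dots> = 1 - a" using sq by (simp add: algebra_simps)
    finally have "\<bar>(1 / sqrt a - 1) * (sqrt a * (1 + sqrt a))\<bar> = \<bar>1 - a\<bar>" by simp
    then show ?thesis using s by (simp add: abs_mult abs_minus_commute)
  qed
  have "1/2 \<le> sqrt a * (1 + sqrt a)"
    using mult_mono[of "1/2" "sqrt a" 1 "1 + sqrt a"] s a by simp
  then have "\<bar>1 / sqrt a - 1\<bar> * (1/2) \<le> \<bar>1 / sqrt a - 1\<bar> * (sqrt a * (1 + sqrt a))" by (rule mult_left_mono) simp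
  then have "\<bar>1 / sqrt a - 1\<bar> * (1/2) \<le> \<bar>a - 1\<bar>" unfolding eqT .
  then show "\<bar>1 / sqrt a - 1\<bar> \<le> 2 * \<bar>a - 1\<bar>" by argo
qed

lemma sum3_sq_le: "(a + b + c)\<^sup>2 \<le> 3 * (a\<^sup>2 + b\<^sup>2 + (c::real)\<^sup>2)"
proof -
  have "3 * (a\<^sup>2 + b\<^sup>2 + c\<^sup>2) - (a + b + c)\<^sup>2 = (a - b)\<^sup>2 + (b - c)\<^sup>2 + (a - c)\<^sup>2" by algebra
  moreover have "0 \<le> (a - b)\<^sup>2 + (b - c)\<^sup>2 + (a - c)\<^sup>2" by simp
  ultimately show ?thesis by linarith
qed

lemma scaled_sq_le:
  fixes r t B :: real
  assumes "r \<ge> 1" "r * \<bar>t\<bar> \<le> B" shows "r * t\<^sup>2 \<le> B\<^sup>2"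
proof -
  have "r * t\<^sup>2 \<le> r * (r * t\<^sup>2)" using assms(1) mult_right_mono[of 1 r "r * t\<^sup>2"] by simp
  also have "\<dots> = (r * \<bar>t\<bar>)\<^sup>2" by (simp add: power_mult_distrib power2_eq_square)
  also have "\<dots> \<le> B\<^sup>2" using assms by (intro power_mono) auto
  finally show ?thesis .
qed

context net_filter
begin

text \<open>A mean is \<open>c + w * u\<close>, where \<open>c - \<mu>\<close> is of order
  \<open>1/sqrt n\<close> but \<open>u\<close> only of its square root. A standard deviation is
  \<open>\<sigma> * ssd x\<close> over the root of \<open>a1\<close> or \<open>a2\<close>; these
  differ from \<open>a\<close> by \<open>\<alpha>\<close>, which causes the slow rate. With equal
  standard deviations \<open>\<alpha> = 0\<close> and the fast rate returns.\<close>

lemma estimator_asymptotics: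
  assumes \<sigma>: "\<sigma> > 0"
  shows "\<exists>C. \<forall>e>0. eventually (\<lambda>x. \<forall>xs m1 m2 s1 s2 r \<theta>c. x = samp \<mu> \<sigma> (fst x) xs \<longrightarrow>
     is_maximizer (loglik (fst x) (\<lambda>i. unorder (xs i))) (Theta_of eq) (m1, m2, s1, s2, r) \<longrightarrow>
     is_maximizer (loglik (fst x) (\<lambda>i. unorder (xs i))) Theta_check \<theta>c \<longrightarrow>
     \<bar>2 * (loglik (fst x) (\<lambda>i. unorder (xs i)) (m1, m2, s1, s2, r) - loglik (fst x) (\<lambda>i. unorder (xs i)) \<theta>c) - Rlim eq (V1 x, V2 x, V3 x)\<bar> \<le> e \<and>
     rn x * (m1 - \<mu>)\<^sup>2 \<le> C \<and> rn x * (m2 - \<mu>)\<^sup>2 \<le> C \<and> rn x * (s1 - \<sigma>)\<^sup>2 \<le> C \<and> rn x * (s2 - \<sigma>)\<^sup>2 \<le> C \<and> (eq \<longrightarrow> rn x * \<bar>s1 - \<sigma>\<bar> \<le> C)) F"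
proof -
  obtain C where C: "\<And>e. e > 0 \<Longrightarrow> eventually (\<lambda>x. \<forall>a1 a2 u1 u2. (a1, a2, u1, u2) \<in> par_set eq \<longrightarrow>
     (\<forall>p\<in>par_set eq. Hs x p \<le> Hs x (a1, a2, u1, u2)) \<longrightarrow>
     \<bar>2 * real (fst x) * Hs x (a1, a2, u1, u2) - Rlim eq (V1 x, V2 x, V3 x)\<bar> \<le> e \<and>
     rn x * ((a2 - a1) / 2)\<^sup>2 \<le> C \<and> rn x * \<bar>(a1 + a2) / 2 - 1\<bar> \<le> C \<and> u2 = - u1 \<and> rn x * u1\<^sup>2 \<le> C
     \<and> a1 \<ge> 1/4 \<and> a2 \<ge> 1/4) F"
    using maximizer_asymptotics[of eq] by blast
  define C2 where "C2 = max (\<sigma>\<^sup>2 * (K\<^sup>2 + 8 * C)) (max (\<sigma>\<^sup>2 * (12 * ((2*K)\<^sup>2 + C\<^sup>2 + C))) (\<sigma> * (4 * K + 2 * C)))"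
  show ?thesis
  proof (intro exI[of _ C2] allI impI)
    fix e :: real assume e: "e > 0"
    have "eventually (\<lambda>x. \<bar>ssd x - 1\<bar> < 1) F" by (rule eventually_small[OF ssd_lim]) simp
    with C[OF e] ev_ssd ev_mean_bound ev_svar_bound ev_n[of 1]
    show "eventually (\<lambda>x. \<forall>xs m1 m2 s1 s2 r \<theta>c. x = samp \<mu> \<sigma> (fst x) xs \<longrightarrow>
     is_maximizer (loglik (fst x) (\<lambda>i. unorder (xs i))) (Theta_of eq) (m1, m2, s1, s2, r) \<longrightarrow>
     is_maximizer (loglik (fst x) (\<lambda>i. unorder (xs i))) Theta_check \<theta>c \<longrightarrow>
     \<bar>2 * (loglik (fst x) (\<lambda>i. unorder (xs i)) (m1, m2, s1, s2, r) - loglik (fst x) (\<lambda>i. unorder (xs i)) \<theta>c) - Rlim eq (V1 x, V2 x, V3 x)\<bar> \<le> e \<and>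
     rn x * (m1 - \<mu>)\<^sup>2 \<le> C2 \<and> rn x * (m2 - \<mu>)\<^sup>2 \<le> C2 \<and> rn x * (s1 - \<sigma>)\<^sup>2 \<le> C2 \<and> rn x * (s2 - \<sigma>)\<^sup>2 \<le> C2 \<and> (eq \<longrightarrow> rn x * \<bar>s1 - \<sigma>\<bar> \<le> C2)) F"
    proof eventually_elim
      case (elim x)
      have r1: "rn x \<ge> 1" using elim(5) by simp
      have v: "ssd x > 0" "ssd x \<le> 2" using elim(2,6) by linarith+
      show ?case
      proof (intro allI impI)
        fix xs m1 m2 s1 s2 r \<theta>c
        let ?l = "loglik (fst x) (\<lambda>i. unorder (xs i))"
        assume x: "x = samp \<mu> \<sigma> (fst x) xs"
          and mx: "is_maximizer ?l (Theta_of eq) (m1, m2, s1, s2, r)"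
          and mc: "is_maximizer ?l Theta_check \<theta>c"
        define c w where "c = \<mu> + \<sigma> * smean x / sqrt 2" and "w = \<sigma> * ssd x"
        have w: "w > 0" using \<sigma> v by (simp add: w_def)
        have lH: "?l \<theta> - ?l (c, c, w, w, 0) = real (fst x) * Hs x (par_of c w \<theta>)" if "\<theta> \<in> Theta_of False" for \<theta>
        proof -
          have xx: "samp \<mu> \<sigma> (fst x) xs = x" using x by simp
          show ?thesis
            using loglik_Hs[OF \<sigma> _ that, of "fst x" \<mu> xs] elim(5) v(1) unfolding xx c_def w_def by simp
        qed
        have in_c: "(c, c, w, w, 0) \<in> Theta_check" using w by (simp add: Theta_check_def)
        have tc: "\<theta>c \<in> Theta_check" "?l (c, c, w, w, 0) \<le> ?l \<theta>c" using mc in_c unfolding is_maximizer_def by blast+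
        have "?l \<theta>c - ?l (c, c, w, w, 0) \<le> 0"
        proof -
          have "real (fst x) * Hs x (par_of c w \<theta>c) \<le> 0"
            using Hs_check_nonpos[OF tc(1) w, of x c] by (simp add: mult_nonneg_nonpos)
          then show ?thesis using lH Theta_check_subset tc(1) by fastforce
        qed
        \<comment> \<open>Any maximiser of the null likelihood may be replaced by the explicit null
          fit, since only its likelihood value enters.\<close>
        then have lc: "?l \<theta>c = ?l (c, c, w, w, 0)" using tc(2) by linarith
        have th: "(m1, m2, s1, s2, r) \<in> Theta_of eq" using mx unfolding is_maximizer_def by blast
        then have s: "0 < s1" "0 < s2" "r = 0" "eq \<longrightarrow> s1 = s2" by (auto simp: Theta_of_iff)
        define a1 a2 u1 u2 where "a1 = w\<^sup>2 / s1\<^sup>2" and "a2 = w\<^sup>2 / s2\<^sup>2" and "u1 = (m1 - c) / w" and "u2 = (m2 - c) / w"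
        have po: "par_of c w (m1, m2, s1, s2, r) = (a1, a2, u1, u2)" by (simp add: par_of_def a1_def a2_def u1_def u2_def)
        have par: "(a1, a2, u1, u2) \<in> par_set eq" using par_of_in[OF w th, of c] unfolding po .
        have L: "?l (m1, m2, s1, s2, r) - ?l (c, c, w, w, 0) = real (fst x) * Hs x (a1, a2, u1, u2)"
          using lH[of "(m1, m2, s1, s2, r)"] th Theta_of_subset unfolding po by blast
        have max: "\<forall>p\<in>par_set eq. Hs x p \<le> Hs x (a1, a2, u1, u2)"
        proof
          fix p assume "p \<in> par_set eq"
          then obtain \<theta> where \<theta>: "\<theta> \<in> Theta_of eq" "par_of c w \<theta> = p" using par_of_surj[OF w] by blast
          have "?l \<theta> \<le> ?l (m1, m2, s1, s2, r)" using mx \<theta>(1) unfolding is_maximizer_def by blast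
          moreover have "?l \<theta> - ?l (c, c, w, w, 0) = real (fst x) * Hs x p"
            using lH[of \<theta>] \<theta> Theta_of_subset by blast
          ultimately have "real (fst x) * Hs x p \<le> real (fst x) * Hs x (a1, a2, u1, u2)" using L by linarith
          then show "Hs x p \<le> Hs x (a1, a2, u1, u2)" using elim(5) by simp
        qed
        note A = elim(1)[rule_format, OF par max[rule_format]]
        have R: "\<bar>2 * (?l (m1, m2, s1, s2, r) - ?l \<theta>c) - Rlim eq (V1 x, V2 x, V3 x)\<bar> \<le> e"
          unfolding lc L using conjunct1[OF A] by (simp only: mult.assoc)
        have m: "m1 = c + w * u1" "m2 = c + w * u2" using w by (simp_all add: u1_def u2_def)
        have cm: "rn x * (c - \<mu>)\<^sup>2 \<le> \<sigma>\<^sup>2 * K\<^sup>2 / 2"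
        proof -
          have "rn x * (smean x)\<^sup>2 \<le> K\<^sup>2" using elim(3) r1 by (intro scaled_sq_le) (auto simp: abs_mult)
          then have "\<sigma>\<^sup>2 / 2 * (rn x * (smean x)\<^sup>2) \<le> \<sigma>\<^sup>2 / 2 * K\<^sup>2" by (intro mult_left_mono) auto
          then show ?thesis unfolding c_def by (simp add: power_divide power_mult_distrib mult_ac)
        qed
        have mu: "rn x * (c + w * u - \<mu>)\<^sup>2 \<le> \<sigma>\<^sup>2 * (K\<^sup>2 + 8 * C)" if "rn x * u\<^sup>2 \<le> C" for u
        proof -
          have "w\<^sup>2 \<le> \<sigma>\<^sup>2 * 4" unfolding w_def power_mult_distrib
            using power_mono[OF v(2), of 2] v(1) by (intro mult_left_mono) auto
          then have "w\<^sup>2 * (rn x * u\<^sup>2) \<le> \<sigma>\<^sup>2 * 4 * C" using that r1 by (intro mult_mono) auto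
          moreover have "(c + w * u - \<mu>)\<^sup>2 \<le> 2 * (c - \<mu>)\<^sup>2 + 2 * (w * u)\<^sup>2"
          proof -
            have "2 * (c - \<mu>)\<^sup>2 + 2 * (w * u)\<^sup>2 - (c + w * u - \<mu>)\<^sup>2 = (c - \<mu> - w * u)\<^sup>2" by algebra
            then show ?thesis by (smt (verit) zero_le_power2)
          qed
          then have "rn x * (c + w * u - \<mu>)\<^sup>2 \<le> rn x * (2 * (c - \<mu>)\<^sup>2 + 2 * (w * u)\<^sup>2)" using r1 by (intro mult_left_mono) auto
          moreover have "rn x * (2 * (c - \<mu>)\<^sup>2 + 2 * (w * u)\<^sup>2) = 2 * (rn x * (c - \<mu>)\<^sup>2) + 2 * (w\<^sup>2 * (rn x * u\<^sup>2))"
            by (simp add: algebra_simps power_mult_distrib)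
          ultimately have "rn x * (c + w * u - \<mu>)\<^sup>2 \<le> 2 * (\<sigma>\<^sup>2 * K\<^sup>2 / 2) + 2 * (\<sigma>\<^sup>2 * 4 * C)" using cm by linarith
          then show ?thesis by (simp add: algebra_simps)
        qed
        have M: "rn x * (m1 - \<mu>)\<^sup>2 \<le> C2" "rn x * (m2 - \<mu>)\<^sup>2 \<le> C2"
          using mu[of u1] mu[of u2] A unfolding m C2_def by (simp_all add: le_max_iff_disj)
        have ss: "\<bar>ssd x - 1\<bar> \<le> \<bar>svar x - 1\<bar>"
        proof -
          have "svar x - 1 = (ssd x - 1) * (ssd x + 1)" using ssd_sq[OF v(1)] by (simp add: power2_eq_square algebra_simps)
          then have "\<bar>svar x - 1\<bar> = \<bar>ssd x - 1\<bar> * (ssd x + 1)" using v by (simp add: abs_mult)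
          then show ?thesis using v mult_left_mono[of 1 "ssd x + 1" "\<bar>ssd x - 1\<bar>"] by simp
        qed
        have sd: "\<bar>s - \<sigma>\<bar> \<le> \<sigma> * (2 * \<bar>svar x - 1\<bar> + 2 * \<bar>a - 1\<bar>)" if "s > 0" "a = w\<^sup>2 / s\<^sup>2" "a \<ge> 1/4" for s a
        proof -
          have "sqrt a = w / s" unfolding that(2) using w that(1) by (simp add: real_sqrt_divide)
          moreover from this have "sqrt a \<noteq> 0" using w that(1) by simp
          ultimately have "s = \<sigma> * (ssd x * (1 / sqrt a))" using that(1) by (simp add: w_def field_simps)
          then have "s - \<sigma> = \<sigma> * ((ssd x - 1) * (1 / sqrt a) + (1 / sqrt a - 1))"
            by (simp add: algebra_simps add_divide_distrib diff_divide_distrib)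
          then have "\<bar>s - \<sigma>\<bar> = \<sigma> * \<bar>(ssd x - 1) * (1 / sqrt a) + (1 / sqrt a - 1)\<bar>" using \<sigma> by (simp add: abs_mult)
          also have "\<dots> \<le> \<sigma> * (2 * \<bar>svar x - 1\<bar> + 2 * \<bar>a - 1\<bar>)"
          proof (rule mult_left_mono)
            have "\<bar>(ssd x - 1) * (1 / sqrt a)\<bar> \<le> \<bar>svar x - 1\<bar> * 2"
              unfolding abs_mult using ss inv_sqrt_le[OF that(3)] that(3) by (intro mult_mono) auto
            then show "\<bar>(ssd x - 1) * (1 / sqrt a) + (1 / sqrt a - 1)\<bar> \<le> 2 * \<bar>svar x - 1\<bar> + 2 * \<bar>a - 1\<bar>"
              using inv_sqrt_close[OF that(3)] abs_triangle_ineq[of "(ssd x - 1) * (1 / sqrt a)" "1 / sqrt a - 1"] by linarith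
          qed (use \<sigma> in simp)
          finally show ?thesis .
        qed
        define ab al where "ab = (a1 + a2) / 2" and "al = (a2 - a1) / 2"
        have svK: "rn x * \<bar>svar x - 1\<bar> \<le> 2 * K" using elim(4) by (simp add: abs_mult)
        have sq2: "(a * (2 * t))\<^sup>2 = a\<^sup>2 * (4 * t\<^sup>2)" for a t :: real by algebra
        have S: "rn x * (s - \<sigma>)\<^sup>2 \<le> C2" if "s > 0" "a = w\<^sup>2 / s\<^sup>2" "a \<ge> 1/4" "\<bar>a - 1\<bar> \<le> \<bar>ab - 1\<bar> + \<bar>al\<bar>" for s a
        proof -
          have "\<bar>s - \<sigma>\<bar> \<le> \<sigma> * (2 * (\<bar>svar x - 1\<bar> + \<bar>ab - 1\<bar> + \<bar>al\<bar>))"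
            using sd[OF that(1-3)] that(4) \<sigma> by (elim order_trans) (intro mult_left_mono, auto)
          then have "\<bar>s - \<sigma>\<bar>\<^sup>2 \<le> (\<sigma> * (2 * (\<bar>svar x - 1\<bar> + \<bar>ab - 1\<bar> + \<bar>al\<bar>)))\<^sup>2" by (rule power_mono) simp
          also have "\<dots> = \<sigma>\<^sup>2 * (4 * (\<bar>svar x - 1\<bar> + \<bar>ab - 1\<bar> + \<bar>al\<bar>)\<^sup>2)"
            by (rule sq2)
          also have "\<dots> \<le> \<sigma>\<^sup>2 * (4 * (3 * (\<bar>svar x - 1\<bar>\<^sup>2 + \<bar>ab - 1\<bar>\<^sup>2 + \<bar>al\<bar>\<^sup>2)))" by (intro mult_left_mono sum3_sq_le) auto
          finally have "(s - \<sigma>)\<^sup>2 \<le> \<sigma>\<^sup>2 * (12 * ((svar x - 1)\<^sup>2 + (ab - 1)\<^sup>2 + al\<^sup>2))" by simp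
          then have "rn x * (s - \<sigma>)\<^sup>2 \<le> rn x * (\<sigma>\<^sup>2 * (12 * ((svar x - 1)\<^sup>2 + (ab - 1)\<^sup>2 + al\<^sup>2)))" using r1 by (intro mult_left_mono) auto
          also have "\<dots> = \<sigma>\<^sup>2 * (12 * (rn x * (svar x - 1)\<^sup>2 + rn x * (ab - 1)\<^sup>2 + rn x * al\<^sup>2))" by (simp add: algebra_simps)
          also have "\<dots> \<le> \<sigma>\<^sup>2 * (12 * ((2*K)\<^sup>2 + C\<^sup>2 + C))"
            using A scaled_sq_le[OF r1 svK] scaled_sq_le[OF r1, of "ab - 1" C] unfolding ab_def al_def
            by (intro mult_left_mono add_mono) auto
          finally show ?thesis unfolding C2_def by (simp add: le_max_iff_disj)
        qed
        have a12: "\<bar>a1 - 1\<bar> \<le> \<bar>ab - 1\<bar> + \<bar>al\<bar>" "\<bar>a2 - 1\<bar> \<le> \<bar>ab - 1\<bar> + \<bar>al\<bar>"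
        proof -
          have "a1 - 1 = (ab - 1) - al" "a2 - 1 = (ab - 1) + al" by (simp_all add: ab_def al_def field_simps)
          then show "\<bar>a1 - 1\<bar> \<le> \<bar>ab - 1\<bar> + \<bar>al\<bar>" "\<bar>a2 - 1\<bar> \<le> \<bar>ab - 1\<bar> + \<bar>al\<bar>" by linarith+
        qed
        have S12: "rn x * (s1 - \<sigma>)\<^sup>2 \<le> C2" "rn x * (s2 - \<sigma>)\<^sup>2 \<le> C2"
          using S[OF s(1) a1_def _ a12(1)] S[OF s(2) a2_def _ a12(2)] A by blast+
        have S3: "rn x * \<bar>s1 - \<sigma>\<bar> \<le> C2" if eq
        proof -
          have a: "a1 = a2" using par that by (auto simp: par_set_def)
          then have ab1: "rn x * \<bar>a1 - 1\<bar> \<le> C" using A by simp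
          have "rn x * \<bar>s1 - \<sigma>\<bar> \<le> rn x * (\<sigma> * (2 * \<bar>svar x - 1\<bar> + 2 * \<bar>a1 - 1\<bar>))"
            using sd[OF s(1) a1_def] A r1 by (intro mult_left_mono) auto
          also have "\<dots> = \<sigma> * (2 * (rn x * \<bar>svar x - 1\<bar>) + 2 * (rn x * \<bar>a1 - 1\<bar>))" by (simp add: algebra_simps)
          also have "\<dots> \<le> \<sigma> * (4 * K + 2 * C)" using svK ab1 \<sigma> by (intro mult_left_mono) auto
          finally show ?thesis unfolding C2_def by (simp add: le_max_iff_disj)
        qed
        show "\<bar>2 * (?l (m1, m2, s1, s2, r) - ?l \<theta>c) - Rlim eq (V1 x, V2 x, V3 x)\<bar> \<le> e \<and>
     rn x * (m1 - \<mu>)\<^sup>2 \<le> C2 \<and> rn x * (m2 - \<mu>)\<^sup>2 \<le> C2 \<and> rn x * (s1 - \<sigma>)\<^sup>2 \<le> C2 \<and> rn x * (s2 - \<sigma>)\<^sup>2 \<le> C2 \<and> (eq \<longrightarrow> rn x * \<bar>s1 - \<sigma>\<bar> \<le> C2)"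
          using R M S12 S3 by blast
      qed
    qed
  qed
qed

end

subsection \<open>The limit laws\<close>

lemma poly_bdd_add:
  assumes "poly_bdd f" "poly_bdd g" shows "poly_bdd (\<lambda>z. f z + g z)"
proof -
  obtain C D where "f \<in> borel_measurable borel" "g \<in> borel_measurable borel"
    and C: "\<And>z. \<bar>f z\<bar> \<le> C * ((1 + (fst z)\<^sup>2)^4 * (1 + (snd z)\<^sup>2)^4)" and D: "\<And>z. \<bar>g z\<bar> \<le> D * ((1 + (fst z)\<^sup>2)^4 * (1 + (snd z)\<^sup>2)^4)"
    using assms unfolding poly_bdd_def by blast
  moreover have "\<bar>f z + g z\<bar> \<le> (C + D) * ((1 + (fst z)\<^sup>2)^4 * (1 + (snd z)\<^sup>2)^4)" for z
    using C[of z] D[of z] abs_triangle_ineq[of "f z" "g z"] unfolding distrib_right by linarith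
  ultimately show ?thesis unfolding poly_bdd_def by (intro conjI borel_measurable_add exI[of _ "C + D"]) auto
qed

lemma poly_bdd_cmult:
  assumes "poly_bdd f" shows "poly_bdd (\<lambda>z. c * f z)"
proof -
  obtain C where "f \<in> borel_measurable borel"
    and C: "\<And>z. \<bar>f z\<bar> \<le> C * ((1 + (fst z)\<^sup>2)^4 * (1 + (snd z)\<^sup>2)^4)"
    using assms unfolding poly_bdd_def by blast
  moreover have "\<bar>c * f z\<bar> \<le> (\<bar>c\<bar> * C) * ((1 + (fst z)\<^sup>2)^4 * (1 + (snd z)\<^sup>2)^4)" for z
    unfolding abs_mult mult.assoc using C[of z] by (intro mult_left_mono) auto
  ultimately show ?thesis unfolding poly_bdd_def by (intro conjI borel_measurable_times exI[of _ "\<bar>c\<bar> * C"]) auto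
qed

text \<open>The family \<open>Fs\<close> is fixed before \<open>K\<close>. Enlarging
  \<open>K\<close> later raises the probability of a good sample without changing the functions
  being controlled.\<close>

lemma exists_net:
  "\<exists>Fs \<eta> \<epsilon>. finite Fs \<and> (\<forall>f\<in>Fs. poly_bdd f) \<and> (\<forall>K\<ge>0. net_filter Fs K \<eta> \<epsilon>)"
proof -
  obtain \<eta> where \<eta>: "\<eta> > 0" "\<And>\<alpha> \<beta> a. \<delta>_loc \<le> \<alpha>\<^sup>2 + \<beta>\<^sup>2 \<Longrightarrow> \<alpha>\<^sup>2 + \<beta>\<^sup>2 \<le> 10001 \<Longrightarrow> \<bar>\<alpha>\<bar> < a \<Longrightarrow> L_pop \<alpha> \<beta> + \<eta> \<le> g_prof a \<alpha> \<beta>"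
    using L_pop_gap[OF \<delta>_loc(1), of 10001] by blast
  define \<epsilon> where "\<epsilon> = \<eta> / (4 * (EZ f_lip + 1))"
  have p: "0 < 4 * (EZ f_lip + 1)" using EZ_lip_nonneg by simp
  then have \<epsilon>: "\<epsilon> > 0" "\<epsilon> * (4 * (EZ f_lip + 1)) = \<eta>" using \<eta>(1) unfolding \<epsilon>_def by auto
  have "compact {z :: real \<times> real. (fst z)\<^sup>2 + (snd z)\<^sup>2 \<le> 10001}"
  proof -
    have "{z :: real \<times> real. (fst z)\<^sup>2 + (snd z)\<^sup>2 \<le> 10001} = cball 0 (sqrt 10001)"
    proof (intro set_eqI)
      fix z :: "real \<times> real"
      have "norm z \<le> sqrt 10001 \<longleftrightarrow> (fst z)\<^sup>2 + (snd z)\<^sup>2 \<le> 10001"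
        by (cases z) (simp add: norm_Pair)
      then show "z \<in> {z. (fst z)\<^sup>2 + (snd z)\<^sup>2 \<le> 10001} \<longleftrightarrow> z \<in> cball 0 (sqrt 10001)" by simp
    qed
    then show ?thesis by simp
  qed
  then obtain G where G: "finite G" "{z :: real \<times> real. (fst z)\<^sup>2 + (snd z)\<^sup>2 \<le> 10001} \<subseteq> (\<Union>x\<in>G. ball x (\<epsilon>/2))"
    unfolding compact_eq_totally_bounded using half_gt_zero[OF \<epsilon>(1)] by meson
  define Fs where "Fs = base_funs \<union> (\<lambda>z. f_lnc (fst z) (snd z)) ` G"
  have "finite base_funs" by (simp add: base_funs_def)
  then have "finite Fs" using G(1) by (simp add: Fs_def)
  moreover have "\<forall>f\<in>Fs. poly_bdd f" using poly_bdd_base poly_bdd_lnc by (auto simp: Fs_def)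
  moreover have "net_filter Fs K \<eta> \<epsilon>" if "K \<ge> 0" for K
  proof
    show "base_funs \<subseteq> Fs" by (auto simp: Fs_def)
    fix \<alpha> \<beta> assume "q2 \<alpha> \<beta> \<le> 10001"
    then have "(\<alpha>, \<beta>) \<in> {z. (fst z)\<^sup>2 + (snd z)\<^sup>2 \<le> 10001}" by (simp add: q2_def)
    then have "(\<alpha>, \<beta>) \<in> (\<Union>x\<in>G. ball x (\<epsilon>/2))" using G(2) by blast
    then obtain z where z: "z \<in> G" "dist z (\<alpha>, \<beta>) < \<epsilon>/2" by auto
    have "\<bar>\<alpha> - fst z\<bar> + \<bar>\<beta> - snd z\<bar> \<le> \<epsilon>"
      using dist_fst_le[of z "(\<alpha>, \<beta>)"] dist_snd_le[of z "(\<alpha>, \<beta>)"] z(2) by (simp add: dist_real_def abs_minus_commute)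
    then show "\<exists>\<alpha>0 \<beta>0. f_lnc \<alpha>0 \<beta>0 \<in> Fs \<and> \<bar>\<alpha> - \<alpha>0\<bar> + \<bar>\<beta> - \<beta>0\<bar> \<le> \<epsilon>"
      using z(1) by (auto simp: Fs_def)
  qed (use that \<epsilon> \<eta> in \<open>auto simp: q2_def\<close>)
  ultimately show ?thesis by blast
qed

text \<open>The function whose normalised sums are the inner products of \<open>(V1, V2, V3)\<close> with
  \<open>(t1, t2, t3)\<close>.\<close>

definition f_lin :: "real \<Rightarrow> real \<Rightarrow> real \<Rightarrow> real \<times> real \<Rightarrow> real" where
  "f_lin t1 t2 t3 z = (t1 - t2) / 2 * mon 2 0 z + (- (t1 + t2) / 2) * mon 0 2 z + t2 / 2 * mon 2 2 z + t2 / 2 * mon 0 0 z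
     + t3 / sqrt 2 * mon 2 1 z + (- t3 / sqrt 2) * mon 0 1 z"

lemma poly_bdd_lin: "poly_bdd (f_lin t1 t2 t3)"
  unfolding f_lin_def[abs_def] by (intro poly_bdd_add poly_bdd_cmult poly_bdd_mon) auto

lemma int_mon: "integrable std_normal2 (mon i j)"
  using moment2[of i j] unfolding mon_def[abs_def] has_bochner_integral_iff by simp

lemma mon_mult: "mon i j z * mon k l z = mon (i + k) (j + l) z"
  by (simp add: mon_def power_add mult_ac)

lemma EZ_lin: "EZ (f_lin t1 t2 t3) = 0"
  unfolding f_lin_def[abs_def] by (simp add: int_mon EZ_mon field_simps)

text \<open>This is the orthonormality of the three functions behind \<open>V1\<close>,
  \<open>V2\<close>, \<open>V3\<close>, and the reason why the limiting Gaussian vector has identity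
  covariance.\<close>

lemma EZ_lin_sq: "EZ (\<lambda>z. (f_lin t1 t2 t3 z)\<^sup>2) = t1\<^sup>2 + t2\<^sup>2 + t3\<^sup>2"
proof -
  have sq: "(c1 * a + c2 * b + c3 * c + c4 * d + c5 * e + c6 * f)\<^sup>2 =
     c1\<^sup>2 * (a*a) + c2\<^sup>2 * (b*b) + c3\<^sup>2 * (c*c) + c4\<^sup>2 * (d*d) + c5\<^sup>2 * (e*e) + c6\<^sup>2 * (f*f)
     + 2*c1*c2 * (a*b) + 2*c1*c3 * (a*c) + 2*c1*c4 * (a*d) + 2*c1*c5 * (a*e) + 2*c1*c6 * (a*f)
     + 2*c2*c3 * (b*c) + 2*c2*c4 * (b*d) + 2*c2*c5 * (b*e) + 2*c2*c6 * (b*f)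
     + 2*c3*c4 * (c*d) + 2*c3*c5 * (c*e) + 2*c3*c6 * (c*f) + 2*c4*c5 * (d*e) + 2*c4*c6 * (d*f) + 2*c5*c6 * (e*f)"
    for a b c d e f c1 c2 c3 c4 c5 c6 :: real by algebra
  define c1 c2 c3 c5 c6 where "c1 = (t1 - t2) / 2" and "c2 = - (t1 + t2) / 2" and "c3 = t2 / 2"
    and "c5 = t3 / sqrt 2" and "c6 = - t3 / sqrt 2"
  have m2: "std_mom (Suc (Suc 0)) = 1" using std_mom_values(3) by (simp only: numeral_2_eq_2)
  have "EZ (\<lambda>z. (f_lin t1 t2 t3 z)\<^sup>2) = 3 * c1\<^sup>2 + 3 * c2\<^sup>2 + 9 * c3\<^sup>2 + c3\<^sup>2 + 3 * c5\<^sup>2 + c6\<^sup>2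
     + 2*c1*c2 + 6*c1*c3 + 2*c1*c3 + 6*c2*c3 + 2*c2*c3 + 2*c3*c3 + 2*c5*c6"
    unfolding f_lin_def c1_def[symmetric] c2_def[symmetric] c3_def[symmetric] c5_def[symmetric] c6_def[symmetric] sq mon_mult
    by (simp add: int_mon EZ_mon m2)
  also have "\<dots> = t1\<^sup>2 + t2\<^sup>2 + t3\<^sup>2"
  proof -
    have c56: "c5\<^sup>2 = t3\<^sup>2 / 2" "c6\<^sup>2 = t3\<^sup>2 / 2" "c5 * c6 = - (t3\<^sup>2 / 2)"
      unfolding c5_def c6_def by (simp_all add: power_divide power2_eq_square)
    have "3 * c1\<^sup>2 + 3 * c2\<^sup>2 + 9 * c3\<^sup>2 + c3\<^sup>2 + 2*c1*c2 + 6*c1*c3 + 2*c1*c3 + 6*c2*c3 + 2*c2*c3 + 2*c3*c3 = t1\<^sup>2 + t2\<^sup>2"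
      unfolding c1_def c2_def c3_def by (simp add: power2_eq_square field_simps)
    moreover have "2*c5*c6 = 2 * (c5 * c6)" by simp
    ultimately show ?thesis using c56 by linarith
  qed
  finally show ?thesis .
qed

lemma gaussian3: "gaussian_like (std_normal \<Otimes>\<^sub>M (std_normal \<Otimes>\<^sub>M std_normal))
    (1 / sqrt (2 * pi) * (1 / sqrt (2 * pi) * (1 / sqrt (2 * pi))))"
  by (intro gaussian_like_pair gaussian_like_std_normal)

section \<open>The limiting functional and the chi-bar law\<close>

lemma Rlim_continuous: "continuous_on UNIV (Rlim eq)"
proof (rule continuous_onI)
  fix w :: "real \<times> real \<times> real" and e :: real assume "e > 0"
  obtain w1 w2 w3 where w: "w = (w1, w2, w3)" by (cases w)
  define K where "K = \<bar>w1\<bar> + \<bar>w2\<bar> + \<bar>w3\<bar> + 1"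
  have K: "K \<ge> 1" by (simp add: K_def)
  define d where "d = min 1 (e / (16 * K))"
  have d: "d > 0" "16 * K * d \<le> e"
  proof -
    show "d > 0" using \<open>e > 0\<close> K by (simp add: d_def)
    have "16 * K * d \<le> 16 * K * (e / (16 * K))" using K by (intro mult_left_mono) (auto simp: d_def)
    then show "16 * K * d \<le> e" using K by simp
  qed
  show "\<exists>d>0. \<forall>x'\<in>UNIV. dist x' w < d \<longrightarrow> dist (Rlim eq x') (Rlim eq w) \<le> e"
  proof (intro exI[of _ d] conjI ballI impI d)
    fix v :: "real \<times> real \<times> real" assume dv: "dist v w < d"
    obtain v1 v2 v3 where v: "v = (v1, v2, v3)" by (cases v)
    have "dist v1 w1 \<le> dist v w" "dist v2 w2 \<le> dist v w" "dist v3 w3 \<le> dist v w"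
      using dist_fst_le[of v w] dist_snd_le[of v w] dist_fst_le[of "snd v" "snd w"] dist_snd_le[of "snd v" "snd w"]
      by (auto simp: v w)
    then have dd: "\<bar>v1 - w1\<bar> \<le> d" "\<bar>v2 - w2\<bar> \<le> d" "\<bar>v3 - w3\<bar> \<le> d" using dv by (auto simp: dist_real_def)
    have "d \<le> 1" by (simp add: d_def)
    then have "\<bar>v1\<bar> \<le> K" "\<bar>v2\<bar> \<le> K" "\<bar>v3\<bar> \<le> K" "\<bar>w1\<bar> \<le> K" "\<bar>w2\<bar> \<le> K" "\<bar>w3\<bar> \<le> K" using dd unfolding K_def by linarith+
    then have "Rlim eq v \<le> Rlim eq w + 16 * K * d" "Rlim eq w \<le> Rlim eq v + 16 * K * d"
      unfolding v w using dd by (auto intro!: Rlim_close simp: abs_minus_commute)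
    then show "dist (Rlim eq v) (Rlim eq w) \<le> e" using d(2) unfolding dist_real_def abs_le_iff by linarith
  qed
qed

text \<open>In \<open>y = x1\<^sup>2\<close> the form is \<open>2 * y * w1 - y\<^sup>2\<close>,
  maximised over \<open>y \<ge> 0\<close> at \<open>y = max w1 0\<close>. The sign restriction on
  \<open>y\<close> produces the point mass at zero.\<close>

lemma Rlim_True: "Rlim True (w1, w2, w3) = (max w1 0)\<^sup>2"
proof (rule antisym)
  show "Rlim True (w1, w2, w3) \<le> (max w1 0)\<^sup>2"
  proof (rule Rlim_leI)
    fix x assume "x \<in> cone True"
    then obtain x1 where x: "x = (x1, 0)" by (cases x) (auto simp: cone_def)
    have q: "qform (w1, w2, w3) x = 2 * (x1\<^sup>2 * w1) - (x1\<^sup>2)\<^sup>2" by (simp add: x qform_def)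
    have "x1\<^sup>2 * w1 \<le> x1\<^sup>2 * max w1 0" by (intro mult_left_mono) auto
    moreover have "0 \<le> (max w1 0)\<^sup>2 - 2 * (x1\<^sup>2 * max w1 0) + (x1\<^sup>2)\<^sup>2"
    proof -
      have "(max w1 0)\<^sup>2 - 2 * (x1\<^sup>2 * max w1 0) + (x1\<^sup>2)\<^sup>2 = (max w1 0 - x1\<^sup>2)\<^sup>2" unfolding power2_diff by (simp add: mult_ac)
      then show ?thesis by simp
    qed
    ultimately show "qform (w1, w2, w3) x \<le> (max w1 0)\<^sup>2" unfolding q by linarith
  qed
  have "qform (w1, w2, w3) (sqrt (max w1 0), 0) \<le> Rlim True (w1, w2, w3)"
    by (rule qform_le_Rlim) (simp add: cone_def)
  moreover have "qform (w1, w2, w3) (sqrt (max w1 0), 0) = (max w1 0)\<^sup>2"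
  proof -
    have "(sqrt (max w1 0))\<^sup>2 = max w1 0" by simp
    then show ?thesis unfolding qform_def prod.case by (simp add: max_def power2_eq_square)
  qed
  ultimately show "(max w1 0)\<^sup>2 \<le> Rlim True (w1, w2, w3)" by simp
qed

lemma nn_integral_std_normal_reflect:
  assumes [measurable]: "f \<in> borel_measurable borel"
  shows "(\<integral>\<^sup>+z. f (- z) \<partial>std_normal) = (\<integral>\<^sup>+z. f z \<partial>std_normal)"
proof -
  have "(\<integral>\<^sup>+z. f z \<partial>std_normal) = (\<integral>\<^sup>+z. ennreal (std_normal_density z) * f z \<partial>lborel)"
    unfolding std_normal_def by (subst nn_integral_density) auto
  also have "\<dots> = ennreal \<bar>-1\<bar> * (\<integral>\<^sup>+z. ennreal (std_normal_density (0 + (-1) * z)) * f (0 + (-1) * z) \<partial>lborel)"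
    by (rule nn_integral_real_affine) auto
  also have "\<dots> = (\<integral>\<^sup>+z. ennreal (std_normal_density z) * f (- z) \<partial>lborel)"
    by (simp add: std_normal_density_def)
  also have "\<dots> = (\<integral>\<^sup>+z. f (- z) \<partial>std_normal)"
    unfolding std_normal_def by (subst nn_integral_density) auto
  finally show ?thesis by simp
qed

text \<open>At every point \<open>z\<close> the values \<open>max z 0\<close> and \<open>max (-z) 0\<close> are \<open>\<bar>z\<bar>\<close> and \<open>0\<close> in some order.\<close>

lemma half_chibar_eq:
  "half_chibar = distr (std_normal \<Otimes>\<^sub>M (std_normal \<Otimes>\<^sub>M std_normal)) borel (Rlim True)"
proof (rule measure_eqI)
  interpret P2: pair_prob_space std_normal std_normal ..
  interpret P3: pair_prob_space std_normal "std_normal \<Otimes>\<^sub>M std_normal" ..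
  interpret G: gaussian_like "std_normal \<Otimes>\<^sub>M (std_normal \<Otimes>\<^sub>M std_normal)" "1 / sqrt (2 * pi) * (1 / sqrt (2 * pi) * (1 / sqrt (2 * pi)))"
    by (rule gaussian3)
  interpret chi: prob_space chi2_1 unfolding chi2_1_def by (rule std_normal.prob_space_distr) auto
  have "(if b then return borel 0 else chi2_1) \<in> space (subprob_algebra borel)" for b
    by (cases b) (auto simp: space_subprob_algebra chi2_1_def intro!: prob_space_imp_subprob_space std_normal.prob_space_distr prob_space_return)
  then have k: "(\<lambda>b. if b then return borel 0 else chi2_1) \<in> measurable (measure_pmf (bernoulli_pmf (1/2))) (subprob_algebra borel)"
    by simp
  have "sets (if b then return borel 0 else chi2_1) = sets borel" for b
    by (cases b) (simp_all add: chi2_1_def)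
  then have sh: "sets half_chibar = sets borel" unfolding half_chibar_def by (rule sets_bind) simp
  then show "sets half_chibar = sets (distr (std_normal \<Otimes>\<^sub>M (std_normal \<Otimes>\<^sub>M std_normal)) borel (Rlim True))" by simp
  have Rm: "Rlim True \<in> borel_measurable borel" by (rule borel_measurable_continuous_onI[OF Rlim_continuous])
  then have Rm': "Rlim True \<in> borel_measurable (std_normal \<Otimes>\<^sub>M (std_normal \<Otimes>\<^sub>M std_normal))"
    by (simp add: measurable_cong_sets[OF G.sets_N refl])
  fix A assume "A \<in> sets half_chibar"
  then have A[measurable]: "A \<in> sets borel" by (simp add: sh)
  define g where "g z = (indicator A ((max z 0)\<^sup>2) :: ennreal)" for z :: real
  have g[measurable]: "g \<in> borel_measurable borel" unfolding g_def by measurable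
  have "emeasure half_chibar A = (\<integral>\<^sup>+b. emeasure (if b then return borel 0 else chi2_1) A \<partial>measure_pmf (bernoulli_pmf (1/2)))"
    unfolding half_chibar_def by (rule emeasure_bind[OF _ k A]) simp
  also have "\<dots> = ennreal (1/2) * indicator A 0 + ennreal (1/2) * emeasure chi2_1 A"
    by (subst nn_integral_bernoulli_pmf) (auto simp: mult.commute)
  finally have 1: "emeasure half_chibar A = ennreal (1/2) * (indicator A 0 + emeasure chi2_1 A)" by (simp add: distrib_left)
  have "emeasure (distr (std_normal \<Otimes>\<^sub>M (std_normal \<Otimes>\<^sub>M std_normal)) borel (Rlim True)) A
     = (\<integral>\<^sup>+w. indicator A (Rlim True w) \<partial>(std_normal \<Otimes>\<^sub>M (std_normal \<Otimes>\<^sub>M std_normal)))"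
    using Rm' by (simp add: nn_integral_distr flip: nn_integral_indicator)
  also have "\<dots> = (\<integral>\<^sup>+w. g (fst w) \<partial>(std_normal \<Otimes>\<^sub>M (std_normal \<Otimes>\<^sub>M std_normal)))"
    by (intro nn_integral_cong) (auto simp: g_def Rlim_True)
  also have "\<dots> = (\<integral>\<^sup>+z. g z \<partial>distr (std_normal \<Otimes>\<^sub>M (std_normal \<Otimes>\<^sub>M std_normal)) std_normal fst)"
    by (subst nn_integral_distr) auto
  also have "distr (std_normal \<Otimes>\<^sub>M (std_normal \<Otimes>\<^sub>M std_normal)) std_normal fst = std_normal"
    by (rule prob_space.distr_pair_fst) (rule gaussian_like.axioms(1)[OF gaussian_like_pair[OF gaussian_like_std_normal gaussian_like_std_normal]])
  finally have 2: "emeasure (distr (std_normal \<Otimes>\<^sub>M (std_normal \<Otimes>\<^sub>M std_normal)) borel (Rlim True)) A = (\<integral>\<^sup>+z. g z \<partial>std_normal)" .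
  have "(\<integral>\<^sup>+z. g z \<partial>std_normal) + (\<integral>\<^sup>+z. g z \<partial>std_normal) = (\<integral>\<^sup>+z. g z + g (- z) \<partial>std_normal)"
    by (subst nn_integral_add) (auto simp: nn_integral_std_normal_reflect)
  also have "\<dots> = (\<integral>\<^sup>+z. indicator A 0 + indicator A (z\<^sup>2) \<partial>std_normal)"
  proof (rule nn_integral_cong)
    fix z :: real
    show "g z + g (- z) = indicator A 0 + indicator A (z\<^sup>2)"
      by (cases "z \<ge> 0") (auto simp: g_def max_def add.commute)
  qed
  also have "\<dots> = indicator A 0 + (\<integral>\<^sup>+z. indicator A (z\<^sup>2) \<partial>std_normal)"
    by (subst nn_integral_add) (auto simp: std_normal.emeasure_space_1[simplified])
  also have "(\<integral>\<^sup>+z. indicator A (z\<^sup>2) \<partial>std_normal) = emeasure chi2_1 A"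
    unfolding chi2_1_def by (simp add: nn_integral_distr flip: nn_integral_indicator)
  finally have "ennreal (1/2) * ((\<integral>\<^sup>+z. g z \<partial>std_normal) + (\<integral>\<^sup>+z. g z \<partial>std_normal)) = emeasure half_chibar A"
    unfolding 1 by simp
  moreover have "ennreal (1/2) * (y + y) = y" for y
  proof -
    have "ennreal (1/2) * (y + y) = (ennreal (1/2) + ennreal (1/2)) * y" by (simp add: distrib_left distrib_right)
    also have "ennreal (1/2) + ennreal (1/2) = ennreal (1/2 + 1/2)" by (rule ennreal_plus[symmetric]) auto
    finally show ?thesis by simp
  qed
  ultimately show "emeasure half_chibar A = emeasure (distr (std_normal \<Otimes>\<^sub>M (std_normal \<Otimes>\<^sub>M std_normal)) borel (Rlim True)) A"
    unfolding 2 by simp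
qed

subsection \<open>Random samples\<close>

lemma avg_samp: "avg (samp \<mu> \<sigma> n xs) f = (\<Sum>i<n. f (rot \<mu> \<sigma> (xs i))) / real n"
  by (simp add: avg_def samp_def)

locale sampling = prob_space M for M :: "'a measure" +
  fixes X :: "nat \<Rightarrow> 'a \<Rightarrow> real \<times> real" and \<mu> \<sigma> :: real
  assumes \<sigma>_pos: "\<sigma> > 0"
    and X_indep: "indep_vars (\<lambda>_. borel) X UNIV"
    and X_distr: "\<And>i. distributed M lborel (X i) (\<lambda>x. ennreal (bvn_density (\<mu>, \<mu>, \<sigma>, \<sigma>, 0) x))"
begin

definition Z :: "nat \<Rightarrow> 'a \<Rightarrow> real \<times> real" where "Z i \<omega> = rot \<mu> \<sigma> (X i \<omega>)"

lemma X_meas [measurable]: "X i \<in> borel_measurable M"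
  using distributed_measurable[OF X_distr[of i]] by simp

lemma Z_meas [measurable]: "Z i \<in> borel_measurable M"
  unfolding Z_def[abs_def] by measurable

lemma distr_Z: "distr M borel (Z i) = std_normal2"
proof -
  have "distr M borel (Z i) = distr (distr M lborel (X i)) borel (rot \<mu> \<sigma>)"
    by (subst distr_distr) (auto simp: Z_def[abs_def] comp_def)
  also have "distr M lborel (X i) = density lborel (\<lambda>x. ennreal (bvn_density (\<mu>, \<mu>, \<sigma>, \<sigma>, 0) x))"
    by (rule distributed_distr_eq_density[OF X_distr])
  finally show ?thesis using distr_rot[OF \<sigma>_pos] by simp
qed

lemma Z_indep: "indep_vars (\<lambda>_. borel) (\<lambda>i \<omega>. f (Z i \<omega>)) UNIV" if "f \<in> borel_measurable borel"
  for f :: "real \<times> real \<Rightarrow> real"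
proof -
  have "indep_vars (\<lambda>_. borel) (\<lambda>i \<omega>. (\<lambda>x. f (rot \<mu> \<sigma> x)) (X i \<omega>)) UNIV"
    by (rule indep_vars_compose2[OF X_indep]) (use that in measurable)
  then show ?thesis by (simp add: Z_def)
qed

lemma Z_expectation:
  fixes f :: "real \<times> real \<Rightarrow> real"
  assumes "f \<in> borel_measurable borel"
  shows "integrable M (\<lambda>\<omega>. f (Z i \<omega>)) \<longleftrightarrow> integrable std_normal2 f" "expectation (\<lambda>\<omega>. f (Z i \<omega>)) = EZ f"
  using assms unfolding distr_Z[of i, symmetric] by (simp_all add: integrable_distr_eq integral_distr)

text \<open>Induction on \<open>n\<close>: the new summand is independent of the partial sum, so the
  cross term has expectation zero.\<close>

lemma sum_second_moment:
  assumes f: "poly_bdd f" "EZ f = 0"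
  shows "integrable M (\<lambda>\<omega>. (\<Sum>i<n. f (Z i \<omega>))\<^sup>2) \<and> expectation (\<lambda>\<omega>. (\<Sum>i<n. f (Z i \<omega>))\<^sup>2) = real n * EZ (\<lambda>z. (f z)\<^sup>2)"
proof (induction n)
  case 0 then show ?case by simp
next
  case (Suc n)
  have fm[measurable]: "f \<in> borel_measurable borel" using f by (simp add: poly_bdd_def)
  let ?T = "\<lambda>\<omega>. \<Sum>i<n. f (Z i \<omega>)" and ?Y = "\<lambda>\<omega>. f (Z n \<omega>)"
  have iY: "integrable M (\<lambda>\<omega>. f (Z i \<omega>))" for i using poly_bdd_integrable(1)[OF f(1)] by (simp add: Z_expectation)
  have iY2: "integrable M (\<lambda>\<omega>. (?Y \<omega>)\<^sup>2)" "expectation (\<lambda>\<omega>. (?Y \<omega>)\<^sup>2) = EZ (\<lambda>z. (f z)\<^sup>2)"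
    using poly_bdd_integrable(2)[OF f(1)] Z_expectation[of "\<lambda>z. (f z)\<^sup>2"] by simp_all
  have "indep_var borel ?Y borel ?T"
    by (rule indep_vars_sum) (auto intro: indep_vars_subset[OF Z_indep[OF fm]])
  then have ind: "indep_var borel ?Y borel ?T" .
  have iT: "integrable M ?T" by (intro Bochner_Integration.integrable_sum iY)
  have p: "integrable M (\<lambda>\<omega>. ?Y \<omega> * ?T \<omega>)" "expectation (\<lambda>\<omega>. ?Y \<omega> * ?T \<omega>) = 0"
    using indep_var_integrable[OF ind iY iT] indep_var_lebesgue_integral[OF ind iY iT] Z_expectation(2)[OF fm, of n] f(2) by simp_all
  have e: "(\<Sum>i<Suc n. f (Z i \<omega>))\<^sup>2 = (?T \<omega>)\<^sup>2 + 2 * (?Y \<omega> * ?T \<omega>) + (?Y \<omega>)\<^sup>2" for \<omega>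
    by (simp add: power2_sum mult_ac)
  show ?case unfolding e using Suc iY2 p by (auto simp: algebra_simps)
qed

lemma prob_deviation:
  assumes f: "poly_bdd f" and K: "K > 0" and n: "n > 0"
  shows "prob {\<omega>\<in>space M. \<bar>(\<Sum>i<n. f (Z i \<omega>)) / real n - EZ f\<bar> * sqrt n > K} \<le> EZ (\<lambda>z. (f z - EZ f)\<^sup>2) / K\<^sup>2"
proof -
  let ?h = "\<lambda>z. f z - EZ f"
  have h: "poly_bdd ?h"
    using poly_bdd_add[OF f poly_bdd_cmult[OF poly_bdd_mon[of 0 0], of "- EZ f"]] by (simp add: mon_def)
  have h0: "EZ ?h = 0" using poly_bdd_integrable(1)[OF f] N2.prob_space by simp
  have fm[measurable]: "f \<in> borel_measurable borel" using f by (simp add: poly_bdd_def)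
  note m = sum_second_moment[OF h h0, of n]
  define T where "T \<omega> = (\<Sum>i<n. f (Z i \<omega>) - EZ f)" for \<omega>
  have [measurable]: "T \<in> borel_measurable M" unfolding T_def[abs_def] by measurable
  have a: "0 < K * sqrt n" using K n by simp
  have "prob {\<omega>\<in>space M. \<bar>(\<Sum>i<n. f (Z i \<omega>)) / real n - EZ f\<bar> * sqrt n > K} \<le> prob {\<omega>\<in>space M. \<bar>T \<omega>\<bar> \<ge> K * sqrt n}"
  proof (rule finite_measure_mono)
    show "{\<omega>\<in>space M. \<bar>(\<Sum>i<n. f (Z i \<omega>)) / real n - EZ f\<bar> * sqrt n > K} \<subseteq> {\<omega>\<in>space M. \<bar>T \<omega>\<bar> \<ge> K * sqrt n}"
    proof safe
      fix \<omega> assume "\<bar>(\<Sum>i<n. f (Z i \<omega>)) / real n - EZ f\<bar> * sqrt n > K"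
      moreover have "(\<Sum>i<n. f (Z i \<omega>)) / real n - EZ f = T \<omega> / real n"
        using n unfolding T_def by (simp add: sum_subtractf diff_divide_distrib)
      ultimately have "K < \<bar>T \<omega>\<bar> / real n * sqrt n" by simp
      also have "\<dots> = \<bar>T \<omega>\<bar> / sqrt n" using n by (simp add: real_div_sqrt field_simps)
      finally show "K * sqrt n \<le> \<bar>T \<omega>\<bar>" using n by (simp add: field_simps)
    qed
  qed measurable
  also have "\<dots> \<le> expectation (\<lambda>\<omega>. (T \<omega>)\<^sup>2) / (K * sqrt n)\<^sup>2"
    using m a by (intro second_moment_method) (auto simp: T_def)
  also have "\<dots> = EZ (\<lambda>z. (?h z)\<^sup>2) / K\<^sup>2"
    using m n unfolding T_def by (simp add: power_mult_distrib)
  finally show ?thesis .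
qed

abbreviation sm :: "nat \<Rightarrow> 'a \<Rightarrow> sample" where "sm n \<omega> \<equiv> samp \<mu> \<sigma> n (\<lambda>i. X i \<omega>)"

lemma avg_sm: "avg (sm n \<omega>) f = (\<Sum>i<n. f (Z i \<omega>)) / real n"
  by (simp add: avg_samp Z_def)

lemma fst_sm: "fst (sm n \<omega>) = n" by (simp add: samp_def)

lemma good_measurable:
  assumes "finite Fs" "\<And>f. f \<in> Fs \<Longrightarrow> poly_bdd f"
  shows "{\<omega>\<in>space M. \<not> good Fs K (sm n \<omega>)} \<in> events"
proof -
  have "{\<omega>\<in>space M. \<not> good Fs K (sm n \<omega>)} = (\<Union>f\<in>Fs. {\<omega>\<in>space M. \<not> sqrt n * \<bar>(\<Sum>i<n. f (Z i \<omega>)) / real n - EZ f\<bar> \<le> K})"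
    unfolding good_def avg_sm fst_sm by auto
  also have "\<dots> \<in> events"
  proof (rule sets.finite_UN[OF assms(1)])
    fix f assume "f \<in> Fs"
    then have [measurable]: "f \<in> borel_measurable borel" using assms(2) by (simp add: poly_bdd_def)
    show "{\<omega>\<in>space M. \<not> sqrt n * \<bar>(\<Sum>i<n. f (Z i \<omega>)) / real n - EZ f\<bar> \<le> K} \<in> events" by measurable
  qed
  finally show ?thesis .
qed

text \<open>Chebyshev's inequality for each function and a union bound over the finite family give
  \<open>S / K\<^sup>2\<close>, uniformly in \<open>n > 0\<close>.\<close>

lemma good_prob:
  assumes Fs: "finite Fs" "\<And>f. f \<in> Fs \<Longrightarrow> poly_bdd f" and "\<epsilon> > 0"
  shows "\<exists>K\<ge>0. \<forall>n>0. prob {\<omega>\<in>space M. \<not> good Fs K (sm n \<omega>)} < \<epsilon>"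
proof -
  define S where "S = (\<Sum>f\<in>Fs. EZ (\<lambda>z. (f z - EZ f)\<^sup>2))"
  have S: "S \<ge> 0" unfolding S_def by (intro sum_nonneg Bochner_Integration.integral_nonneg) auto
  \<comment> \<open>Then \<open>S / K\<^sup>2\<close> equals
    \<open>\<epsilon> * S / (S + 1)\<close>, which is strictly below \<open>\<epsilon>\<close> even
    for \<open>S = 0\<close>.\<close>
  define K where "K = sqrt ((S + 1) / \<epsilon>)"
  have K: "K > 0" "K\<^sup>2 = (S + 1) / \<epsilon>" using S \<open>\<epsilon> > 0\<close> by (simp_all add: K_def)
  have "prob {\<omega>\<in>space M. \<not> good Fs K (sm n \<omega>)} < \<epsilon>" if n: "n > 0" for n
  proof -
    have "{\<omega>\<in>space M. \<not> good Fs K (sm n \<omega>)} = (\<Union>f\<in>Fs. {\<omega>\<in>space M. \<bar>(\<Sum>i<n. f (Z i \<omega>)) / real n - EZ f\<bar> * sqrt n > K})"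
      unfolding good_def avg_sm fst_sm by (auto simp: not_le mult.commute)
    then have "prob {\<omega>\<in>space M. \<not> good Fs K (sm n \<omega>)} \<le> (\<Sum>f\<in>Fs. prob {\<omega>\<in>space M. \<bar>(\<Sum>i<n. f (Z i \<omega>)) / real n - EZ f\<bar> * sqrt n > K})"
    proof (simp only:, intro finite_measure_subadditive_finite Fs(1))
      show "(\<lambda>f. {\<omega>\<in>space M. \<bar>(\<Sum>i<n. f (Z i \<omega>)) / real n - EZ f\<bar> * sqrt n > K}) ` Fs \<subseteq> events"
      proof safe
        fix f assume "f \<in> Fs"
        then have [measurable]: "f \<in> borel_measurable borel" using Fs(2) by (simp add: poly_bdd_def)
        show "{\<omega>\<in>space M. \<bar>(\<Sum>i<n. f (Z i \<omega>)) / real n - EZ f\<bar> * sqrt n > K} \<in> events" by measurable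
      qed
    qed
    also have "\<dots> \<le> (\<Sum>f\<in>Fs. EZ (\<lambda>z. (f z - EZ f)\<^sup>2) / K\<^sup>2)"
      by (intro sum_mono prob_deviation Fs(2) K n)
    also have "\<dots> = S / K\<^sup>2" by (simp add: S_def sum_divide_distrib)
    also have "\<dots> < \<epsilon>" unfolding K(2) using S \<open>\<epsilon> > 0\<close> by (simp add: field_simps)
    finally show ?thesis .
  qed
  then show ?thesis using K(1) by (intro exI[of _ K]) auto
qed

section \<open>Central limit theorem for the three normalised sums\<close>

definition VV :: "nat \<Rightarrow> 'a \<Rightarrow> real \<times> real \<times> real" where
  "VV n \<omega> = (V1 (sm n \<omega>), V2 (sm n \<omega>), V3 (sm n \<omega>))"

lemma mon_measurable [measurable]: "mon i j \<in> borel_measurable borel"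
  unfolding mon_def[abs_def] borel_prod[symmetric] by measurable

lemma VV_meas [measurable]: "VV n \<in> borel_measurable M"
  unfolding VV_def[abs_def] V1_def V2_def V3_def smean_def avg_sm fst_sm borel_prod[symmetric] by measurable

lemma inner_VV:
  assumes "n > 0"
  shows "(t1, t2, t3) \<bullet> VV n \<omega> = (\<Sum>i<n. f_lin t1 t2 t3 (Z i \<omega>)) / sqrt n"
proof -
  have fp: "fst (sm n \<omega>) > 0" using assms by (simp add: fst_sm)
  have "avg (sm n \<omega>) (f_lin t1 t2 t3) = (t1 - t2) / 2 * avg (sm n \<omega>) (mon 2 0) + (- (t1 + t2) / 2) * avg (sm n \<omega>) (mon 0 2)
      + t2 / 2 * avg (sm n \<omega>) (mon 2 2) + t2 / 2 * 1 + t3 / sqrt 2 * avg (sm n \<omega>) (mon 2 1) + (- t3 / sqrt 2) * avg (sm n \<omega>) (mon 0 1)"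
    unfolding f_lin_def[abs_def] avg_add avg_cmult using avg_const[OF fp, of 1] by (simp add: mon_def[of 0 0, abs_def])
  moreover have "t1 * (r * (a - b) / 2) + (t2 * (r * (c - a - b + 1) / 2) + t3 * (r * (d - m) / s))
      = r * ((t1 - t2) / 2 * a + (- (t1 + t2) / 2) * b + t2 / 2 * c + t2 / 2 * 1 + t3 / s * d + (- t3 / s) * m)"
    for r a b c d m s :: real
    by (simp add: diff_divide_distrib add_divide_distrib algebra_simps)
  ultimately have "(t1, t2, t3) \<bullet> VV n \<omega> = sqrt n * avg (sm n \<omega>) (f_lin t1 t2 t3)"
    unfolding VV_def V1_def V2_def V3_def smean_def fst_sm by (simp only: inner_Pair inner_real_def)
  also have "\<dots> = sqrt n / real n * (\<Sum>i<n. f_lin t1 t2 t3 (Z i \<omega>))" unfolding avg_sm by simp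
  also have "sqrt n / real n = 1 / sqrt n" using assms by (simp add: real_div_sqrt field_simps)
  finally show ?thesis by simp
qed

text \<open>The Cramer-Wold device: \<open>u \<bullet> VV n\<close> is a normalised sum of variables
  with variance \<open>(norm u)\<^sup>2\<close>, so the scalar central limit theorem applies to its
  quotient by \<open>norm u\<close>, and the characteristic function is read off at
  \<open>norm u\<close>. The case \<open>u = 0\<close> is split off because the variance must be
  positive.\<close>

lemma char_VV: "(\<lambda>n. CLINT w|distr M borel (VV n). cis (u \<bullet> w)) \<longlonglongrightarrow> of_real (exp (- (norm u)\<^sup>2 / 2))"
proof (cases "u = 0")
  case True
  have "(CLINT w|distr M borel (VV n). cis (u \<bullet> w)) = 1" for n
    by (subst integral_distr) (auto simp: True prob_space)
  then show ?thesis using True by simp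
next
  case False
  obtain t1 t2 t3 where u: "u = (t1, t2, t3)" by (cases u)
  have nu: "(norm u)\<^sup>2 = t1\<^sup>2 + t2\<^sup>2 + t3\<^sup>2" unfolding u by (simp add: norm_Pair)
  have np: "norm u > 0" using False by simp
  let ?f = "f_lin t1 t2 t3"
  have fm[measurable]: "?f \<in> borel_measurable borel" using poly_bdd_lin by (simp add: poly_bdd_def)
  have exp0: "expectation (\<lambda>\<omega>. ?f (Z n \<omega>)) = 0" for n using Z_expectation(2)[OF fm] EZ_lin by simp
  have exp2: "integrable M (\<lambda>\<omega>. (?f (Z n \<omega>))\<^sup>2)" "expectation (\<lambda>\<omega>. (?f (Z n \<omega>))\<^sup>2) = (norm u)\<^sup>2" for n
    using Z_expectation[of "\<lambda>z. (?f z)\<^sup>2"] poly_bdd_integrable(2)[OF poly_bdd_lin] EZ_lin_sq[of t1 t2 t3] nu by simp_all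
  define S where "S n \<omega> = (\<Sum>i<n. ?f (Z i \<omega>) - 0) / sqrt (n * (norm u)\<^sup>2)" for n \<omega>
  have Sm[measurable]: "S n \<in> borel_measurable M" for n unfolding S_def[abs_def] by measurable
  have "weak_conv_m (\<lambda>n. distr M borel (\<lambda>\<omega>. (\<Sum>i<n. ?f (Z i \<omega>) - 0) / sqrt (n * (norm u)\<^sup>2))) std_normal_distribution"
  proof (rule central_limit_theorem[where \<mu>="distr std_normal2 borel ?f"])
    show "distr M borel (\<lambda>\<omega>. ?f (Z n \<omega>)) = distr std_normal2 borel ?f" for n
      unfolding distr_Z[of n, symmetric] by (subst distr_distr) (auto simp: comp_def)
  qed (use Z_indep[OF fm] exp0 exp2 np in auto)
  then have "weak_conv_m (\<lambda>n. distr M borel (S n)) std_normal_distribution" unfolding S_def .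
  then have "(\<lambda>n. char (distr M borel (S n)) (norm u)) \<longlonglongrightarrow> char std_normal_distribution (norm u)"
    by (intro levy_continuity1 real_distribution_distr real_dist_normal_dist) auto
  moreover have "char (distr M borel (S n)) (norm u) = (CLINT w|distr M borel (VV n). cis (u \<bullet> w))" if "n > 0" for n
  proof -
    have e: "norm u * S n \<omega> = u \<bullet> VV n \<omega>" for \<omega>
      using np inner_VV[OF that, of t1 t2 t3 \<omega>] unfolding u[symmetric] S_def by (simp add: real_sqrt_mult)
    have "char (distr M borel (S n)) (norm u) = (CLINT \<omega>|M. cis (norm u * S n \<omega>))"
      unfolding char_def cis_conv_exp by (subst integral_distr) auto
    also have "\<dots> = (CLINT w|distr M borel (VV n). cis (u \<bullet> w))" unfolding e by (subst integral_distr) auto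
    finally show ?thesis .
  qed
  then have "eventually (\<lambda>n. char (distr M borel (S n)) (norm u) = (CLINT w|distr M borel (VV n). cis (u \<bullet> w))) sequentially"
    by (intro eventually_mono[OF eventually_gt_at_top[of 0]]) blast
  ultimately have "(\<lambda>n. CLINT w|distr M borel (VV n). cis (u \<bullet> w)) \<longlonglongrightarrow> char std_normal_distribution (norm u)"
    by (rule Lim_transform_eventually)
  then show ?thesis by (simp add: char_std_normal_distribution)
qed

lemma VV_conv:
  fixes f :: "real \<times> real \<times> real \<Rightarrow> real"
  assumes "continuous_on UNIV f" "\<And>x. \<bar>f x\<bar> \<le> B"
  shows "(\<lambda>n. expectation (\<lambda>\<omega>. f (VV n \<omega>))) \<longlonglongrightarrow> (\<integral>w. f w \<partial>(std_normal \<Otimes>\<^sub>M (std_normal \<Otimes>\<^sub>M std_normal)))"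
proof -
  interpret G: gaussian_like "std_normal \<Otimes>\<^sub>M (std_normal \<Otimes>\<^sub>M std_normal)" "1 / sqrt (2 * pi) * (1 / sqrt (2 * pi) * (1 / sqrt (2 * pi)))"
    by (rule gaussian3)
  have fm: "f \<in> borel_measurable borel" by (rule borel_measurable_continuous_onI[OF assms(1)])
  have "(\<lambda>n. \<integral>w. f w \<partial>distr M borel (VV n)) \<longlonglongrightarrow> (\<integral>w. f w \<partial>(std_normal \<Otimes>\<^sub>M (std_normal \<Otimes>\<^sub>M std_normal)))"
  proof (rule G.char_conv_imp_bdd_continuous_conv[OF _ _ _ assms])
    show "prob_space (distr M borel (VV n))" for n by (rule prob_space_distr) simp
    show "(\<lambda>n. CLINT w|distr M borel (VV n). cis (u \<bullet> w)) \<longlonglongrightarrow> (CLINT w|(std_normal \<Otimes>\<^sub>M (std_normal \<Otimes>\<^sub>M std_normal)). cis (u \<bullet> w))" for u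
      using char_VV[of u] unfolding G.char_N .
  qed simp
  then show ?thesis using fm by (simp add: integral_distr)
qed

text \<open>Slutsky's argument on step functions \<open>cts_step\<close>, which are uniformly
  continuous and take values in the unit interval: an exceptional event costs at most its
  probability, and elsewhere the modulus of continuity applies.\<close>

lemma weak_conv_Rlim:
  fixes T :: "nat \<Rightarrow> 'a \<Rightarrow> real"
  assumes T[measurable]: "\<And>n. T n \<in> borel_measurable M"
    and close: "\<And>\<epsilon> e. \<epsilon> > 0 \<Longrightarrow> e > 0 \<Longrightarrow>
      \<exists>N. \<forall>n\<ge>N. \<exists>A\<in>events. prob A < \<epsilon> \<and> (AE \<omega> in M. \<omega> \<notin> A \<longrightarrow> \<bar>T n \<omega> - Rlim eq (VV n \<omega>)\<bar> \<le> e)"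
  shows "weak_conv_m (\<lambda>n. distr M borel (T n)) (distr (std_normal \<Otimes>\<^sub>M (std_normal \<Otimes>\<^sub>M std_normal)) borel (Rlim eq))"
proof -
  interpret G: gaussian_like "std_normal \<Otimes>\<^sub>M (std_normal \<Otimes>\<^sub>M std_normal)" "1 / sqrt (2 * pi) * (1 / sqrt (2 * pi) * (1 / sqrt (2 * pi)))"
    by (rule gaussian3)
  have Rm[measurable]: "Rlim eq \<in> borel_measurable borel" by (rule borel_measurable_continuous_onI[OF Rlim_continuous])
  then have Rm': "Rlim eq \<in> borel_measurable (std_normal \<Otimes>\<^sub>M (std_normal \<Otimes>\<^sub>M std_normal))"
    by (simp add: measurable_cong_sets[OF G.sets_N refl])
  show ?thesis
  proof (rule integral_cts_step_conv_imp_weak_conv)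
    show "real_distribution (distr M borel (T n))" for n by (rule real_distribution_distr) simp
    show "real_distribution (distr (std_normal \<Otimes>\<^sub>M (std_normal \<Otimes>\<^sub>M std_normal)) borel (Rlim eq))"
      by (rule G.real_distribution_distr[OF Rm'])
    fix a b :: real assume "a < b"
    let ?h = "cts_step a b"
    have uc: "uniformly_continuous_on UNIV ?h" using \<open>a < b\<close> by (rule cts_step_uniformly_continuous)
    then have hc: "continuous_on UNIV ?h" by (rule uniformly_continuous_imp_continuous)
    then have hm[measurable]: "?h \<in> borel_measurable borel" by (rule borel_measurable_continuous_onI)
    have h01: "0 \<le> ?h t" "?h t \<le> 1" for t using \<open>a < b\<close> by (auto simp: cts_step_def divide_simps)
    have L: "(\<lambda>n. expectation (\<lambda>\<omega>. ?h (Rlim eq (VV n \<omega>)))) \<longlonglongrightarrow> (\<integral>w. ?h (Rlim eq w) \<partial>(std_normal \<Otimes>\<^sub>M (std_normal \<Otimes>\<^sub>M std_normal)))"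
      by (rule VV_conv[where B=1]) (use h01 in \<open>auto intro!: continuous_on_compose2[OF hc Rlim_continuous]\<close>)
    have D: "(\<lambda>n. expectation (\<lambda>\<omega>. ?h (T n \<omega>)) - expectation (\<lambda>\<omega>. ?h (Rlim eq (VV n \<omega>)))) \<longlonglongrightarrow> 0"
    proof (rule LIMSEQ_I)
      fix r :: real assume "r > 0"
      then obtain d where d: "d > 0" "\<And>s t. \<bar>s - t\<bar> < d \<Longrightarrow> \<bar>?h s - ?h t\<bar> < r/3"
        using uc unfolding uniformly_continuous_on_def dist_real_def by (drule_tac x="r/3" in spec) auto
      obtain N where N: "\<And>n. n \<ge> N \<Longrightarrow> \<exists>A\<in>events. prob A < r/3 \<and> (AE \<omega> in M. \<omega> \<notin> A \<longrightarrow> \<bar>T n \<omega> - Rlim eq (VV n \<omega>)\<bar> \<le> d/2)"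
        using close[of "r/3" "d/2"] \<open>r > 0\<close> d(1) by auto
      show "\<exists>no. \<forall>n\<ge>no. norm (expectation (\<lambda>\<omega>. ?h (T n \<omega>)) - expectation (\<lambda>\<omega>. ?h (Rlim eq (VV n \<omega>))) - 0) < r"
      proof (intro exI allI impI)
        fix n assume "n \<ge> N"
        then obtain A where A: "A \<in> events" "prob A < r/3" "AE \<omega> in M. \<omega> \<notin> A \<longrightarrow> \<bar>T n \<omega> - Rlim eq (VV n \<omega>)\<bar> \<le> d/2"
          using N by blast
        have i: "integrable M (\<lambda>\<omega>. ?h (T n \<omega>))" "integrable M (\<lambda>\<omega>. ?h (Rlim eq (VV n \<omega>)))"
          by (rule integrable_const_bound[where B=1]; use h01 in auto)+
        have iA: "integrable M (indicator A :: 'a \<Rightarrow> real)"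
          using A(1) by (intro integrable_real_indicator) (auto simp: emeasure_eq_measure)
        have "\<bar>expectation (\<lambda>\<omega>. ?h (T n \<omega>)) - expectation (\<lambda>\<omega>. ?h (Rlim eq (VV n \<omega>)))\<bar>
            = \<bar>expectation (\<lambda>\<omega>. ?h (T n \<omega>) - ?h (Rlim eq (VV n \<omega>)))\<bar>" using i by simp
        also have "\<dots> \<le> expectation (\<lambda>\<omega>. \<bar>?h (T n \<omega>) - ?h (Rlim eq (VV n \<omega>))\<bar>)"
          using integral_norm_bound[of M "\<lambda>\<omega>. ?h (T n \<omega>) - ?h (Rlim eq (VV n \<omega>))"] by simp
        also have "\<dots> \<le> expectation (\<lambda>\<omega>. r/3 + indicator A \<omega>)"
        proof (rule integral_mono_AE)
          show "AE \<omega> in M. \<bar>?h (T n \<omega>) - ?h (Rlim eq (VV n \<omega>))\<bar> \<le> r/3 + indicator A \<omega>"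
            using A(3)
          proof eventually_elim
            case (elim \<omega>)
            show ?case
            proof (cases "\<omega> \<in> A")
              case True
              then show ?thesis using h01[of "T n \<omega>"] h01[of "Rlim eq (VV n \<omega>)"] \<open>r > 0\<close> by (auto simp: abs_le_iff)
            next
              case False
              then have "\<bar>T n \<omega> - Rlim eq (VV n \<omega>)\<bar> < d" using elim d(1) by auto
              from d(2)[OF this] show ?thesis using False by simp
            qed
          qed
        qed (use i iA in auto)
        also have "\<dots> = r/3 + prob A" using A(1) iA by (simp add: prob_space)
        finally show "norm (expectation (\<lambda>\<omega>. ?h (T n \<omega>)) - expectation (\<lambda>\<omega>. ?h (Rlim eq (VV n \<omega>))) - 0) < r"
          using A(2) \<open>r > 0\<close> by simp
      qed
    qed
    have "(\<lambda>n. expectation (\<lambda>\<omega>. ?h (T n \<omega>))) \<longlonglongrightarrow> (\<integral>w. ?h (Rlim eq w) \<partial>(std_normal \<Otimes>\<^sub>M (std_normal \<Otimes>\<^sub>M std_normal)))"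
      using tendsto_add[OF D L] by simp
    then show "(\<lambda>n. integral\<^sup>L (distr M borel (T n)) ?h) \<longlonglongrightarrow> integral\<^sup>L (distr (std_normal \<Otimes>\<^sub>M (std_normal \<Otimes>\<^sub>M std_normal)) borel (Rlim eq)) ?h"
      using Rm' by (simp add: integral_distr)
  qed
qed

section \<open>From deterministic estimates to the limit theorems\<close>

lemma loglik_measurable:
  assumes [measurable]: "\<theta> \<in> borel_measurable M"
  shows "(\<lambda>\<omega>. loglik n (\<lambda>i. unorder (X i \<omega>)) (\<theta> \<omega>)) \<in> borel_measurable M"
proof -
  have b: "(\<lambda>p. bvn_density (fst p) (snd p)) \<in> borel_measurable borel"
    unfolding bvn_density_def case_prod_beta borel_prod[symmetric] by measurable
  have [measurable]: "(\<lambda>\<omega>. bvn_density (\<theta> \<omega>) (g \<omega>)) \<in> borel_measurable M" if "g \<in> borel_measurable M" for g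
  proof -
    have "(\<lambda>\<omega>. (\<theta> \<omega>, g \<omega>)) \<in> borel_measurable M" by (rule borel_measurable_Pair[OF assms that])
    from measurable_compose[OF this b] show ?thesis by simp
  qed
  have [measurable]: "(\<lambda>\<omega>. fst (X i \<omega>)) \<in> borel_measurable M" "(\<lambda>\<omega>. snd (X i \<omega>)) \<in> borel_measurable M" for i
    using X_meas[of i] unfolding borel_prod[symmetric] by (auto intro: measurable_compose[OF _ measurable_fst] measurable_compose[OF _ measurable_snd])
  have [measurable]: "(\<lambda>\<omega>. (fst (X i \<omega>), snd (X i \<omega>))) \<in> borel_measurable M" "(\<lambda>\<omega>. (snd (X i \<omega>), fst (X i \<omega>))) \<in> borel_measurable M" for i
    unfolding borel_prod[symmetric] by measurable
  show ?thesis unfolding loglik_unorder by measurable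
qed

theorem mle_asymptotics:
  fixes est est_check :: "nat \<Rightarrow> 'a \<Rightarrow> param"
  assumes [measurable]: "\<And>n. est n \<in> borel_measurable M" "\<And>n. est_check n \<in> borel_measurable M"
    and mx: "\<forall>\<^sub>F n in sequentially. AE \<omega> in M. is_maximizer (loglik n (\<lambda>i. unorder (X i \<omega>))) (Theta_of eq) (est n \<omega>)"
    and mc: "\<forall>\<^sub>F n in sequentially. AE \<omega> in M. is_maximizer (loglik n (\<lambda>i. unorder (X i \<omega>))) Theta_check (est_check n \<omega>)"
  shows "bounded_in_prob M (\<lambda>n \<omega>. (fst (est n \<omega>) - \<mu>)\<^sup>2) (\<lambda>n. 1 / sqrt (real n))"
    "bounded_in_prob M (\<lambda>n \<omega>. (fst (snd (est n \<omega>)) - \<mu>)\<^sup>2) (\<lambda>n. 1 / sqrt (real n))"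
    "bounded_in_prob M (\<lambda>n \<omega>. (fst (snd (snd (est n \<omega>))) - \<sigma>)\<^sup>2) (\<lambda>n. 1 / sqrt (real n))"
    "bounded_in_prob M (\<lambda>n \<omega>. (fst (snd (snd (snd (est n \<omega>)))) - \<sigma>)\<^sup>2) (\<lambda>n. 1 / sqrt (real n))"
    "eq \<Longrightarrow> bounded_in_prob M (\<lambda>n \<omega>. fst (snd (snd (est n \<omega>))) - \<sigma>) (\<lambda>n. 1 / sqrt (real n))"
    "weak_conv_m (\<lambda>n. distr M borel (\<lambda>\<omega>. 2 * (loglik n (\<lambda>i. unorder (X i \<omega>)) (est n \<omega>) - loglik n (\<lambda>i. unorder (X i \<omega>)) (est_check n \<omega>))))
       (distr (std_normal \<Otimes>\<^sub>M (std_normal \<Otimes>\<^sub>M std_normal)) borel (Rlim eq))"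
proof -
  let ?T = "\<lambda>n \<omega>. 2 * (loglik n (\<lambda>i. unorder (X i \<omega>)) (est n \<omega>) - loglik n (\<lambda>i. unorder (X i \<omega>)) (est_check n \<omega>))"
  define D where "D n \<omega> C \<longleftrightarrow>
     sqrt (real n) * (fst (est n \<omega>) - \<mu>)\<^sup>2 \<le> C \<and> sqrt (real n) * (fst (snd (est n \<omega>)) - \<mu>)\<^sup>2 \<le> C \<and>
     sqrt (real n) * (fst (snd (snd (est n \<omega>))) - \<sigma>)\<^sup>2 \<le> C \<and> sqrt (real n) * (fst (snd (snd (snd (est n \<omega>)))) - \<sigma>)\<^sup>2 \<le> C \<and>
     (eq \<longrightarrow> sqrt (real n) * \<bar>fst (snd (snd (est n \<omega>))) - \<sigma>\<bar> \<le> C)" for n \<omega> C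
  \<comment> \<open>\<open>C\<close> may depend on the probability level \<open>\<epsilon>\<close>
    but not on the tolerance \<open>e\<close>. Boundedness in probability uses \<open>e = 1\<close>,
    the limit law all \<open>e > 0\<close>.\<close>
  have key: "\<exists>C. \<forall>e>0. \<exists>N. \<forall>n\<ge>N. \<exists>A\<in>events. prob A < \<epsilon> \<and> (AE \<omega> in M. \<omega> \<notin> A \<longrightarrow>
     \<bar>?T n \<omega> - Rlim eq (VV n \<omega>)\<bar> \<le> e \<and> D n \<omega> C)" if "\<epsilon> > 0" for \<epsilon> :: real
  proof -
    obtain Fs \<eta> \<epsilon>' where Fs: "finite Fs" "\<And>f. f \<in> Fs \<Longrightarrow> poly_bdd f" and nf: "\<And>K. K \<ge> 0 \<Longrightarrow> net_filter Fs K \<eta> \<epsilon>'"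
      using exists_net by blast
    obtain K where K: "K \<ge> 0" "\<And>n. n > 0 \<Longrightarrow> prob {\<omega>\<in>space M. \<not> good Fs K (sm n \<omega>)} < \<epsilon>"
      using good_prob[OF Fs \<open>\<epsilon> > 0\<close>] by blast
    interpret nf: net_filter Fs K \<eta> \<epsilon>' by (rule nf[OF K(1)])
    obtain C where C: "\<And>e. e > 0 \<Longrightarrow> eventually (\<lambda>x. \<forall>xs m1 m2 s1 s2 r \<theta>c. x = samp \<mu> \<sigma> (fst x) xs \<longrightarrow>
     is_maximizer (loglik (fst x) (\<lambda>i. unorder (xs i))) (Theta_of eq) (m1, m2, s1, s2, r) \<longrightarrow>
     is_maximizer (loglik (fst x) (\<lambda>i. unorder (xs i))) Theta_check \<theta>c \<longrightarrow>
     \<bar>2 * (loglik (fst x) (\<lambda>i. unorder (xs i)) (m1, m2, s1, s2, r) - loglik (fst x) (\<lambda>i. unorder (xs i)) \<theta>c) - Rlim eq (V1 x, V2 x, V3 x)\<bar> \<le> e \<and>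
     rn x * (m1 - \<mu>)\<^sup>2 \<le> C \<and> rn x * (m2 - \<mu>)\<^sup>2 \<le> C \<and> rn x * (s1 - \<sigma>)\<^sup>2 \<le> C \<and> rn x * (s2 - \<sigma>)\<^sup>2 \<le> C \<and> (eq \<longrightarrow> rn x * \<bar>s1 - \<sigma>\<bar> \<le> C)) (dfilter Fs K)"
      using nf.estimator_asymptotics[OF \<sigma>_pos, of \<mu> eq] by blast
    show ?thesis
    proof (intro exI[of _ C] allI impI)
      fix e :: real assume "e > 0"
      from C[OF this] obtain N1 where N1: "\<And>n d. n \<ge> N1 \<Longrightarrow> good Fs K (n, d) \<Longrightarrow> \<forall>xs m1 m2 s1 s2 r \<theta>c. (n, d) = samp \<mu> \<sigma> n xs \<longrightarrow>
     is_maximizer (loglik n (\<lambda>i. unorder (xs i))) (Theta_of eq) (m1, m2, s1, s2, r) \<longrightarrow>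
     is_maximizer (loglik n (\<lambda>i. unorder (xs i))) Theta_check \<theta>c \<longrightarrow>
     \<bar>2 * (loglik n (\<lambda>i. unorder (xs i)) (m1, m2, s1, s2, r) - loglik n (\<lambda>i. unorder (xs i)) \<theta>c) - Rlim eq (V1 (n, d), V2 (n, d), V3 (n, d))\<bar> \<le> e \<and>
     sqrt n * (m1 - \<mu>)\<^sup>2 \<le> C \<and> sqrt n * (m2 - \<mu>)\<^sup>2 \<le> C \<and> sqrt n * (s1 - \<sigma>)\<^sup>2 \<le> C \<and> sqrt n * (s2 - \<sigma>)\<^sup>2 \<le> C \<and> (eq \<longrightarrow> sqrt n * \<bar>s1 - \<sigma>\<bar> \<le> C)"
        unfolding eventually_dfilter fst_conv by blast
      obtain N2 where N2: "\<And>n. n \<ge> N2 \<Longrightarrow> AE \<omega> in M. is_maximizer (loglik n (\<lambda>i. unorder (X i \<omega>))) (Theta_of eq) (est n \<omega>)"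
        using mx unfolding eventually_sequentially by blast
      obtain N3 where N3: "\<And>n. n \<ge> N3 \<Longrightarrow> AE \<omega> in M. is_maximizer (loglik n (\<lambda>i. unorder (X i \<omega>))) Theta_check (est_check n \<omega>)"
        using mc unfolding eventually_sequentially by blast
      show "\<exists>N. \<forall>n\<ge>N. \<exists>A\<in>events. prob A < \<epsilon> \<and> (AE \<omega> in M. \<omega> \<notin> A \<longrightarrow>
         \<bar>?T n \<omega> - Rlim eq (VV n \<omega>)\<bar> \<le> e \<and> D n \<omega> C)"
      proof (intro exI allI impI)
        fix n assume n: "n \<ge> max 1 (max N1 (max N2 N3))"
        \<comment> \<open>The exceptional event depends on the sample averages alone and not on the
          estimators, so it is measurable and its probability is bounded by
          \<open>good_prob\<close>.\<close>
        define A where "A = {\<omega>\<in>space M. \<not> good Fs K (sm n \<omega>)}"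
        have n0: "n > 0" "n \<ge> N1" "n \<ge> N2" "n \<ge> N3" using n by simp_all
        have "AE \<omega> in M. \<omega> \<notin> A \<longrightarrow> \<bar>?T n \<omega> - Rlim eq (VV n \<omega>)\<bar> \<le> e \<and> D n \<omega> C"
          using N2[OF n0(3)] N3[OF n0(4)] AE_space
        proof eventually_elim
          case (elim \<omega>)
          show ?case
          proof (rule impI)
            assume "\<omega> \<notin> A"
            have s: "(n, \<lambda>i. rot \<mu> \<sigma> (X i \<omega>)) = samp \<mu> \<sigma> n (\<lambda>i. X i \<omega>)" by (simp add: samp_def)
            have g: "good Fs K (n, \<lambda>i. rot \<mu> \<sigma> (X i \<omega>))" using elim(3) \<open>\<omega> \<notin> A\<close> unfolding A_def s by blast
            obtain m1 m2 s1 s2 r where est: "est n \<omega> = (m1, m2, s1, s2, r)" by (cases "est n \<omega>")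
            from N1[OF n0(2) g, rule_format, OF s elim(1)[unfolded est] elim(2)]
            show "\<bar>?T n \<omega> - Rlim eq (VV n \<omega>)\<bar> \<le> e \<and> D n \<omega> C"
              unfolding est VV_def D_def s fst_conv snd_conv .
          qed
        qed
        moreover have "A \<in> events" unfolding A_def by (rule good_measurable[OF Fs])
        moreover have "prob A < \<epsilon>" unfolding A_def by (rule K(2)[OF n0(1)])
        ultimately show "\<exists>A\<in>events. prob A < \<epsilon> \<and> (AE \<omega> in M. \<omega> \<notin> A \<longrightarrow>
           \<bar>?T n \<omega> - Rlim eq (VV n \<omega>)\<bar> \<le> e \<and> D n \<omega> C)" by blast
      qed
    qed
  qed
  have bip: "bounded_in_prob M Q (\<lambda>n. 1 / sqrt (real n))"
    if Q: "\<And>\<epsilon>. \<epsilon> > 0 \<Longrightarrow> \<exists>C N. \<forall>n\<ge>N. \<exists>A\<in>events. prob A < \<epsilon> \<and> (AE \<omega> in M. \<omega> \<notin> A \<longrightarrow> sqrt n * \<bar>Q n \<omega>\<bar> \<le> C)"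
    for Q :: "nat \<Rightarrow> 'a \<Rightarrow> real"
    unfolding bounded_in_prob_def
  proof (intro allI impI)
    fix \<epsilon> :: real assume "\<epsilon> > 0"
    then obtain C N where N: "\<And>n. n \<ge> N \<Longrightarrow> \<exists>A\<in>events. prob A < \<epsilon> \<and> (AE \<omega> in M. \<omega> \<notin> A \<longrightarrow> sqrt n * \<bar>Q n \<omega>\<bar> \<le> C)"
      using Q by blast
    show "\<exists>C N. \<forall>n\<ge>N. prob {\<omega> \<in> space M. C * (1 / sqrt (real n)) < \<bar>Q n \<omega>\<bar>} < \<epsilon>"
    proof (intro exI[of _ C] exI[of _ "max 1 N"] allI impI)
      fix n assume n: "n \<ge> max 1 N"
      then obtain A where A: "A \<in> events" "prob A < \<epsilon>" "AE \<omega> in M. \<omega> \<notin> A \<longrightarrow> sqrt n * \<bar>Q n \<omega>\<bar> \<le> C" using N by auto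
      have "prob {\<omega> \<in> space M. C * (1 / sqrt (real n)) < \<bar>Q n \<omega>\<bar>} \<le> prob A"
      proof (rule finite_measure_mono_AE[OF _ A(1)])
        show "AE \<omega> in M. \<omega> \<in> {\<omega> \<in> space M. C * (1 / sqrt (real n)) < \<bar>Q n \<omega>\<bar>} \<longrightarrow> \<omega> \<in> A"
          using A(3)
        proof eventually_elim
          case (elim \<omega>)
          have "sqrt n > 0" using n by simp
          then show ?case using elim by (auto simp: field_simps)
        qed
      qed
      then show "prob {\<omega> \<in> space M. C * (1 / sqrt (real n)) < \<bar>Q n \<omega>\<bar>} < \<epsilon>" using A(2) by linarith
    qed
  qed
  have weaken: "\<exists>C N. \<forall>n\<ge>N. \<exists>A\<in>events. prob A < \<epsilon> \<and> (AE \<omega> in M. \<omega> \<notin> A \<longrightarrow> P n \<omega> C)"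
    if Q: "\<exists>C N. \<forall>n\<ge>N. \<exists>A\<in>events. prob A < \<epsilon> \<and> (AE \<omega> in M. \<omega> \<notin> A \<longrightarrow> Q n \<omega> C)" and QP: "\<And>n \<omega> C. Q n \<omega> C \<Longrightarrow> P n \<omega> C"
    for \<epsilon> :: real and P Q :: "nat \<Rightarrow> 'a \<Rightarrow> real \<Rightarrow> bool"
  proof -
    obtain C N where CN: "\<forall>n\<ge>N. \<exists>A\<in>events. prob A < \<epsilon> \<and> (AE \<omega> in M. \<omega> \<notin> A \<longrightarrow> Q n \<omega> C)" using Q by blast
    show ?thesis
    proof (intro exI[of _ C] exI[of _ N] allI impI)
      fix n assume "n \<ge> N"
      then obtain A where "A \<in> events" "prob A < \<epsilon>" and ae: "AE \<omega> in M. \<omega> \<notin> A \<longrightarrow> Q n \<omega> C" using CN by blast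
      moreover have "AE \<omega> in M. \<omega> \<notin> A \<longrightarrow> P n \<omega> C" using ae by eventually_elim (use QP in blast)
      ultimately show "\<exists>A\<in>events. prob A < \<epsilon> \<and> (AE \<omega> in M. \<omega> \<notin> A \<longrightarrow> P n \<omega> C)" by blast
    qed
  qed
  have key1: "\<exists>C N. \<forall>n\<ge>N. \<exists>A\<in>events. prob A < \<epsilon> \<and> (AE \<omega> in M. \<omega> \<notin> A \<longrightarrow> D n \<omega> C)"
    if \<epsilon>: "\<epsilon> > 0" for \<epsilon> :: real
  proof -
    obtain C where "\<forall>e>0. \<exists>N. \<forall>n\<ge>N. \<exists>A\<in>events. prob A < \<epsilon> \<and> (AE \<omega> in M. \<omega> \<notin> A \<longrightarrow>
       \<bar>?T n \<omega> - Rlim eq (VV n \<omega>)\<bar> \<le> e \<and> D n \<omega> C)" using key[OF \<epsilon>] by blast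
    from this[rule_format, OF zero_less_one]
    have "\<exists>C N. \<forall>n\<ge>N. \<exists>A\<in>events. prob A < \<epsilon> \<and> (AE \<omega> in M. \<omega> \<notin> A \<longrightarrow>
       \<bar>?T n \<omega> - Rlim eq (VV n \<omega>)\<bar> \<le> 1 \<and> D n \<omega> C)" by (rule exI)
    from weaken[OF this] show ?thesis by blast
  qed
  show "bounded_in_prob M (\<lambda>n \<omega>. (fst (est n \<omega>) - \<mu>)\<^sup>2) (\<lambda>n. 1 / sqrt (real n))"
    by (rule bip, rule weaken[OF key1]) (auto simp: D_def)
  show "bounded_in_prob M (\<lambda>n \<omega>. (fst (snd (est n \<omega>)) - \<mu>)\<^sup>2) (\<lambda>n. 1 / sqrt (real n))"
    by (rule bip, rule weaken[OF key1]) (auto simp: D_def)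
  show "bounded_in_prob M (\<lambda>n \<omega>. (fst (snd (snd (est n \<omega>))) - \<sigma>)\<^sup>2) (\<lambda>n. 1 / sqrt (real n))"
    by (rule bip, rule weaken[OF key1]) (auto simp: D_def)
  show "bounded_in_prob M (\<lambda>n \<omega>. (fst (snd (snd (snd (est n \<omega>)))) - \<sigma>)\<^sup>2) (\<lambda>n. 1 / sqrt (real n))"
    by (rule bip, rule weaken[OF key1]) (auto simp: D_def)
  show "bounded_in_prob M (\<lambda>n \<omega>. fst (snd (snd (est n \<omega>))) - \<sigma>) (\<lambda>n. 1 / sqrt (real n))" if eq
    by (rule bip, rule weaken[OF key1]) (use that in \<open>auto simp: D_def\<close>)
  show "weak_conv_m (\<lambda>n. distr M borel (?T n)) (distr (std_normal \<Otimes>\<^sub>M (std_normal \<Otimes>\<^sub>M std_normal)) borel (Rlim eq))"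
  proof (rule weak_conv_Rlim)
    show "?T n \<in> borel_measurable M" for n
      using loglik_measurable[OF assms(1)[of n], of n] loglik_measurable[OF assms(2)[of n], of n] by measurable
    fix \<epsilon> e :: real assume \<epsilon>: "\<epsilon> > 0" and e: "e > 0"
    obtain C where "\<forall>e>0. \<exists>N. \<forall>n\<ge>N. \<exists>A\<in>events. prob A < \<epsilon> \<and> (AE \<omega> in M. \<omega> \<notin> A \<longrightarrow>
       \<bar>?T n \<omega> - Rlim eq (VV n \<omega>)\<bar> \<le> e \<and> D n \<omega> C)" using key[OF \<epsilon>] by blast
    from this[rule_format, OF e]
    have "\<exists>C N. \<forall>n\<ge>N. \<exists>A\<in>events. prob A < \<epsilon> \<and> (AE \<omega> in M. \<omega> \<notin> A \<longrightarrow>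
       \<bar>?T n \<omega> - Rlim eq (VV n \<omega>)\<bar> \<le> e \<and> D n \<omega> C)" by (rule exI)
    from weaken[OF this, of "\<lambda>n \<omega> C. \<bar>?T n \<omega> - Rlim eq (VV n \<omega>)\<bar> \<le> e"]
    show "\<exists>N. \<forall>n\<ge>N. \<exists>A\<in>events. prob A < \<epsilon> \<and> (AE \<omega> in M. \<omega> \<notin> A \<longrightarrow> \<bar>?T n \<omega> - Rlim eq (VV n \<omega>)\<bar> \<le> e)" by blast
  qed
qed

end

theorem theorem1:
  fixes M :: "'a measure"
    and X :: "nat \<Rightarrow> 'a \<Rightarrow> real \<times> real"
    and \<mu>0 \<sigma>0 :: real
    and est_hat est_tilde est_check :: "nat \<Rightarrow> 'a \<Rightarrow> param"
  assumes "prob_space M"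
    and "\<sigma>0 > 0"
    and "prob_space.indep_vars M (\<lambda>_. borel) X UNIV"
    and "\<And>i. distributed M lborel (X i) (\<lambda>x. ennreal (bvn_density (\<mu>0, \<mu>0, \<sigma>0, \<sigma>0, 0) x))"
    and "\<And>n. est_hat n \<in> borel_measurable M"
    and "\<And>n. est_tilde n \<in> borel_measurable M"
    and "\<And>n. est_check n \<in> borel_measurable M"
    and "\<forall>\<^sub>F n in sequentially. AE \<omega> in M.
           is_maximizer (loglik n (\<lambda>i. unorder (X i \<omega>))) Theta_hat (est_hat n \<omega>)"
    and "\<forall>\<^sub>F n in sequentially. AE \<omega> in M.
           is_maximizer (loglik n (\<lambda>i. unorder (X i \<omega>))) Theta_tilde (est_tilde n \<omega>)"
    and "\<forall>\<^sub>F n in sequentially. AE \<omega> in M.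
           is_maximizer (loglik n (\<lambda>i. unorder (X i \<omega>))) Theta_check (est_check n \<omega>)"
  shows
    "(bounded_in_prob M (\<lambda>n \<omega>. (fst (est_tilde n \<omega>) - \<mu>0)\<^sup>2) (\<lambda>n. 1 / sqrt (real n))
      \<and> bounded_in_prob M (\<lambda>n \<omega>. (fst (snd (est_tilde n \<omega>)) - \<mu>0)\<^sup>2) (\<lambda>n. 1 / sqrt (real n))
      \<and> bounded_in_prob M (\<lambda>n \<omega>. fst (snd (snd (est_tilde n \<omega>))) - \<sigma>0) (\<lambda>n. 1 / sqrt (real n))
      \<and> weak_conv_m
          (\<lambda>n. distr M borel (\<lambda>\<omega>. 2 * (loglik n (\<lambda>i. unorder (X i \<omega>)) (est_tilde n \<omega>)
                                        - loglik n (\<lambda>i. unorder (X i \<omega>)) (est_check n \<omega>))))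
          half_chibar)
   \<and> (bounded_in_prob M (\<lambda>n \<omega>. (fst (est_hat n \<omega>) - \<mu>0)\<^sup>2) (\<lambda>n. 1 / sqrt (real n))
      \<and> bounded_in_prob M (\<lambda>n \<omega>. (fst (snd (est_hat n \<omega>)) - \<mu>0)\<^sup>2) (\<lambda>n. 1 / sqrt (real n))
      \<and> bounded_in_prob M (\<lambda>n \<omega>. (fst (snd (snd (est_hat n \<omega>))) - \<sigma>0)\<^sup>2) (\<lambda>n. 1 / sqrt (real n))
      \<and> bounded_in_prob M (\<lambda>n \<omega>. (fst (snd (snd (snd (est_hat n \<omega>)))) - \<sigma>0)\<^sup>2) (\<lambda>n. 1 / sqrt (real n))
      \<and> weak_conv_m
          (\<lambda>n. distr M borel (\<lambda>\<omega>. 2 * (loglik n (\<lambda>i. unorder (X i \<omega>)) (est_hat n \<omega>)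
                                        - loglik n (\<lambda>i. unorder (X i \<omega>)) (est_check n \<omega>))))
          R_law)"
proof -
  interpret sampling M X \<mu>0 \<sigma>0
    by (intro sampling.intro sampling_axioms.intro assms(1-4))
  have hat: "\<forall>\<^sub>F n in sequentially. AE \<omega> in M. is_maximizer (loglik n (\<lambda>i. unorder (X i \<omega>))) (Theta_of False) (est_hat n \<omega>)"
    using assms(8) by (simp add: Theta_of_def)
  have tilde: "\<forall>\<^sub>F n in sequentially. AE \<omega> in M. is_maximizer (loglik n (\<lambda>i. unorder (X i \<omega>))) (Theta_of True) (est_tilde n \<omega>)"
    using assms(9) by (simp add: Theta_of_def)
  note a = mle_asymptotics[OF assms(6,7) tilde assms(10)]
  note b = mle_asymptotics[OF assms(5,7) hat assms(10)]
  show ?thesis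
    unfolding half_chibar_eq R_law_def R_stat_eq
    by (intro conjI a(1,2,6) a(5)[OF TrueI] b(1,2,3,4,6))
qed

end
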